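(* Fix an integer $n\geq 1$. Given $\kappa_0>0$, there exist $\epsilon,\epsilon_1>0$ and $k\in\mathbb N$ such that the following holds for all $\delta>0$ small enough. Let $\mu$ be a Borel probability measure on $[1/2,1]^n\subset\mathbb R^n$ such that \[\forall \rho\geq \delta,\qquad \sup_{a\in\mathbb R,\ v\in\mathbb S^{n-1}} \mu\{x\in\mathbb R^n : \langle v,x\rangle\in B_{\mathbb R}(a,\rho)\}\leq \delta^{-\epsilon}\rho^{\kappa_0}.\] Then for all $\xi\in\mathbb R^n$ with $\|\xi\|\in[\delta^{-1}/2,\delta^{-1}]$, \[|\hat\mu_k(\xi)|=\left|\int \exp\big(2i\pi\langle \xi, x_1\cdots x_k\rangle\big)\,d\mu(x_1)\cdots d\mu(x_k)\right|\leq \delta^{\epsilon_1}.\]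
   Context: $\mathbb R^n$ is equipped with the standard scalar product $\langle\cdot,\cdot\rangle$ and Euclidean norm, and with coordinatewise multiplication: for $x=(x^1,\dots,x^n)$, $y=(y^1,\dots,y^n)$, $xy=(x^1y^1,\dots,x^ny^n)$. $B_{\mathbb R}(a,\rho)$ is the closed interval $[a-\rho,a+\rho]$, $\mathbb S^{n-1}$ the unit sphere. $\mu_k$ denotes the $k$-fold multiplicative convolution of $\mu$, i.e. the law of $x_1\cdots x_k$ with $x_i$ independent with law $\mu$, and $\hat\nu(\xi)=\int e^{2i\pi\langle\xi,x\rangle}d\nu(x)$. *)

theory Defs
  imports "HOL-Probability.Probability"
begin

text \<open>k-fold multiplicative convolution: law of x_1 * ... * x_k (coordinatewise product
  in real^'n), x_i i.i.d. with law mu.\<close>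
definition mult_conv :: "(real ^ 'n) measure \<Rightarrow> nat \<Rightarrow> (real ^ 'n) measure" where
  "mult_conv mu k = distr (PiM {..<k} (\<lambda>_. mu)) borel (\<lambda>x. \<Prod>i<k. x i)"

definition fourier_tr :: "(real ^ 'n) measure \<Rightarrow> real ^ 'n \<Rightarrow> complex" where
  "fourier_tr nu xi = (\<integral>x. exp (2 * pi * \<i> * complex_of_real (xi \<bullet> x)) \<partial>nu)"

end

theory Submission
  imports Defs
begin

text \<open>
  Approximate \<mu> by a finitely supported law and form the random polynomials Y_0 = c R T and
  Y_{j+1} = T Y_j - T' Y'_j, where T, T', Y'_j are independent copies and R = \<delta>^{-2}. By positive
  definiteness of the squared modulus of a characteristic function, a power of the Fourier coefficient of \<mu>_k is at
  most the average of |\<mu>^|^2 over Y_J, so by Cauchy-Schwarz it suffices that the collision probability of the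
  unit cells of Y_J is at most R^{\<gamma> - n}. Collision probabilities decrease up to constants. If they stagnate
  before this bound is reached, a weighted Balog-Szemeredi-Gowers argument gives an approximate group H that is almost
  invariant under dilation by many ratios t / t_0. The dilations that almost preserve H form a ring up to losses;
  the non-concentration of \<mu> on strips makes this ring dense at a coarse scale, and powers of one of its
  contracting elements propagate the density through all scales, so H has nearly R^n unit cells, which is absurd.
\<close>

section \<open>Additive combinatorics\<close>

text \<open>The exponent in R = \<delta>^{-2} is what lets a collision bound finish the proof. With
  \<open>c\<close> of size R, the frequency \<eta> = \<xi> / c has size R^{-1/2}: so small that
  rounding Y_J to its unit cell hardly moves the phase, yet so large that \<eta> times the integer
  points of [-R, R]^n runs over a range R^{1/2}, and the squared transform of the approximating law
  averages to about R^{-\<kappa>/4} over them. Hence \<gamma> = \<kappa> / 16 suffices. The price is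
  non-concentration down to scale \<delta>^2, paid by halving the exponent. The obstacle is that R^n
  has zero divisors and that a dilation contracts the coordinates at different rates. Therefore
  differences that are to be inverted are kept away from 0 in all coordinates at once
  (\<open>greedy_spread\<close>), strips in oblique directions serve to find a well-conditioned
  basis (\<open>spread_basis\<close>), and boxes have one radius per coordinate. All losses are
  powers of one K = R^\<epsilon>. The number m of scales and the number of ring operations depend
  only on n, \<kappa> and \<gamma>, so \<epsilon> is fixed last and beats even K^{2^m}.\<close>

definition sumset :: "'a::ab_group_add set \<Rightarrow> 'a set \<Rightarrow> 'a set" where
 "sumset A B = (\<lambda>(a, b). a + b) ` (A \<times> B)"

definition diffset :: "'a::ab_group_add set \<Rightarrow> 'a set \<Rightarrow> 'a set" where
 "diffset A B = (\<lambda>(a, b). a - b) ` (A \<times> B)"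

lemma sumsetI: "a \<in> A \<Longrightarrow> b \<in> B \<Longrightarrow> a + b \<in> sumset A B"
 unfolding sumset_def by force

lemma diffsetI: "a \<in> A \<Longrightarrow> b \<in> B \<Longrightarrow> a - b \<in> diffset A B"
 unfolding diffset_def by force

lemma sumsetE: assumes "x \<in> sumset A B" obtains a b where "a \<in> A" "b \<in> B" "x = a + b"
 using assms unfolding sumset_def by force

lemma diffsetE: assumes "x \<in> diffset A B" obtains a b where "a \<in> A" "b \<in> B" "x = a - b"
 using assms unfolding diffset_def by force

lemma finite_sumset [simp]: "finite A \<Longrightarrow> finite B \<Longrightarrow> finite (sumset A B)"
 unfolding sumset_def by simp

lemma finite_diffset [simp]: "finite A \<Longrightarrow> finite B \<Longrightarrow> finite (diffset A B)"
 unfolding diffset_def by simp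

lemma sumset_mono: "A \<subseteq> A' \<Longrightarrow> B \<subseteq> B' \<Longrightarrow> sumset A B \<subseteq> sumset A' B'"
 unfolding sumset_def by blast

lemma diffset_mono: "A \<subseteq> A' \<Longrightarrow> B \<subseteq> B' \<Longrightarrow> diffset A B \<subseteq> diffset A' B'"
 unfolding diffset_def by blast

section \<open>Packing and Ruzsa covering\<close>

text \<open>The cardinality bound makes a packing of maximal size exist, and a point close to none
  of its elements could be added to it. As \<open>close\<close> is an arbitrary symmetric relation,
  \<open>b = y\<close> appears as an alternative of its own.\<close>

lemma ex_maximal_packing:
 fixes close :: "'a \<Rightarrow> 'a \<Rightarrow> bool" and m :: nat
 assumes bound: "\<And>Y. Y \<subseteq> B \<Longrightarrow> finite Y \<Longrightarrow> (\<forall>x\<in>Y. \<forall>y\<in>Y. x \<noteq> y \<longrightarrow> \<not> close x y) \<Longrightarrow> card Y \<le> m"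
 assumes symm: "\<And>x y. close x y \<Longrightarrow> close y x"
 obtains Y where "Y \<subseteq> B" "finite Y" "\<And>x y. x \<in> Y \<Longrightarrow> y \<in> Y \<Longrightarrow> x \<noteq> y \<Longrightarrow> \<not> close x y"
  "card Y \<le> m" "\<And>b. b \<in> B \<Longrightarrow> \<exists>y\<in>Y. b = y \<or> close b y"
proof -
 let ?P = "\<lambda>Y. Y \<subseteq> B \<and> finite Y \<and> (\<forall>x\<in>Y. \<forall>y\<in>Y. x \<noteq> y \<longrightarrow> \<not> close x y)"
 let ?N = "card ` Collect ?P"
 have fin: "finite ?N" by (rule finite_subset[of _ "{..m}"]) (use bound in auto)
 have "?P {}" by simp
 hence ne: "?N \<noteq> {}" by blast
 from Max_in[OF fin ne] obtain Y where Y: "?P Y" "card Y = Max ?N" by force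
 have "\<exists>y\<in>Y. b = y \<or> close b y" if b: "b \<in> B" for b
 proof (rule ccontr)
  assume n: "\<not> ?thesis"
  hence nb: "b \<notin> Y" by blast
  have "?P (insert b Y)" using Y(1) n b symm by (auto; metis)
  hence "card (insert b Y) \<in> ?N" by blast
  hence "card (insert b Y) \<le> card Y" unfolding Y(2) by (rule Max_ge[OF fin])
  thus False using Y(1) nb by simp
 qed
 moreover have "card Y \<le> m" using Y(1) by (intro bound) simp_all
 moreover have "\<not> close x y" if "x \<in> Y" "y \<in> Y" "x \<noteq> y" for x y using Y(1) that by blast
 ultimately show ?thesis using that[of Y] Y(1) by simp
qed

text \<open>The translates \<open>y + C\<close> of a maximal family are disjoint and lie in
  \<open>B + C\<close>, which bounds their number; by maximality every \<open>b + C\<close> meets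
  one of them.\<close>

lemma ruzsa_covering:
 fixes B C :: "'a::ab_group_add set"
 assumes fin: "finite B" "finite C" and ne: "C \<noteq> {}"
 obtains Y where "Y \<subseteq> B" "finite Y" "card Y * card C \<le> card (sumset B C)"
  "\<And>b. b \<in> B \<Longrightarrow> \<exists>y\<in>Y. \<exists>c\<in>C. \<exists>c'\<in>C. b = y + (c - c')"
proof -
 let ?cl = "\<lambda>x y. \<exists>c\<in>C. \<exists>c'\<in>C. x + c = y + c'"
 have main: "card Y * card C \<le> card (sumset B C)"
  if "Y \<subseteq> B" "finite Y" and sep: "\<forall>x\<in>Y. \<forall>y\<in>Y. x \<noteq> y \<longrightarrow> \<not> ?cl x y" for Y
 proof -
  have "inj_on (\<lambda>(y, c). y + c) (Y \<times> C)"
  proof (rule inj_onI, clarsimp)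
   fix y c y' c' assume "y \<in> Y" "c \<in> C" "y' \<in> Y" "c' \<in> C" "y + c = y' + c'"
   moreover from this have "y = y'" using sep by blast
   ultimately show "y = y' \<and> c = c'" by simp
  qed
  hence "card ((\<lambda>(y, c). y + c) ` (Y \<times> C)) = card Y * card C" by (simp add: card_image card_cartesian_product)
  moreover have "(\<lambda>(y, c). y + c) ` (Y \<times> C) \<subseteq> sumset B C" using that(1) unfolding sumset_def by auto
  ultimately show ?thesis using card_mono[OF finite_sumset[OF fin]] by metis
 qed
 have c1: "card C \<ge> 1" using ne fin by (simp add: Suc_le_eq card_gt_0_iff)
 obtain Y where Y: "Y \<subseteq> B" "finite Y" "\<And>x y. x \<in> Y \<Longrightarrow> y \<in> Y \<Longrightarrow> x \<noteq> y \<Longrightarrow> \<not> ?cl x y"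
  "\<And>b. b \<in> B \<Longrightarrow> \<exists>y\<in>Y. b = y \<or> ?cl b y"
 proof (rule ex_maximal_packing[of B ?cl "card (sumset B C)"])
  fix Y assume "Y \<subseteq> B" "finite Y" "\<forall>x\<in>Y. \<forall>y\<in>Y. x \<noteq> y \<longrightarrow> \<not> ?cl x y"
  from main[OF this] mult_le_mono2[OF c1, of "card Y"] show "card Y \<le> card (sumset B C)"
   by linarith
 next
  fix x y assume "?cl x y" thus "?cl y x" by (auto dest: sym)
 qed blast
 have "\<exists>y\<in>Y. \<exists>c\<in>C. \<exists>c'\<in>C. b = y + (c - c')" if "b \<in> B" for b
 proof -
  obtain y where y: "y \<in> Y" "b = y \<or> ?cl b y" using Y(4) \<open>b \<in> B\<close> by blast
  obtain c0 where "c0 \<in> C" using ne by blast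
  from y(2) show ?thesis
  proof
   assume "b = y"
   thus ?thesis using y(1) \<open>c0 \<in> C\<close> by (intro bexI[of _ y] bexI[of _ c0]) auto
  next
   assume "?cl b y"
   then obtain c c' where c: "c \<in> C" "c' \<in> C" "b + c = y + c'" by blast
   hence "b = y + (c' - c)" by (simp add: algebra_simps eq_diff_eq)
   thus ?thesis using y(1) c by blast
  qed
 qed
 moreover have "card Y * card C \<le> card (sumset B C)" using main[OF Y(1,2)] Y(3) by simp
 ultimately show ?thesis using that[OF Y(1,2)] by simp
qed

section \<open>Popular differences\<close>

text \<open>When \<open>K\<close> bounds the ratio of the sizes of \<open>A - A\<close> and
  \<open>A\<close>, a difference has at least \<open>card A / K\<close> representations on average;
  the threshold is half of that.\<close>

definition popular :: "real \<Rightarrow> 'a::ab_group_add set \<Rightarrow> 'a set" where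
 "popular K A = {x \<in> diffset A A. real (card {y \<in> A. x + y \<in> A}) \<ge> real (card A) / (2 * K)}"

lemma popular_subset: "popular K A \<subseteq> diffset A A" unfolding popular_def by blast

lemma finite_popular [simp]: "finite A \<Longrightarrow> finite (popular K A)"
 by (rule finite_subset[OF popular_subset]) simp

lemma popular_minus: assumes "x \<in> popular K A" "finite A" shows "- x \<in> popular K A"
proof -
 have "bij_betw (\<lambda>y. x + y) {y \<in> A. x + y \<in> A} {y \<in> A. - x + y \<in> A}"
  by (rule bij_betw_byWitness[where f' = "\<lambda>y. - x + y"]) auto
 hence "card {y \<in> A. x + y \<in> A} = card {y \<in> A. - x + y \<in> A}" by (rule bij_betw_same_card)
 moreover have "- x \<in> diffset A A"
  using assms(1) popular_subset by (smt (verit) diffsetE diffsetI minus_diff_eq subsetD)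
 ultimately show ?thesis using assms unfolding popular_def by simp
qed

lemma zero_in_popular: assumes "A \<noteq> {}" "K \<ge> 1" shows "0 \<in> popular K A"
proof -
 have "0 \<in> diffset A A" using assms(1) by (metis all_not_in_conv diff_self diffsetI)
 moreover have "{y \<in> A. 0 + y \<in> A} = A" by auto
 moreover have "real (card A) / (2 * K) \<le> real (card A)" using assms(2)
  by (simp add: divide_le_eq mult_le_cancel_left1)
 ultimately show ?thesis unfolding popular_def by auto
qed

lemma sum_card_reps:
 assumes "finite A"
 shows "(\<Sum>x\<in>diffset A A. card {y \<in> A. x + y \<in> A}) = card A * card A"
proof -
 have "A \<times> A = (\<Union>x\<in>diffset A A. (\<lambda>y. (x + y, y)) ` {y \<in> A. x + y \<in> A})"
 proof (intro equalityI subsetI)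
  fix z assume "z \<in> A \<times> A"
  then obtain a b where "z = (a, b)" "a \<in> A" "b \<in> A" by blast
  thus "z \<in> (\<Union>x\<in>diffset A A. (\<lambda>y. (x + y, y)) ` {y \<in> A. x + y \<in> A})"
   by (intro UN_I[of "a - b"]) (auto intro: diffsetI simp: image_iff)
 qed auto
 hence "card (A \<times> A) = card (\<Union>x\<in>diffset A A. (\<lambda>y. (x + y, y)) ` {y \<in> A. x + y \<in> A})" by simp
 also have "\<dots> = (\<Sum>x\<in>diffset A A. card ((\<lambda>y. (x + y, y)) ` {y \<in> A. x + y \<in> A}))"
  by (rule card_UN_disjoint) (use assms in auto)
 also have "\<dots> = (\<Sum>x\<in>diffset A A. card {y \<in> A. x + y \<in> A})"
  by (intro sum.cong refl card_image) (auto simp: inj_on_def)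
 finally show ?thesis by (simp add: card_cartesian_product)
qed

text \<open>The unpopular differences carry at most half of all pairs from \<open>A\<close>, and a
  popular one carries at most \<open>card A\<close> of them.\<close>

lemma card_popular_ge:
 assumes fin: "finite A" and ne: "A \<noteq> {}" and K: "K > 0" and dbl: "real (card (diffset A A)) \<le> K * real (card A)"
 shows "real (card (popular K A)) \<ge> real (card A) / 2"
proof -
 let ?r = "\<lambda>x. card {y \<in> A. x + y \<in> A}" and ?D = "diffset A A" and ?n = "real (card A)"
 have n: "?n > 0" using fin ne by (simp add: card_gt_0_iff)
 have finD: "finite ?D" using fin by simp
 have "?n * ?n = (\<Sum>x\<in>?D. real (?r x))"
  by (simp only: of_nat_mult[symmetric] of_nat_sum[symmetric] sum_card_reps[OF fin])
 also have "\<dots> = (\<Sum>x\<in>popular K A. real (?r x)) + (\<Sum>x\<in>?D - popular K A. real (?r x))"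
  using sum.subset_diff[OF popular_subset[of K A] finD, of "\<lambda>x. real (?r x)"] by (simp only: add.commute)
 also have "\<dots> \<le> (\<Sum>x\<in>popular K A. ?n) + (\<Sum>x\<in>?D - popular K A. ?n / (2 * K))"
 proof (intro add_mono sum_mono)
  fix x show "real (?r x) \<le> ?n" by (simp add: fin card_mono)
 next
  fix x assume "x \<in> ?D - popular K A"
  thus "real (?r x) \<le> ?n / (2 * K)" unfolding popular_def by auto
 qed
 also have "\<dots> \<le> real (card (popular K A)) * ?n + real (card ?D) * (?n / (2 * K))"
  using n K finD by (auto intro!: divide_right_mono mult_right_mono card_mono)
 also have "\<dots> \<le> real (card (popular K A)) * ?n + (K * ?n) * (?n / (2 * K))"
  using dbl n K by (intro add_left_mono mult_right_mono) auto
 also have "\<dots> = (real (card (popular K A)) + ?n / 2) * ?n" using K by (simp add: field_simps)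
 finally show ?thesis using n by (simp add: field_simps)
qed

text \<open>A Pluennecke-type step: \<open>b + s - a = (b - y) + (s + y - a)\<close> for each of the
  many \<open>y\<close> such that \<open>y\<close> and \<open>s + y\<close> are in \<open>A\<close>,
  so every element of the set to be counted has at least \<open>card A / (2 * K)\<close>
  representations by pairs from \<open>B - A\<close> and \<open>A - A\<close>. The bound is linear
  in the size of \<open>B - A\<close> and can be iterated.\<close>

lemma card_sumset_popular:
 fixes A B :: "'a::ab_group_add set"
 assumes fin: "finite A" "finite B" and ne: "A \<noteq> {}" and K: "K > 0"
  and dbl: "real (card (diffset A A)) \<le> K * real (card A)"
 shows "real (card (diffset (sumset B (popular K A)) A)) \<le> 2 * K^2 * real (card (diffset B A))"
proof -
 let ?Z = "diffset (sumset B (popular K A)) A" and ?n = "real (card A)"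
 let ?T = "diffset B A \<times> diffset A A"
 have n: "?n > 0" using fin ne by (simp add: card_gt_0_iff)
 have finZ: "finite ?Z" using fin by simp
 define R where "R z = {uv \<in> ?T. fst uv + snd uv = z}" for z
 have R: "real (card (R z)) \<ge> ?n / (2 * K)" if zin: "z \<in> ?Z" for z
 proof -
  obtain w a where w: "w \<in> sumset B (popular K A)" "a \<in> A" "z = w - a" using zin by (rule diffsetE)
  obtain b s where "b \<in> B" "s \<in> popular K A" "w = b + s" using w(1) by (rule sumsetE)
  hence z: "b \<in> B" "s \<in> popular K A" "a \<in> A" "z = b + s - a" using w by auto
  let ?Y = "{y \<in> A. s + y \<in> A}"
  have "(\<lambda>y. (b - y, s + y - a)) ` ?Y \<subseteq> R z"
   using z(1-3) by (auto simp: R_def z(4) intro!: diffsetI)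
  moreover have "inj_on (\<lambda>y. (b - y, s + y - a)) ?Y" by (auto simp: inj_on_def)
  moreover have "finite (R z)" unfolding R_def using fin by simp
  ultimately have "card ?Y \<le> card (R z)" using card_inj_on_le by blast
  moreover have "real (card ?Y) \<ge> ?n / (2 * K)" using z(2) unfolding popular_def by simp
  ultimately show ?thesis by linarith
 qed
 have "real (card ?Z) * (?n / (2 * K)) = (\<Sum>z\<in>?Z. ?n / (2 * K))" by simp
 also have "\<dots> \<le> (\<Sum>z\<in>?Z. real (card (R z)))" by (intro sum_mono R)
 also have "\<dots> = real (card (\<Union>z\<in>?Z. R z))"
  by (subst card_UN_disjoint) (use fin finZ in \<open>auto simp: R_def\<close>)
 also have "\<dots> \<le> real (card ?T)" using fin by (intro of_nat_mono card_mono) (auto simp: R_def)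
 also have "\<dots> \<le> real (card (diffset B A)) * (K * ?n)"
  using dbl by (simp add: card_cartesian_product mult_left_mono)
 finally have "real (card ?Z) * ?n \<le> (2 * K^2 * real (card (diffset B A))) * ?n" using K
  by (simp add: field_simps power2_eq_square)
 thus ?thesis using n by simp
qed

lemma sum_shift_le:
 fixes f :: "'a::ab_group_add \<Rightarrow> real"
 assumes "finite D" "finite S" "\<And>x. x \<notin> S \<Longrightarrow> f x = 0" "\<And>x. f x \<ge> 0" "inj_on h D"
 shows "(\<Sum>x\<in>D. f (h x)) \<le> (\<Sum>a\<in>S. f a)"
proof -
 have "(\<Sum>x\<in>D. f (h x)) = (\<Sum>a\<in>h ` D. f a)" using assms by (simp add: sum.reindex)
 also have "\<dots> = (\<Sum>a\<in>h ` D \<inter> S. f a)" using assms by (intro sum.mono_neutral_right) auto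
 also have "\<dots> \<le> (\<Sum>a\<in>S. f a)" using assms by (intro sum_mono2) auto
 finally show ?thesis .
qed

section \<open>Weighted Balog-Szemeredi-Gowers theorem\<close>

text \<open>\<open>r\<close> is the autocorrelation of \<open>p\<close>, and a pair
  \<open>a\<close>, \<open>a'\<close> counts as an edge if \<open>r (a - a')\<close> is at least
  \<open>\<tau>\<close>. For a suitable sum \<open>s\<close>, most pairs are edges under the weights
  \<open>p a * q (s - a)\<close>, so two vertices of large degree have many common neighbours
  \<open>b\<close>. Writing \<open>a - a' = (a - b) - (a' - b)\<close> gives every element of
  \<open>A - A\<close> many representations by popular differences, and all such representations
  together have mass at most 1.\<close>

lemma weighted_BSG:
 fixes p q :: "'a::ab_group_add \<Rightarrow> real"
 assumes fin: "finite S" "finite T"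
  and p0: "\<And>x. p x \<ge> 0" and q0: "\<And>x. q x \<ge> 0"
  and pS: "\<And>x. x \<notin> S \<Longrightarrow> p x = 0" and qT: "\<And>x. x \<notin> T \<Longrightarrow> q x = 0"
  and psum: "(\<Sum>x\<in>S. p x) \<le> 1" and qsum: "(\<Sum>x\<in>T. q x) \<le> 1"
  and L: "L \<ge> 1" and N: "N > 0"
  and pL: "\<And>x. p x \<le> L / N" and qL: "\<And>x. q x \<le> L / N"
  and energy: "(\<Sum>s\<in>sumset S T. (\<Sum>a\<in>S. p a * q (s - a))\<^sup>2) \<ge> 1 / (L * N)"
 obtains A s where "A \<subseteq> S" "\<And>a. a \<in> A \<Longrightarrow> p a > 0 \<and> q (s - a) > 0"
  "(\<Sum>a\<in>A. p a) \<ge> 1 / (8 * L^2)" "(\<Sum>a\<in>A. q (s - a)) \<ge> 1 / (8 * L^2)"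
  "real (card (diffset A A)) \<le> 2048 * L^5 * N"
proof -
 define U where "U = sumset S T"
 define D where "D = diffset S S"
 define g where "g s = (\<Sum>a\<in>S. p a * q (s - a))" for s
 define r where "r x = (\<Sum>b\<in>S. p b * p (b + x))" for x
 define h where "h x = (\<Sum>v\<in>T. q v * q (v + x))" for x
 \<comment> \<open>Chosen so that \<open>8 * \<tau>\<close> is half of the assumed energy
   \<open>1 / (L * N)\<close>.\<close>
 define \<tau> where "\<tau> = 1 / (16 * L * N)"
 define bad where "bad s = (\<Sum>a\<in>S. \<Sum>a'\<in>S. (if r (a - a') < \<tau> then p a * q (s - a) * (p a' * q (s - a')) else 0))" for s
 have finU: "finite U" and finD: "finite D" unfolding U_def D_def using fin by simp_all
 have tau: "\<tau> > 0" unfolding \<tau>_def using L N by simp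
 have r0: "r x \<ge> 0" for x unfolding r_def by (intro sum_nonneg mult_nonneg_nonneg p0)
 have h0: "h x \<ge> 0" for x unfolding h_def by (intro sum_nonneg mult_nonneg_nonneg q0)
 have g0: "g s \<ge> 0" for s unfolding g_def by (intro sum_nonneg mult_nonneg_nonneg p0 q0)
 have rD: "r x = 0" if "x \<notin> D" for x
 proof -
  have "p b * p (b + x) = 0" if "b \<in> S" for b
  proof (rule ccontr)
   assume "p b * p (b + x) \<noteq> 0"
   hence "b + x \<in> S" using pS by auto
   hence "(b + x) - b \<in> D" unfolding D_def using that by (intro diffsetI)
   thus False using \<open>x \<notin> D\<close> by simp
  qed
  thus ?thesis unfolding r_def by (intro sum.neutral) blast
 qed
 have rsum: "(\<Sum>x\<in>D. r x) \<le> 1"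
 proof -
  have "(\<Sum>x\<in>D. r x) = (\<Sum>b\<in>S. p b * (\<Sum>x\<in>D. p (b + x)))"
   unfolding r_def by (subst sum.swap) (simp add: sum_distrib_left)
  also have "\<dots> \<le> (\<Sum>b\<in>S. p b * 1)"
  proof (intro sum_mono mult_left_mono p0)
   fix b
   have "(\<Sum>x\<in>D. p (b + x)) \<le> (\<Sum>a\<in>S. p a)" by (rule sum_shift_le) (use finD fin pS p0 in auto)
   thus "(\<Sum>x\<in>D. p (b + x)) \<le> 1" using psum by linarith
  qed
  finally show ?thesis using psum by simp
 qed
 have hsum: "(\<Sum>x\<in>D. h x) \<le> 1"
 proof -
  have "(\<Sum>x\<in>D. h x) = (\<Sum>b\<in>T. q b * (\<Sum>x\<in>D. q (b + x)))"
   unfolding h_def by (subst sum.swap) (simp add: sum_distrib_left)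
  also have "\<dots> \<le> (\<Sum>b\<in>T. q b * 1)"
  proof (intro sum_mono mult_left_mono q0)
   fix b
   have "(\<Sum>x\<in>D. q (b + x)) \<le> (\<Sum>a\<in>T. q a)" by (rule sum_shift_le) (use finD fin qT q0 in auto)
   thus "(\<Sum>x\<in>D. q (b + x)) \<le> 1" using qsum by linarith
  qed
  finally show ?thesis using qsum by simp
 qed
 have gsum: "(\<Sum>s\<in>U. g s) \<le> 1"
 proof -
  have "(\<Sum>s\<in>U. g s) = (\<Sum>a\<in>S. p a * (\<Sum>s\<in>U. q (s - a)))"
   unfolding g_def by (subst sum.swap) (simp add: sum_distrib_left)
  also have "\<dots> \<le> (\<Sum>a\<in>S. p a * 1)"
  proof (intro sum_mono mult_left_mono p0)
   fix a
   have "(\<Sum>s\<in>U. q (s - a)) \<le> (\<Sum>v\<in>T. q v)" by (rule sum_shift_le) (use finU fin qT q0 in \<open>auto simp: inj_on_def\<close>)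
   thus "(\<Sum>s\<in>U. q (s - a)) \<le> 1" using qsum by linarith
  qed
  finally show ?thesis using psum by simp
 qed
 have qq: "(\<Sum>s\<in>U. q (s - a) * q (s - a')) \<le> h (a - a')" for a a'
 proof -
  have "(\<Sum>s\<in>U. (\<lambda>v. q v * q (v + (a - a'))) (s - a)) \<le> (\<Sum>v\<in>T. q v * q (v + (a - a')))"
   by (rule sum_shift_le) (use finU fin qT q0 in \<open>auto simp: inj_on_def\<close>)
  thus ?thesis unfolding h_def by simp
 qed
 \<comment> \<open>Summing over \<open>s\<close> turns the two factors \<open>q\<close> into at most
   \<open>h (a - a')\<close>, and summing over the pairs of a given difference \<open>x\<close>
   turns the two factors \<open>p\<close> into \<open>r x\<close>, which is below
   \<open>\<tau>\<close> on the non-edges.\<close>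
 have badsum: "(\<Sum>s\<in>U. bad s) \<le> \<tau>"
 proof -
  let ?f = "\<lambda>x. if r x < \<tau> then h x else 0"
  have f0: "?f x \<ge> 0" for x using h0 by simp
  have "(\<Sum>s\<in>U. bad s) = (\<Sum>a\<in>S. \<Sum>a'\<in>S. if r (a - a') < \<tau> then p a * p a' * (\<Sum>s\<in>U. q (s - a) * q (s - a')) else 0)"
  proof -
   let ?F = "\<lambda>s a a'. if r (a - a') < \<tau> then p a * q (s - a) * (p a' * q (s - a')) else 0"
   have "(\<Sum>s\<in>U. bad s) = (\<Sum>a\<in>S. \<Sum>s\<in>U. \<Sum>a'\<in>S. ?F s a a')" unfolding bad_def by (rule sum.swap)
   also have "\<dots> = (\<Sum>a\<in>S. \<Sum>a'\<in>S. \<Sum>s\<in>U. ?F s a a')" by (intro sum.cong refl sum.swap)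
   finally show ?thesis by (auto simp: sum_distrib_left mult_ac intro!: sum.cong)
  qed
  also have "\<dots> \<le> (\<Sum>a\<in>S. \<Sum>a'\<in>S. p a' * (p a * ?f (a - a')))"
   using qq p0 by (intro sum_mono) (auto simp: mult_ac intro!: mult_left_mono)
  also have "\<dots> = (\<Sum>a'\<in>S. p a' * (\<Sum>a\<in>S. p a * ?f (a - a')))"
   by (subst sum.swap) (simp only: sum_distrib_left)
  also have "\<dots> \<le> (\<Sum>a'\<in>S. p a' * (\<Sum>x\<in>D. p (a' + x) * ?f x))"
  proof (intro sum_mono mult_left_mono p0)
   fix a' assume a': "a' \<in> S"
   have "(\<Sum>a\<in>S. p a * ?f (a - a')) = (\<Sum>a\<in>S. (\<lambda>x. p (a' + x) * ?f x) (a - a'))" by simp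
   also have "\<dots> = (\<Sum>x\<in>(\<lambda>a. a - a') ` S. p (a' + x) * ?f x)" by (subst sum.reindex) (auto simp: inj_on_def)
   also have "\<dots> \<le> (\<Sum>x\<in>D. p (a' + x) * ?f x)"
    by (intro sum_mono2 finD mult_nonneg_nonneg p0 f0) (use a' in \<open>auto simp: D_def intro: diffsetI\<close>)
   finally show "(\<Sum>a\<in>S. p a * ?f (a - a')) \<le> (\<Sum>x\<in>D. p (a' + x) * ?f x)" .
  qed
  also have "\<dots> = (\<Sum>x\<in>D. r x * ?f x)"
   unfolding r_def sum_distrib_left sum_distrib_right by (subst sum.swap) (simp only: mult.assoc)
  also have "\<dots> \<le> (\<Sum>x\<in>D. \<tau> * h x)"
   using r0 h0 tau by (intro sum_mono) (auto intro: mult_right_mono)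
  also have "\<dots> \<le> \<tau>" using hsum tau by (simp add: sum_distrib_left[symmetric] mult_left_le)
  finally show ?thesis .
 qed
 \<comment> \<open>First moment method: on average the energy beats both penalties. The term with
   \<open>bad\<close> leaves few non-edges, and the linear term forces \<open>g s\<close> above
   \<open>1 / (4 * L * N)\<close>.\<close>
 have "\<exists>s\<in>U. (g s)\<^sup>2 - 8 * bad s - g s / (4 * L * N) > 0"
 proof (rule ccontr)
  assume "\<not> ?thesis"
  hence "(\<Sum>s\<in>U. (g s)\<^sup>2 - 8 * bad s - g s / (4 * L * N)) \<le> 0" by (intro sum_nonpos) (auto simp: not_less)
  moreover have "(\<Sum>s\<in>U. (g s)\<^sup>2 - 8 * bad s - g s / (4 * L * N))
   = (\<Sum>s\<in>U. (g s)\<^sup>2) - 8 * (\<Sum>s\<in>U. bad s) - (\<Sum>s\<in>U. g s) / (4 * L * N)"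
   by (simp add: sum_subtractf sum_distrib_left sum_divide_distrib)
  moreover have "(\<Sum>s\<in>U. (g s)\<^sup>2) \<ge> 1 / (L * N)" using energy unfolding U_def g_def .
  moreover have "(\<Sum>s\<in>U. g s) / (4 * L * N) \<le> 1 / (4 * L * N)" using gsum L N by (simp add: divide_right_mono)
  moreover have "1 / (L * N) - 8 * \<tau> - 1 / (4 * L * N) = 1 / (4 * (L * N))" unfolding \<tau>_def using L N by (simp add: field_simps)
  moreover have "1 / (4 * (L * N)) > 0" using L N by simp
  ultimately show False using badsum by linarith
 qed
 then obtain s where s: "s \<in> U" "(g s)\<^sup>2 > 8 * bad s + g s / (4 * L * N)" by force
 have bad0: "bad x \<ge> 0" for x unfolding bad_def using p0 q0 by (intro sum_nonneg) auto
 have gpos: "g s > 0" using s(2) g0[of s] bad0[of s] by (cases "g s = 0") auto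
 have gbig: "g s > 1 / (4 * L * N)"
 proof -
  have "g s * (1 / (4 * L * N)) < g s * g s" using s(2) bad0[of s] by (simp add: power2_eq_square)
  thus ?thesis using gpos by (simp only: mult_less_cancel_left_pos)
 qed
 have bads: "bad s < (g s)\<^sup>2 / 8"
 proof -
  have "g s / (4 * L * N) \<ge> 0" using gpos L N by simp
  thus ?thesis using s(2) by simp
 qed
 define w where "w a = p a * q (s - a)" for a
 have w0: "w a \<ge> 0" for a unfolding w_def using p0 q0 by simp
 have gw: "g s = (\<Sum>a\<in>S. w a)" unfolding g_def w_def ..
 define B where "B a = (\<Sum>a'\<in>S. if r (a - a') < \<tau> then w a' else 0)" for a
 have B0: "B a \<ge> 0" for a unfolding B_def using w0 by (intro sum_nonneg) auto
 have badB: "bad s = (\<Sum>a\<in>S. w a * B a)"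
  unfolding bad_def B_def w_def sum_distrib_left by (intro sum.cong refl) auto
 \<comment> \<open>\<open>B a\<close> is the weight of the non-neighbours of \<open>a\<close>; only
   vertices of high degree are kept.\<close>
 define A where "A = {a \<in> S. w a > 0 \<and> B a \<le> g s / 4}"
 have finA: "finite A" unfolding A_def using fin by simp
 have AS: "A \<subseteq> S" unfolding A_def by blast
 have wA: "(\<Sum>a\<in>A. w a) \<ge> g s / 2"
 proof -
  have "(\<Sum>a\<in>S - A. w a) * (g s / 4) = (\<Sum>a\<in>S - A. w a * (g s / 4))" by (simp add: sum_distrib_right)
  also have "\<dots> \<le> (\<Sum>a\<in>S - A. w a * B a)"
  proof (intro sum_mono)
   fix a assume a: "a \<in> S - A"
   show "w a * (g s / 4) \<le> w a * B a"
   proof (cases "w a > 0")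
    case True thus ?thesis using a unfolding A_def by auto
   next
    case False hence "w a = 0" using w0[of a] by linarith
    thus ?thesis by simp
   qed
  qed
  also have "\<dots> \<le> (\<Sum>a\<in>S. w a * B a)" using fin w0 B0 by (intro sum_mono2) auto
  also have "\<dots> < (g s)\<^sup>2 / 8" using bads badB by simp
  finally have "(\<Sum>a\<in>S - A. w a) * (g s / 4) < (g s / 2) * (g s / 4)" by (simp add: power2_eq_square)
  hence "(\<Sum>a\<in>S - A. w a) < g s / 2" using gpos by (simp add: mult_less_cancel_right)
  moreover have "g s = (\<Sum>a\<in>S - A. w a) + (\<Sum>a\<in>A. w a)" unfolding gw by (rule sum.subset_diff[OF AS fin(1)])
  ultimately show ?thesis by linarith
 qed
 have wA8: "(\<Sum>a\<in>A. w a) \<ge> 1 / (8 * L * N)"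
 proof -
  have "1 / (8 * L * N) = (1 / (4 * L * N)) / 2" by simp
  thus ?thesis using wA gbig by linarith
 qed
 have LN: "1 / (8 * L * N) = (1 / (8 * L^2)) * (L / N)" using L N by (simp add: field_simps power2_eq_square)
 have LNpos: "L / N > 0" using L N by simp
 have pA: "(\<Sum>a\<in>A. p a) \<ge> 1 / (8 * L^2)"
 proof -
  have "(\<Sum>a\<in>A. w a) \<le> (\<Sum>a\<in>A. p a * (L / N))" unfolding w_def by (intro sum_mono mult_left_mono qL p0)
  also have "\<dots> = (\<Sum>a\<in>A. p a) * (L / N)" by (simp only: sum_distrib_right)
  finally have "(1 / (8 * L^2)) * (L / N) \<le> (\<Sum>a\<in>A. p a) * (L / N)" using wA8 LN by linarith
  thus ?thesis using LNpos by (simp only: mult_le_cancel_right_pos)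
 qed
 have qA: "(\<Sum>a\<in>A. q (s - a)) \<ge> 1 / (8 * L^2)"
 proof -
  have "(\<Sum>a\<in>A. w a) \<le> (\<Sum>a\<in>A. (L / N) * q (s - a))" unfolding w_def by (intro sum_mono mult_right_mono pL q0)
  also have "\<dots> = (\<Sum>a\<in>A. q (s - a)) * (L / N)" by (simp only: sum_distrib_left[symmetric] mult.commute)
  finally have "(1 / (8 * L^2)) * (L / N) \<le> (\<Sum>a\<in>A. q (s - a)) * (L / N)" using wA8 LN by linarith
  thus ?thesis using LNpos by (simp only: mult_le_cancel_right_pos)
 qed
 \<comment> \<open>\<open>G d\<close> counts, with weights \<open>r\<close>, the ways to write
   \<open>d\<close> as a difference of two differences. The set \<open>E\<close> below consists of
   the common neighbours of \<open>a\<close> and \<open>a'\<close>, which carry at least half of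
   \<open>g s\<close>.\<close>
 define G where "G d = (\<Sum>u\<in>D. r u * r (u - d))" for d
 have Gbig: "G d \<ge> 1 / (2048 * L^5 * N)" if "d \<in> diffset A A" for d
 proof -
  obtain a a' where aa: "a \<in> A" "a' \<in> A" "d = a - a'" using \<open>d \<in> diffset A A\<close> by (rule diffsetE)
  define E where "E = {b \<in> S. r (a - b) \<ge> \<tau> \<and> r (a' - b) \<ge> \<tau>}"
  have finE: "finite E" unfolding E_def using fin by simp
  have "g s = (\<Sum>b\<in>S. w b)" by (rule gw)
  also have "\<dots> \<le> (\<Sum>b\<in>S. (if b \<in> E then w b else 0) + (if r (a - b) < \<tau> then w b else 0) + (if r (a' - b) < \<tau> then w b else 0))"
   unfolding E_def using w0 by (intro sum_mono) (auto simp: not_less)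
  also have "\<dots> = (\<Sum>b\<in>S. (if b \<in> E then w b else 0)) + B a + B a'"
   unfolding B_def by (simp add: sum.distrib)
  also have "(\<Sum>b\<in>S. (if b \<in> E then w b else 0)) = (\<Sum>b\<in>E. w b)"
   using fin by (simp add: sum.If_cases E_def Int_def)
  finally have "g s \<le> (\<Sum>b\<in>E. w b) + B a + B a'" .
  moreover have "B a \<le> g s / 4" "B a' \<le> g s / 4" using aa unfolding A_def by auto
  ultimately have "g s / 2 \<le> (\<Sum>b\<in>E. w b)" by linarith
  also have "(\<Sum>b\<in>E. w b) \<le> (\<Sum>b\<in>E. (L / N) * (L / N))"
   unfolding w_def by (intro sum_mono mult_mono pL qL p0 q0) (use LNpos in simp)
  finally have "g s / 2 \<le> real (card E) * (L / N)\<^sup>2" by (simp add: power2_eq_square)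
  hence "1 / (8 * L * N) \<le> real (card E) * (L / N)\<^sup>2" using gbig by (simp add: field_simps)
  hence cE: "real (card E) \<ge> N / (8 * L^3)" using L N by (simp add: field_simps power2_eq_square power3_eq_cube)
  have "real (card E) * \<tau>\<^sup>2 = (\<Sum>b\<in>E. \<tau> * \<tau>)" by (simp add: power2_eq_square)
  also have "\<dots> \<le> (\<Sum>b\<in>E. r (a - b) * r (a' - b))"
   unfolding E_def using tau r0 by (intro sum_mono mult_mono) auto
  also have "\<dots> = (\<Sum>b\<in>E. (\<lambda>u. r u * r (u - d)) (a - b))" unfolding aa(3) by simp
  also have "\<dots> \<le> (\<Sum>u\<in>D. r u * r (u - d))"
   by (rule sum_shift_le) (use finE finD rD r0 in \<open>auto simp: inj_on_def\<close>)
  finally have "real (card E) * \<tau>\<^sup>2 \<le> G d" unfolding G_def .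
  moreover have "N / (8 * L^3) * \<tau>\<^sup>2 \<le> real (card E) * \<tau>\<^sup>2" using cE by (intro mult_right_mono) auto
  moreover have "N / (8 * L^3) * \<tau>\<^sup>2 = 1 / (2048 * L^5 * N)"
   unfolding \<tau>_def using L N by (simp add: field_simps power2_eq_square power3_eq_cube eval_nat_numeral)
  ultimately show ?thesis by linarith
 qed
 have "(\<Sum>d\<in>diffset A A. G d) \<le> 1"
 proof -
  have "(\<Sum>d\<in>diffset A A. G d) = (\<Sum>u\<in>D. r u * (\<Sum>d\<in>diffset A A. r (u - d)))"
   unfolding G_def by (subst sum.swap) (simp add: sum_distrib_left)
  also have "\<dots> \<le> (\<Sum>u\<in>D. r u * 1)"
  proof (intro sum_mono mult_left_mono r0)
   fix u
   have "(\<Sum>d\<in>diffset A A. r (u - d)) \<le> (\<Sum>x\<in>D. r x)"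
    by (rule sum_shift_le) (use finA finD rD r0 in \<open>auto simp: inj_on_def\<close>)
   thus "(\<Sum>d\<in>diffset A A. r (u - d)) \<le> 1" using rsum by linarith
  qed
  finally show ?thesis using rsum by simp
 qed
 moreover have "real (card (diffset A A)) * (1 / (2048 * L^5 * N)) \<le> (\<Sum>d\<in>diffset A A. G d)"
  using Gbig by (intro sum_bounded_below) auto
 ultimately have "real (card (diffset A A)) * (1 / (2048 * L^5 * N)) \<le> 1" by linarith
 hence "real (card (diffset A A)) \<le> 2048 * L^5 * N" using L N by (simp add: field_simps)
 moreover have "p a > 0 \<and> q (s - a) > 0" if "a \<in> A" for a
 proof -
  have "p a * q (s - a) > 0" using \<open>a \<in> A\<close> unfolding A_def w_def by simp
  thus ?thesis using p0[of a] q0[of "s - a"] by (auto simp: zero_less_mult_iff)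
 qed
 ultimately show ?thesis using that[OF AS _ pA qA] by blast
qed

section \<open>Approximate groups and their stabilizers\<close>

text \<open>One radius per coordinate, because the contractions used later shrink the coordinates at
  different rates.\<close>

definition vbx :: "('n \<Rightarrow> real) \<Rightarrow> (real^'n) set" where
 "vbx r = {x. \<forall>i. \<bar>x $ i\<bar> \<le> r i}"

definition separated :: "('n \<Rightarrow> real) \<Rightarrow> (real^'n) set \<Rightarrow> bool" where
 "separated r Y \<longleftrightarrow> (\<forall>x\<in>Y. \<forall>y\<in>Y. x \<noteq> y \<longrightarrow> x - y \<notin> vbx r)"

text \<open>The centres \<open>Y\<close> are arbitrary, and the bound \<open>m\<close> is real so
  that losses multiply. This relation is the approximate form of inclusion used throughout.\<close>

definition covers :: "real \<Rightarrow> 'a::ab_group_add set \<Rightarrow> 'a set \<Rightarrow> bool" where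
 "covers m B H \<longleftrightarrow> (\<exists>Y. finite Y \<and> real (card Y) \<le> m \<and> (\<forall>x\<in>B. \<exists>y\<in>Y. x - y \<in> H))"

definition vinv :: "real^'n \<Rightarrow> real^'n" where
 "vinv b = (\<chi> i. inverse (b $ i))"

lemma vbx_uminus: "x \<in> vbx r \<Longrightarrow> - x \<in> vbx r"
 unfolding vbx_def by simp

lemma vbx_minus_commute: "x - y \<in> vbx r \<longleftrightarrow> y - x \<in> vbx r"
 using vbx_uminus[of "x - y"] vbx_uminus[of "y - x"] by auto

lemma vbx_add: "x \<in> vbx r \<Longrightarrow> y \<in> vbx s \<Longrightarrow> x + y \<in> vbx (\<lambda>i. r i + s i)"
 unfolding vbx_def by (auto intro: order_trans[OF abs_triangle_ineq add_mono])

lemma vbx_mono: "x \<in> vbx r \<Longrightarrow> (\<And>i. r i \<le> s i) \<Longrightarrow> x \<in> vbx s"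
 unfolding vbx_def by (auto intro: order_trans)

lemma separated_mono: "separated r Y \<Longrightarrow> Z \<subseteq> Y \<Longrightarrow> (\<And>i. s i \<le> r i) \<Longrightarrow> separated s Z"
 unfolding separated_def using vbx_mono by (metis subsetD)

lemma coversI: "finite Y \<Longrightarrow> real (card Y) \<le> m \<Longrightarrow> (\<And>x. x \<in> B \<Longrightarrow> \<exists>y\<in>Y. x - y \<in> H) \<Longrightarrow> covers m B H"
 unfolding covers_def by blast

lemma coversE: assumes "covers m B H"
 obtains Y where "finite Y" "real (card Y) \<le> m" "\<And>x. x \<in> B \<Longrightarrow> \<exists>y\<in>Y. x - y \<in> H"
 using assms unfolding covers_def by blast

lemma covers_mono: assumes "covers m B H" "B' \<subseteq> B" "m \<le> m'" "H \<subseteq> H'" shows "covers m' B' H'"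
proof -
 obtain Y where Y: "finite Y" "real (card Y) \<le> m" "\<And>x. x \<in> B \<Longrightarrow> \<exists>y\<in>Y. x - y \<in> H"
  using assms(1) by (rule coversE) blast
 show ?thesis
 proof (rule coversI[OF Y(1)])
  show "real (card Y) \<le> m'" using Y(2) assms(3) by linarith
  fix x assume "x \<in> B'"
  hence "x \<in> B" using assms(2) by blast
  from Y(3)[OF this] show "\<exists>y\<in>Y. x - y \<in> H'" using assms(4) by blast
 qed
qed

lemma covers_refl: "B \<subseteq> H \<Longrightarrow> m \<ge> 1 \<Longrightarrow> covers m B H"
 by (rule coversI[of "{0}"]) auto

lemma covers_nonneg: assumes "covers m B H" shows "m \<ge> 0"
proof -
 obtain Y :: "'a set" where "real (card Y) \<le> m" using assms unfolding covers_def by blast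
 thus ?thesis using of_nat_0_le_iff[of "card Y"] by linarith
qed

lemma card_sumset_le: "finite A \<Longrightarrow> finite B \<Longrightarrow> card (sumset A B) \<le> card A * card B"
 unfolding sumset_def using card_image_le[of "A \<times> B" "\<lambda>(a, b). a + b"] by (simp add: card_cartesian_product)

lemma covers_trans: assumes "covers m A B" "covers m' B C" shows "covers (m * m') A C"
proof -
 obtain Y where Y: "finite Y" "real (card Y) \<le> m" "\<And>x. x \<in> A \<Longrightarrow> \<exists>y\<in>Y. x - y \<in> B"
  using assms(1) by (rule coversE) blast
 obtain Z where Z: "finite Z" "real (card Z) \<le> m'" "\<And>x. x \<in> B \<Longrightarrow> \<exists>y\<in>Z. x - y \<in> C"
  using assms(2) by (rule coversE) blast
 show ?thesis
 proof (rule coversI[of "sumset Y Z"])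
  show "finite (sumset Y Z)" using Y Z by simp
  have "real (card (sumset Y Z)) \<le> real (card Y) * real (card Z)"
   using card_sumset_le[OF Y(1) Z(1)] by (simp only: of_nat_mult[symmetric] of_nat_le_iff)
  also have "\<dots> \<le> m * m'" using Y(2) Z(2) by (intro mult_mono) auto
  finally show "real (card (sumset Y Z)) \<le> m * m'" .
  fix x assume "x \<in> A"
  from Y(3)[OF this] obtain y where y: "y \<in> Y" "x - y \<in> B" by blast
  from Z(3)[OF y(2)] obtain z where z: "z \<in> Z" "x - y - z \<in> C" by blast
  show "\<exists>y\<in>sumset Y Z. x - y \<in> C"
   by (rule bexI[of _ "y + z"]) (use y z in \<open>auto intro: sumsetI simp: diff_diff_add\<close>)
 qed
qed

lemma covers_sumset: assumes "covers m A B" "covers m' A' B'" shows "covers (m * m') (sumset A A') (sumset B B')"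
proof -
 obtain Y where Y: "finite Y" "real (card Y) \<le> m" "\<And>x. x \<in> A \<Longrightarrow> \<exists>y\<in>Y. x - y \<in> B"
  using assms(1) by (rule coversE) blast
 obtain Z where Z: "finite Z" "real (card Z) \<le> m'" "\<And>x. x \<in> A' \<Longrightarrow> \<exists>y\<in>Z. x - y \<in> B'"
  using assms(2) by (rule coversE) blast
 show ?thesis
 proof (rule coversI[of "sumset Y Z"])
  show "finite (sumset Y Z)" using Y Z by simp
  have "real (card (sumset Y Z)) \<le> real (card Y) * real (card Z)"
   using card_sumset_le[OF Y(1) Z(1)] by (simp only: of_nat_mult[symmetric] of_nat_le_iff)
  also have "\<dots> \<le> m * m'" using Y(2) Z(2) by (intro mult_mono) auto
  finally show "real (card (sumset Y Z)) \<le> m * m'" .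
  fix x assume "x \<in> sumset A A'"
  then obtain a a' where a: "a \<in> A" "a' \<in> A'" "x = a + a'" by (rule sumsetE)
  from Y(3)[OF a(1)] obtain y where y: "y \<in> Y" "a - y \<in> B" by blast
  from Z(3)[OF a(2)] obtain z where z: "z \<in> Z" "a' - z \<in> B'" by blast
  have "x - (y + z) = (a - y) + (a' - z)" using a(3) by simp
  also have "\<dots> \<in> sumset B B'" using y z by (intro sumsetI)
  finally show "\<exists>y\<in>sumset Y Z. x - y \<in> sumset B B'"
   using y z by (intro bexI[of _ "y + z"]) (auto intro: sumsetI)
 qed
qed

lemma covers_dilate:
 fixes t :: "real^'n"
 assumes "covers m A B" shows "covers m ((*) t ` A) ((*) t ` B)"
proof -
 obtain Y where Y: "finite Y" "real (card Y) \<le> m" "\<And>x. x \<in> A \<Longrightarrow> \<exists>y\<in>Y. x - y \<in> B"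
  using assms(1) by (rule coversE) blast
 show ?thesis
 proof (rule coversI[of "(*) t ` Y"])
  show "real (card ((*) t ` Y)) \<le> m" using Y(2) card_image_le[OF Y(1), of "(*) t"] by linarith
  fix x assume "x \<in> (*) t ` A"
  then obtain a where a: "a \<in> A" "x = t * a" by blast
  from Y(3)[OF a(1)] obtain y where y: "y \<in> Y" "a - y \<in> B" by blast
  have "x - t * y = t * (a - y)" using a by (simp add: right_diff_distrib)
  thus "\<exists>y\<in>(*) t ` Y. x - y \<in> (*) t ` B" using y by blast
 qed (use Y in simp)
qed

lemma card_le_sum_card:
 assumes "finite Y" "\<And>y. y \<in> Y \<Longrightarrow> finite (F y)" "E \<subseteq> (\<Union>y\<in>Y. F y)"
 shows "real (card E) \<le> (\<Sum>y\<in>Y. real (card (F y)))"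
proof -
 have "card E \<le> card (\<Union>y\<in>Y. F y)" using assms by (intro card_mono) auto
 also have "\<dots> \<le> (\<Sum>y\<in>Y. card (F y))" using assms(1) by (rule card_UN_le)
 finally have "real (card E) \<le> real (\<Sum>y\<in>Y. card (F y))" by (simp only: of_nat_le_iff)
 thus ?thesis by simp
qed

text \<open>The fullest of the translates. This is how a large set in \<open>B\<close> yields a
  large set that lies in \<open>H\<close> after a translation.\<close>

lemma covers_pigeonhole:
 assumes "covers m B H" "finite E" "E \<subseteq> B"
 obtains y E' where "E' \<subseteq> E" "\<And>x. x \<in> E' \<Longrightarrow> x - y \<in> H" "real (card E) \<le> m * real (card E')"
proof -
 obtain Y where Y: "finite Y" "real (card Y) \<le> m" "\<And>x. x \<in> B \<Longrightarrow> \<exists>y\<in>Y. x - y \<in> H"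
  using assms(1) by (rule coversE) blast
 let ?E = "\<lambda>y. {x \<in> E. x - y \<in> H}"
 have "\<exists>y. real (card E) \<le> m * real (card (?E y))"
 proof (rule ccontr)
  assume n: "\<not> ?thesis"
  show False
  proof (cases "Y = {}")
   case True
   hence "E = {}" using Y(3) assms(3) by blast
   thus False using n by simp
  next
   case False
   have m: "m > 0"
   proof -
    have "card Y > 0" using False Y(1) by (simp add: card_gt_0_iff)
    thus ?thesis using Y(2) by linarith
   qed
   have "E \<subseteq> (\<Union>y\<in>Y. ?E y)" using Y(3) assms(3) by blast
   hence "real (card E) \<le> (\<Sum>y\<in>Y. real (card (?E y)))" using Y(1) assms(2) by (intro card_le_sum_card) auto
   also have "\<dots> < (\<Sum>y\<in>Y. real (card E) / m)"
   proof (rule sum_strict_mono[OF Y(1) False])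
    fix y
    have "m * real (card (?E y)) < real (card E)" using n by (metis not_less)
    thus "real (card (?E y)) < real (card E) / m" using m by (simp add: pos_less_divide_eq mult.commute)
   qed
   also have "\<dots> = real (card Y) * (real (card E) / m)" by simp
   also have "\<dots> \<le> m * (real (card E) / m)" using Y(2) m by (intro mult_right_mono) auto
   also have "\<dots> = real (card E)" using m by simp
   finally show False by simp
  qed
 qed
 then obtain y where "real (card E) \<le> m * real (card (?E y))" by blast
 thus ?thesis using that[of "?E y" y] by blast
qed

lemma card_vec_PiE:
 fixes S :: "'n::finite \<Rightarrow> int set"
 assumes "\<And>i. finite (S i)"
 shows "finite {x :: int^'n. \<forall>i. x $ i \<in> S i}" "card {x :: int^'n. \<forall>i. x $ i \<in> S i} = (\<Prod>i\<in>UNIV. card (S i))"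
proof -
 have e: "{x :: int^'n. \<forall>i. x $ i \<in> S i} = vec_lambda ` (PiE UNIV S)"
 proof (intro equalityI subsetI)
  fix x :: "int^'n" assume "x \<in> {x. \<forall>i. x $ i \<in> S i}"
  thus "x \<in> vec_lambda ` (PiE UNIV S)" by (intro image_eqI[of _ _ "vec_nth x"]) auto
 qed auto
 have inj: "inj_on vec_lambda (PiE UNIV S)" by (auto simp: inj_on_def)
 show "finite {x :: int^'n. \<forall>i. x $ i \<in> S i}" unfolding e using assms by (intro finite_imageI finite_PiE) auto
 show "card {x :: int^'n. \<forall>i. x $ i \<in> S i} = (\<Prod>i\<in>UNIV. card (S i))"
  unfolding e by (subst card_image[OF inj]) (simp add: card_PiE)
qed

text \<open>Rounding the coordinates to grids of mesh \<open>r i\<close> is injective on a separated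
  set.\<close>

lemma card_separated_le:
 fixes Y :: "(real^'n) set"
 assumes Y: "\<And>x. x \<in> Y \<Longrightarrow> x - c \<in> vbx a" and sep: "separated r Y"
  and r: "\<And>i. r i > 0" and a: "\<And>i. a i \<ge> 0"
 shows "finite Y" "real (card Y) \<le> (\<Prod>i\<in>UNIV. (2 * a i / r i + 1))"
proof -
 define f :: "real^'n \<Rightarrow> int^'n" where "f x = (\<chi> i. \<lfloor>(x $ i - c $ i + a i) / r i\<rfloor>)" for x
 let ?S = "\<lambda>i. {0..\<lfloor>2 * a i / r i\<rfloor>}"
 have inj: "inj_on f Y"
 proof (rule inj_onI, rule ccontr)
  fix x y assume xy: "x \<in> Y" "y \<in> Y" "f x = f y" "x \<noteq> y"
  have "\<bar>(x - y) $ i\<bar> \<le> r i" for i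
  proof -
   have "\<lfloor>(x $ i - c $ i + a i) / r i\<rfloor> = \<lfloor>(y $ i - c $ i + a i) / r i\<rfloor>"
    using arg_cong[OF xy(3), of "\<lambda>v. v $ i"] unfolding f_def by simp
   hence "\<bar>(x $ i - c $ i + a i) / r i - (y $ i - c $ i + a i) / r i\<bar> < 1"
    using floor_correct[of "(x $ i - c $ i + a i) / r i"] floor_correct[of "(y $ i - c $ i + a i) / r i"] by linarith
   hence "\<bar>(x $ i - y $ i) / r i\<bar> < 1" by (simp add: diff_divide_distrib[symmetric])
   thus ?thesis using r[of i] by (simp add: abs_divide pos_divide_less_eq)
  qed
  hence "x - y \<in> vbx r" unfolding vbx_def by blast
  thus False using sep xy unfolding separated_def by blast
 qed
 have img: "f ` Y \<subseteq> {x. \<forall>i. x $ i \<in> ?S i}"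
 proof clarify
  fix x i assume "x \<in> Y"
  hence "\<bar>x $ i - c $ i\<bar> \<le> a i" using Y unfolding vbx_def by auto
  hence "0 \<le> x $ i - c $ i + a i" "x $ i - c $ i + a i \<le> 2 * a i" by linarith+
  hence "0 \<le> (x $ i - c $ i + a i) / r i" "(x $ i - c $ i + a i) / r i \<le> 2 * a i / r i"
   using r[of i] by (auto simp: divide_right_mono)
  thus "f x $ i \<in> ?S i" unfolding f_def by (auto simp: floor_mono)
 qed
 note fin = card_vec_PiE(1)[of ?S]
 show finY: "finite Y" using inj_on_finite[OF inj img] fin by simp
 have "card Y \<le> card {x :: int^'n. \<forall>i. x $ i \<in> ?S i}" using card_inj_on_le[OF inj img] fin by simp
 also have "\<dots> = (\<Prod>i\<in>UNIV. card (?S i))" by (rule card_vec_PiE) simp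
 finally have "real (card Y) \<le> real (\<Prod>i\<in>UNIV. card (?S i))" by (simp only: of_nat_le_iff)
 also have "\<dots> = (\<Prod>i\<in>UNIV. real (card (?S i)))" by simp
 also have "\<dots> \<le> (\<Prod>i\<in>UNIV. (2 * a i / r i + 1))"
 proof (rule prod_mono, intro conjI)
  fix i
  have "0 \<le> 2 * a i / r i" using a[of i] r[of i] by simp
  hence "\<lfloor>2 * a i / r i\<rfloor> \<ge> 0" by simp
  thus "real (card (?S i)) \<le> 2 * a i / r i + 1" by simp
 qed simp
 finally show "real (card Y) \<le> (\<Prod>i\<in>UNIV. (2 * a i / r i + 1))" .
qed

lemma ex_maximal_separated:
 fixes B :: "(real^'n) set"
 assumes B: "B \<subseteq> vbx a" and r: "\<And>i. r i > 0"
 obtains Y where "Y \<subseteq> B" "finite Y" "separated r Y" "\<And>b. b \<in> B \<Longrightarrow> \<exists>y\<in>Y. b - y \<in> vbx r"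
proof -
 define a' where "a' i = \<bar>a i\<bar>" for i
 have B': "x - 0 \<in> vbx a'" if "x \<in> B" for x using subsetD[OF B that] unfolding vbx_def a'_def
  by (auto intro: order_trans[OF _ abs_ge_self])
 define m where "m = nat \<lceil>\<Prod>i\<in>UNIV. (2 * a' i / r i + 1)\<rceil>"
 obtain Y where Y: "Y \<subseteq> B" "finite Y" "\<And>x y. x \<in> Y \<Longrightarrow> y \<in> Y \<Longrightarrow> x \<noteq> y \<Longrightarrow> \<not> x - y \<in> vbx r"
  "card Y \<le> m" "\<And>b. b \<in> B \<Longrightarrow> \<exists>y\<in>Y. b = y \<or> b - y \<in> vbx r"
 proof (rule ex_maximal_packing[of B "\<lambda>x y. x - y \<in> vbx r" m])
  fix Y assume Y: "Y \<subseteq> B" "finite Y" "\<forall>x\<in>Y. \<forall>y\<in>Y. x \<noteq> y \<longrightarrow> x - y \<notin> vbx r"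
  hence "separated r Y" unfolding separated_def by blast
  from card_separated_le(2)[of Y 0 a' r, OF _ this r] Y(1) B'
  have "real (card Y) \<le> (\<Prod>i\<in>UNIV. (2 * a' i / r i + 1))" unfolding a'_def by auto
  thus "card Y \<le> m" unfolding m_def by linarith
 next
  show "x - y \<in> vbx r \<Longrightarrow> y - x \<in> vbx r" for x y by (simp add: vbx_minus_commute)
 qed blast
 have "0 \<in> vbx r" using r unfolding vbx_def by (simp add: less_imp_le)
 hence "\<exists>y\<in>Y. b - y \<in> vbx r" if "b \<in> B" for b using Y(5)[OF that] by (metis diff_self)
 moreover have "separated r Y" using Y(3) unfolding separated_def by blast
 ultimately show ?thesis using that Y(1,2) by blast
qed

section \<open>Approximate groups and the price of a dilation\<close>

text \<open>A discretised approximate group: 1 is the resolution, below which \<open>H\<close> is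
  full, and \<open>R\<close> bounds the diameter. Containing a box, \<open>H\<close> is infinite;
  its size is measured by packings and coverings.\<close>

locale approx_group =
 fixes H :: "(real^'n) set" and K R :: real
 assumes symm: "x \<in> H \<Longrightarrow> - x \<in> H"
  and unit_box: "vbx (\<lambda>_. 1) \<subseteq> H"
  and bounded_by: "H \<subseteq> vbx (\<lambda>_. R)"
  and K_ge_1: "K \<ge> 1"
  and doubling: "covers K (sumset H H) H"
begin

text \<open>The parameter \<open>L\<close> is the price of the dilation. Sums, products and, away
  from the zero divisors, inverses are again in the family, and the prices multiply; this is the
  approximate substitute for a stabilizer ring.\<close>

definition stab :: "real \<Rightarrow> (real^'n) set" where
 "stab L = {t. covers L ((*) t ` H) H}"

lemma stabD: "t \<in> stab L \<Longrightarrow> covers L ((*) t ` H) H"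
 unfolding stab_def by blast

lemma zero_in: "0 \<in> H"
 using unit_box unfolding vbx_def by auto

lemma stab_mono: "t \<in> stab L \<Longrightarrow> L \<le> M \<Longrightarrow> t \<in> stab M"
 unfolding stab_def using covers_mono by blast

lemma stab_one: "L \<ge> 1 \<Longrightarrow> 1 \<in> stab L"
 unfolding stab_def by (auto intro: covers_refl)

lemma stab_zero: "L \<ge> 1 \<Longrightarrow> 0 \<in> stab L"
 unfolding stab_def using zero_in by (auto intro!: covers_refl)

lemma stab_nonneg: "t \<in> stab L \<Longrightarrow> L \<ge> 0"
 unfolding stab_def using covers_nonneg by blast

lemma stab_minus: assumes "t \<in> stab L" shows "- t \<in> stab L"
proof -
 have "(*) (- t) ` H \<subseteq> (*) t ` H"
 proof
  fix x assume "x \<in> (*) (- t) ` H"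
  then obtain h where "h \<in> H" "x = t * (- h)" by auto
  thus "x \<in> (*) t ` H" using symm by blast
 qed
 thus ?thesis using assms unfolding stab_def using covers_mono by blast
qed

lemma stab_add: assumes "s \<in> stab L" "t \<in> stab M" shows "s + t \<in> stab (L * M * K)"
proof -
 have "(*) (s + t) ` H \<subseteq> sumset ((*) s ` H) ((*) t ` H)"
  by (auto simp: distrib_right intro!: sumsetI)
 moreover have "covers (L * M * K) (sumset ((*) s ` H) ((*) t ` H)) H"
  using assms unfolding stab_def by (intro covers_trans[OF covers_sumset doubling]) auto
 ultimately show ?thesis unfolding stab_def using covers_mono by blast
qed

lemma stab_diff: "s \<in> stab L \<Longrightarrow> t \<in> stab M \<Longrightarrow> s - t \<in> stab (L * M * K)"
 using stab_add[of s L "- t" M] stab_minus by simp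

lemma stab_mult: assumes "s \<in> stab L" "t \<in> stab M" shows "s * t \<in> stab (L * M)"
proof -
 have "(*) (s * t) ` H = (*) s ` ((*) t ` H)" by (auto simp: mult.assoc)
 moreover have "covers (M * L) ((*) s ` ((*) t ` H)) H"
  using assms unfolding stab_def by (intro covers_trans[OF covers_dilate]) auto
 ultimately show ?thesis unfolding stab_def by (simp add: mult.commute)
qed

lemma triple: "covers (K^2) (sumset (sumset H H) H) H"
proof -
 have "covers (K * 1) (sumset (sumset H H) H) (sumset H H)"
  by (intro covers_sumset doubling covers_refl) auto
 from covers_trans[OF this doubling] show ?thesis by (simp add: power2_eq_square)
qed

text \<open>Ruzsa covering with \<open>b\<close> times \<open>\<Lambda>\<close>, where
  \<open>\<Lambda>\<close> is a maximal unit packing of \<open>H\<close>: as \<open>H + b H\<close>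
  is covered by \<open>L * K\<close> translates of \<open>H\<close>, few separated translates
  \<open>y + b \<Lambda>\<close> fit. Every \<open>h\<close> is then \<open>y + b * (l' - l)\<close>
  up to an error of size \<open>\<sigma>\<close>, and dividing by \<open>b\<close> sends that error
  into the unit box. The factor \<open>(3 / \<sigma>) ^ CARD('n)\<close> compares packings at scale
  \<open>\<sigma>\<close> with packings at scale 1.\<close>

lemma stab_inverse:
 assumes b: "b \<in> stab L" and big: "\<And>i. \<bar>b $ i\<bar> \<ge> \<sigma>" and s: "0 < \<sigma>" "\<sigma> \<le> 1"
 shows "vinv b \<in> stab (L * K^3 * (3 / \<sigma>) ^ CARD('n))"
proof -
 obtain \<Lambda> where La: "\<Lambda> \<subseteq> H" "finite \<Lambda>" "separated (\<lambda>_. 1) \<Lambda>" "\<And>h. h \<in> H \<Longrightarrow> \<exists>l\<in>\<Lambda>. h - l \<in> vbx (\<lambda>_. 1)"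
  using ex_maximal_separated[OF bounded_by, of "\<lambda>_. 1"] by auto
 have Lne: "\<Lambda> \<noteq> {}" using La(4)[OF zero_in] by blast
 hence cL: "card \<Lambda> > 0" using La(2) by (simp add: card_gt_0_iff)
 define C where "C = (3 / \<sigma>) ^ CARD('n)"
 have cov: "covers (L * K) (sumset H ((*) b ` H)) H"
 proof -
  have "covers (1 * L) (sumset H ((*) b ` H)) (sumset H H)"
   using b by (intro covers_sumset covers_refl stabD) auto
  from covers_trans[OF this doubling] show ?thesis by simp
 qed
 have packH: "real (card E) \<le> real (card \<Lambda>) * C" if E: "finite E" "\<And>x. x \<in> E \<Longrightarrow> x - y \<in> H" "separated (\<lambda>_. \<sigma>) E" for E y
 proof -
  let ?E = "\<lambda>l. {x \<in> E. x - (y + l) \<in> vbx (\<lambda>_. 1)}"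
  have "E \<subseteq> (\<Union>l\<in>\<Lambda>. ?E l)"
  proof
   fix x assume x: "x \<in> E"
   obtain l where "l \<in> \<Lambda>" "x - y - l \<in> vbx (\<lambda>_. 1)" using La(4)[OF E(2)[OF x]] by blast
   thus "x \<in> (\<Union>l\<in>\<Lambda>. ?E l)" using x by (auto simp: diff_diff_add)
  qed
  hence "real (card E) \<le> (\<Sum>l\<in>\<Lambda>. real (card (?E l)))" using La(2) E(1) by (intro card_le_sum_card) auto
  also have "\<dots> \<le> (\<Sum>l\<in>\<Lambda>. C)"
  proof (intro sum_mono)
   fix l
   have "separated (\<lambda>_. \<sigma>) (?E l)" using E(3) by (rule separated_mono) auto
   hence "real (card (?E l)) \<le> (\<Prod>i\<in>(UNIV::'n set). (2 * 1 / \<sigma> + 1))"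
    using s by (intro card_separated_le(2)[of _ "y + l"]) auto
   also have "\<dots> = (2 / \<sigma> + 1) ^ CARD('n)" by simp
   also have "\<dots> \<le> C" unfolding C_def using s by (intro power_mono) (auto simp: field_simps)
   finally show "real (card (?E l)) \<le> C" .
  qed
  finally show ?thesis by simp
 qed
 let ?cl = "\<lambda>y y'. \<exists>l\<in>\<Lambda>. \<exists>l'\<in>\<Lambda>. (y + b * l) - (y' + b * l') \<in> vbx (\<lambda>_. \<sigma>)"
 have main: "real (card Y) \<le> L * K * C"
  if Y: "Y \<subseteq> H" "finite Y" "\<forall>x\<in>Y. \<forall>y\<in>Y. x \<noteq> y \<longrightarrow> \<not> ?cl x y" for Y
 proof -
  let ?f = "\<lambda>(y, l). y + b * l"
  have far: "?f p - ?f p' \<notin> vbx (\<lambda>_. \<sigma>)" if "p \<in> Y \<times> \<Lambda>" "p' \<in> Y \<times> \<Lambda>" "p \<noteq> p'" for p p'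
  proof -
   obtain y l y' l' where p: "p = (y, l)" "p' = (y', l')" by force
   show ?thesis
   proof (cases "y = y'")
    case False
    thus ?thesis using Y(3) that p by auto
   next
    case True
    hence "l \<noteq> l'" using that p by simp
    hence "l - l' \<notin> vbx (\<lambda>_. 1)" using La(3) that p unfolding separated_def by blast
    then obtain i where i: "\<bar>(l - l') $ i\<bar> > 1" by (auto simp: vbx_def not_le)
    have "\<sigma> * 1 < \<bar>b $ i\<bar> * \<bar>(l - l') $ i\<bar>" using big[of i] i s by (intro mult_le_less_imp_less) auto
    hence "\<bar>(b * (l - l')) $ i\<bar> > \<sigma>" by (simp add: abs_mult)
    moreover have "?f p - ?f p' = b * (l - l')" using p True by (simp add: right_diff_distrib)
    ultimately have "?f p - ?f p' \<notin> vbx (\<lambda>_. \<sigma>)" by (auto simp: vbx_def not_le intro: exI[of _ i])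
    thus ?thesis .
   qed
  qed
  have s0: "0 \<in> vbx (\<lambda>_::'n. \<sigma>)" unfolding vbx_def using s by simp
  have inj: "inj_on ?f (Y \<times> \<Lambda>)"
  proof (rule inj_onI, rule ccontr)
   fix p p' assume "p \<in> Y \<times> \<Lambda>" "p' \<in> Y \<times> \<Lambda>" "?f p = ?f p'" "p \<noteq> p'"
   thus False using far[of p p'] s0 by simp
  qed
  let ?W = "?f ` (Y \<times> \<Lambda>)"
  have finW: "finite ?W" using Y(2) La(2) by simp
  have sepW: "separated (\<lambda>_. \<sigma>) ?W" unfolding separated_def using far by blast
  have WH: "?W \<subseteq> sumset H ((*) b ` H)" using Y(1) La(1) by (auto intro!: sumsetI)
  obtain y E' where E': "E' \<subseteq> ?W" "\<And>x. x \<in> E' \<Longrightarrow> x - y \<in> H" "real (card ?W) \<le> L * K * real (card E')"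
   using covers_pigeonhole[OF cov finW WH] by metis
  have "real (card E') \<le> real (card \<Lambda>) * C"
   using packH[of E' y] E' finW sepW finite_subset separated_mono[of _ ?W] by (metis order_refl)
  hence "L * K * real (card E') \<le> L * K * (real (card \<Lambda>) * C)"
   using stab_nonneg[OF b] K_ge_1 by (intro mult_left_mono) auto
  moreover have "card ?W = card Y * card \<Lambda>" using inj by (simp add: card_image card_cartesian_product)
  ultimately have "real (card Y) * real (card \<Lambda>) \<le> (L * K * C) * real (card \<Lambda>)" using E'(3) by (simp add: mult_ac)
  thus ?thesis using cL by simp
 qed
 obtain Y where Y: "Y \<subseteq> H" "finite Y" "\<And>x y. x \<in> Y \<Longrightarrow> y \<in> Y \<Longrightarrow> x \<noteq> y \<Longrightarrow> \<not> ?cl x y"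
  "\<And>h. h \<in> H \<Longrightarrow> \<exists>y\<in>Y. h = y \<or> ?cl h y"
 proof (rule ex_maximal_packing[of H ?cl "nat \<lceil>L * K * C\<rceil>"])
  fix Y assume "Y \<subseteq> H" "finite Y" "\<forall>x\<in>Y. \<forall>y\<in>Y. x \<noteq> y \<longrightarrow> \<not> ?cl x y"
  from main[OF this] show "card Y \<le> nat \<lceil>L * K * C\<rceil>" by linarith
 next
  fix x y assume "?cl x y"
  then obtain l l' where "l \<in> \<Lambda>" "l' \<in> \<Lambda>" "(x + b * l) - (y + b * l') \<in> vbx (\<lambda>_. \<sigma>)" by blast
  moreover from this(3) have "(y + b * l') - (x + b * l) \<in> vbx (\<lambda>_. \<sigma>)" by (simp add: vbx_minus_commute)
  ultimately show "?cl y x" by blast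
 qed blast
 have bnz: "b $ i \<noteq> 0" for i using big[of i] s by auto
 have bi: "vinv b * (b * x) = x" for x unfolding vinv_def using bnz by (simp add: vec_eq_iff)
 have "covers (L * K * C) ((*) (vinv b) ` H) (sumset (sumset H H) H)"
 proof (rule coversI[of "(*) (vinv b) ` Y"])
  show "real (card ((*) (vinv b) ` Y)) \<le> L * K * C"
   using card_image_le[OF Y(2), of "(*) (vinv b)"] main[of Y] Y(1-3) by fastforce
  fix x assume "x \<in> (*) (vinv b) ` H"
  then obtain h where h: "h \<in> H" "x = vinv b * h" by blast
  from Y(4)[OF h(1)] obtain y where y: "y \<in> Y" "h = y \<or> ?cl h y" by blast
  have "vinv b * (h - y) \<in> sumset (sumset H H) H"
  proof (cases "h = y")
   case True
   thus ?thesis using sumsetI[OF sumsetI[OF zero_in zero_in] zero_in] by simp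
  next
   case False
   then obtain l l' where l: "l \<in> \<Lambda>" "l' \<in> \<Lambda>" "(h + b * l) - (y + b * l') \<in> vbx (\<lambda>_. \<sigma>)" using y by blast
   define e where "e = (h + b * l) - (y + b * l')"
   have "vinv b * e \<in> vbx (\<lambda>_. 1)"
   proof -
    have "\<bar>(vinv b * e) $ i\<bar> \<le> 1" for i
    proof -
     have "\<bar>e $ i\<bar> \<le> \<bar>b $ i\<bar>" using l(3) big[of i] unfolding e_def vbx_def by (auto intro: order_trans)
     thus ?thesis unfolding vinv_def using bnz[of i] by (simp add: abs_mult field_simps)
    qed
    thus ?thesis unfolding vbx_def by blast
   qed
   hence "vinv b * e \<in> H" using unit_box by blast
   moreover have "vinv b * (h - y) = (l' + (- l)) + vinv b * e"
   proof -
    have "h - y = b * (l' - l) + e" unfolding e_def by (simp add: right_diff_distrib)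
    thus ?thesis by (simp add: distrib_left bi)
   qed
   moreover have "l' \<in> H" "- l \<in> H" using l La(1) symm by auto
   ultimately show ?thesis by (simp only:) (intro sumsetI)
  qed
  thus "\<exists>y\<in>(*) (vinv b) ` Y. x - y \<in> sumset (sumset H H) H" using y h
   by (intro bexI[of _ "vinv b * y"]) (auto simp: right_diff_distrib)
 qed (use Y in simp)
 from covers_trans[OF this triple] have "covers (L * K * C * K^2) ((*) (vinv b) ` H) H" .
 moreover have "L * K * C * K^2 = L * K^3 * C" by (simp add: power2_eq_square power3_eq_cube)
 ultimately show ?thesis unfolding stab_def C_def by simp
qed

end

section \<open>Density of the stabilizer at one scale\<close>

text \<open>Exponent of the price in \<open>stab_dense\<close> after \<open>j\<close> pivot steps.
  An element of the next set is \<open>x + p * z\<close>: here \<open>x\<close> costs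
  \<open>gexp n j\<close>, the new element \<open>p\<close> costs
  \<open>2 * gexp n j + 12 + 5 * n\<close>, \<open>z\<close> costs 1, and the addition costs one
  factor \<open>K\<close>.\<close>

fun gexp :: "nat \<Rightarrow> nat \<Rightarrow> nat" where
 "gexp n 0 = 0"
| "gexp n (Suc j) = 3 * gexp n j + 5 * n + 14"

lemma gexp_mono: "i \<le> j \<Longrightarrow> gexp n i \<le> gexp n j"
 by (induction j) (auto simp: le_Suc_eq)

text \<open>The quotient set (X - X) / (Z - Z) of the pivot method for sum-product
  estimates.\<close>

definition quots :: "(real^'n) set \<Rightarrow> (real^'n) set \<Rightarrow> (real^'n) set" where
 "quots X Z = {q. \<exists>x\<in>X. \<exists>x'\<in>X. \<exists>z\<in>Z. \<exists>z'\<in>Z. z \<noteq> z' \<and> q = (x - x') * vinv (z - z')}"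

lemma vec_sum_scaleR_bound:
 fixes v :: "'n::finite \<Rightarrow> real^'n"
 assumes "\<And>i. v i \<in> vbx (\<lambda>_. 2)" "\<And>i. 0 \<le> c i" "\<And>i. c i \<le> 1"
 shows "(\<Sum>i\<in>UNIV. c i *\<^sub>R v i) \<in> vbx (\<lambda>_. 2 * real CARD('n))"
 unfolding vbx_def
proof (clarify)
 fix k
 have "\<bar>(\<Sum>i\<in>UNIV. c i *\<^sub>R v i) $ k\<bar> \<le> (\<Sum>i\<in>UNIV. \<bar>c i * v i $ k\<bar>)" by simp
 also have "\<dots> \<le> (\<Sum>i\<in>(UNIV::'n set). 1 * 2)"
  unfolding abs_mult using assms by (intro sum_mono mult_mono) (auto simp: vbx_def)
 finally show "\<bar>(\<Sum>i\<in>UNIV. c i *\<^sub>R v i) $ k\<bar> \<le> 2 * real CARD('n)" by simp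
qed

text \<open>Binary expansion: a combination with \<open>N + 1\<close> binary digits is the mean of
  \<open>sum v d\<close>, with \<open>d\<close> the indices of leading digit 1, and of a combination
  with \<open>N\<close> digits. Halving also halves the inherited error, so that
  \<open>2 * \<sigma>\<close> reproduces itself as
  \<open>\<sigma> + 2 * \<sigma> / 2\<close>.\<close>

lemma dyadic_dense:
 fixes v :: "'n::finite \<Rightarrow> real^'n"
 assumes v: "\<And>i. v i \<in> vbx (\<lambda>_. 2)" and s: "0 < \<sigma>" "\<sigma> \<le> 1" and Q0: "0 \<in> Q"
  and step: "\<And>r d. r \<in> Q \<Longrightarrow> r \<in> vbx (\<lambda>_. 2 * real CARD('n) + 2) \<Longrightarrow>
    \<exists>q\<in>Q. q - (1/2) *\<^sub>R (r + sum v d) \<in> vbx (\<lambda>_. \<sigma>)"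
  and k: "\<And>i. k i < (2::nat)^N"
 shows "\<exists>q\<in>Q. q - (\<Sum>i\<in>UNIV. (real (k i) / 2^N) *\<^sub>R v i) \<in> vbx (\<lambda>_. 2 * \<sigma>)"
 using k
proof (induction N arbitrary: k)
 case 0
 hence "k = (\<lambda>_. 0)" by auto
 thus ?case using Q0 s by (intro bexI[of _ 0]) (auto simp: vbx_def)
next
 case (Suc N)
 define d where "d = {i. k i \<ge> 2^N}"
 define k' where "k' i = k i mod 2^N" for i
 have k'lt: "k' i < 2^N" for i unfolding k'_def by simp
 have ki: "real (k i) = (if i \<in> d then 2^N else 0) + real (k' i)" for i
 proof (cases "k i \<ge> 2^N")
  case True
  have "k i < 2 * 2^N" using Suc.prems[of i] by simp
  hence "k' i = k i - 2^N" unfolding k'_def using True by (simp add: le_mod_geq)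
  thus ?thesis using True unfolding d_def by (simp add: of_nat_diff)
 next
  case False thus ?thesis unfolding d_def k'_def by simp
 qed
 let ?p = "\<Sum>i\<in>UNIV. (real (k i) / 2^Suc N) *\<^sub>R v i" and ?p' = "\<Sum>i\<in>UNIV. (real (k' i) / 2^N) *\<^sub>R v i"
 have pp: "?p = (1/2) *\<^sub>R (?p' + sum v d)"
 proof -
  have "sum v d = (\<Sum>i\<in>UNIV. (if i \<in> d then 1 else 0) *\<^sub>R v i)"
   by (simp add: if_distrib[of "\<lambda>c. c *\<^sub>R v _"] sum.If_cases cong: if_cong)
  hence "(1/2) *\<^sub>R (?p' + sum v d) = (\<Sum>i\<in>UNIV. ((1/2) * (real (k' i) / 2^N + (if i \<in> d then 1 else 0))) *\<^sub>R v i)"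
   by (simp only: sum.distrib[symmetric] scaleR_sum_right scaleR_add_left[symmetric] scaleR_scaleR)
  also have "\<dots> = ?p" by (intro sum.cong refl arg_cong2[of _ _ _ _ "(*\<^sub>R)"]) (simp add: ki field_simps)
  finally show ?thesis by simp
 qed
 have "\<exists>q\<in>Q. q - ?p' \<in> vbx (\<lambda>_. 2 * \<sigma>)" by (rule Suc.IH) (rule k'lt)
 then obtain q' where q': "q' \<in> Q" "q' - ?p' \<in> vbx (\<lambda>_. 2 * \<sigma>)" by (elim bexE)
 have "?p' \<in> vbx (\<lambda>_. 2 * real CARD('n))"
  by (rule vec_sum_scaleR_bound[OF v]) (use k'lt in \<open>auto simp: less_imp_le divide_le_eq\<close>)
 from vbx_add[OF q'(2) this] have "q' \<in> vbx (\<lambda>_. 2 * \<sigma> + 2 * real CARD('n))" by simp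
 hence "q' \<in> vbx (\<lambda>_. 2 * real CARD('n) + 2)" by (rule vbx_mono) (use s in simp)
 from step[OF q'(1) this, of d] obtain q where q: "q \<in> Q" "q - (1/2) *\<^sub>R (q' + sum v d) \<in> vbx (\<lambda>_. \<sigma>)" by blast
 have "(1/2) *\<^sub>R (q' - ?p') \<in> vbx (\<lambda>_. \<sigma>)" using q'(2) by (simp add: vbx_def mult.commute)
 from vbx_add[OF q(2) this] have "q - (1/2) *\<^sub>R (q' + sum v d) + (1/2) *\<^sub>R (q' - ?p') \<in> vbx (\<lambda>_. 2 * \<sigma>)"
  by simp
 moreover have "q - (1/2) *\<^sub>R (q' + sum v d) + (1/2) *\<^sub>R (q' - ?p') = q - ?p" unfolding pp
  by (simp add: scaleR_right_diff_distrib scaleR_right_distrib)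
 ultimately have "q - ?p \<in> vbx (\<lambda>_. 2 * \<sigma>)" by simp
 thus ?case using q(1) by blast
qed

text \<open>Coefficients at most 1/2 round down to dyadic ones with numerators below
  \<open>2 ^ N\<close>; a large \<open>N\<close> makes this rounding cost at most one more
  \<open>\<sigma>\<close>.\<close>

lemma dyadic_approx:
 fixes v :: "'n::finite \<Rightarrow> real^'n"
 assumes v: "\<And>i. v i \<in> vbx (\<lambda>_. 2)" and s: "0 < \<sigma>"
  and Q: "\<And>N k. (\<And>i. k i < (2::nat)^N) \<Longrightarrow> \<exists>q\<in>Q. q - (\<Sum>i\<in>UNIV. (real (k i) / 2^N) *\<^sub>R v i) \<in> vbx (\<lambda>_. 2 * \<sigma>)"
  and c: "\<And>i. 0 \<le> c i" "\<And>i. c i \<le> 1 / 2"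
 shows "\<exists>q\<in>Q. q - (\<Sum>i\<in>UNIV. c i *\<^sub>R v i) \<in> vbx (\<lambda>_. 3 * \<sigma>)"
proof -
 obtain N where N: "2 * real CARD('n) / \<sigma> < 2^N" using real_arch_pow[of 2] by auto
 define k where "k i = nat \<lfloor>c i * 2^N\<rfloor>" for i
 have kr: "real (k i) = real_of_int \<lfloor>c i * 2^N\<rfloor>" for i unfolding k_def using c(1)[of i] by simp
 have klt: "k i < 2^N" for i
 proof -
  have "real (k i) \<le> c i * 2^N" unfolding kr by simp
  also have "\<dots> \<le> (1/2) * 2^N" using c by (intro mult_right_mono) auto
  also have "\<dots> < 2^N" by simp
  finally show ?thesis by (metis of_nat_less_iff of_nat_numeral of_nat_power)
 qed
 define e where "e i = real (k i) / 2^N - c i" for i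
 have e: "\<bar>e i\<bar> \<le> 1 / 2^N" for i
 proof -
  have "e i * 2^N = real (k i) - c i * 2^N" unfolding e_def by (simp add: field_simps)
  hence "\<bar>e i * 2^N\<bar> \<le> 1" unfolding kr by linarith
  thus ?thesis by (simp add: abs_mult pos_le_divide_eq)
 qed
 have "\<exists>q\<in>Q. q - (\<Sum>i\<in>UNIV. (real (k i) / 2^N) *\<^sub>R v i) \<in> vbx (\<lambda>_. 2 * \<sigma>)" by (rule Q) (rule klt)
 then obtain q where q: "q \<in> Q" "q - (\<Sum>i\<in>UNIV. (real (k i) / 2^N) *\<^sub>R v i) \<in> vbx (\<lambda>_. 2 * \<sigma>)" by (elim bexE)
 have "(\<Sum>i\<in>UNIV. e i *\<^sub>R v i) \<in> vbx (\<lambda>_. \<sigma>)" unfolding vbx_def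
 proof clarify
  fix j
  have "\<bar>(\<Sum>i\<in>UNIV. e i *\<^sub>R v i) $ j\<bar> \<le> (\<Sum>i\<in>UNIV. \<bar>e i * v i $ j\<bar>)" by simp
  also have "\<dots> \<le> (\<Sum>i\<in>(UNIV::'n set). (1 / 2^N) * 2)"
   unfolding abs_mult using e v by (intro sum_mono mult_mono) (auto simp: vbx_def)
  also have "\<dots> = 2 * real CARD('n) / 2^N" by simp
  also have "\<dots> \<le> \<sigma>" using N s by (simp add: field_simps)
  finally show "\<bar>(\<Sum>i\<in>UNIV. e i *\<^sub>R v i) $ j\<bar> \<le> \<sigma>" .
 qed
 from vbx_add[OF q(2) this] have "q - (\<Sum>i\<in>UNIV. c i *\<^sub>R v i) \<in> vbx (\<lambda>_. 2 * \<sigma> + \<sigma>)"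
  by (simp add: e_def scaleR_diff_left sum_subtractf)
 thus ?thesis using q(1) by (intro bexI[of _ q]) simp_all
qed

context approx_group
begin

lemma stab_sum:
 assumes l: "K \<le> l" "1 \<le> l" and v: "\<And>i. v i \<in> stab l" and d: "finite d"
 shows "sum v d \<in> stab (l ^ (2 * card d))"
 using d
proof (induction d)
 case empty thus ?case using stab_zero[of 1] by simp
next
 case (insert i d)
 have "v i + sum v d \<in> stab (l * l ^ (2 * card d) * K)" by (intro stab_add v insert.IH)
 moreover have "l * l ^ (2 * card d) * K \<le> l * l ^ (2 * card d) * l" using l by (intro mult_left_mono) auto
 moreover have "l * l ^ (2 * card d) * l = l ^ (2 * card (insert i d))" using insert by simp
 ultimately show ?case using insert stab_mono by auto
qed

text \<open>\<open>2 = 1 + 1\<close> belongs to \<open>stab K\<close>, and its inverse is paid for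
  by \<open>stab_inverse\<close> with \<open>\<sigma> = 1\<close>.\<close>

lemma stab_half:
 assumes l: "K \<le> l" "3 \<le> l" and x: "x \<in> stab (l ^ e)"
 shows "(1/2) *\<^sub>R x \<in> stab (l ^ (e + 4 + CARD('n)))"
proof -
 have "1 + 1 \<in> stab (1 * 1 * K)" by (intro stab_add stab_one) auto
 hence "2 \<in> stab K" by simp
 hence "vinv 2 \<in> stab (K * K^3 * (3 / 1) ^ CARD('n))" by (rule stab_inverse) (auto simp: numeral_index)
 moreover have "K * K^3 * (3 / 1) ^ CARD('n) \<le> l * l^3 * l ^ CARD('n)"
  using l K_ge_1 by (intro mult_mono power_mono) auto
 moreover have "l * l^3 * l ^ CARD('n) = l ^ (4 + CARD('n))" by (simp add: power_add eval_nat_numeral)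
 ultimately have "vinv 2 \<in> stab (l ^ (4 + CARD('n)))" using stab_mono by simp
 from stab_mult[OF x this] have "x * vinv 2 \<in> stab (l ^ (e + 4 + CARD('n)))" by (simp add: power_add mult_ac)
 moreover have "x * vinv 2 = (1/2) *\<^sub>R x" by (simp add: vec_eq_iff vinv_def numeral_index)
 ultimately show ?thesis by simp
qed

text \<open>Either the quotient set is almost closed under the operations sending \<open>r\<close>
  to half of \<open>r + sum v d\<close>, and \<open>dyadic_dense\<close> makes it dense, or one such
  value \<open>s\<close> stays \<open>\<sigma>\<close>-far from all quotients. In the second case a
  sum \<open>x + s * z\<close> determines \<open>x\<close> and \<open>z\<close> robustly when
  \<open>X\<close> is separated, so a larger separated set can be formed. Quotients are affordable
  because all coordinates of differences in \<open>Z\<close> are at least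
  \<open>\<sigma>\<close>.\<close>

lemma pivot:
 fixes v :: "'n \<Rightarrow> real^'n"
 assumes l: "K \<le> l" "3 \<le> l" and s: "\<sigma> = 1 / l"
  and Z: "Z \<subseteq> stab l" "z1 \<in> Z" "z2 \<in> Z" "z1 \<noteq> z2"
   "\<And>z z' i. z \<in> Z \<Longrightarrow> z' \<in> Z \<Longrightarrow> z \<noteq> z' \<Longrightarrow> \<bar>(z - z') $ i\<bar> \<ge> \<sigma>"
  and v: "\<And>i. v i \<in> stab l" "\<And>i. v i \<in> vbx (\<lambda>_. 2)"
  and X: "X \<subseteq> stab (l ^ e)" "X \<noteq> {}"
 shows "quots X Z \<subseteq> stab (l ^ (2 * e + 7 + 2 * CARD('n)))"
  and "(\<forall>c. (\<forall>i. 0 \<le> c i \<and> c i \<le> 1 / 2) \<longrightarrow> (\<exists>q\<in>quots X Z. q - (\<Sum>i\<in>UNIV. c i *\<^sub>R v i) \<in> vbx (\<lambda>_. 3 * \<sigma>))) \<or>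
   (\<exists>s\<in>stab (l ^ (2 * e + 12 + 5 * CARD('n))). s \<in> vbx (\<lambda>_. 2 * real CARD('n) + 2) \<and> (\<forall>q\<in>quots X Z. q - s \<notin> vbx (\<lambda>_. \<sigma>)))"
proof -
 have sig: "0 < \<sigma>" "\<sigma> \<le> 1" unfolding s using l by auto
 have l1: "l \<ge> 1" using l by simp
 show Qs: "quots X Z \<subseteq> stab (l ^ (2 * e + 7 + 2 * CARD('n)))"
 proof
  fix q assume "q \<in> quots X Z"
  then obtain x x' z z' where q: "x \<in> X" "x' \<in> X" "z \<in> Z" "z' \<in> Z" "z \<noteq> z'" "q = (x - x') * vinv (z - z')"
   unfolding quots_def by blast
  have "z - z' \<in> stab (l * l * K)" using q Z(1) by (intro stab_diff) auto
  from stab_inverse[OF this Z(5)[OF q(3-5)] sig]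
  have "vinv (z - z') \<in> stab (l * l * K * K^3 * (3 / \<sigma>) ^ CARD('n))" .
  moreover have "l * l * K * K^3 * (3 / \<sigma>) ^ CARD('n) \<le> l * l * l * l^3 * (l * l) ^ CARD('n)"
   using l K_ge_1 sig by (intro mult_mono power_mono) (auto simp: s intro!: mult_right_mono)
  moreover have "l * l * l * l^3 * (l * l) ^ CARD('n) = l ^ (6 + 2 * CARD('n))"
   by (simp add: power_add eval_nat_numeral power_mult_distrib mult_2)
  ultimately have A: "vinv (z - z') \<in> stab (l ^ (6 + 2 * CARD('n)))" using stab_mono by auto
  have "x - x' \<in> stab (l ^ e * l ^ e * K)" using q X by (intro stab_diff) auto
  moreover have "l ^ e * l ^ e * K \<le> l ^ e * l ^ e * l" using l by (intro mult_left_mono) auto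
  ultimately have "x - x' \<in> stab (l ^ e * l ^ e * l)" using stab_mono by blast
  from stab_mult[OF this A] show "q \<in> stab (l ^ (2 * e + 7 + 2 * CARD('n)))"
   unfolding q(6) by (simp add: power_add mult_2 eval_nat_numeral mult_ac)
 qed
 obtain x0 where x0: "x0 \<in> X" using X(2) by blast
 have Q0: "0 \<in> quots X Z" unfolding quots_def using x0 Z(2-4)
  by (intro CollectI bexI[of _ x0] bexI[of _ z1] bexI[of _ z2]) auto
 show "(\<forall>c. (\<forall>i. 0 \<le> c i \<and> c i \<le> 1 / 2) \<longrightarrow> (\<exists>q\<in>quots X Z. q - (\<Sum>i\<in>UNIV. c i *\<^sub>R v i) \<in> vbx (\<lambda>_. 3 * \<sigma>))) \<or>
   (\<exists>s\<in>stab (l ^ (2 * e + 12 + 5 * CARD('n))). s \<in> vbx (\<lambda>_. 2 * real CARD('n) + 2) \<and> (\<forall>q\<in>quots X Z. q - s \<notin> vbx (\<lambda>_. \<sigma>)))"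
 proof (cases "\<forall>r d. r \<in> quots X Z \<longrightarrow> r \<in> vbx (\<lambda>_. 2 * real CARD('n) + 2) \<longrightarrow>
    (\<exists>q\<in>quots X Z. q - (1/2) *\<^sub>R (r + sum v d) \<in> vbx (\<lambda>_. \<sigma>))")
  case True
  have "\<exists>q\<in>quots X Z. q - (\<Sum>i\<in>UNIV. (real (k i) / 2^N) *\<^sub>R v i) \<in> vbx (\<lambda>_. 2 * \<sigma>)"
   if "\<And>i. k i < (2::nat)^N" for N k
   by (rule dyadic_dense[OF v(2) sig Q0]) (use True that in auto)
  from dyadic_approx[OF v(2) sig(1) this] show ?thesis by blast
 next
  case False
  then obtain r d where r: "r \<in> quots X Z" "r \<in> vbx (\<lambda>_. 2 * real CARD('n) + 2)"
   "\<And>q. q \<in> quots X Z \<Longrightarrow> q - (1/2) *\<^sub>R (r + sum v d) \<notin> vbx (\<lambda>_. \<sigma>)" by blast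
  let ?s = "(1/2) *\<^sub>R (r + sum v d)"
  have d: "sum v d \<in> stab (l ^ (2 * CARD('n)))"
  proof (rule stab_mono[OF stab_sum[OF l(1) l1 v(1)]])
   show "l ^ (2 * card d) \<le> l ^ (2 * CARD('n))" using l1 by (intro power_increasing) (auto simp: card_mono)
  qed simp
  have "r + sum v d \<in> stab (l ^ (2 * e + 7 + 2 * CARD('n)) * l ^ (2 * CARD('n)) * K)"
   using Qs r(1) d by (intro stab_add) auto
  moreover have "l ^ (2 * e + 7 + 2 * CARD('n)) * l ^ (2 * CARD('n)) * K \<le> l ^ (2 * e + 7 + 2 * CARD('n)) * l ^ (2 * CARD('n)) * l"
   using l by (intro mult_left_mono) auto
  moreover have "l ^ (2 * e + 7 + 2 * CARD('n)) * l ^ (2 * CARD('n)) * l = l ^ (2 * e + 8 + 4 * CARD('n))"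
   by (simp add: power_add eval_nat_numeral mult_ac)
  ultimately have "r + sum v d \<in> stab (l ^ (2 * e + 8 + 4 * CARD('n)))" using stab_mono by simp
  from stab_half[OF l this] have "?s \<in> stab (l ^ (2 * e + 12 + 5 * CARD('n)))" by (simp add: algebra_simps)
  moreover have "?s \<in> vbx (\<lambda>_. 2 * real CARD('n) + 2)"
  proof -
   have "sum v d = (\<Sum>i\<in>UNIV. (if i \<in> d then 1 else 0) *\<^sub>R v i)"
    by (simp add: if_distrib[of "\<lambda>c. c *\<^sub>R v _"] sum.If_cases cong: if_cong)
   moreover have "\<dots> \<in> vbx (\<lambda>_. 2 * real CARD('n))" by (rule vec_sum_scaleR_bound[OF v(2)]) auto
   ultimately have "sum v d \<in> vbx (\<lambda>_. 2 * real CARD('n))" by simp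
   from vbx_add[OF r(2) this] have "r + sum v d \<in> vbx (\<lambda>_. 2 * (2 * real CARD('n) + 2))"
    by (rule vbx_mono) simp
   thus ?thesis by (auto simp: vbx_def)
  qed
  ultimately show ?thesis using r(3) by blast
 qed
qed

text \<open>Each failure of density multiplies the cardinality by \<open>card Z\<close>, while the
  set stays \<open>\<sigma>\<^sup>2\<close>-separated in a box that grows linearly in the number of
  steps. The hypothesis \<open>big\<close> makes \<open>J\<close> failures in a row
  impossible.\<close>

lemma stab_dense:
 fixes v :: "'n \<Rightarrow> real^'n"
 assumes l: "K \<le> l" "3 \<le> l" and s: "\<sigma> = 1 / l"
  and Z: "Z \<subseteq> stab l" "finite Z" "card Z \<ge> 2" "Z \<subseteq> vbx (\<lambda>_. 2)"
   "\<And>z z' i. z \<in> Z \<Longrightarrow> z' \<in> Z \<Longrightarrow> z \<noteq> z' \<Longrightarrow> \<bar>(z - z') $ i\<bar> \<ge> \<sigma>"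
  and v: "\<And>i. v i \<in> stab l" "\<And>i. v i \<in> vbx (\<lambda>_. 2)"
  and big: "real (card Z) ^ J > (2 * (real J * (4 * real CARD('n) + 4)) / \<sigma>\<^sup>2 + 1) ^ CARD('n)"
  and c: "\<And>i. \<bar>c i\<bar> \<le> 1 / 2"
 shows "\<exists>t\<in>stab (l ^ (4 * gexp CARD('n) J + 15 + 4 * CARD('n))). t - (\<Sum>i\<in>UNIV. c i *\<^sub>R v i) \<in> vbx (\<lambda>_. 6 * \<sigma>)"
proof -
 let ?n = "CARD('n)"
 define B where "B = 4 * real ?n + 4"
 have l1: "l \<ge> 1" using l by simp
 have sig: "0 < \<sigma>" "\<sigma> \<le> 1" unfolding s using l by auto
 define dense where "dense X \<longleftrightarrow> (\<forall>c. (\<forall>i. 0 \<le> c i \<and> c i \<le> 1 / 2) \<longrightarrow> (\<exists>q\<in>quots X Z. q - (\<Sum>i\<in>UNIV. c i *\<^sub>R v i) \<in> vbx (\<lambda>_. 3 * \<sigma>)))" for X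
 obtain z1 z2 where zz: "z1 \<in> Z" "z2 \<in> Z" "z1 \<noteq> z2"
 proof -
  have "\<not> card Z \<le> Suc 0" using Z(3) by simp
  thus ?thesis using that unfolding card_le_Suc0_iff_eq[OF Z(2)] by blast
 qed
 have piv: "quots X Z \<subseteq> stab (l ^ (2 * e + 7 + 2 * ?n))"
  "dense X \<or> (\<exists>s\<in>stab (l ^ (2 * e + 12 + 5 * ?n)). s \<in> vbx (\<lambda>_. 2 * real ?n + 2) \<and> (\<forall>q\<in>quots X Z. q - s \<notin> vbx (\<lambda>_. \<sigma>)))"
  if X: "X \<subseteq> stab (l ^ e)" "X \<noteq> {}" for X e
  unfolding dense_def
  by (rule pivot(1)[where v = v, OF l s Z(1) zz _ _ _ X], (fact Z(5) v)+)
   (rule pivot(2)[OF l s Z(1) zz _ _ _ X], (fact Z(5) v)+)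
 have step: "(\<exists>i<j. \<exists>X. X \<subseteq> stab (l ^ gexp ?n i) \<and> X \<noteq> {} \<and> dense X) \<or>
  (\<exists>X. X \<subseteq> stab (l ^ gexp ?n j) \<and> finite X \<and> card X = card Z ^ j \<and> separated (\<lambda>_. \<sigma>\<^sup>2) X \<and> X \<subseteq> vbx (\<lambda>_. real j * B))" for j
 proof (induction j)
  case 0
  have "{0} \<subseteq> stab (l ^ gexp ?n 0)" using stab_zero[of 1] by simp
  thus ?case by (intro disjI2 exI[of _ "{0}"]) (auto simp: separated_def vbx_def)
 next
  case (Suc j)
  show ?case
  proof (cases "\<exists>i<Suc j. \<exists>X. X \<subseteq> stab (l ^ gexp ?n i) \<and> X \<noteq> {} \<and> dense X")
   case True thus ?thesis by blast
  next
   case False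
   hence "\<not> (\<exists>i<j. \<exists>X. X \<subseteq> stab (l ^ gexp ?n i) \<and> X \<noteq> {} \<and> dense X)" by (meson less_SucI)
   then obtain X where X: "X \<subseteq> stab (l ^ gexp ?n j)" "finite X" "card X = card Z ^ j"
    "separated (\<lambda>_. \<sigma>\<^sup>2) X" "X \<subseteq> vbx (\<lambda>_. real j * B)" using Suc.IH by blast
   have Xne: "X \<noteq> {}" using X(3) Z(3) by (metis card.empty not_numeral_le_zero power_not_zero)
   have "\<not> dense X" using False X(1) Xne by blast
   then obtain p where p: "p \<in> stab (l ^ (2 * gexp ?n j + 12 + 5 * ?n))" "p \<in> vbx (\<lambda>_. 2 * real ?n + 2)"
    "\<And>q. q \<in> quots X Z \<Longrightarrow> q - p \<notin> vbx (\<lambda>_. \<sigma>)"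
    using piv(2)[OF X(1) Xne] by blast
   let ?f = "\<lambda>(x, z). x + p * z"
   let ?X = "?f ` (X \<times> Z)"
   \<comment> \<open>If \<open>x + p * z\<close> and \<open>x' + p * z'\<close> were
     \<open>\<sigma>\<^sup>2\<close>-close, dividing by \<open>z - z'\<close> would put the quotient
     of \<open>x' - x\<close> by \<open>z - z'\<close> within \<open>\<sigma>\<close> of
     \<open>p\<close>.\<close>
   have far: "?f a - ?f b \<notin> vbx (\<lambda>_. \<sigma>\<^sup>2)" if ab: "a \<in> X \<times> Z" "b \<in> X \<times> Z" "a \<noteq> b" for a b
   proof -
    obtain x z x' z' where e: "a = (x, z)" "b = (x', z')" by force
    show ?thesis
    proof (cases "z = z'")
     case True
     thus ?thesis using ab e X(4) unfolding separated_def by auto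
    next
     case False
     let ?q = "(x' - x) * vinv (z - z')"
     have nz: "(z - z') $ i \<noteq> 0" for i using Z(5)[of z z' i] ab e False sig by auto
     have "?q \<in> quots X Z" unfolding quots_def using ab e False by blast
     from p(3)[OF this] obtain i where i: "\<bar>(?q - p) $ i\<bar> > \<sigma>" by (auto simp: vbx_def not_le)
     have "\<sigma> * \<sigma> < \<bar>(?q - p) $ i\<bar> * \<bar>(z - z') $ i\<bar>"
      using i Z(5)[of z z' i] ab e False sig by (intro mult_less_le_imp_less) auto
     also have "\<dots> = \<bar>(?q - p) $ i * (z - z') $ i\<bar>" by (simp add: abs_mult)
     also have "(?q - p) $ i * (z - z') $ i = - ((?f a - ?f b) $ i)"
     proof -
      have "(?q - p) $ i * (z - z') $ i = ((x' - x) $ i * inverse ((z - z') $ i) - p $ i) * (z - z') $ i"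
       by (simp add: vinv_def)
      also have "\<dots> = (x' - x) $ i - p $ i * (z - z') $ i"
       by (simp only: left_diff_distrib mult.assoc left_inverse[OF nz[of i]] mult_1_right)
      also have "\<dots> = - ((?f a - ?f b) $ i)" by (simp add: e algebra_simps)
      finally show ?thesis .
     qed
     finally show ?thesis unfolding vbx_def by (auto simp: power2_eq_square not_le intro!: exI[of _ i])
    qed
   qed
   have z0: "0 \<in> vbx (\<lambda>_::'n. \<sigma>\<^sup>2)" unfolding vbx_def by simp
   have inj: "inj_on ?f (X \<times> Z)"
   proof (rule inj_onI, rule ccontr)
    fix a b assume "a \<in> X \<times> Z" "b \<in> X \<times> Z" "?f a = ?f b" "a \<noteq> b"
    thus False using far[of a b] z0 by simp
   qed
   have "?X \<subseteq> stab (l ^ gexp ?n (Suc j))"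
   proof clarify
    fix x z assume xz: "x \<in> X" "z \<in> Z"
    have "p * z \<in> stab (l ^ (2 * gexp ?n j + 12 + 5 * ?n) * l)" using p xz Z(1) by (intro stab_mult) auto
    hence "x + p * z \<in> stab (l ^ gexp ?n j * (l ^ (2 * gexp ?n j + 12 + 5 * ?n) * l) * K)"
     using X(1) xz by (intro stab_add) auto
    moreover have "l ^ gexp ?n j * (l ^ (2 * gexp ?n j + 12 + 5 * ?n) * l) * K
     \<le> l ^ gexp ?n j * (l ^ (2 * gexp ?n j + 12 + 5 * ?n) * l) * l" using l by (intro mult_left_mono) auto
    moreover have "l ^ gexp ?n j * (l ^ (2 * gexp ?n j + 12 + 5 * ?n) * l) * l = l ^ gexp ?n (Suc j)"
    proof -
     have "gexp ?n (Suc j) = gexp ?n j + ((2 * gexp ?n j + 12 + 5 * ?n) + 1) + 1" by simp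
     thus ?thesis by (simp only: power_add power_one_right)
    qed
    ultimately show "x + p * z \<in> stab (l ^ gexp ?n (Suc j))" using stab_mono by simp
   qed
   moreover have "?X \<subseteq> vbx (\<lambda>_. real (Suc j) * B)"
   proof clarify
    fix x z assume xz: "x \<in> X" "z \<in> Z"
    have "p * z \<in> vbx (\<lambda>_. B)" unfolding vbx_def
    proof clarify
     fix i
     have "\<bar>p $ i\<bar> * \<bar>z $ i\<bar> \<le> (2 * real ?n + 2) * 2"
      using p(2) xz(2) Z(4) by (intro mult_mono) (auto simp: vbx_def)
     thus "\<bar>(p * z) $ i\<bar> \<le> B" unfolding B_def by (simp add: abs_mult)
    qed
    from vbx_add[OF subsetD[OF X(5) xz(1)] this] show "x + p * z \<in> vbx (\<lambda>_. real (Suc j) * B)"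
     by (simp add: algebra_simps)
   qed
   moreover have "card ?X = card Z ^ Suc j" using inj X(3) by (simp add: card_image card_cartesian_product mult.commute)
   moreover have "separated (\<lambda>_. \<sigma>\<^sup>2) ?X" unfolding separated_def using far by blast
   moreover have "finite ?X" using X(2) Z(2) by simp
   ultimately show ?thesis by blast
  qed
 qed
 have "\<exists>i<J. \<exists>X. X \<subseteq> stab (l ^ gexp ?n i) \<and> X \<noteq> {} \<and> dense X"
 proof (rule ccontr)
  assume "\<not> ?thesis"
  then obtain X :: "(real^'n) set" where X: "card X = card Z ^ J" "separated (\<lambda>_. \<sigma>\<^sup>2) X" "X \<subseteq> vbx (\<lambda>_. real J * B)" using step[of J] by blast
  have "real (card X) \<le> (\<Prod>i\<in>(UNIV::'n set). (2 * (real J * B) / \<sigma>\<^sup>2 + 1))"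
   using X sig by (intro card_separated_le(2)[of _ 0]) (auto simp: B_def)
  thus False using big X(1) unfolding B_def by simp
 qed
 then obtain j X where j: "j < J" "X \<subseteq> stab (l ^ gexp ?n j)" "X \<noteq> {}" "dense X" by blast
 let ?e = "2 * gexp ?n J + 7 + 2 * ?n"
 have Qs: "quots X Z \<subseteq> stab (l ^ ?e)"
 proof -
  have "l ^ (2 * gexp ?n j + 7 + 2 * ?n) \<le> l ^ ?e"
   using l1 gexp_mono[of j J ?n] j(1) by (intro power_increasing) auto
  thus ?thesis using piv(1)[OF j(2,3)] stab_mono by blast
 qed
 \<comment> \<open>\<open>dense\<close> concerns coefficients in [0, 1/2]; signs are recovered by
   approximating the positive and the negative parts separately and subtracting, which doubles the
   error \<open>3 * \<sigma>\<close>.\<close>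
 have cp: "0 \<le> max (c i) 0 \<and> max (c i) 0 \<le> 1 / 2" for i using c[of i] by (auto simp: abs_le_iff)
 obtain q where q: "q \<in> quots X Z" "q - (\<Sum>i\<in>UNIV. max (c i) 0 *\<^sub>R v i) \<in> vbx (\<lambda>_. 3 * \<sigma>)"
  using j(4)[unfolded dense_def, rule_format, of "\<lambda>i. max (c i) 0", OF cp] by blast
 have cm: "0 \<le> max (- c i) 0 \<and> max (- c i) 0 \<le> 1 / 2" for i using c[of i] by (auto simp: abs_le_iff)
 obtain q' where q': "q' \<in> quots X Z" "q' - (\<Sum>i\<in>UNIV. max (- c i) 0 *\<^sub>R v i) \<in> vbx (\<lambda>_. 3 * \<sigma>)"
  using j(4)[unfolded dense_def, rule_format, of "\<lambda>i. max (- c i) 0", OF cm] by blast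
 have "q - q' \<in> stab (l ^ ?e * l ^ ?e * K)" using q(1) q'(1) Qs by (intro stab_diff) auto
 moreover have "l ^ ?e * l ^ ?e * K \<le> l ^ ?e * l ^ ?e * l" using l by (intro mult_left_mono) auto
 moreover have "l ^ ?e * l ^ ?e * l = l ^ (4 * gexp ?n J + 15 + 4 * ?n)"
 proof -
  have "4 * gexp ?n J + 15 + 4 * ?n = ?e + ?e + 1" by simp
  thus ?thesis by (simp only: power_add power_one_right)
 qed
 ultimately have "q - q' \<in> stab (l ^ (4 * gexp ?n J + 15 + 4 * ?n))" using stab_mono by simp
 moreover have "(q - q') - (\<Sum>i\<in>UNIV. c i *\<^sub>R v i) \<in> vbx (\<lambda>_. 6 * \<sigma>)"
 proof -
  have "(\<Sum>i\<in>UNIV. c i *\<^sub>R v i) = (\<Sum>i\<in>UNIV. max (c i) 0 *\<^sub>R v i) - (\<Sum>i\<in>UNIV. max (- c i) 0 *\<^sub>R v i)"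
   unfolding sum_subtractf[symmetric] scaleR_diff_left[symmetric] by (intro sum.cong refl) (auto simp: max_def)
  hence "(q - q') - (\<Sum>i\<in>UNIV. c i *\<^sub>R v i) = (q - (\<Sum>i\<in>UNIV. max (c i) 0 *\<^sub>R v i)) + - (q' - (\<Sum>i\<in>UNIV. max (- c i) 0 *\<^sub>R v i))"
   by simp
  also have "\<dots> \<in> vbx (\<lambda>_. 3 * \<sigma> + 3 * \<sigma>)" by (intro vbx_add vbx_uminus q(2) q'(2))
  finally show ?thesis by simp
 qed
 ultimately show ?thesis by blast
qed

end

section \<open>Separated sets and expansions over several scales\<close>

text \<open>A maximal subset at separation \<open>C * r\<close>: each of the boxes around its points
  contains at most \<open>(2 * C + 1) ^ CARD('n)\<close> points of \<open>Y\<close>.\<close>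

lemma separated_thin:
 fixes Y :: "(real^'n) set"
 assumes fin: "finite Y" and sep: "separated r Y" and r: "\<And>i. r i > 0" and C: "C \<ge> 1"
 obtains Z where "Z \<subseteq> Y" "separated (\<lambda>i. C * r i) Z" "real (card Y) \<le> (2 * C + 1) ^ CARD('n) * real (card Z)"
proof -
 define a where "a = Max (insert 0 ((\<lambda>(x, i). \<bar>x $ i\<bar>) ` (Y \<times> UNIV)))"
 have "Y \<subseteq> vbx (\<lambda>_. a)"
 proof (clarsimp simp: vbx_def)
  fix x :: "real^'n" and i assume "x \<in> Y"
  thus "\<bar>x $ i\<bar> \<le> a" unfolding a_def using fin by (intro Max_ge) auto
 qed
 moreover have "\<And>i. C * r i > 0" using r C by simp
 ultimately obtain Z where Z: "Z \<subseteq> Y" "finite Z" "separated (\<lambda>i. C * r i) Z" "\<And>b. b \<in> Y \<Longrightarrow> \<exists>y\<in>Z. b - y \<in> vbx (\<lambda>i. C * r i)"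
  using ex_maximal_separated[of Y "\<lambda>_. a" "\<lambda>i. C * r i"] by blast
 have "real (card Y) \<le> (\<Sum>y\<in>Z. real (card {b \<in> Y. b - y \<in> vbx (\<lambda>i. C * r i)}))"
  using Z(4) by (intro card_le_sum_card Z(2)) (auto simp: fin)
 also have "\<dots> \<le> (\<Sum>y\<in>Z. (2 * C + 1) ^ CARD('n))"
 proof (intro sum_mono)
  fix y
  have "real (card {b \<in> Y. b - y \<in> vbx (\<lambda>i. C * r i)}) \<le> (\<Prod>i\<in>UNIV. (2 * (C * r i) / r i + 1))"
   using C r separated_mono[OF sep] by (intro card_separated_le(2)[of _ y]) (auto simp: less_imp_le)
  also have "\<dots> = (\<Prod>i\<in>(UNIV::'n set). (2 * C + 1))"
  proof (rule prod.cong[OF refl])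
   fix i show "2 * (C * r i) / r i + 1 = 2 * C + 1" using r[of i] by simp
  qed
  finally show "real (card {b \<in> Y. b - y \<in> vbx (\<lambda>i. C * r i)}) \<le> (2 * C + 1) ^ CARD('n)" by simp
 qed
 finally show ?thesis using that[OF Z(1,3)] by (simp add: mult.commute)
qed

text \<open>Cauchy-Schwarz on the fibres of a map from \<open>V\<close> to a maximal separated
  subset of the image; two points of one fibre collide at scale \<open>2 * r\<close>.\<close>

lemma separated_from_collisions:
 fixes f :: "'b \<Rightarrow> real^'n"
 assumes fin: "finite V" and r: "\<And>i. r i > 0"
 obtains Y where "Y \<subseteq> f ` V" "finite Y" "separated r Y"
  "(real (card V))\<^sup>2 \<le> real (card Y) * real (card {(v, v'). v \<in> V \<and> v' \<in> V \<and> f v - f v' \<in> vbx (\<lambda>i. 2 * r i)})"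
proof -
 define a where "a = Max (insert 0 ((\<lambda>(x, i). \<bar>x $ i\<bar>) ` (f ` V \<times> UNIV)))"
 have "f ` V \<subseteq> vbx (\<lambda>_. a)"
 proof (clarsimp simp: vbx_def)
  fix v i assume "v \<in> V"
  thus "\<bar>f v $ i\<bar> \<le> a" unfolding a_def using fin by (intro Max_ge) force+
 qed
 then obtain Y where Y: "Y \<subseteq> f ` V" "finite Y" "separated r Y" "\<And>b. b \<in> f ` V \<Longrightarrow> \<exists>y\<in>Y. b - y \<in> vbx r"
  using ex_maximal_separated[of "f ` V" "\<lambda>_. a" r] r by blast
 have "\<forall>v\<in>V. \<exists>y\<in>Y. f v - y \<in> vbx r" using Y(4) by blast
 then obtain g where g: "\<And>v. v \<in> V \<Longrightarrow> g v \<in> Y \<and> f v - g v \<in> vbx r" by metis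
 let ?C = "{(v, v'). v \<in> V \<and> v' \<in> V \<and> f v - f v' \<in> vbx (\<lambda>i. 2 * r i)}"
 define F where "F y = {v \<in> V. g v = y}" for y
 have finF: "finite (F y)" for y unfolding F_def using fin by simp
 have "real (card V) = (\<Sum>y\<in>Y. real (card (F y)))"
 proof -
  have "V = (\<Union>y\<in>Y. F y)" unfolding F_def using g by blast
  moreover have "card (\<Union>y\<in>Y. F y) = (\<Sum>y\<in>Y. card (F y))"
   by (rule card_UN_disjoint) (use Y(2) finF in \<open>auto simp: F_def\<close>)
  ultimately show ?thesis by simp
 qed
 hence "(real (card V))\<^sup>2 = (\<Sum>y\<in>Y. 1 * real (card (F y)))\<^sup>2" by simp
 also have "\<dots> \<le> (\<Sum>y\<in>Y. 1\<^sup>2) * (\<Sum>y\<in>Y. (real (card (F y)))\<^sup>2)" by (rule Cauchy_Schwarz_ineq_sum)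
 also have "\<dots> = real (card Y) * (\<Sum>y\<in>Y. real (card (F y \<times> F y)))"
  by (simp add: card_cartesian_product power2_eq_square)
 also have "(\<Sum>y\<in>Y. real (card (F y \<times> F y))) = real (card (\<Union>y\<in>Y. F y \<times> F y))"
  by (subst card_UN_disjoint) (use Y(2) finF in \<open>auto simp: F_def\<close>)
 also have "\<dots> \<le> real (card ?C)"
 proof (intro of_nat_mono card_mono)
  show "finite ?C" by (rule finite_subset[of _ "V \<times> V"]) (use fin in auto)
  show "(\<Union>y\<in>Y. F y \<times> F y) \<subseteq> ?C"
  proof clarify
   fix y v v' assume v: "v \<in> F y" "v' \<in> F y"
   have "f v - f v' = (f v - g v) + - (f v' - g v')" using v unfolding F_def by simp
   also have "\<dots> \<in> vbx (\<lambda>i. r i + r i)" using v g[of v] g[of v'] unfolding F_def by (intro vbx_add vbx_uminus) simp_all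
   finally show "v \<in> V \<and> v' \<in> V \<and> f v - f v' \<in> vbx (\<lambda>i. 2 * r i)" using v unfolding F_def by simp
  qed
 qed
 finally have "(real (card V))\<^sup>2 \<le> real (card Y) * real (card ?C)" by (simp add: mult_left_mono)
 thus ?thesis using that Y by blast
qed

text \<open>At the first index \<open>j\<close> where two digit strings differ, some coordinate
  differs by more than \<open>C1 * s (Suc j)\<close>. Earlier digits agree, and the later ones,
  bounded by \<open>C0 * s (Suc j)\<close> since the scales decrease, are together too small to
  compensate.\<close>

lemma separated_digit_sums:
 fixes \<Theta> :: "nat \<Rightarrow> (real^'n) set" and s :: "nat \<Rightarrow> 'n \<Rightarrow> real"
 assumes bd: "\<And>j. j < m \<Longrightarrow> \<Theta> j \<subseteq> vbx (\<lambda>k. C0 * s j k)"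
  and sep: "\<And>j. j < m \<Longrightarrow> separated (\<lambda>k. C1 * s (Suc j) k) (\<Theta> j)"
  and s1: "\<And>j k. s j k \<ge> 1" and anti: "\<And>i j k. i \<le> j \<Longrightarrow> s j k \<le> s i k"
  and C: "C0 \<ge> 0" "C1 \<ge> 2 * C0 * real m + 1"
 shows "inj_on (\<lambda>\<theta>. \<Sum>j<m. \<theta> j) (PiE {..<m} \<Theta>)"
  and "separated (\<lambda>_. 1) ((\<lambda>\<theta>. \<Sum>j<m. \<theta> j) ` (PiE {..<m} \<Theta>))"
proof -
 have far: "(\<Sum>j<m. \<theta> j) - (\<Sum>j<m. \<theta>' j) \<notin> vbx (\<lambda>_. 1)"
  if th: "\<theta> \<in> PiE {..<m} \<Theta>" "\<theta>' \<in> PiE {..<m} \<Theta>" "\<theta> \<noteq> \<theta>'" for \<theta> \<theta>'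
 proof -
  have "\<exists>j. j < m \<and> \<theta> j \<noteq> \<theta>' j" using th by (meson PiE_ext lessThan_iff)
  define j where "j = (LEAST j. j < m \<and> \<theta> j \<noteq> \<theta>' j)"
  have j: "j < m" "\<theta> j \<noteq> \<theta>' j" using LeastI_ex[OF \<open>\<exists>j. j < m \<and> \<theta> j \<noteq> \<theta>' j\<close>] unfolding j_def by auto
  have below: "\<theta> i = \<theta>' i" if "i < j" for i using not_less_Least[OF that[unfolded j_def]] that j(1) by auto
  have "\<theta> j - \<theta>' j \<notin> vbx (\<lambda>k. C1 * s (Suc j) k)"
   using sep[OF j(1)] j th unfolding separated_def by (auto simp: PiE_iff)
  then obtain k where k: "\<bar>(\<theta> j - \<theta>' j) $ k\<bar> > C1 * s (Suc j) k" by (auto simp: vbx_def not_le)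
  let ?d = "\<lambda>i. (\<theta> i - \<theta>' i) $ k"
  have d: "\<bar>?d i\<bar> \<le> 2 * C0 * s (Suc j) k" if "i \<in> {..<m} - {j}" for i
  proof (cases "i < j")
   case True
   have "0 \<le> s (Suc j) k" using s1[of "Suc j" k] by linarith
   thus ?thesis using below[OF True] C by simp
  next
   case False
   hence i: "Suc j \<le> i" "i < m" using that by auto
   have "\<bar>\<theta> i $ k\<bar> \<le> C0 * s i k" "\<bar>\<theta>' i $ k\<bar> \<le> C0 * s i k"
    using bd[OF i(2)] th i(2) by (auto simp: vbx_def PiE_iff)
   moreover have "C0 * s i k \<le> C0 * s (Suc j) k" using anti[OF i(1)] C by (intro mult_left_mono) auto
   ultimately show ?thesis unfolding vector_minus_component by linarith
  qed
  have "((\<Sum>j<m. \<theta> j) - (\<Sum>j<m. \<theta>' j)) $ k = (\<Sum>i<m. ?d i)" by (simp add: sum_subtractf)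
  also have "\<dots> = ?d j + (\<Sum>i\<in>{..<m} - {j}. ?d i)" using j(1) by (simp add: sum.remove)
  finally have e: "((\<Sum>j<m. \<theta> j) - (\<Sum>j<m. \<theta>' j)) $ k = ?d j + (\<Sum>i\<in>{..<m} - {j}. ?d i)" .
  have "\<bar>\<Sum>i\<in>{..<m} - {j}. ?d i\<bar> \<le> (\<Sum>i\<in>{..<m} - {j}. \<bar>?d i\<bar>)" by (rule sum_abs)
  also have "\<dots> \<le> (\<Sum>i\<in>{..<m} - {j}. 2 * C0 * s (Suc j) k)" by (intro sum_mono d)
  also have "\<dots> = real (m - 1) * (2 * C0 * s (Suc j) k)" using j(1) by simp
  also have "\<dots> \<le> real m * (2 * C0 * s (Suc j) k)" using C s1[of "Suc j" k] by (intro mult_right_mono) auto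
  finally have tail: "\<bar>\<Sum>i\<in>{..<m} - {j}. ?d i\<bar> \<le> 2 * C0 * real m * s (Suc j) k" by (simp add: mult_ac)
  have "(2 * C0 * real m + 1) * s (Suc j) k \<le> C1 * s (Suc j) k" using C(2) s1[of "Suc j" k] by (intro mult_right_mono) auto
  hence "2 * C0 * real m * s (Suc j) k + 1 \<le> C1 * s (Suc j) k" using s1[of "Suc j" k] by (simp add: distrib_right)
  hence "\<bar>((\<Sum>j<m. \<theta> j) - (\<Sum>j<m. \<theta>' j)) $ k\<bar> > 1" unfolding e using k tail by linarith
  thus ?thesis by (auto simp: vbx_def not_le intro!: exI[of _ k])
 qed
 have z: "0 \<in> vbx (\<lambda>_::'n. 1)" unfolding vbx_def by simp
 show "inj_on (\<lambda>\<theta>. \<Sum>j<m. \<theta> j) (PiE {..<m} \<Theta>)"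
 proof (rule inj_onI, rule ccontr)
  fix a b assume "a \<in> PiE {..<m} \<Theta>" "b \<in> PiE {..<m} \<Theta>" "(\<Sum>j<m. a j) = (\<Sum>j<m. b j)" "a \<noteq> b"
  thus False using far[of a b] z by simp
 qed
 show "separated (\<lambda>_. 1) ((\<lambda>\<theta>. \<Sum>j<m. \<theta> j) ` (PiE {..<m} \<Theta>))"
  unfolding separated_def
 proof (clarify)
  fix a b assume "a \<in> PiE {..<m} \<Theta>" "b \<in> PiE {..<m} \<Theta>" "(\<Sum>j<m. a j) \<noteq> (\<Sum>j<m. b j)"
   "(\<Sum>j<m. a j) - (\<Sum>j<m. b j) \<in> vbx (\<lambda>_. 1)"
  thus False using far[of a b] by blast
 qed
qed

context approx_group
begin

text \<open>The sumset of 2^j copies of \<open>H\<close>, in which the remainder after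
  \<open>j\<close> steps of \<open>multiscale_expansion\<close> lives. As the number of steps is
  bounded, the covering cost \<open>K ^ (2 ^ j - 1)\<close> is acceptable.\<close>

primrec dbl :: "nat \<Rightarrow> (real^'n) set" where
 "dbl 0 = H"
| "dbl (Suc j) = sumset (dbl j) (dbl j)"

lemma dbl_symm: "x \<in> dbl j \<Longrightarrow> - x \<in> dbl j"
proof (induction j arbitrary: x)
 case 0 thus ?case using symm by simp
next
 case (Suc j)
 then obtain a b where ab: "a \<in> dbl j" "b \<in> dbl j" "x = a + b" by (auto elim: sumsetE)
 have "- a + - b \<in> dbl (Suc j)" unfolding dbl.simps(2) using Suc.IH ab by (intro sumsetI) auto
 moreover have "- x = - a + - b" using ab by simp
 ultimately show ?case by (simp only:)
qed

lemma zero_dbl: "0 \<in> dbl j"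
proof (induction j)
 case 0 thus ?case using zero_in by simp
next
 case (Suc j)
 from sumsetI[OF this this] show ?case by simp
qed

lemma dbl_Suc_mono: "dbl j \<subseteq> dbl (Suc j)"
proof
 fix x assume "x \<in> dbl j"
 from sumsetI[OF this zero_dbl[of j]] show "x \<in> dbl (Suc j)" by simp
qed

lemma dbl_mono: "i \<le> j \<Longrightarrow> dbl i \<subseteq> dbl j"
 by (rule lift_Suc_mono_le[of dbl]) (use dbl_Suc_mono in auto)

lemma covers_dbl: "covers (K ^ (2 ^ j - 1)) (dbl j) H"
proof (induction j)
 case 0 thus ?case by (simp add: covers_refl)
next
 case (Suc j)
 have e: "2 ^ Suc j - 1 = (2 ^ j - 1) + (2 ^ j - 1) + (1::nat)"
 proof -
  have "(2::nat) ^ j \<ge> 1" by simp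
  moreover have "(2::nat) ^ Suc j = 2 ^ j + 2 ^ j" by simp
  ultimately show ?thesis by linarith
 qed
 from covers_trans[OF covers_sumset[OF Suc Suc] doubling] show ?case
  by (simp only: dbl.simps e power_add power_one_right)
qed

lemma sum_in_dbl: "(\<And>j. j < m \<Longrightarrow> x j \<in> dbl j) \<Longrightarrow> (\<Sum>j<m. x j) \<in> dbl m"
proof (induction m)
 case 0 thus ?case using zero_in by simp
next
 case (Suc m)
 hence "(\<Sum>j<m. x j) \<in> dbl m" "x m \<in> dbl m" by simp_all
 from sumsetI[OF this] show ?case by simp
qed

lemma sum_in_dbl_Suc: "(\<And>j. j < m \<Longrightarrow> x j \<in> dbl (Suc 0)) \<Longrightarrow> (\<Sum>j<m. x j) \<in> dbl (Suc m)"
proof (induction m)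
 case 0 thus ?case using zero_dbl[of "Suc 0"] by simp
next
 case (Suc m)
 have "x m \<in> dbl (Suc m)" using Suc.prems dbl_mono[of "Suc 0" "Suc m"] by (metis lessI One_nat_def le_add1 plus_1_eq_Suc subsetD)
 moreover have "(\<Sum>j<m. x j) \<in> dbl (Suc m)" using Suc by simp
 ultimately have "(\<Sum>j<m. x j) + x m \<in> dbl (Suc (Suc m))" unfolding dbl.simps(2)[of "Suc m"] by (rule sumsetI[rotated])
 thus ?case by simp
qed

text \<open>Greedy expansion: each digit comes from a net of \<open>dbl j\<close> in the current
  box, and by symmetry subtracting it leaves a remainder in \<open>dbl (Suc j)\<close>.\<close>

lemma multiscale_expansion:
 fixes s :: "nat \<Rightarrow> 'n \<Rightarrow> real"
 assumes La: "\<And>j b. b \<in> dbl j \<Longrightarrow> b \<in> vbx (s j) \<Longrightarrow> \<exists>y\<in>\<Lambda> j. b - y \<in> vbx (s (Suc j))"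
  and sub: "\<And>j. \<Lambda> j \<subseteq> dbl j" and s0: "H \<subseteq> vbx (s 0)" and x: "x \<in> H"
 shows "\<exists>\<theta>\<in>PiE {..<m} \<Lambda>. x - (\<Sum>j<m. \<theta> j) \<in> dbl m \<and> x - (\<Sum>j<m. \<theta> j) \<in> vbx (s m)"
proof (induction m)
 case 0
 show ?case using x s0 by (auto intro!: bexI[of _ "\<lambda>_. undefined"])
next
 case (Suc m)
 then obtain \<theta> where th: "\<theta> \<in> PiE {..<m} \<Lambda>" "x - (\<Sum>j<m. \<theta> j) \<in> dbl m" "x - (\<Sum>j<m. \<theta> j) \<in> vbx (s m)" by blast
 obtain y where y: "y \<in> \<Lambda> m" "x - (\<Sum>j<m. \<theta> j) - y \<in> vbx (s (Suc m))" using La[OF th(2,3)] by blast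
 define \<theta>' where "\<theta>' = \<theta>(m := y)"
 have "\<theta>' \<in> PiE {..<Suc m} \<Lambda>" using th(1) y(1) unfolding \<theta>'_def by (auto simp: PiE_iff extensional_def less_Suc_eq)
 moreover have S: "x - (\<Sum>j<Suc m. \<theta>' j) = x - (\<Sum>j<m. \<theta> j) - y" unfolding \<theta>'_def by simp
 moreover have "x - (\<Sum>j<m. \<theta> j) - y \<in> dbl (Suc m)"
  using sumsetI[OF th(2) dbl_symm[OF subsetD[OF sub y(1)]]] by simp
 ultimately show ?case using y(2) by metis
qed

end

section \<open>A multiplier that is generic at all scales\<close>

lemma vec_power_component: "((b::real^'n) ^ j) $ k = (b $ k) ^ j"
 by (induction j) auto

lemma card_nat_le_diameter:
 assumes "finite (S::nat set)" "\<And>a a'. a \<in> S \<Longrightarrow> a' \<in> S \<Longrightarrow> real a - real a' \<le> D" "D \<ge> 0"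
 shows "real (card S) \<le> D + 1"
proof (cases "S = {}")
 case True thus ?thesis using assms by simp
next
 case False
 have "S \<subseteq> {Min S..Max S}" using assms(1) by auto
 hence "card S \<le> card {Min S..Max S}" by (intro card_mono) auto
 also have "\<dots> = Max S + 1 - Min S" by simp
 finally have "card S \<le> Max S + 1 - Min S" .
 moreover have "Min S \<le> Max S" using False assms(1) by simp
 ultimately have "real (card S) \<le> real (Max S) - real (Min S) + 1" by linarith
 thus ?thesis using assms(2)[of "Max S" "Min S"] False assms(1) by simp
qed

text \<open>The values form an arithmetic progression of step
  \<open>\<eta> * \<bar>e\<bar> / N\<close>; the final 1 counts an endpoint.\<close>

lemma card_grid_hits:
 assumes "e \<noteq> 0" "\<eta> > 0" "N > 0" "B \<ge> 0"
 shows "real (card {a::nat. a < N \<and> \<bar>d + \<eta> * real a / real N * e\<bar> \<le> B}) \<le> 2 * B * real N / (\<eta> * \<bar>e\<bar>) + 1"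
proof (rule card_nat_le_diameter)
 fix a a' assume a: "a \<in> {a. a < N \<and> \<bar>d + \<eta> * real a / real N * e\<bar> \<le> B}" "a' \<in> {a. a < N \<and> \<bar>d + \<eta> * real a / real N * e\<bar> \<le> B}"
 have "\<bar>\<eta> * real a / real N * e - \<eta> * real a' / real N * e\<bar> \<le> 2 * B" using a by (simp add: abs_le_iff)
 also have "\<eta> * real a / real N * e - \<eta> * real a' / real N * e = (\<eta> * e / real N) * (real a - real a')"
  by (simp add: algebra_simps diff_divide_distrib)
 finally have "(\<eta> * \<bar>e\<bar> / real N) * \<bar>real a - real a'\<bar> \<le> 2 * B" using assms by (simp add: abs_mult)
 moreover have "\<eta> * \<bar>e\<bar> / real N > 0" using assms by simp
 ultimately have "\<bar>real a - real a'\<bar> \<le> 2 * B / (\<eta> * \<bar>e\<bar> / real N)" by (simp only: pos_le_divide_eq mult.commute)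
 thus "real a - real a' \<le> 2 * B * real N / (\<eta> * \<bar>e\<bar>)" using assms by simp
qed (use assms in auto)

text \<open>In each coordinate where \<open>e\<close> has size at least \<open>\<theta> * s\<close>,
  the value falls into an interval of length comparable to \<open>s'\<close> for a proportion of
  order \<open>s' / (\<theta> * \<eta> * s)\<close> of the grid. In a frozen coordinate, where
  \<open>s' = s\<close>, the trivial bound has the same form. The error \<open>6 * \<sigma>\<close>
  of the multiplier times \<open>8 * s\<close> is at most \<open>48 * s'\<close>, whence 97 = 2 * 48
  + 1, the 1 absorbing the rounding of the count.\<close>

lemma card_generic_hits:
 fixes d e :: "real^'n" and s s' :: "'n \<Rightarrow> real"
 assumes eta: "0 < \<eta>" "\<eta> \<le> 1" and th: "0 < \<theta>" "\<theta> \<le> 1" and sg: "0 < \<sigma>" and N: "real N * \<sigma> \<ge> 1" and C: "C1 \<ge> 0"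
  and tau: "\<And>k. k \<in> PiE UNIV (\<lambda>_. {..<N}) \<Longrightarrow> \<tau> k - (\<chi> i. \<eta> * real (k i) / real N) \<in> vbx (\<lambda>_. 6 * \<sigma>)"
  and s: "\<And>i. 0 < s' i" "\<And>i. s' i \<le> s i" "\<And>i. \<sigma> * s i \<le> s' i"
  and e: "\<And>i. \<bar>e $ i\<bar> \<le> 8 * s i" "\<And>i. \<bar>e $ i\<bar> \<ge> \<theta> * s i \<or> s' i = s i"
 shows "real (card {k \<in> PiE UNIV (\<lambda>_. {..<N}). d + \<tau> k * e \<in> vbx (\<lambda>i. C1 * s' i)})
  \<le> real N ^ CARD('n) * (\<Prod>i\<in>UNIV. (2 * C1 + 97) * (s' i / s i) / (\<theta> * \<eta>))"
proof -
 define A where "A i = {a::nat. a < N \<and> \<bar>d $ i + \<eta> * real a / real N * e $ i\<bar> \<le> (C1 + 48) * s' i}" for i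
 have Npos: "N > 0" using N sg by (cases N) auto
 have finA: "finite (A i)" for i unfolding A_def by simp
 have "{k \<in> PiE UNIV (\<lambda>_. {..<N}). d + \<tau> k * e \<in> vbx (\<lambda>i. C1 * s' i)} \<subseteq> PiE UNIV A"
 proof clarify
  fix k assume k: "k \<in> PiE UNIV (\<lambda>_. {..<N})" "d + \<tau> k * e \<in> vbx (\<lambda>i. C1 * s' i)"
  have "k i \<in> A i" for i
  proof -
   let ?p = "\<eta> * real (k i) / real N"
   have "\<bar>(\<tau> k $ i - ?p) * e $ i\<bar> \<le> (6 * \<sigma>) * (8 * s i)"
    unfolding abs_mult using tau[OF k(1)] e(1) sg by (intro mult_mono) (auto simp: vbx_def)
   also have "\<dots> \<le> 48 * s' i" using s(3)[of i] by simp
   finally have "\<bar>\<tau> k $ i * e $ i - ?p * e $ i\<bar> \<le> 48 * s' i" by (simp add: left_diff_distrib)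
   moreover have "\<bar>d $ i + \<tau> k $ i * e $ i\<bar> \<le> C1 * s' i" using k(2) by (auto simp: vbx_def)
   ultimately have "\<bar>d $ i + ?p * e $ i\<bar> \<le> C1 * s' i + 48 * s' i" by linarith
   thus ?thesis unfolding A_def using k(1) by (auto simp: distrib_right)
  qed
  thus "k \<in> PiE UNIV A" by (auto simp: PiE_iff)
 qed
 hence "card {k \<in> PiE UNIV (\<lambda>_. {..<N}). d + \<tau> k * e \<in> vbx (\<lambda>i. C1 * s' i)} \<le> card (PiE UNIV A)"
  using finA by (intro card_mono finite_PiE) auto
 also have "card (PiE UNIV A) = (\<Prod>i\<in>UNIV. card (A i))" by (simp add: card_PiE)
 finally have "real (card {k \<in> PiE UNIV (\<lambda>_. {..<N}). d + \<tau> k * e \<in> vbx (\<lambda>i. C1 * s' i)}) \<le> (\<Prod>i\<in>UNIV. real (card (A i)))"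
  by (simp only: of_nat_prod[symmetric] of_nat_le_iff)
 also have "\<dots> \<le> (\<Prod>i\<in>UNIV. real N * ((2 * C1 + 97) * (s' i / s i) / (\<theta> * \<eta>)))"
 proof (rule prod_mono, intro conjI)
  fix i
  let ?f = "s' i / s i"
  have si: "s i > 0" using s(1)[of i] s(2)[of i] by linarith
  have te: "0 < \<theta> * \<eta>" "\<theta> * \<eta> \<le> 1" using th eta by (auto intro: mult_le_one)
  have f: "?f \<ge> \<sigma>" using s(3)[of i] si by (simp add: pos_le_divide_eq)
  have "1 \<le> real N * ?f" using N f mult_left_mono[OF f, of "real N"] by linarith
  hence one: "1 \<le> real N * ?f / (\<theta> * \<eta>)" using te by (subst pos_le_divide_eq) linarith+
  show "real (card (A i)) \<le> real N * ((2 * C1 + 97) * ?f / (\<theta> * \<eta>))"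
  proof (cases "s' i = s i")
   case True
   have "card (A i) \<le> card {..<N}" unfolding A_def by (intro card_mono) auto
   hence "real (card (A i)) \<le> real N * 1" by simp
   also have "\<dots> \<le> real N * ((2 * C1 + 97) * ?f / (\<theta> * \<eta>))"
    using True si te C by (intro mult_left_mono) (auto simp: pos_le_divide_eq)
   finally show ?thesis .
  next
   case False
   hence ei: "\<bar>e $ i\<bar> \<ge> \<theta> * s i" using e(2) by blast
   have ts: "\<theta> * s i > 0" using th si by simp
   have "real (card (A i)) \<le> 2 * ((C1 + 48) * s' i) * real N / (\<eta> * \<bar>e $ i\<bar>) + 1"
    unfolding A_def using ei ts eta Npos C s(1)[of i] by (intro card_grid_hits) (auto intro!: mult_nonneg_nonneg)
   also have "2 * ((C1 + 48) * s' i) * real N / (\<eta> * \<bar>e $ i\<bar>) \<le> 2 * ((C1 + 48) * s' i) * real N / (\<eta> * (\<theta> * s i))"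
    using ei ts eta C s(1)[of i] by (intro divide_left_mono mult_left_mono mult_nonneg_nonneg) auto
   also have "\<dots> = (2 * C1 + 96) * (real N * ?f / (\<theta> * \<eta>))" by (simp add: field_simps)
   finally have "real (card (A i)) \<le> (2 * C1 + 96) * (real N * ?f / (\<theta> * \<eta>)) + real N * ?f / (\<theta> * \<eta>)" using one by linarith
   also have "\<dots> = (2 * C1 + 97) * (real N * ?f / (\<theta> * \<eta>))" by (simp only: distrib_right) simp
   also have "\<dots> = real N * ((2 * C1 + 97) * ?f / (\<theta> * \<eta>))" by (simp only: times_divide_eq_right mult.left_commute)
   finally show ?thesis .
  qed
 qed simp
 also have "\<dots> = real N ^ CARD('n) * (\<Prod>i\<in>UNIV. (2 * C1 + 97) * (s' i / s i) / (\<theta> * \<eta>))"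
  by (simp only: prod.distrib prod_constant)
 finally show ?thesis .
qed

text \<open>The sum of the \<open>m\<close> normalised quantities has mean at most \<open>m\<close>,
  so at some \<open>g\<close> the sum, and with it every term, is at most \<open>m\<close>.\<close>

lemma simultaneous_average:
 fixes N :: "nat \<Rightarrow> 'g \<Rightarrow> real"
 assumes fin: "finite G" "G \<noteq> {}" and A: "\<And>j. j < m \<Longrightarrow> A j > 0" and N0: "\<And>j g. N j g \<ge> 0"
  and avg: "\<And>j. j < m \<Longrightarrow> (\<Sum>g\<in>G. N j g) \<le> real (card G) * A j"
 shows "\<exists>g\<in>G. \<forall>j<m. N j g \<le> real m * A j"
proof (rule ccontr)
 assume n: "\<not> ?thesis"
 have "(\<Sum>g\<in>G. real m) < (\<Sum>g\<in>G. \<Sum>j<m. N j g / A j)"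
 proof (rule sum_strict_mono[OF fin])
  fix g assume "g \<in> G"
  then obtain j where j: "j < m" "N j g > real m * A j" using n by (auto simp: not_le)
  hence "real m < N j g / A j" using A[OF j(1)] by (simp add: pos_less_divide_eq)
  also have "\<dots> \<le> (\<Sum>j<m. N j g / A j)"
   using j(1) N0 A by (intro member_le_sum[of j]) (auto simp: less_imp_le)
  finally show "real m < (\<Sum>j<m. N j g / A j)" .
 qed
 also have "\<dots> = (\<Sum>j<m. (\<Sum>g\<in>G. N j g) / A j)" by (subst sum.swap) (simp add: sum_divide_distrib)
 also have "\<dots> \<le> (\<Sum>j<m. real (card G))"
  using avg A by (intro sum_mono) (simp add: pos_divide_le_eq)
 finally show False by simp
qed

lemma packing_covers:
 fixes H :: "(real^'n) set"
 assumes cov: "covers m B H" and P: "\<And>E. E \<subseteq> H \<Longrightarrow> finite E \<Longrightarrow> separated r E \<Longrightarrow> real (card E) \<le> P"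
  and E: "E \<subseteq> B" "finite E" "separated r E"
 shows "real (card E) \<le> m * P"
proof -
 obtain y E' where E': "E' \<subseteq> E" "\<And>x. x \<in> E' \<Longrightarrow> x - y \<in> H" "real (card E) \<le> m * real (card E')"
  using covers_pigeonhole[OF cov E(2,1)] by metis
 let ?F = "(\<lambda>x. x - y) ` E'"
 have "card ?F = card E'" by (intro card_image) (auto simp: inj_on_def)
 moreover have "real (card ?F) \<le> P"
 proof (rule P)
  show "?F \<subseteq> H" using E'(2) by blast
  show "finite ?F" using E'(1) E(2) finite_subset by blast
  show "separated r ?F" using E(3) E'(1) unfolding separated_def by auto
 qed
 ultimately have "m * real (card E') \<le> m * P" using covers_nonneg[OF cov] by (intro mult_left_mono) auto
 thus ?thesis using E'(3) by linarith
qed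

context approx_group
begin

lemma stab_power: assumes "b \<in> stab L" "L \<ge> 1" shows "b ^ j \<in> stab (L ^ j)"
proof (induction j)
 case 0 thus ?case by (simp add: stab_one)
next
 case (Suc j)
 from stab_mult[OF assms(1) Suc] show ?case by simp
qed

text \<open>The dilate of \<open>Z0\<close> by \<open>b ^ j\<close> has the right separation at
  scale \<open>\<bar>b\<bar> ^ j * R\<close> but may lie outside \<open>H + H\<close>. It is covered
  by few translates of \<open>H\<close>; the part in the fullest one, translated by one of its
  points, lies in \<open>H - H = H + H\<close>. This translation turns the bound 2 on the
  coordinates into 4.\<close>

lemma contracted_copies:
 assumes b: "b \<in> stab L" "L \<ge> 1" "\<And>k. 0 < \<bar>b $ k\<bar>" "\<And>k. \<bar>b $ k\<bar> \<le> 1" and jm: "j \<le> m"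
  and Z0: "finite Z0" "Z0 \<subseteq> sumset H H" "Z0 \<noteq> {}" "\<And>z z' k. z \<in> Z0 \<Longrightarrow> z' \<in> Z0 \<Longrightarrow> z \<noteq> z' \<Longrightarrow> \<bar>(z - z') $ k\<bar> \<ge> \<theta> * R"
 obtains Z where "Z \<subseteq> sumset H H" "finite Z" "Z \<noteq> {}" "card Z \<le> card Z0" "real (card Z0) \<le> L ^ (2 * m) * K * real (card Z)"
  "\<And>z z' k. z \<in> Z \<Longrightarrow> z' \<in> Z \<Longrightarrow> z \<noteq> z' \<Longrightarrow> \<bar>(z - z') $ k\<bar> \<ge> \<theta> * (\<bar>b $ k\<bar> ^ j * R)"
  "\<And>z k. z \<in> Z \<Longrightarrow> \<bar>z $ k\<bar> \<le> 4 * (\<bar>b $ k\<bar> ^ j * R)"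
proof -
 let ?E = "(*) (b ^ j) ` Z0"
 have nz: "(b ^ j) $ k \<noteq> 0" for k using b(3)[of k] by (simp add: vec_power_component)
 have inj: "inj_on ((*) (b ^ j)) Z0" using nz by (auto simp: inj_on_def vec_eq_iff)
 have "covers (L ^ j * L ^ j * K) (sumset ((*) (b ^ j) ` H) ((*) (b ^ j) ` H)) H"
  using stabD[OF stab_power[OF b(1,2), of j]] by (intro covers_trans[OF covers_sumset doubling])
 moreover have "?E \<subseteq> sumset ((*) (b ^ j) ` H) ((*) (b ^ j) ` H)"
 proof clarify
  fix z assume "z \<in> Z0"
  then obtain h h' where "h \<in> H" "h' \<in> H" "z = h + h'" using Z0(2) by (blast elim: sumsetE)
  thus "b ^ j * z \<in> sumset ((*) (b ^ j) ` H) ((*) (b ^ j) ` H)" by (auto simp: distrib_left intro!: sumsetI)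
 qed
 ultimately obtain y E' where E': "E' \<subseteq> ?E" "\<And>x. x \<in> E' \<Longrightarrow> x - y \<in> H" "real (card ?E) \<le> L ^ j * L ^ j * K * real (card E')"
  using covers_pigeonhole[of _ _ H ?E] Z0(1) by (metis finite_imageI)
 have cE: "card ?E = card Z0" using inj by (rule card_image)
 have "E' \<noteq> {}" using E'(3) cE Z0(1,3) by (auto simp: card_gt_0_iff)
 then obtain e0 where e0: "e0 \<in> E'" by blast
 let ?Z = "(\<lambda>x. x - e0) ` E'"
 have finE: "finite E'" using E'(1) Z0(1) finite_subset by blast
 have cZ: "card ?Z = card E'" by (intro card_image) (auto simp: inj_on_def)
 show ?thesis
 proof (rule that[of ?Z])
  show "?Z \<subseteq> sumset H H"
  proof clarify
   fix x assume "x \<in> E'"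
   from sumsetI[OF E'(2)[OF this] symm[OF E'(2)[OF e0]]] show "x - e0 \<in> sumset H H" by simp
  qed
  show "finite ?Z" "?Z \<noteq> {}" using finE e0 by auto
  show "card ?Z \<le> card Z0" unfolding cZ using card_mono[OF _ E'(1)] Z0(1) cE by simp
  have "L ^ j * L ^ j = L ^ (2 * j)" by (simp add: power_add[symmetric] mult_2)
  also have "\<dots> \<le> L ^ (2 * m)" using b(2) jm by (intro power_increasing) auto
  finally have "L ^ j * L ^ j * K * real (card E') \<le> L ^ (2 * m) * K * real (card E')"
   using K_ge_1 by (intro mult_right_mono) auto
  thus "real (card Z0) \<le> L ^ (2 * m) * K * real (card ?Z)" using E'(3) cE cZ by simp
 next
  fix z z' k assume "z \<in> ?Z" "z' \<in> ?Z" "z \<noteq> z'"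
  then obtain x x' where x: "x \<in> E'" "x' \<in> E'" "z = x - e0" "z' = x' - e0" "x \<noteq> x'" by auto
  then obtain w w' where w: "w \<in> Z0" "w' \<in> Z0" "x = b ^ j * w" "x' = b ^ j * w'" using E'(1) by blast
  have "\<bar>(z - z') $ k\<bar> = \<bar>b $ k\<bar> ^ j * \<bar>(w - w') $ k\<bar>"
   unfolding x(3,4) w(3,4) by (simp add: vec_power_component right_diff_distrib[symmetric] abs_mult power_abs)
  also have "\<dots> \<ge> \<bar>b $ k\<bar> ^ j * (\<theta> * R)" using Z0(4)[of w w' k] w x(5) by (intro mult_left_mono) auto
  finally show "\<bar>(z - z') $ k\<bar> \<ge> \<theta> * (\<bar>b $ k\<bar> ^ j * R)" by (simp add: mult_ac)
 next
  have E'bd: "\<bar>x $ k\<bar> \<le> 2 * (\<bar>b $ k\<bar> ^ j * R)" if "x \<in> E'" for x k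
  proof -
   obtain w where w: "w \<in> Z0" "x = b ^ j * w" using \<open>x \<in> E'\<close> E'(1) by blast
   then obtain h h' where h: "h \<in> H" "h' \<in> H" "w = h + h'" using Z0(2) by (blast elim: sumsetE)
   have "\<bar>h $ k\<bar> \<le> R" "\<bar>h' $ k\<bar> \<le> R" using h bounded_by by (auto simp: vbx_def)
   hence "\<bar>w $ k\<bar> \<le> 2 * R" unfolding h(3) by (simp add: abs_le_iff)
   hence "\<bar>b $ k\<bar> ^ j * \<bar>w $ k\<bar> \<le> \<bar>b $ k\<bar> ^ j * (2 * R)" by (intro mult_left_mono) auto
   thus ?thesis unfolding w(2) by (simp add: vec_power_component abs_mult power_abs mult_ac)
  qed
  fix z k assume "z \<in> ?Z"
  then obtain x where x: "x \<in> E'" "z = x - e0" by blast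
  show "\<bar>z $ k\<bar> \<le> 4 * (\<bar>b $ k\<bar> ^ j * R)"
   using E'bd[OF x(1), of k] E'bd[OF e0, of k] unfolding x(2) vector_minus_component by linarith
 qed
qed

end

context approx_group
begin

text \<open>Double counting over a grid of multipliers of mesh at most \<open>\<sigma>\<close> and
  over all pairs with \<open>z \<noteq> z'\<close>, followed by \<open>simultaneous_average\<close>,
  so that one \<open>t\<close> serves all scales. Pairs with \<open>z = z'\<close> are the same for
  every \<open>t\<close>; they are left to the separation of \<open>\<Lambda> j\<close>.\<close>

lemma generic_multiplier:
 fixes s :: "nat \<Rightarrow> 'n \<Rightarrow> real" and \<Lambda> Z :: "nat \<Rightarrow> (real^'n) set"
 assumes sg: "0 < \<sigma>" "\<sigma> \<le> 1" and eta: "0 < \<eta>" "\<eta> \<le> 1" and th: "0 < \<theta>" "\<theta> \<le> 1" and C: "C1 \<ge> 0"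
  and T: "\<And>w. (\<And>k. 0 \<le> w $ k \<and> w $ k \<le> \<eta>) \<Longrightarrow> \<exists>t\<in>stab Lt. t - w \<in> vbx (\<lambda>_. 6 * \<sigma>)"
  and s: "\<And>j i. 0 < s j i" "\<And>j i. s (Suc j) i \<le> s j i" "\<And>j i. \<sigma> * s j i \<le> s (Suc j) i"
  and La: "\<And>j. j < m \<Longrightarrow> finite (\<Lambda> j) \<and> \<Lambda> j \<noteq> {}"
  and Z: "\<And>j. j < m \<Longrightarrow> finite (Z j) \<and> Z j \<noteq> {}"
   "\<And>j z k. j < m \<Longrightarrow> z \<in> Z j \<Longrightarrow> \<bar>z $ k\<bar> \<le> 4 * s j k"
   "\<And>j z z' k. j < m \<Longrightarrow> z \<in> Z j \<Longrightarrow> z' \<in> Z j \<Longrightarrow> z \<noteq> z' \<Longrightarrow> \<bar>(z - z') $ k\<bar> \<ge> \<theta> * s j k \<or> s (Suc j) k = s j k"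
 obtains t where "t \<in> stab Lt" "t \<in> vbx (\<lambda>_. 7)"
  "\<And>j. j < m \<Longrightarrow> real (card {((l, z), (l', z')). l \<in> \<Lambda> j \<and> z \<in> Z j \<and> l' \<in> \<Lambda> j \<and> z' \<in> Z j \<and> z \<noteq> z' \<and>
    (l + t * z) - (l' + t * z') \<in> vbx (\<lambda>i. C1 * s (Suc j) i)})
   \<le> real m * ((real (card (\<Lambda> j)) * real (card (Z j)))\<^sup>2 * (\<Prod>i\<in>UNIV. (2 * C1 + 97) * (s (Suc j) i / s j i) / (\<theta> * \<eta>)))"
proof -
 obtain N :: nat where N: "1 / \<sigma> \<le> real N" using real_arch_simple by blast
 hence N1: "real N * \<sigma> \<ge> 1" using sg by (simp add: pos_divide_le_eq)
 hence Npos: "N > 0" by (cases N) auto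
 define G where "G = PiE (UNIV :: 'n set) (\<lambda>_. {..<N})"
 have finG: "finite G" unfolding G_def by (intro finite_PiE) auto
 have cG: "real (card G) = real N ^ CARD('n)" unfolding G_def by (simp add: card_PiE)
 have Gne: "G \<noteq> {}" using cG Npos by fastforce
 define p :: "('n \<Rightarrow> nat) \<Rightarrow> real^'n" where "p k = (\<chi> i. \<eta> * real (k i) / real N)" for k
 have pr: "0 \<le> p k $ i \<and> p k $ i \<le> \<eta>" if "k \<in> G" for k i
 proof -
  have "k i < N" using that unfolding G_def by auto
  hence "\<eta> * real (k i) \<le> \<eta> * real N" using eta by simp
  thus ?thesis unfolding p_def using eta Npos by (simp add: divide_le_eq)
 qed
 have "\<forall>k\<in>G. \<exists>t\<in>stab Lt. t - p k \<in> vbx (\<lambda>_. 6 * \<sigma>)"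
 proof
  fix k assume "k \<in> G"
  show "\<exists>t\<in>stab Lt. t - p k \<in> vbx (\<lambda>_. 6 * \<sigma>)" by (rule T) (rule pr[OF \<open>k \<in> G\<close>])
 qed
 then obtain \<tau> where tau: "\<And>k. k \<in> G \<Longrightarrow> \<tau> k \<in> stab Lt" "\<And>k. k \<in> G \<Longrightarrow> \<tau> k - p k \<in> vbx (\<lambda>_. 6 * \<sigma>)"
  by metis
 define V where "V j = (\<Lambda> j \<times> Z j) \<times> (\<Lambda> j \<times> Z j)" for j
 define hit where "hit j t = {((l, z), (l', z')). l \<in> \<Lambda> j \<and> z \<in> Z j \<and> l' \<in> \<Lambda> j \<and> z' \<in> Z j \<and> z \<noteq> z' \<and>
    (l + t * z) - (l' + t * z') \<in> vbx (\<lambda>i. C1 * s (Suc j) i)}" for j and t :: "real^'n"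
 define F where "F j = (\<Prod>i\<in>UNIV. (2 * C1 + 97) * (s (Suc j) i / s j i) / (\<theta> * \<eta>))" for j
 define A where "A j = (real (card (\<Lambda> j)) * real (card (Z j)))\<^sup>2 * F j" for j
 have Fpos: "F j > 0" for j unfolding F_def
  using C th eta s(1) by (intro prod_pos) (auto intro!: divide_pos_pos mult_pos_pos)
 have Apos: "A j > 0" if "j < m" for j
  unfolding A_def using La[OF that] Z(1)[OF that] Fpos[of j] by (simp add: card_gt_0_iff)
 have finV: "finite (V j)" if "j < m" for j unfolding V_def using La[OF that] Z(1)[OF that] by simp
 have avg: "(\<Sum>k\<in>G. real (card (hit j (\<tau> k)))) \<le> real (card G) * A j" if j: "j < m" for j
 proof -
  let ?W = "{((l, z), (l', z')). ((l, z), (l', z')) \<in> V j \<and> z \<noteq> z'}"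
  have W: "?W \<subseteq> V j" by auto
  have finW: "finite ?W" by (rule finite_subset[OF W finV[OF j]])
  let ?P = "\<lambda>w t. case w of ((l, z), (l', z')) \<Rightarrow> (l + t * z) - (l' + t * z') \<in> vbx (\<lambda>i. C1 * s (Suc j) i)"
  have "(\<Sum>k\<in>G. real (card (hit j (\<tau> k)))) = (\<Sum>k\<in>G. \<Sum>w\<in>?W. if ?P w (\<tau> k) then 1 else 0)"
  proof (intro sum.cong refl)
   fix k
   have "hit j (\<tau> k) = {w \<in> ?W. ?P w (\<tau> k)}" unfolding hit_def V_def by auto
   thus "real (card (hit j (\<tau> k))) = (\<Sum>w\<in>?W. if ?P w (\<tau> k) then 1 else 0)" using finW by (simp add: sum.If_cases Int_def)
  qed
  also have "\<dots> = (\<Sum>w\<in>?W. \<Sum>k\<in>G. if ?P w (\<tau> k) then 1 else 0)" by (rule sum.swap)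
  also have "\<dots> = (\<Sum>w\<in>?W. real (card {k \<in> G. ?P w (\<tau> k)}))" using finG by (simp add: sum.If_cases Int_def)
  also have "\<dots> \<le> (\<Sum>w\<in>?W. real (card G) * F j)"
  proof (intro sum_mono)
   fix w assume "w \<in> ?W"
   then obtain l z l' z' where w: "w = ((l, z), (l', z'))" "l \<in> \<Lambda> j" "z \<in> Z j" "l' \<in> \<Lambda> j" "z' \<in> Z j" "z \<noteq> z'"
    unfolding V_def by auto
   have e: "{k \<in> G. ?P w (\<tau> k)} = {k \<in> PiE UNIV (\<lambda>_. {..<N}). (l - l') + \<tau> k * (z - z') \<in> vbx (\<lambda>i. C1 * s (Suc j) i)}"
    unfolding G_def w(1) by (auto simp: right_diff_distrib algebra_simps)
   show "real (card {k \<in> G. ?P w (\<tau> k)}) \<le> real (card G) * F j"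
    unfolding e cG F_def
   proof (rule card_generic_hits[OF eta th sg(1) N1 C])
    show "\<tau> k - (\<chi> i. \<eta> * real (k i) / real N) \<in> vbx (\<lambda>_. 6 * \<sigma>)" if "k \<in> PiE UNIV (\<lambda>_. {..<N})" for k
     using tau(2)[of k] that unfolding G_def p_def by blast
    show "\<bar>(z - z') $ i\<bar> \<le> 8 * s j i" for i
     using Z(2)[OF j w(3), of i] Z(2)[OF j w(5), of i] unfolding vector_minus_component by linarith
    show "\<bar>(z - z') $ i\<bar> \<ge> \<theta> * s j i \<or> s (Suc j) i = s j i" for i using Z(3)[OF j w(3,5,6)] .
   qed (use s in auto)
  qed
  also have "\<dots> = real (card ?W) * (real (card G) * F j)" by simp
  also have "\<dots> \<le> real (card (V j)) * (real (card G) * F j)"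
   using card_mono[OF finV[OF j] W] Fpos[of j] by (intro mult_right_mono) (auto simp: less_imp_le)
  also have "\<dots> = real (card G) * A j" unfolding V_def A_def by (simp add: card_cartesian_product power2_eq_square)
  finally show ?thesis .
 qed
 obtain k where k: "k \<in> G" "\<And>j. j < m \<Longrightarrow> real (card (hit j (\<tau> k))) \<le> real m * A j"
  using simultaneous_average[OF finG Gne, of m A "\<lambda>j k. real (card (hit j (\<tau> k)))"] Apos avg by auto
 have "\<tau> k \<in> vbx (\<lambda>_. 7)" unfolding vbx_def
 proof clarify
  fix i
  have "\<bar>\<tau> k $ i - p k $ i\<bar> \<le> 6 * \<sigma>" using tau(2)[OF k(1)] by (auto simp: vbx_def)
  thus "\<bar>\<tau> k $ i\<bar> \<le> 7" using pr[OF k(1), of i] sg eta by linarith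
 qed
 thus ?thesis using that[of "\<tau> k"] tau(1)[OF k(1)] k(2) unfolding hit_def A_def F_def by blast
qed

section \<open>Propagation of density through all scales\<close>

text \<open>The scales \<open>s j\<close> shrink by \<open>\<bar>b\<bar>\<close> from
  \<open>R\<close> to 1, and \<open>\<Lambda> j\<close> contains the digits of \<open>H\<close> at
  scale \<open>j\<close>. If they leave room (predicate \<open>X\<close>), then
  \<open>\<Lambda> j + t * Z j\<close> is larger by a factor of about \<open>card (Z j)\<close> and
  still contains a separated set of that size. Sums of such digits lie in a set covered by few
  translates of \<open>H\<close>, so this happens at few scales; that is the first conclusion, with
  \<open>ne\<close> the number of these scales. At the other scales the digits are nearly full, and
  the product over all scales gives the lower bound on the packing number \<open>P\<close> in the
  second conclusion.\<close>

lemma windows: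
 assumes R1: "R \<ge> 1" and sg: "0 < \<sigma>" "\<sigma> \<le> 1"
  and b: "b \<in> stab Lb" "Lb \<ge> 1" "\<And>k. \<sigma> \<le> \<bar>b $ k\<bar>" "\<And>k. \<bar>b $ k\<bar> \<le> \<rho>" "\<rho> \<le> 1" "\<rho> ^ m * R \<le> 1"
  and Z0: "finite Z0" "Z0 \<subseteq> sumset H H" "Z0 \<noteq> {}" "\<And>z z' k. z \<in> Z0 \<Longrightarrow> z' \<in> Z0 \<Longrightarrow> z \<noteq> z' \<Longrightarrow> \<bar>(z - z') $ k\<bar> \<ge> \<theta> * R"
  and th: "0 < \<theta>" "\<theta> \<le> 1" and eta: "0 < \<eta>" "\<eta> \<le> 1"
  and T: "\<And>w. (\<And>k. 0 \<le> w $ k \<and> w $ k \<le> \<eta>) \<Longrightarrow> \<exists>t\<in>stab Lt. t - w \<in> vbx (\<lambda>_. 6 * \<sigma>)"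
  and PH: "\<And>E. E \<subseteq> H \<Longrightarrow> finite E \<Longrightarrow> separated (\<lambda>_. 1) E \<Longrightarrow> real (card E) \<le> P"
  and C1: "C1 = 58 * real m + 1" and C3: "C3 = (real m + 1) * ((4 * C1 + 97) / \<eta>) ^ CARD('n)"
 obtains ne where "(real (card Z0) / (Lb ^ (2 * m) * K)) ^ ne \<le> C3 ^ m * (K ^ (3 * 2 ^ m) * Lt) * 5 ^ CARD('n)"
  "R ^ CARD('n) * (\<theta> ^ CARD('n) / real (card Z0)) ^ m * \<sigma> ^ (CARD('n) * ne) \<le> (2 * C1 + 1) ^ (CARD('n) * m) * (K ^ (2 ^ m) * P)"
proof -
 let ?n = "CARD('n)"
 \<comment> \<open>The maximum freezes a coordinate once it has reached unit scale; the coordinates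
   get there at different times.\<close>
 define s :: "nat \<Rightarrow> 'n \<Rightarrow> real" where "s j k = max 1 (\<bar>b $ k\<bar> ^ j * R)" for j k
 have b1: "\<bar>b $ k\<bar> \<le> 1" for k using b(4)[of k] b(5) by linarith
 have b0: "0 < \<bar>b $ k\<bar>" for k using b(3)[of k] sg(1) by linarith
 have s1: "s j k \<ge> 1" for j k unfolding s_def by simp
 have spos: "0 < s j k" for j k using s1[of j k] by linarith
 have sdec: "s (Suc j) k \<le> s j k" for j k
 proof -
  have "\<bar>b $ k\<bar> * (\<bar>b $ k\<bar> ^ j * R) \<le> 1 * (\<bar>b $ k\<bar> ^ j * R)" using b1[of k] R1 by (intro mult_right_mono) auto
  thus ?thesis unfolding s_def by (auto simp: mult.assoc intro: max.mono)
 qed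
 have anti: "s j k \<le> s i k" if "i \<le> j" for i j k
  using lift_Suc_antimono_le[of "\<lambda>j. s j k", OF sdec that] .
 have sshr: "\<sigma> * s j k \<le> s (Suc j) k" for j k
 proof -
  have "\<sigma> * (\<bar>b $ k\<bar> ^ j * R) \<le> \<bar>b $ k\<bar> * (\<bar>b $ k\<bar> ^ j * R)" using b(3)[of k] R1 by (intro mult_right_mono) auto
  thus ?thesis unfolding s_def using sg by (auto simp: max_def mult.assoc split: if_splits)
 qed
 have s0: "s 0 k = R" for k unfolding s_def using R1 by simp
 have sm: "s m k = 1" for k
 proof -
  have "\<bar>b $ k\<bar> ^ m * R \<le> \<rho> ^ m * R" using b(4)[of k] R1 by (intro mult_right_mono power_mono) auto
  thus ?thesis unfolding s_def using b(6) by simp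
 qed
 have H0: "H \<subseteq> vbx (s 0)" using bounded_by unfolding s0 .
 \<comment> \<open>Nets of \<open>dbl j\<close> at the next scale: the candidates for the digit
   number \<open>j\<close>.\<close>
 have "\<exists>\<Lambda>. \<Lambda> \<subseteq> dbl j \<inter> vbx (s j) \<and> finite \<Lambda> \<and> separated (s (Suc j)) \<Lambda> \<and> (\<forall>x. x \<in> dbl j \<longrightarrow> x \<in> vbx (s j) \<longrightarrow> (\<exists>y\<in>\<Lambda>. x - y \<in> vbx (s (Suc j))))" for j
  using ex_maximal_separated[of "dbl j \<inter> vbx (s j)" "s j" "s (Suc j)"] spos by (metis Int_iff inf_le2)
 then obtain \<Lambda> where La: "\<And>j. \<Lambda> j \<subseteq> dbl j \<inter> vbx (s j)" "\<And>j. finite (\<Lambda> j)" "\<And>j. separated (s (Suc j)) (\<Lambda> j)"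
  "\<And>j x. x \<in> dbl j \<Longrightarrow> x \<in> vbx (s j) \<Longrightarrow> \<exists>y\<in>\<Lambda> j. x - y \<in> vbx (s (Suc j))" by metis
 have Lane: "\<Lambda> j \<noteq> {}" for j
 proof -
  have "0 \<in> vbx (s j)" unfolding vbx_def using spos by (simp add: less_imp_le)
  thus ?thesis using La(4)[OF zero_dbl, of j] by blast
 qed
 have cLa: "real (card (\<Lambda> j)) \<ge> 1" for j
  using La(2)[of j] Lane[of j] by (metis One_nat_def Suc_leI card_gt_0_iff of_nat_1 of_nat_le_iff)
 define good where "good j Z \<longleftrightarrow> Z \<subseteq> sumset H H \<and> finite Z \<and> Z \<noteq> {} \<and> card Z \<le> card Z0 \<and> real (card Z0) \<le> Lb ^ (2 * m) * K * real (card Z) \<and>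
  (\<forall>z\<in>Z. \<forall>z'\<in>Z. z \<noteq> z' \<longrightarrow> (\<forall>k. \<bar>(z - z') $ k\<bar> \<ge> \<theta> * (\<bar>b $ k\<bar> ^ j * R))) \<and>
  (\<forall>z\<in>Z. \<forall>k. \<bar>z $ k\<bar> \<le> 4 * (\<bar>b $ k\<bar> ^ j * R))" for j Z
 have "\<exists>Z. good j Z" if jm: "j \<le> m" for j
 proof (rule contracted_copies[OF b(1,2) b0 b1 jm Z0])
  fix Z assume "Z \<subseteq> sumset H H" "finite Z" "Z \<noteq> {}" "card Z \<le> card Z0" "real (card Z0) \<le> Lb ^ (2 * m) * K * real (card Z)"
   "\<And>z z' k. z \<in> Z \<Longrightarrow> z' \<in> Z \<Longrightarrow> z \<noteq> z' \<Longrightarrow> \<bar>(z - z') $ k\<bar> \<ge> \<theta> * (\<bar>b $ k\<bar> ^ j * R)"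
   "\<And>z k. z \<in> Z \<Longrightarrow> \<bar>z $ k\<bar> \<le> 4 * (\<bar>b $ k\<bar> ^ j * R)"
  hence "good j Z" unfolding good_def by simp
  thus "\<exists>Z. good j Z" ..
 qed
 then obtain Z where gZ: "\<And>j. j \<le> m \<Longrightarrow> good j (Z j)" by metis
 have Z: "\<And>j. j \<le> m \<Longrightarrow> Z j \<subseteq> sumset H H" "\<And>j. j \<le> m \<Longrightarrow> finite (Z j) \<and> Z j \<noteq> {}"
  "\<And>j. j \<le> m \<Longrightarrow> card (Z j) \<le> card Z0" "\<And>j. j \<le> m \<Longrightarrow> real (card Z0) \<le> Lb ^ (2 * m) * K * real (card (Z j))"
  "\<And>j z z' k. j \<le> m \<Longrightarrow> z \<in> Z j \<Longrightarrow> z' \<in> Z j \<Longrightarrow> z \<noteq> z' \<Longrightarrow> \<bar>(z - z') $ k\<bar> \<ge> \<theta> * (\<bar>b $ k\<bar> ^ j * R)"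
  "\<And>j z k. j \<le> m \<Longrightarrow> z \<in> Z j \<Longrightarrow> \<bar>z $ k\<bar> \<le> 4 * (\<bar>b $ k\<bar> ^ j * R)"
  using gZ unfolding good_def by simp_all
 have Zs: "\<bar>z $ k\<bar> \<le> 4 * s j k" if "j \<le> m" "z \<in> Z j" for j z k
 proof -
  have "4 * (\<bar>b $ k\<bar> ^ j * R) \<le> 4 * s j k" unfolding s_def by simp
  thus ?thesis using Z(6)[OF that, of k] by linarith
 qed
 have Zsep: "\<bar>(z - z') $ k\<bar> \<ge> \<theta> * s j k \<or> s (Suc j) k = s j k" if "j \<le> m" "z \<in> Z j" "z' \<in> Z j" "z \<noteq> z'" for j z z' k
 proof (cases "\<bar>b $ k\<bar> ^ j * R \<ge> 1")
  case True
  hence "s j k = \<bar>b $ k\<bar> ^ j * R" unfolding s_def by simp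
  thus ?thesis using Z(5)[OF that] by simp
 next
  case False
  hence "s j k = 1" unfolding s_def by simp
  thus ?thesis using sdec[of j k] s1[of "Suc j" k] by simp
 qed
 have C1pos: "C1 \<ge> 1" unfolding C1 by simp
 obtain t where t: "t \<in> stab Lt" "t \<in> vbx (\<lambda>_. 7)"
  "\<And>j. j < m \<Longrightarrow> real (card {((l, z), (l', z')). l \<in> \<Lambda> j \<and> z \<in> Z j \<and> l' \<in> \<Lambda> j \<and> z' \<in> Z j \<and> z \<noteq> z' \<and>
    (l + t * z) - (l' + t * z') \<in> vbx (\<lambda>i. (2 * C1) * s (Suc j) i)})
   \<le> real m * ((real (card (\<Lambda> j)) * real (card (Z j)))\<^sup>2 * (\<Prod>i\<in>UNIV. (2 * (2 * C1) + 97) * (s (Suc j) i / s j i) / (\<theta> * \<eta>)))"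
 proof (rule generic_multiplier[OF sg eta th, where ?C1.0 = "2 * C1" and s = s and \<Lambda> = \<Lambda> and Z = Z and m = m and Lt = Lt])
  show "\<exists>t\<in>stab Lt. t - w \<in> vbx (\<lambda>_. 6 * \<sigma>)" if "\<And>k. 0 \<le> w $ k \<and> w $ k \<le> \<eta>" for w by (rule T) (rule that)
  show "\<bar>(z - z') $ k\<bar> \<ge> \<theta> * s j k \<or> s (Suc j) k = s j k" if "j < m" "z \<in> Z j" "z' \<in> Z j" "z \<noteq> z'" for j z z' k
   using Zsep[of j] that by simp
 qed (use C1pos spos sdec sshr La Lane Z Zs in auto)
 \<comment> \<open>\<open>F j\<close> is the volume ratio of consecutive boxes, up to constants the
   number of digits in a full window; \<open>X j\<close> says that there is room for
   \<open>card (Z j)\<close> copies of the actual digits, with the loss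
   \<open>\<theta> ^ CARD('n)\<close>.\<close>
 define F where "F j = (\<Prod>i\<in>UNIV. s j i / s (Suc j) i)" for j
 define X where "X j \<longleftrightarrow> real (card (\<Lambda> j)) * real (card (Z j)) \<le> F j * \<theta> ^ ?n" for j
 define C2 where "C2 = (4 * C1 + 97) / \<eta>"
 have C2big: "C2 \<ge> 4 * C1 + 97"
 proof -
  have "(4 * C1 + 97) * \<eta> \<le> (4 * C1 + 97) * 1" using eta C1pos by (intro mult_left_mono) auto
  thus ?thesis unfolding C2_def using eta by (simp add: pos_le_divide_eq)
 qed
 have C3': "C3 = (real m + 1) * C2 ^ ?n" unfolding C3 C2_def ..
 have C2n: "C2 ^ ?n \<ge> 1" using C2big C1pos by (intro one_le_power) auto
 have C3big: "C2 ^ ?n \<le> C3"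
 proof -
  have "1 * C2 ^ ?n \<le> (real m + 1) * C2 ^ ?n" using C2n by (intro mult_right_mono) auto
  thus ?thesis unfolding C3' by simp
 qed
 have Fpos: "F j > 0" for j unfolding F_def using spos by (intro prod_pos) auto
 \<comment> \<open>The new digits \<open>\<Theta> j\<close> are separated at scale
   \<open>C1 * s (Suc j)\<close>, at the cost of the constant \<open>C3\<close>. Where there is no
   room they are a thinned copy of \<open>\<Lambda> j\<close>, obtained from
   \<open>z = 0\<close>.\<close>
 have "\<exists>\<Theta>. finite \<Theta> \<and> \<Theta> \<subseteq> (\<lambda>(l, z). l + t * z) ` (\<Lambda> j \<times> insert 0 (Z j)) \<and> separated (\<lambda>i. C1 * s (Suc j) i) \<Theta> \<and>
   real (card (\<Lambda> j)) * (if X j then real (card (Z j)) else 1) \<le> C3 * real (card \<Theta>)" if j: "j < m" for j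
 proof (cases "X j")
  case False
  obtain \<Theta> where T: "\<Theta> \<subseteq> \<Lambda> j" "separated (\<lambda>i. C1 * s (Suc j) i) \<Theta>" "real (card (\<Lambda> j)) \<le> (2 * C1 + 1) ^ ?n * real (card \<Theta>)"
   by (rule separated_thin[OF La(2)[of j] La(3)[of j] spos C1pos])
  have "(2 * C1 + 1) ^ ?n \<le> C2 ^ ?n" using C2big C1pos by (intro power_mono) auto
  hence "(2 * C1 + 1) ^ ?n * real (card \<Theta>) \<le> C3 * real (card \<Theta>)" using C3big by (intro mult_right_mono) auto
  moreover have "\<Theta> \<subseteq> (\<lambda>(l, z). l + t * z) ` (\<Lambda> j \<times> insert 0 (Z j))"
  proof
   fix x assume "x \<in> \<Theta>"
   thus "x \<in> (\<lambda>(l, z). l + t * z) ` (\<Lambda> j \<times> insert 0 (Z j))" using T(1) by (intro image_eqI[of _ _ "(x, 0)"]) auto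
  qed
  moreover have "finite \<Theta>" using T(1) La(2) by (rule finite_subset)
  ultimately show ?thesis using T False by (intro exI[of _ \<Theta>]) auto
 next
  case True
  let ?V = "\<Lambda> j \<times> Z j" and ?f = "\<lambda>(l, z). l + t * z"
  have finV: "finite ?V" using La(2) Z(2)[of j] j by simp
  have rpos: "0 < C1 * s (Suc j) i" for i using C1pos spos by simp
  obtain \<Theta> where T: "\<Theta> \<subseteq> ?f ` ?V" "finite \<Theta>" "separated (\<lambda>i. C1 * s (Suc j) i) \<Theta>"
   "(real (card ?V))\<^sup>2 \<le> real (card \<Theta>) * real (card {(v, v'). v \<in> ?V \<and> v' \<in> ?V \<and> ?f v - ?f v' \<in> vbx (\<lambda>i. 2 * (C1 * s (Suc j) i))})"
   by (rule separated_from_collisions[OF finV rpos])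
  let ?C = "{(v, v'). v \<in> ?V \<and> v' \<in> ?V \<and> ?f v - ?f v' \<in> vbx (\<lambda>i. 2 * (C1 * s (Suc j) i))}"
  let ?hit = "{((l, z), (l', z')). l \<in> \<Lambda> j \<and> z \<in> Z j \<and> l' \<in> \<Lambda> j \<and> z' \<in> Z j \<and> z \<noteq> z' \<and>
    (l + t * z) - (l' + t * z') \<in> vbx (\<lambda>i. (2 * C1) * s (Suc j) i)}"
  let ?same = "\<Union>v\<in>?V. (\<lambda>l'. (v, (l', snd v))) ` {l' \<in> \<Lambda> j. l' - fst v \<in> vbx (\<lambda>i. 2 * C1 * s (Suc j) i)}"
  \<comment> \<open>Near-collisions with \<open>z \<noteq> z'\<close> are controlled by the choice
    of \<open>t\<close>; those with \<open>z = z'\<close> are near-collisions inside the separated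
    set \<open>\<Lambda> j\<close>, boundedly many for each point.\<close>
  have "?C \<subseteq> ?hit \<union> ?same"
  proof (rule subsetI)
   fix w assume wC: "w \<in> ?C"
   obtain l z l' z' where w: "w = ((l, z), (l', z'))" by (metis prod.collapse)
   have a: "l \<in> \<Lambda> j" "z \<in> Z j" "l' \<in> \<Lambda> j" "z' \<in> Z j" "l + t * z - (l' + t * z') \<in> vbx (\<lambda>i. 2 * C1 * s (Suc j) i)"
    using wC unfolding w by (auto simp: mult.assoc)
   show "w \<in> ?hit \<union> ?same"
   proof (cases "z = z'")
    case True
    have "l - l' \<in> vbx (\<lambda>i. 2 * C1 * s (Suc j) i)" using a(5) True by simp
    hence "l' - l \<in> vbx (\<lambda>i. 2 * C1 * s (Suc j) i)" by (simp add: vbx_minus_commute)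
    hence "w \<in> ?same" unfolding w using a True by (intro UN_I[of "(l, z)"]) auto
    thus ?thesis by blast
   next
    case False
    hence "w \<in> ?hit" unfolding w using a by simp
    thus ?thesis by blast
   qed
  qed
  moreover have finS: "finite ?same" using finV La(2) by auto
  moreover have "finite ?hit" by (rule finite_subset[of _ "?V \<times> ?V"]) (use finV in auto)
  ultimately have "card ?C \<le> card (?hit \<union> ?same)" by (intro card_mono) auto
  also have "\<dots> \<le> card ?hit + card ?same" by (rule card_Un_le)
  finally have c1: "real (card ?C) \<le> real (card ?hit) + real (card ?same)" by linarith
  have "real (card ?same) \<le> (\<Sum>v\<in>?V. real (card ((\<lambda>l'. (v, (l', snd v))) ` {l' \<in> \<Lambda> j. l' - fst v \<in> vbx (\<lambda>i. 2 * C1 * s (Suc j) i)})))"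
   by (rule card_le_sum_card) (use finV La(2) in auto)
  also have "\<dots> \<le> (\<Sum>v\<in>?V. C2 ^ ?n)"
  proof (intro sum_mono)
   fix v :: "(real^'n) \<times> (real^'n)"
   have "card ((\<lambda>l'. (v, (l', snd v))) ` {l' \<in> \<Lambda> j. l' - fst v \<in> vbx (\<lambda>i. 2 * C1 * s (Suc j) i)})
     \<le> card {l' \<in> \<Lambda> j. l' - fst v \<in> vbx (\<lambda>i. 2 * C1 * s (Suc j) i)}" using La(2) by (intro card_image_le) auto
   moreover have "real (card {l' \<in> \<Lambda> j. l' - fst v \<in> vbx (\<lambda>i. 2 * C1 * s (Suc j) i)})
     \<le> (\<Prod>i\<in>UNIV. (2 * (2 * C1 * s (Suc j) i) / s (Suc j) i + 1))"
    using separated_mono[OF La(3)[of j]] spos C1pos by (intro card_separated_le(2)[of _ "fst v"]) (auto simp: less_imp_le)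
   moreover have "(\<Prod>i\<in>UNIV. (2 * (2 * C1 * s (Suc j) i) / s (Suc j) i + 1)) = (4 * C1 + 1) ^ ?n"
   proof -
    have "2 * (2 * C1 * s (Suc j) i) / s (Suc j) i + 1 = 4 * C1 + 1" for i using spos[of "Suc j" i] by simp
    thus ?thesis by simp
   qed
   moreover have "(4 * C1 + 1) ^ ?n \<le> C2 ^ ?n" using C2big C1pos by (intro power_mono) auto
   ultimately show "real (card ((\<lambda>l'. (v, (l', snd v))) ` {l' \<in> \<Lambda> j. l' - fst v \<in> vbx (\<lambda>i. 2 * C1 * s (Suc j) i)})) \<le> C2 ^ ?n"
    by linarith
  qed
  finally have c2: "real (card ?same) \<le> real (card ?V) * C2 ^ ?n" by simp
  have VV: "real (card ?V) = real (card (\<Lambda> j)) * real (card (Z j))" by (simp add: card_cartesian_product)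
  have prd: "(\<Prod>i\<in>UNIV. (2 * (2 * C1) + 97) * (s (Suc j) i / s j i) / (\<theta> * \<eta>)) = C2 ^ ?n / (F j * \<theta> ^ ?n)"
  proof -
   have "(\<Prod>i\<in>UNIV. (2 * (2 * C1) + 97) * (s (Suc j) i / s j i) / (\<theta> * \<eta>)) = (\<Prod>i\<in>UNIV. C2 / ((s j i / s (Suc j) i) * \<theta>))"
    unfolding C2_def by (intro prod.cong refl) simp
   also have "\<dots> = C2 ^ ?n / (F j * \<theta> ^ ?n)" unfolding F_def by (simp only: prod_dividef prod.distrib prod_constant)
   finally show ?thesis .
  qed
  have FT: "F j * \<theta> ^ ?n > 0" using Fpos th by simp
  have "real (card ?hit) \<le> real m * ((real (card ?V))\<^sup>2 * (C2 ^ ?n / (F j * \<theta> ^ ?n)))" using t(3)[OF j] unfolding prd VV .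
  also have "\<dots> = real m * (real (card ?V) * C2 ^ ?n) * (real (card ?V) / (F j * \<theta> ^ ?n))" by (simp add: power2_eq_square)
  \<comment> \<open>Here the room expressed by \<open>X j\<close> enters: the generic collisions
    exceed the bound for those with \<open>z = z'\<close> at most by the factor
    \<open>m\<close>.\<close>
  also have "\<dots> \<le> real m * (real (card ?V) * C2 ^ ?n) * 1"
  proof (rule mult_left_mono)
   have "real (card ?V) \<le> F j * \<theta> ^ ?n" using True unfolding X_def VV .
   thus "real (card ?V) / (F j * \<theta> ^ ?n) \<le> 1" using FT by (simp add: divide_le_eq)
  qed (use C2n in auto)
  finally have "real (card ?C) \<le> real (card ?V) * C3" using c1 c2 unfolding C3' by (simp add: algebra_simps)
  hence "real (card \<Theta>) * real (card ?C) \<le> real (card \<Theta>) * (real (card ?V) * C3)" by (intro mult_left_mono) auto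
  hence "real (card ?V) * real (card ?V) \<le> real (card ?V) * (C3 * real (card \<Theta>))" using T(4) by (simp add: power2_eq_square mult_ac)
  moreover have "real (card ?V) > 0" using finV Lane Z(2)[of j] j by (simp add: card_gt_0_iff)
  ultimately have "real (card ?V) \<le> C3 * real (card \<Theta>)" by (simp only: mult_le_cancel_left_pos)
  moreover have "\<Theta> \<subseteq> ?f ` (\<Lambda> j \<times> insert 0 (Z j))" using T(1) by blast
  ultimately show ?thesis using T(2,3) True unfolding VV by auto
 qed
 then obtain \<Theta> where Th: "\<And>j. j < m \<Longrightarrow> finite (\<Theta> j)" "\<And>j. j < m \<Longrightarrow> \<Theta> j \<subseteq> (\<lambda>(l, z). l + t * z) ` (\<Lambda> j \<times> insert 0 (Z j))"
  "\<And>j. j < m \<Longrightarrow> separated (\<lambda>i. C1 * s (Suc j) i) (\<Theta> j)"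
  "\<And>j. j < m \<Longrightarrow> real (card (\<Lambda> j)) * (if X j then real (card (Z j)) else 1) \<le> C3 * real (card (\<Theta> j))" by metis
 have Th2: "\<exists>l\<in>\<Lambda> j. \<exists>z\<in>insert 0 (Z j). x = l + t * z" if j: "j < m" and x: "x \<in> \<Theta> j" for j x
 proof -
  from subsetD[OF Th(2)[OF j] x] obtain w where w: "w \<in> \<Lambda> j \<times> insert 0 (Z j)" "x = (case w of (l, z) \<Rightarrow> l + t * z)"
   by (rule imageE)
  obtain l z where "w = (l, z)" by (cases w)
  thus ?thesis using w by (intro bexI[of _ l] bexI[of _ z]) auto
 qed
 have Thbd: "\<Theta> j \<subseteq> vbx (\<lambda>k. 29 * s j k)" if j: "j < m" for j
 proof
  fix x assume "x \<in> \<Theta> j"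
  from Th2[OF j this] obtain l z where lz: "l \<in> \<Lambda> j" "z \<in> insert 0 (Z j)" "x = l + t * z" by (elim bexE)
  have "t * z \<in> vbx (\<lambda>k. 28 * s j k)" unfolding vbx_def
  proof clarify
   fix k
   have "\<bar>z $ k\<bar> \<le> 4 * s j k" using lz(2) Zs[of j z k] j spos[of j k] by auto
   hence "\<bar>t $ k\<bar> * \<bar>z $ k\<bar> \<le> 7 * (4 * s j k)" using t(2) by (intro mult_mono) (auto simp: vbx_def)
   thus "\<bar>(t * z) $ k\<bar> \<le> 28 * s j k" by (simp add: abs_mult)
  qed
  moreover have "l \<in> vbx (s j)" using lz(1) La(1) by blast
  ultimately have "x \<in> vbx (\<lambda>k. s j k + 28 * s j k)" unfolding lz(3) by (intro vbx_add)
  thus "x \<in> vbx (\<lambda>k. 29 * s j k)" by (rule vbx_mono) simp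
 qed
 have C1ge: "C1 \<ge> 2 * 29 * real m + 1" unfolding C1 by simp
 let ?sum = "\<lambda>\<theta>. \<Sum>j<m. \<theta> j"
 have Thinj: "inj_on ?sum (PiE {..<m} \<Theta>)" and Thsep: "separated (\<lambda>_. 1) (?sum ` PiE {..<m} \<Theta>)"
  using separated_digit_sums[of m \<Theta> 29 s C1] Thbd Th(3) s1 anti C1ge by auto
 have Thsub: "?sum ` PiE {..<m} \<Theta> \<subseteq> sumset (dbl m) ((*) t ` dbl (Suc m))"
 proof clarify
  fix \<theta> assume th: "\<theta> \<in> PiE {..<m} \<Theta>"
  have "\<forall>j\<in>{..<m}. \<exists>l z. l \<in> \<Lambda> j \<and> z \<in> insert 0 (Z j) \<and> \<theta> j = l + t * z"
  proof
   fix j assume "j \<in> {..<m}"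
   hence j: "\<theta> j \<in> \<Theta> j" "j < m" using th by auto
   from Th2[OF j(2,1)] show "\<exists>l z. l \<in> \<Lambda> j \<and> z \<in> insert 0 (Z j) \<and> \<theta> j = l + t * z" by (elim bexE) metis
  qed
  then obtain l z where lz: "\<And>j. j < m \<Longrightarrow> l j \<in> \<Lambda> j" "\<And>j. j < m \<Longrightarrow> z j \<in> insert 0 (Z j)" "\<And>j. j < m \<Longrightarrow> \<theta> j = l j + t * z j"
   by (metis lessThan_iff)
  have "(\<Sum>j<m. \<theta> j) = (\<Sum>j<m. l j) + t * (\<Sum>j<m. z j)" using lz(3) by (simp add: sum.distrib sum_distrib_left)
  moreover have "(\<Sum>j<m. l j) \<in> dbl m" using lz(1) La(1) by (intro sum_in_dbl) blast
  moreover have "(\<Sum>j<m. z j) \<in> dbl (Suc m)"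
  proof (rule sum_in_dbl_Suc)
   fix j assume "j < m"
   thus "z j \<in> dbl (Suc 0)" using lz(2)[of j] Z(1)[of j] zero_dbl[of "Suc 0"] by auto
  qed
  ultimately show "(\<Sum>j<m. \<theta> j) \<in> sumset (dbl m) ((*) t ` dbl (Suc m))" by (auto intro!: sumsetI)
 qed
 have pos_Lt: "Lt \<ge> 0" using stab_nonneg[OF t(1)] .
 have Thcov: "covers (K ^ (3 * 2 ^ m) * Lt) (sumset (dbl m) ((*) t ` dbl (Suc m))) H"
 proof -
  have cv: "covers (K ^ (2 ^ m - 1) * (K ^ (2 ^ Suc m - 1) * Lt) * K) (sumset (dbl m) ((*) t ` dbl (Suc m))) H"
   by (intro covers_trans[OF covers_sumset doubling] covers_dbl covers_trans[OF covers_dilate[OF covers_dbl] stabD[OF t(1)]])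
  have "K ^ (2 ^ m - 1) * (K ^ (2 ^ Suc m - 1) * Lt) * K = K ^ ((2 ^ m - 1) + (2 ^ Suc m - 1) + 1) * Lt"
   by (simp only: power_add power_one_right mult_ac)
  moreover have "K ^ ((2 ^ m - 1) + (2 ^ Suc m - 1) + 1) * Lt \<le> K ^ (3 * 2 ^ m) * Lt"
  proof (intro mult_right_mono power_increasing K_ge_1 pos_Lt)
   have "(1::nat) \<le> 2 ^ m" "(2::nat) ^ Suc m = 2 * 2 ^ m" by simp_all
   thus "(2 ^ m - 1) + (2 ^ Suc m - 1) + 1 \<le> (3 * 2 ^ m :: nat)" by linarith
  qed
  ultimately have "K ^ (2 ^ m - 1) * (K ^ (2 ^ Suc m - 1) * Lt) * K \<le> K ^ (3 * 2 ^ m) * Lt" by (simp only:)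
  from covers_mono[OF cv order_refl this order_refl] show ?thesis .
 qed
 \<comment> \<open>Points that differ by more than 2 in some coordinate have different digit
   strings, so thinning by the factor 2, at the cost \<open>5 ^ CARD('n)\<close>, makes the
   expansion injective.\<close>
 have PB: "real (card E) \<le> 5 ^ ?n * (\<Prod>j<m. real (card (\<Lambda> j)))" if E: "E \<subseteq> H" "finite E" "separated (\<lambda>_. 1) E" for E
 proof -
  obtain E' where E': "E' \<subseteq> E" "separated (\<lambda>i. 2 * 1) E'" "real (card E) \<le> (2 * 2 + 1) ^ ?n * real (card E')"
   by (rule separated_thin[OF E(2,3), of 2]) auto
  have "\<forall>x\<in>E'. \<exists>\<theta>\<in>PiE {..<m} \<Lambda>. x - (\<Sum>j<m. \<theta> j) \<in> vbx (\<lambda>_. 1)"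
  proof
   fix x assume "x \<in> E'"
   hence "x \<in> H" using E' E by blast
   have sm': "s m = (\<lambda>_. 1)" using sm by auto
   show "\<exists>\<theta>\<in>PiE {..<m} \<Lambda>. x - (\<Sum>j<m. \<theta> j) \<in> vbx (\<lambda>_. 1)"
    using multiscale_expansion[of s \<Lambda> x m, OF La(4) _ H0 \<open>x \<in> H\<close>] La(1) unfolding sm' by blast
  qed
  then obtain g where g: "\<And>x. x \<in> E' \<Longrightarrow> g x \<in> PiE {..<m} \<Lambda>" "\<And>x. x \<in> E' \<Longrightarrow> x - (\<Sum>j<m. g x j) \<in> vbx (\<lambda>_. 1)" by metis
  have "inj_on g E'"
  proof (rule inj_onI, rule ccontr)
   fix x y assume xy: "x \<in> E'" "y \<in> E'" "g x = g y" "x \<noteq> y"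
   have "x - y = (x - (\<Sum>j<m. g x j)) + - (y - (\<Sum>j<m. g y j))" using xy(3) by simp
   also have "\<dots> \<in> vbx (\<lambda>_. 1 + 1)" using g xy by (intro vbx_add vbx_uminus)
   finally show False using E'(2) xy unfolding separated_def by auto
  qed
  moreover have "g ` E' \<subseteq> PiE {..<m} \<Lambda>" using g(1) by blast
  moreover have "finite (PiE {..<m} \<Lambda>)" using La(2) by (intro finite_PiE) auto
  ultimately have "card E' \<le> card (PiE {..<m} \<Lambda>)" by (rule card_inj_on_le)
  also have "\<dots> = (\<Prod>j<m. card (\<Lambda> j))" by (simp add: card_PiE)
  finally have "real (card E') \<le> (\<Prod>j<m. real (card (\<Lambda> j)))" by (simp only: of_nat_prod[symmetric] of_nat_le_iff)
  hence "5 ^ ?n * real (card E') \<le> 5 ^ ?n * (\<Prod>j<m. real (card (\<Lambda> j)))" by (intro mult_left_mono) auto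
  moreover have "real (card E) \<le> 5 ^ ?n * real (card E')" using E'(3) by simp
  ultimately show ?thesis by linarith
 qed
 let ?L = "\<Prod>j<m. real (card (\<Lambda> j))"
 have Lpos: "?L > 0"
 proof (rule prod_pos)
  fix j show "0 < real (card (\<Lambda> j))" using cLa[of j] by linarith
 qed
 have main1: "(\<Prod>j<m. real (card (\<Theta> j))) \<le> (K ^ (3 * 2 ^ m) * Lt) * (5 ^ ?n * ?L)"
 proof -
  have fin: "finite (PiE {..<m} \<Theta>)" using Th(1) by (intro finite_PiE) auto
  have "real (card (?sum ` PiE {..<m} \<Theta>)) \<le> (K ^ (3 * 2 ^ m) * Lt) * (5 ^ ?n * ?L)"
   by (rule packing_covers[OF Thcov PB Thsub _ Thsep]) (use fin in auto)
  moreover have "card (?sum ` PiE {..<m} \<Theta>) = (\<Prod>j<m. card (\<Theta> j))" by (simp add: card_image[OF Thinj] card_PiE)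
  ultimately show ?thesis by simp
 qed
 define ne where "ne = card {j \<in> {..<m}. X j}"
 define M where "M = real (card Z0) / (Lb ^ (2 * m) * K)"
 have den: "Lb ^ (2 * m) * K > 0" using b(2) K_ge_1 by simp
 have M0: "M \<ge> 0" unfolding M_def using den by simp
 have MZ: "M \<le> real (card (Z j))" if "j < m" for j
  unfolding M_def using Z(4)[of j] that den by (simp add: pos_divide_le_eq mult.commute)
 have "?L * M ^ ne = (\<Prod>j<m. real (card (\<Lambda> j)) * (if X j then M else 1))"
  unfolding ne_def by (simp add: prod.distrib prod.If_cases Int_def)
 also have "\<dots> \<le> (\<Prod>j<m. C3 * real (card (\<Theta> j)))"
 proof (rule prod_mono, intro conjI)
  fix j assume j: "j \<in> {..<m}"
  show "0 \<le> real (card (\<Lambda> j)) * (if X j then M else 1)" using M0 by simp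
  have "real (card (\<Lambda> j)) * (if X j then M else 1) \<le> real (card (\<Lambda> j)) * (if X j then real (card (Z j)) else 1)"
   using MZ[of j] j by (intro mult_left_mono) auto
  thus "real (card (\<Lambda> j)) * (if X j then M else 1) \<le> C3 * real (card (\<Theta> j))" using Th(4)[of j] j by simp
 qed
 also have "\<dots> = C3 ^ m * (\<Prod>j<m. real (card (\<Theta> j)))" by (simp add: prod.distrib)
 also have "\<dots> \<le> C3 ^ m * ((K ^ (3 * 2 ^ m) * Lt) * (5 ^ ?n * ?L))"
  using main1 C3big C2n by (intro mult_left_mono) auto
 finally have "M ^ ne * ?L \<le> (C3 ^ m * (K ^ (3 * 2 ^ m) * Lt) * 5 ^ ?n) * ?L" by (simp add: mult_ac)
 hence first: "M ^ ne \<le> C3 ^ m * (K ^ (3 * 2 ^ m) * Lt) * 5 ^ ?n" using Lpos by (simp only: mult_le_cancel_right_pos)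
 \<comment> \<open>Conversely, sums of thinned digits form a unit-separated subset of
   \<open>dbl m\<close>, which bounds the product of all \<open>card (\<Lambda> j)\<close> in terms
   of the packing number of \<open>H\<close>.\<close>
 have "\<exists>Y. Y \<subseteq> \<Lambda> j \<and> separated (\<lambda>i. C1 * s (Suc j) i) Y \<and> real (card (\<Lambda> j)) \<le> (2 * C1 + 1) ^ ?n * real (card Y)" for j
  by (rule separated_thin[OF La(2)[of j] La(3)[of j] spos C1pos]) blast
 then obtain Y where Y: "\<And>j. Y j \<subseteq> \<Lambda> j" "\<And>j. separated (\<lambda>i. C1 * s (Suc j) i) (Y j)"
  "\<And>j. real (card (\<Lambda> j)) \<le> (2 * C1 + 1) ^ ?n * real (card (Y j))" by metis
 have Ybd: "Y j \<subseteq> vbx (\<lambda>k. 29 * s j k)" for j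
 proof
  fix x assume "x \<in> Y j"
  hence "x \<in> vbx (s j)" using Y(1)[of j] La(1)[of j] by blast
  thus "x \<in> vbx (\<lambda>k. 29 * s j k)" by (rule vbx_mono) (use spos in \<open>simp add: less_imp_le\<close>)
 qed
 have Yinj: "inj_on ?sum (PiE {..<m} Y)" and Ysep: "separated (\<lambda>_. 1) (?sum ` PiE {..<m} Y)"
  using separated_digit_sums[of m Y 29 s C1] Ybd Y(2) s1 anti C1ge by auto
 have Yfin: "finite (PiE {..<m} Y)" using Y(1) La(2) by (intro finite_PiE) (auto intro: finite_subset)
 have Ysub: "?sum ` PiE {..<m} Y \<subseteq> dbl m"
 proof clarify
  fix \<theta> assume "\<theta> \<in> PiE {..<m} Y"
  hence "\<theta> j \<in> dbl j" if "j < m" for j using that Y(1)[of j] La(1)[of j] by auto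
  thus "(\<Sum>j<m. \<theta> j) \<in> dbl m" by (rule sum_in_dbl)
 qed
 have "real (card (?sum ` PiE {..<m} Y)) \<le> K ^ (2 ^ m - 1) * P"
  by (rule packing_covers[OF covers_dbl PH Ysub _ Ysep]) (use Yfin in auto)
 moreover have P0: "P \<ge> 0" using PH[of "{}"] by (simp add: separated_def)
 moreover have "K ^ (2 ^ m - 1) * P \<le> K ^ (2 ^ m) * P" using K_ge_1 P0 by (intro mult_right_mono power_increasing) auto
 moreover have "card (?sum ` PiE {..<m} Y) = (\<Prod>j<m. card (Y j))" by (simp add: card_image[OF Yinj] card_PiE)
 ultimately have YP: "(\<Prod>j<m. real (card (Y j))) \<le> K ^ (2 ^ m) * P" by simp
 have "?L \<le> (\<Prod>j<m. (2 * C1 + 1) ^ ?n * real (card (Y j)))" using Y(3) by (intro prod_mono) auto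
 also have "\<dots> = (2 * C1 + 1) ^ (?n * m) * (\<Prod>j<m. real (card (Y j)))" by (simp add: prod.distrib power_mult)
 also have "\<dots> \<le> (2 * C1 + 1) ^ (?n * m) * (K ^ (2 ^ m) * P)" using YP C1pos by (intro mult_left_mono) auto
 finally have upper: "?L \<le> (2 * C1 + 1) ^ (?n * m) * (K ^ (2 ^ m) * P)" .
 have cZ0: "real (card Z0) \<ge> 1" using Z0(1,3) by (metis One_nat_def Suc_leI card_gt_0_iff of_nat_1 of_nat_le_iff)
 define q where "q = \<theta> ^ ?n / real (card Z0)"
 have q: "0 < q" "q \<le> 1"
 proof -
  have "\<theta> ^ ?n \<le> 1" using th by (simp add: power_le_one)
  thus "q \<le> 1" unfolding q_def using cZ0 by (simp add: divide_le_eq)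
 qed (use th cZ0 in \<open>auto simp: q_def\<close>)
 \<comment> \<open>Telescoping, from side \<open>R\<close> at scale 0 to side 1 at scale
   \<open>m\<close>.\<close>
 have "(\<Prod>j<m. F j) = R ^ ?n"
 proof -
  have "(\<Prod>j<m. F j) = (\<Prod>i\<in>UNIV. \<Prod>j<m. s j i / s (Suc j) i)" unfolding F_def by (rule prod.swap)
  also have "\<dots> = (\<Prod>i\<in>(UNIV::'n set). R)"
  proof (rule prod.cong[OF refl])
   fix i
   have "(\<Prod>j<k. s j i / s (Suc j) i) = s 0 i / s k i" for k
   proof (induction k)
    case 0 show ?case using spos[of 0 i] by simp
   next
    case (Suc k) thus ?case using spos[of k i] by simp
   qed
   thus "(\<Prod>j<m. s j i / s (Suc j) i) = R" using s0 sm by simp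
  qed
  finally show ?thesis by simp
 qed
 hence "R ^ ?n * q ^ m * \<sigma> ^ (?n * ne) = (\<Prod>j<m. F j * q * (if X j then \<sigma> ^ ?n else 1))"
  unfolding ne_def by (simp add: prod.distrib prod.If_cases Int_def power_mult)
 \<comment> \<open>A window with room contributes at least the trivial 1, and
   \<open>F j * \<sigma> ^ CARD('n)\<close> is at most 1 since no coordinate shrinks by more than
   the factor \<open>\<sigma>\<close> in one step.\<close>
 also have "\<dots> \<le> ?L"
 proof (rule prod_mono, intro conjI)
  fix j assume j: "j \<in> {..<m}"
  show "0 \<le> F j * q * (if X j then \<sigma> ^ ?n else 1)" using Fpos[of j] q sg by simp
  show "F j * q * (if X j then \<sigma> ^ ?n else 1) \<le> real (card (\<Lambda> j))"
  proof (cases "X j")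
   case True
   have "F j * \<sigma> ^ ?n = (\<Prod>i\<in>(UNIV::'n set). s j i / s (Suc j) i * \<sigma>)" unfolding F_def by (simp only: prod.distrib prod_constant)
   also have "\<dots> \<le> (\<Prod>i\<in>(UNIV::'n set). 1)"
   proof (rule prod_mono, intro conjI)
    fix i show "0 \<le> s j i / s (Suc j) i * \<sigma>" using spos[of j i] spos[of "Suc j" i] sg by simp
    show "s j i / s (Suc j) i * \<sigma> \<le> 1" using sshr[of j i] spos[of "Suc j" i] by (simp add: divide_le_eq mult.commute)
   qed
   finally have "F j * \<sigma> ^ ?n \<le> 1" by simp
   hence "(F j * \<sigma> ^ ?n) * q \<le> 1 * 1" using q Fpos[of j] sg by (intro mult_mono) auto
   thus ?thesis using True cLa[of j] by (simp add: mult_ac)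
  next
   case False
   have zj: "real (card (Z j)) \<le> real (card Z0)" "real (card (Z j)) > 0"
    using Z(2,3)[of j] j by (auto simp: card_gt_0_iff)
   have "F j * \<theta> ^ ?n < real (card (\<Lambda> j)) * real (card (Z j))" using False unfolding X_def by simp
   also have "\<dots> \<le> real (card (\<Lambda> j)) * real (card Z0)" using zj by (intro mult_left_mono) auto
   finally have "F j * q < real (card (\<Lambda> j))" unfolding q_def using cZ0 by (simp add: pos_divide_less_eq)
   thus ?thesis using False by simp
  qed
 qed
 finally have second: "R ^ ?n * q ^ m * \<sigma> ^ (?n * ne) \<le> (2 * C1 + 1) ^ (?n * m) * (K ^ (2 ^ m) * P)" using upper by linarith
 show ?thesis using that[OF first[unfolded M_def] second[unfolded q_def]] .
qed

end

section \<open>Extracting spread sets and a well-conditioned basis\<close>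

lemma sum_UN_le:
 fixes w :: "'a \<Rightarrow> real"
 assumes "finite I" "\<And>i. i \<in> I \<Longrightarrow> finite (A i)" "\<And>i x. i \<in> I \<Longrightarrow> x \<in> A i \<Longrightarrow> w x \<ge> 0"
 shows "(\<Sum>x\<in>(\<Union>i\<in>I. A i). w x) \<le> (\<Sum>i\<in>I. \<Sum>x\<in>A i. w x)"
 using assms
proof (induction I)
 case empty thus ?case by simp
next
 case (insert i I)
 let ?U = "\<Union>i\<in>I. A i"
 have "(\<Sum>x\<in>A i \<union> ?U. w x) + (\<Sum>x\<in>A i \<inter> ?U. w x) = (\<Sum>x\<in>A i. w x) + (\<Sum>x\<in>?U. w x)"
  using insert by (intro sum.union_inter) auto
 moreover have "(\<Sum>x\<in>A i \<inter> ?U. w x) \<ge> 0" using insert.prems by (intro sum_nonneg) auto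
 moreover have "(\<Sum>x\<in>?U. w x) \<le> (\<Sum>i\<in>I. \<Sum>x\<in>A i. w x)" using insert by auto
 ultimately show ?case using insert by simp
qed

text \<open>Each chosen point forbids one strip of radius \<open>r\<close> per coordinate, so fewer
  than \<open>M\<close> points forbid less than the total weight.\<close>

lemma greedy_spread:
 fixes X :: "(real^'n) set" and w :: "real^'n \<Rightarrow> real"
 assumes fin: "finite X" and w0: "\<And>x. x \<in> X \<Longrightarrow> w x \<ge> 0" and S0: "S \<ge> 0" and r: "r \<ge> 0"
  and strip: "\<And>k a. (\<Sum>x\<in>{x \<in> X. \<bar>x $ k - a\<bar> \<le> r}. w x) \<le> S"
  and M: "real M * (real CARD('n) * S) < (\<Sum>x\<in>X. w x)"
 obtains Z where "Z \<subseteq> X" "card Z = M" "\<And>z z' k. z \<in> Z \<Longrightarrow> z' \<in> Z \<Longrightarrow> z \<noteq> z' \<Longrightarrow> \<bar>(z - z') $ k\<bar> > r"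
proof -
 have "j \<le> M \<Longrightarrow> \<exists>Z. Z \<subseteq> X \<and> card Z = j \<and> (\<forall>z\<in>Z. \<forall>z'\<in>Z. z \<noteq> z' \<longrightarrow> (\<forall>k. \<bar>(z - z') $ k\<bar> > r))" for j
 proof (induction j)
  case 0 show ?case by (intro exI[of _ "{}"]) simp
 next
  case (Suc j)
  then obtain Z where Z: "Z \<subseteq> X" "card Z = j" "\<forall>z\<in>Z. \<forall>z'\<in>Z. z \<noteq> z' \<longrightarrow> (\<forall>k. \<bar>(z - z') $ k\<bar> > r)" by auto
  have finZ: "finite Z" using Z(1) fin by (rule finite_subset)
  define bad where "bad = (\<Union>p\<in>Z \<times> (UNIV::'n set). {x \<in> X. \<bar>x $ snd p - fst p $ snd p\<bar> \<le> r})"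
  have finb: "finite bad" unfolding bad_def using finZ fin by auto
  have "(\<Sum>x\<in>bad. w x) \<le> (\<Sum>p\<in>Z \<times> (UNIV::'n set). \<Sum>x\<in>{x \<in> X. \<bar>x $ snd p - fst p $ snd p\<bar> \<le> r}. w x)"
   unfolding bad_def using finZ fin w0 by (intro sum_UN_le) auto
  also have "\<dots> \<le> (\<Sum>p\<in>Z \<times> (UNIV::'n set). S)" by (intro sum_mono strip)
  also have "\<dots> = real j * (real CARD('n) * S)" using Z(2) by (simp add: card_cartesian_product)
  also have "\<dots> \<le> real M * (real CARD('n) * S)" using Suc.prems S0 by (intro mult_right_mono) auto
  finally have "(\<Sum>x\<in>bad. w x) < (\<Sum>x\<in>X. w x)" using M by linarith
  hence "\<not> X \<subseteq> bad" using sum_mono2[OF finb, of X w] w0 unfolding bad_def by fastforce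
  then obtain x where x: "x \<in> X" "x \<notin> bad" by blast
  have far: "\<bar>(x - z) $ k\<bar> > r" if z: "z \<in> Z" for z k
  proof (rule ccontr)
   assume "\<not> \<bar>(x - z) $ k\<bar> > r"
   hence "x \<in> bad" unfolding bad_def using x(1) z by (intro UN_I[of "(z, k)"]) auto
   thus False using x(2) by blast
  qed
  have far': "\<bar>(z - x) $ k\<bar> > r" if "z \<in> Z" for z k
   using far[OF that, of k] by (simp add: abs_minus_commute)
  have "x \<notin> Z" using far[of x] r by force
  hence "card (insert x Z) = Suc j" using finZ Z(2) by simp
  moreover have "insert x Z \<subseteq> X" using x(1) Z(1) by blast
  ultimately show ?case using Z(3) far far' by (intro exI[of _ "insert x Z"]) auto
 qed
 from this[of M] show ?thesis using that by auto
qed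

text \<open>Auerbach's choice: among all families from \<open>X\<close> take one of maximal
  determinant. By Cramer's rule its dual functionals are at most 1 in absolute value on
  \<open>X\<close>, so a functional of norm above \<open>D\<close> would put \<open>X\<close> inside
  a strip of half-width \<open>1 / D\<close>.\<close>

lemma spread_basis:
 fixes X :: "(real^'n) set"
 assumes fin: "finite X" and D: "D > 0"
  and strip: "\<And>u :: real^'n. norm u = 1 \<Longrightarrow> \<exists>x\<in>X. \<bar>u \<bullet> x\<bar> > 1 / D"
 shows "\<exists>v \<phi> :: 'n \<Rightarrow> real^'n. (\<forall>i. v i \<in> X) \<and> (\<forall>x. x = (\<Sum>i\<in>UNIV. (\<phi> i \<bullet> x) *\<^sub>R v i)) \<and> (\<forall>i. norm (\<phi> i) \<le> D)"
proof -
 define mat where "mat v = (\<chi> i j. v j $ i)" for v :: "'n \<Rightarrow> real^'n"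
 have matmul: "mat v *v c = (\<Sum>i\<in>UNIV. (c $ i) *\<^sub>R v i)" for v c
  unfolding mat_def matrix_vector_mult_def by (simp add: vec_eq_iff mult.commute)
 have Xne: "X \<noteq> {}"
 proof -
  obtain u :: "real^'n" where "norm u = 1" using vector_choose_size[of 1] by auto
  thus ?thesis using strip by blast
 qed
 have spanX: "span X = UNIV"
 proof (rule ccontr)
  assume "span X \<noteq> UNIV"
  from span_not_UNIV_orthogonal[OF this] obtain a where a: "a \<noteq> 0" "\<forall>x\<in>span X. a \<bullet> x = 0" by blast
  let ?u = "(1 / norm a) *\<^sub>R a"
  have "norm ?u = 1" using a(1) by simp
  from strip[OF this] obtain x where x: "x \<in> X" "\<bar>?u \<bullet> x\<bar> > 1 / D" by blast
  have "a \<bullet> x = 0" using a(2) x(1) span_base by blast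
  thus False using x(2) D by simp
 qed
 obtain B where B: "B \<subseteq> X" "independent B" "X \<subseteq> span B"
  using maximal_independent_subset[of X] by blast
 have "UNIV \<subseteq> span B" unfolding spanX[symmetric] by (rule span_minimal[OF B(3) subspace_span])
 hence sB: "span B = UNIV" by blast
 have "card B = dim (span B)" using dim_eq_card_independent[OF B(2)] by simp
 hence cB: "card B = CARD('n)" unfolding sB by simp
 have finB: "finite B" using B(1) fin by (rule finite_subset)
 obtain v0 where v0: "bij_betw v0 (UNIV::'n set) B" using cB finB finite_same_card_bij[of "UNIV::'n set" B] by auto
 \<comment> \<open>An independent family taken from \<open>X\<close> shows that the maximal
   determinant is nonzero.\<close>
 have det0: "det (mat v0) \<noteq> 0"
 proof -
  have "c = 0" if c: "mat v0 *v c = 0" for c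
  proof -
   have "(\<Sum>x\<in>B. (c $ (the_inv_into UNIV v0 x)) *\<^sub>R x) = (\<Sum>i\<in>UNIV. (c $ i) *\<^sub>R v0 i)"
    using v0 by (subst sum.reindex_bij_betw[OF v0, symmetric]) (simp add: the_inv_into_f_f bij_betw_def)
   also have "\<dots> = 0" using c unfolding matmul .
   finally have z: "(\<Sum>x\<in>B. (c $ (the_inv_into UNIV v0 x)) *\<^sub>R x) = 0" .
   have "c $ i = 0" for i
   proof (rule ccontr)
    assume ci: "c $ i \<noteq> 0"
    have "v0 i \<in> B" "the_inv_into UNIV v0 (v0 i) = i" using v0 by (auto simp: bij_betw_def the_inv_into_f_f)
    hence "\<exists>x\<in>B. c $ (the_inv_into UNIV v0 x) \<noteq> 0" using ci by (intro bexI[of _ "v0 i"]) simp_all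
    hence "dependent B" unfolding dependent_finite[OF finB] using z
     by (intro exI[of _ "\<lambda>x. c $ (the_inv_into UNIV v0 x)"] conjI)
    thus False using B(2) by simp
   qed
   thus "c = 0" by (simp add: vec_eq_iff)
  qed
  hence "\<exists>Bm. Bm ** mat v0 = Finite_Cartesian_Product.mat 1" by (simp add: matrix_left_invertible_ker)
  thus ?thesis by (simp add: invertible_det_nz[symmetric] invertible_left_inverse)
 qed
 let ?T = "(\<lambda>v. \<bar>det (mat v)\<bar>) ` (PiE UNIV (\<lambda>_. X))"
 have finT: "finite ?T" using fin by (intro finite_imageI finite_PiE) auto
 have "v0 \<in> PiE UNIV (\<lambda>_. X)" using v0 B(1) by (auto simp: bij_betw_def)
 hence Tne: "?T \<noteq> {}" by blast
 obtain v where v: "v \<in> PiE UNIV (\<lambda>_. X)" "\<bar>det (mat v)\<bar> = Max ?T" using Max_in[OF finT Tne] by force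
 have vX: "v i \<in> X" for i using v(1) by auto
 have maxv: "\<bar>det (mat u)\<bar> \<le> \<bar>det (mat v)\<bar>" if "\<And>i. u i \<in> X" for u
 proof -
  have "u \<in> PiE UNIV (\<lambda>_. X)" using that by auto
  thus ?thesis unfolding v(2) using finT by (intro Max_ge) auto
 qed
 have v0X: "v0 i \<in> X" for i using v0 B(1) by (auto simp: bij_betw_def)
 have detv: "det (mat v) \<noteq> 0" using maxv[of v0, OF v0X] det0 by auto
 then obtain Bm where Bm: "mat v ** Bm = Finite_Cartesian_Product.mat 1" "Bm ** mat v = Finite_Cartesian_Product.mat 1"
  unfolding invertible_det_nz[symmetric] invertible_def by blast
 define \<phi> where "\<phi> i = Bm $ i" for i
 have comp: "(Bm *v x) $ i = \<phi> i \<bullet> x" for x i unfolding \<phi>_def by (rule matrix_vector_mul_component)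
 have rep: "mat v *v (Bm *v x) = x" for x by (simp add: matrix_vector_mul_assoc Bm)
 have exp: "x = (\<Sum>i\<in>UNIV. (\<phi> i \<bullet> x) *\<^sub>R v i)" for x using rep[of x] unfolding matmul comp by simp
 have small: "\<bar>\<phi> k \<bullet> x\<bar> \<le> 1" if x: "x \<in> X" for k x
 proof -
  have "Bm *v x = (\<chi> k. det (\<chi> i j. if j = k then x $ i else mat v $ i $ j) / det (mat v))"
   using rep[of x] unfolding cramer[OF detv] .
  hence "\<phi> k \<bullet> x = det (\<chi> i j. if j = k then x $ i else mat v $ i $ j) / det (mat v)"
   unfolding comp[symmetric] by simp
  also have "(\<chi> i j. if j = k then x $ i else mat v $ i $ j) = mat (v(k := x))"
   unfolding mat_def by (simp add: vec_eq_iff)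
  finally have "\<bar>\<phi> k \<bullet> x\<bar> = \<bar>det (mat (v(k := x)))\<bar> / \<bar>det (mat v)\<bar>" by (simp add: abs_divide)
  also have "\<dots> \<le> 1" using maxv[of "v(k := x)"] vX x detv by (simp add: divide_le_eq)
  finally show ?thesis .
 qed
 have "norm (\<phi> i) \<le> D" for i
 proof (rule ccontr)
  assume n: "\<not> norm (\<phi> i) \<le> D"
  hence pos: "norm (\<phi> i) > 0" using D by linarith
  let ?u = "(1 / norm (\<phi> i)) *\<^sub>R \<phi> i"
  have "norm ?u = 1" using pos by simp
  from strip[OF this] obtain x where x: "x \<in> X" "\<bar>?u \<bullet> x\<bar> > 1 / D" by blast
  have "\<bar>?u \<bullet> x\<bar> = \<bar>\<phi> i \<bullet> x\<bar> / norm (\<phi> i)" by (simp add: abs_mult)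
  also have "\<dots> \<le> 1 / norm (\<phi> i)" using small[OF x(1)] by (intro divide_right_mono) auto
  also have "\<dots> \<le> 1 / D" using n D pos by (intro divide_left_mono mult_pos_pos) auto
  finally show False using x(2) by simp
 qed
 thus ?thesis using vX exp by (intro exI[of _ v] exI[of _ \<phi>] conjI allI)
qed

section \<open>Choice of parameters and the core contradiction\<close>

lemma eventually_less_powr: "x > 0 \<Longrightarrow> eventually (\<lambda>R::real. C < R powr x) at_top"
proof -
 assume x: "x > 0"
 have "C < R powr x" if R: "R \<ge> (\<bar>C\<bar> + 1) powr (1 / x)" for R :: real
 proof -
  have "C < \<bar>C\<bar> + 1" by linarith
  also have "\<bar>C\<bar> + 1 = ((\<bar>C\<bar> + 1) powr (1 / x)) powr x" using x by (simp add: powr_powr)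
  also have "\<dots> \<le> R powr x" using R x by (intro powr_mono2) auto
  finally show ?thesis .
 qed
 thus ?thesis unfolding eventually_at_top_linorder by blast
qed

lemma power_le_powr:
 assumes "1 \<le> K" "K \<le> R powr \<epsilon>" "R > 0" shows "K ^ j \<le> R powr (\<epsilon> * real j)"
proof -
 have "K ^ j \<le> (R powr \<epsilon>) ^ j" using assms by (intro power_mono) auto
 also have "\<dots> = R powr (\<epsilon> * real j)" using assms(3) by (simp add: powr_realpow[symmetric] powr_powr)
 finally show ?thesis .
qed

text \<open>In the application \<open>X\<close> consists of ratios t / t_0, acting on
  \<open>H\<close> with price \<open>K\<close>, and \<open>A\<close> is the set from the
  Balog-Szemeredi-Gowers argument. \<open>X\<close> provides the dense family of multipliers and the
  contraction, \<open>A\<close> the set \<open>Z0\<close> that is spread at the full scale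
  \<open>R\<close>. Then \<open>windows\<close> yields more unit cells than the bound on separated
  subsets of \<open>H\<close> allows.\<close>

lemma core_contradiction:
 fixes \<kappa> \<gamma> :: real
 assumes kap: "0 < \<kappa>" "\<kappa> \<le> 1" and gam: "0 < \<gamma>" "\<gamma> \<le> 1"
 shows "\<exists>\<epsilon>>0. eventually (\<lambda>R. \<forall>(H :: (real^'n) set) K X w A u.
   approx_group H K R \<longrightarrow> K \<le> R powr \<epsilon> \<longrightarrow>
   finite X \<longrightarrow> X \<subseteq> approx_group.stab H K \<longrightarrow> X \<subseteq> vbx (\<lambda>_. 2) \<longrightarrow> (\<forall>x\<in>X. w x \<ge> 0) \<longrightarrow> (\<Sum>x\<in>X. w x) \<ge> 1 / K \<longrightarrow>
   (\<forall>v a \<rho>. norm v = 1 \<longrightarrow> 1 / R \<le> \<rho> \<longrightarrow> (\<Sum>x\<in>{x \<in> X. \<bar>v \<bullet> x - a\<bar> \<le> \<rho>}. w x) \<le> K * \<rho> powr \<kappa>) \<longrightarrow>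
   finite A \<longrightarrow> covers K A H \<longrightarrow> (\<forall>x\<in>A. u x \<ge> 0) \<longrightarrow> (\<Sum>x\<in>A. u x) \<ge> 1 / K \<longrightarrow>
   (\<forall>k a \<rho>. 1 / R \<le> \<rho> \<longrightarrow> (\<Sum>x\<in>{x \<in> A. \<bar>x $ k - a\<bar> \<le> \<rho> * R}. u x) \<le> K * \<rho> powr \<kappa>) \<longrightarrow>
   (\<forall>E\<subseteq>H. finite E \<longrightarrow> separated (\<lambda>_. 1) E \<longrightarrow> real (card E) \<le> R powr (real CARD('n) - \<gamma>)) \<longrightarrow> False) at_top"
proof -
 define n where "n = CARD('n)"
 have n1: "n \<ge> 1" unfolding n_def by (simp add: Suc_leI)
 \<comment> \<open>The contraction will have size \<open>\<rho> = R powr (- (c * \<beta>))\<close>.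
   Boxes of this size number about \<open>\<rho> powr (- n) = R powr (c * \<kappa> / 4)\<close>, so
   two of \<open>R powr (c * \<kappa> / 2)\<close> points are that close.\<close>
 define \<beta> where "\<beta> = \<kappa> / (4 * real n)"
 \<comment> \<open>Makes \<open>R powr (c * \<kappa> * J / 2)\<close> reach
   \<open>R powr (c * (2 * n + 1))\<close>, as \<open>stab_dense\<close> requires with
   \<open>\<sigma> = R powr (- c)\<close>.\<close>
 define J where "J = nat \<lceil>(4 * real n + 2) / \<kappa>\<rceil>"
 define e where "e = 4 * gexp n J + 15 + 4 * n"
 \<comment> \<open>At most \<open>8 * c * e / (g * \<kappa>)\<close> scales are exceptional, each
   losing \<open>R powr (c * n)\<close>. As \<open>c\<close> and \<open>g\<close> are both of order
   \<open>1 / m\<close>, the total exponent is of order \<open>1 / m\<close> too, and this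
   \<open>m\<close> makes it at most \<open>\<gamma> / 8\<close>. The summand
   \<open>1 / \<beta>\<close> gives \<open>c \<le> 1\<close>.\<close>
 define m where "m = nat \<lceil>512 * real n * (real n + 1) * real e / (\<beta>\<^sup>2 * \<gamma>\<^sup>2 * \<kappa>)\<rceil> + 1 + nat \<lceil>1 / \<beta>\<rceil>"
 \<comment> \<open>So that \<open>m\<close> contractions by \<open>\<rho>\<close> lead from
   \<open>R\<close> down to 1.\<close>
 define c where "c = 1 / (\<beta> * real m)"
 \<comment> \<open>With \<open>\<theta> = R powr (- g)\<close> and
   \<open>card Z0 \<le> R powr g\<close>, the loss over \<open>m\<close> scales is at most
   \<open>R powr (\<gamma> / 8)\<close>.\<close>
 define g where "g = \<gamma> / (8 * (real n + 1) * real m)"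
 define C1 where "C1 = 58 * real m + 1"
 define CJ where "CJ = 2 * (real J * (4 * real n + 4)) + 1"
 \<comment> \<open>Chosen after \<open>m\<close>. The entries control, in this order, the selection
   of \<open>Z\<close>, the loss on \<open>Z0\<close> in \<open>windows\<close>, the factor
   \<open>D ^ (n * m)\<close>, and two powers of \<open>K\<close> whose exponents are of order
   \<open>2 ^ m\<close>.\<close>
 define \<epsilon> where "\<epsilon> = min (c * \<kappa> / 8) (min (g * \<kappa> / (4 * (6 * real m + 2))) (min (c * real e * \<kappa> / (16 * real n * real m)) (min (c * real e / (12 * 2 ^ m)) (\<gamma> / (8 * 2 ^ m)))))"
 have bet: "0 < \<beta>" unfolding \<beta>_def using kap n1 by simp
 have m1: "real m \<ge> 1" unfolding m_def by simp
 have mb: "real m \<ge> 1 / \<beta>" unfolding m_def by linarith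
 have mbig: "real m \<ge> 512 * real n * (real n + 1) * real e / (\<beta>\<^sup>2 * \<gamma>\<^sup>2 * \<kappa>)" unfolding m_def by linarith
 have e1: "real e \<ge> 1" unfolding e_def by simp
 have c0: "0 < c" unfolding c_def using bet m1 by simp
 have c1: "c \<le> 1" unfolding c_def using bet m1 mb by (simp add: divide_le_eq field_simps)
 have g0: "0 < g" unfolding g_def using gam m1 by simp
 have g1: "g \<le> 1"
 proof -
  have "1 * 1 \<le> (8 * (real n + 1)) * real m" using m1 by (intro mult_mono) auto
  thus ?thesis unfolding g_def using gam by (simp add: divide_le_eq)
 qed
 have eps0: "\<epsilon> > 0" unfolding \<epsilon>_def using c0 g0 kap gam m1 e1 n1 by simp
 have ep1: "\<epsilon> \<le> c * \<kappa> / 8" unfolding \<epsilon>_def by (rule min.cobounded1)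
 have ep2: "\<epsilon> \<le> g * \<kappa> / (4 * (6 * real m + 2))" unfolding \<epsilon>_def by (rule min.coboundedI2, rule min.cobounded1)
 have ep3: "\<epsilon> \<le> c * real e * \<kappa> / (16 * real n * real m)" unfolding \<epsilon>_def by (rule min.coboundedI2, rule min.coboundedI2, rule min.cobounded1)
 have ep4: "\<epsilon> \<le> c * real e / (12 * 2 ^ m)" unfolding \<epsilon>_def by (rule min.coboundedI2, rule min.coboundedI2, rule min.coboundedI2, rule min.cobounded1)
 have ep5: "\<epsilon> \<le> \<gamma> / (8 * 2 ^ m)" unfolding \<epsilon>_def by (rule min.coboundedI2, rule min.coboundedI2, rule min.coboundedI2, rule min.cobounded2)
 have ce0: "c * real e > 0" using c0 e1 by simp
 have ev: "eventually (\<lambda>R. R \<ge> 1 \<and> 3 < R powr c \<and> 2 * real n < R powr (c * \<kappa> / 4) \<and> 5 ^ n < R powr (c * \<kappa> / 4) \<and>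
   CJ ^ n < R powr c \<and> 2 < R powr (\<kappa> / 2) \<and> 2 * real n < R powr (g * \<kappa> / 4) \<and> 2 < R powr (g / 2) \<and>
   ((real m + 1) * ((4 * C1 + 97) * (2 * real n)) ^ n) ^ m < R powr (c * real e / 4) \<and> 5 ^ n < R powr (c * real e / 4) \<and>
   (2 * C1 + 1) ^ (n * m) < R powr (\<gamma> / 8) \<and> 2 powr (real n * real m / \<kappa>) < R powr (c * real e / 8)) at_top"
  using kap gam c0 g0 ce0 by (intro eventually_conj eventually_ge_at_top eventually_less_powr) auto
 show ?thesis
 proof (intro exI[of _ \<epsilon>] conjI eps0, rule eventually_mono[OF ev], intro allI impI)
  fix R :: real and H :: "(real^'n) set" and K X w A u
  assume evR: "R \<ge> 1 \<and> 3 < R powr c \<and> 2 * real n < R powr (c * \<kappa> / 4) \<and> 5 ^ n < R powr (c * \<kappa> / 4) \<and>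
   CJ ^ n < R powr c \<and> 2 < R powr (\<kappa> / 2) \<and> 2 * real n < R powr (g * \<kappa> / 4) \<and> 2 < R powr (g / 2) \<and>
   ((real m + 1) * ((4 * C1 + 97) * (2 * real n)) ^ n) ^ m < R powr (c * real e / 4) \<and> 5 ^ n < R powr (c * real e / 4) \<and>
   (2 * C1 + 1) ^ (n * m) < R powr (\<gamma> / 8) \<and> 2 powr (real n * real m / \<kappa>) < R powr (c * real e / 8)"
  assume ag: "approx_group H K R" and KR: "K \<le> R powr \<epsilon>"
   and X: "finite X" "X \<subseteq> approx_group.stab H K" "X \<subseteq> vbx (\<lambda>_. 2)" "\<forall>x\<in>X. w x \<ge> 0" "(\<Sum>x\<in>X. w x) \<ge> 1 / K"
   and Xs: "\<forall>v a \<rho>. norm v = 1 \<longrightarrow> 1 / R \<le> \<rho> \<longrightarrow> (\<Sum>x\<in>{x \<in> X. \<bar>v \<bullet> x - a\<bar> \<le> \<rho>}. w x) \<le> K * \<rho> powr \<kappa>"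
   and A: "finite A" "covers K A H" "\<forall>x\<in>A. u x \<ge> 0" "(\<Sum>x\<in>A. u x) \<ge> 1 / K"
   and As: "\<forall>k a \<rho>. 1 / R \<le> \<rho> \<longrightarrow> (\<Sum>x\<in>{x \<in> A. \<bar>x $ k - a\<bar> \<le> \<rho> * R}. u x) \<le> K * \<rho> powr \<kappa>"
   and PH: "\<forall>E\<subseteq>H. finite E \<longrightarrow> separated (\<lambda>_. 1) E \<longrightarrow> real (card E) \<le> R powr (real CARD('n) - \<gamma>)"
  interpret approx_group H K R by (rule ag)
  have R1: "R \<ge> 1" and Rp: "R > 0" using evR by auto
  note Kpow = power_le_powr[OF K_ge_1 KR Rp]
  have rle: "R powr x \<le> R powr y" if "x \<le> y" for x y using that R1 by (simp add: powr_mono)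
  have r1: "R powr x \<ge> 1" if "x \<ge> 0" for x using rle[OF that] Rp by simp
  have rpos: "R powr x > 0" for x using Rp by simp
  define l where "l = R powr c"
  define \<sigma> where "\<sigma> = 1 / l"
  have sigR: "\<sigma> = R powr (- c)" unfolding \<sigma>_def l_def by (simp add: powr_minus divide_inverse)
  have l3: "3 \<le> l" unfolding l_def using evR by simp
  have Kl: "K \<le> l" unfolding l_def
  proof (rule order_trans[OF KR rle])
   have "c * \<kappa> / 8 \<le> c" using c0 kap by (simp add: divide_le_eq mult_left_le)
   thus "\<epsilon> \<le> c" using ep1 by linarith
  qed
  have sg: "0 < \<sigma>" "\<sigma> \<le> 1" unfolding \<sigma>_def using l3 by auto
  have sgR: "1 / R \<le> \<sigma>"
  proof -
   have "R powr (- 1) \<le> R powr (- c)" using c1 by (intro rle) simp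
   thus ?thesis unfolding sigR using Rp by (simp add: powr_minus_divide)
  qed
  have Kpos: "K > 0" using K_ge_1 by linarith
  \<comment> \<open>Strips of radius \<open>R powr (- y)\<close> have mass at most
    \<open>K * R powr (- y * \<kappa>)\<close>, so about \<open>R powr (y * \<kappa> / 2)\<close>
    points can be chosen greedily; the other half of the exponent pays for \<open>K\<^sup>2\<close>
    and the constants.\<close>
  have spread_ok: "real (nat \<lceil>R powr (y * \<kappa> / 2)\<rceil>) * (real CARD('n) * (K * (R powr (- y)) powr \<kappa>)) < 1 / K"
   if y: "y > 0" "\<epsilon> \<le> y * \<kappa> / 8" "2 * real n < R powr (y * \<kappa> / 4)" for y
  proof -
   have "real (nat \<lceil>R powr (y * \<kappa> / 2)\<rceil>) \<le> 2 * R powr (y * \<kappa> / 2)"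
    using r1[of "y * \<kappa> / 2"] y kap by (simp add: of_nat_nat) linarith
   hence "real (nat \<lceil>R powr (y * \<kappa> / 2)\<rceil>) * (real n * (K * R powr (- y * \<kappa>))) * K
    \<le> (2 * R powr (y * \<kappa> / 2)) * (real n * (K * R powr (- y * \<kappa>))) * K"
    using Kpos by (intro mult_right_mono) auto
   also have "\<dots> = (2 * real n) * K ^ 2 * (R powr (y * \<kappa> / 2) * R powr (- y * \<kappa>))" by (simp add: power2_eq_square)
   also have "R powr (y * \<kappa> / 2) * R powr (- y * \<kappa>) = R powr (- (y * \<kappa> / 2))" by (simp add: powr_add[symmetric] mult.commute)
   also have "(2 * real n) * K ^ 2 * R powr (- (y * \<kappa> / 2)) < R powr (y * \<kappa> / 4) * R powr (y * \<kappa> / 4) * R powr (- (y * \<kappa> / 2))"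
   proof (intro mult_strict_right_mono rpos mult_less_le_imp_less y(3))
    have "K ^ 2 \<le> R powr (\<epsilon> * real 2)" by (rule Kpow)
    also have "\<dots> \<le> R powr (y * \<kappa> / 4)" using y(2) by (intro rle) simp
    finally show "K ^ 2 \<le> R powr (y * \<kappa> / 4)" .
   qed (use Kpos in auto)
   also have "\<dots> = 1" using Rp by (simp add: powr_add[symmetric])
   finally show ?thesis unfolding n_def[symmetric] powr_powr using Kpos by (simp add: pos_less_divide_eq)
  qed
  have strX: "(\<Sum>x\<in>{x \<in> X. \<bar>x $ k - a\<bar> \<le> \<sigma>}. w x) \<le> K * (R powr (- c)) powr \<kappa>" for k a
  proof -
   have "norm (axis k 1 :: real^'n) = 1" by simp
   from Xs[rule_format, OF this sgR, of a] show ?thesis by (simp add: inner_axis' sigR)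
  qed
  define MZ where "MZ = nat \<lceil>R powr (c * \<kappa> / 2)\<rceil>"
  have MZok: "real MZ * (real CARD('n) * (K * (R powr (- c)) powr \<kappa>)) < (\<Sum>x\<in>X. w x)"
   using spread_ok[of c] c0 ep1 evR X(5) unfolding MZ_def by linarith
  obtain Z where Z: "Z \<subseteq> X" "card Z = MZ" "\<And>z z' k. z \<in> Z \<Longrightarrow> z' \<in> Z \<Longrightarrow> z \<noteq> z' \<Longrightarrow> \<bar>(z - z') $ k\<bar> > \<sigma>"
   by (rule greedy_spread[OF X(1) X(4)[rule_format] _ _ strX MZok]) (use Kpos sg in auto)
  have cZ: "real (card Z) \<ge> R powr (c * \<kappa> / 2)" unfolding Z(2) MZ_def by (rule real_nat_ceiling_ge)
  have finZ: "finite Z" using Z(1) X(1) by (rule finite_subset)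
  have XK: "x \<in> stab l" if "x \<in> X" for x using X(2) that Kl stab_mono by blast
  define \<rho> where "\<rho> = R powr (- (c * \<beta>))"
  have rho: "0 < \<rho>" "\<rho> \<le> 1" "\<rho> ^ m * R \<le> 1"
  proof -
   show "0 < \<rho>" unfolding \<rho>_def using Rp by simp
   show "\<rho> \<le> 1" unfolding \<rho>_def using rle[of "- (c * \<beta>)" 0] c0 bet Rp by simp
   have "\<rho> ^ m = R powr (- (c * \<beta>) * real m)" unfolding \<rho>_def using Rp by (simp add: powr_realpow[symmetric] powr_powr)
   also have "- (c * \<beta>) * real m = - 1" unfolding c_def using bet m1 by simp
   finally have "\<rho> ^ m = 1 / R" using Rp by (simp add: powr_minus_divide)
   thus "\<rho> ^ m * R \<le> 1" using Rp by simp
  qed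
  \<comment> \<open>Two points of \<open>Z\<close> are within \<open>\<rho>\<close> in every
    coordinate. Their difference is the contraction \<open>b\<close>, and the spread of
    \<open>Z\<close> keeps each of its coordinates above \<open>\<sigma>\<close>.\<close>
  have "\<not> separated (\<lambda>_. \<rho>) Z"
  proof
   assume "separated (\<lambda>_. \<rho>) Z"
   hence "real (card Z) \<le> (\<Prod>i\<in>(UNIV::'n set). (2 * 2 / \<rho> + 1))"
    using Z(1) X(3) rho by (intro card_separated_le(2)[of _ 0]) auto
   also have "\<dots> = (4 / \<rho> + 1) ^ n" unfolding n_def by simp
   also have "\<dots> \<le> (5 / \<rho>) ^ n" using rho by (intro power_mono) (auto simp: field_simps)
   also have "\<dots> = 5 ^ n * R powr (c * \<kappa> / 4)"
   proof -
    have "(1 / \<rho>) ^ n = R powr (c * \<beta> * real n)" unfolding \<rho>_def using Rp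
     by (simp add: powr_minus divide_inverse powr_realpow[symmetric] powr_powr)
    also have "c * \<beta> * real n = c * \<kappa> / 4" unfolding \<beta>_def using n1 by simp
    finally have "(1 / \<rho>) ^ n = R powr (c * \<kappa> / 4)" .
    moreover have "(5 / \<rho>) ^ n = 5 ^ n * (1 / \<rho>) ^ n" by (simp add: power_divide)
    ultimately show ?thesis by simp
   qed
   also have "\<dots> < R powr (c * \<kappa> / 4) * R powr (c * \<kappa> / 4)" using evR rpos by (intro mult_strict_right_mono) auto
   also have "\<dots> = R powr (c * \<kappa> / 2)" by (simp only: powr_add[symmetric], rule arg_cong[where f = "\<lambda>x. R powr x"], simp)
   finally show False using cZ by simp
  qed
  then obtain z1 z2 where zz: "z1 \<in> Z" "z2 \<in> Z" "z1 \<noteq> z2" "z1 - z2 \<in> vbx (\<lambda>_. \<rho>)" unfolding separated_def by blast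
  define b where "b = z1 - z2"
  have bst: "b \<in> stab (K * K * K)" unfolding b_def using zz Z(1) X(2) by (intro stab_diff) auto
  have blo: "\<sigma> \<le> \<bar>b $ k\<bar>" for k using Z(3)[OF zz(1-3), of k] unfolding b_def by simp
  have bhi: "\<bar>b $ k\<bar> \<le> \<rho>" for k using zz(4) unfolding b_def vbx_def by blast
  \<comment> \<open>A strip of half-width \<open>1 / D\<close> has weight at most
    \<open>K * D powr (- \<kappa>) = 1 / (2 * K)\<close>, less than the weight of
    \<open>X\<close>.\<close>
  define D where "D = (2 * K\<^sup>2) powr (1 / \<kappa>)"
  have Dk: "D powr \<kappa> = 2 * K\<^sup>2" unfolding D_def using kap Kpos by (simp add: powr_powr)
  have D1: "D \<ge> 1"
  proof -
   have "1 \<le> K\<^sup>2" using K_ge_1 by (simp add: one_le_power)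
   thus ?thesis unfolding D_def using kap by (intro ge_one_powr_ge_zero) auto
  qed
  have K2: "2 * K ^ 2 \<le> R powr \<kappa>"
  proof -
   have "2 * K ^ 2 \<le> R powr (\<kappa> / 2) * R powr (\<epsilon> * real 2)" using evR Kpow[of 2] by (intro mult_mono) auto
   also have "\<dots> = R powr (\<kappa> / 2 + \<epsilon> * real 2)" by (simp add: powr_add)
   also have "\<dots> \<le> R powr \<kappa>"
   proof (rule rle)
    have "c * \<kappa> \<le> 1 * \<kappa>" using c1 kap by (intro mult_right_mono) auto
    thus "\<kappa> / 2 + \<epsilon> * real 2 \<le> \<kappa>" using ep1 kap(1) unfolding of_nat_numeral by linarith
   qed
   finally show ?thesis .
  qed
  have DR: "D \<le> R"
  proof -
   have "D \<le> (R powr \<kappa>) powr (1 / \<kappa>)" unfolding D_def using K2 kap by (intro powr_mono2) auto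
   thus ?thesis using kap Rp by (simp add: powr_powr)
  qed
  have basis_strip: "\<exists>x\<in>X. \<bar>v \<bullet> x\<bar> > 1 / D" if v: "norm v = 1" for v
  proof (rule ccontr)
   assume "\<not> ?thesis"
   hence "{x \<in> X. \<bar>v \<bullet> x - 0\<bar> \<le> 1 / D} = X" by (auto simp: not_less)
   moreover have "1 / R \<le> 1 / D" using DR D1 by (intro divide_left_mono) auto
   ultimately have "(\<Sum>x\<in>X. w x) \<le> K * (1 / D) powr \<kappa>" using Xs[rule_format, OF v, of "1 / D" 0] by simp
   also have "(1 / D) powr \<kappa> = 1 / (2 * K\<^sup>2)" using D1 Dk by (simp add: powr_divide)
   also have "K * (1 / (2 * K\<^sup>2)) < 1 / K" using Kpos by (simp add: power2_eq_square field_simps)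
   finally show False using X(5) by simp
  qed
  have Dpos: "D > 0" using D1 by linarith
  obtain v \<phi> :: "'n \<Rightarrow> real^'n" where v: "\<And>i. v i \<in> X" "\<And>x. x = (\<Sum>i\<in>UNIV. (\<phi> i \<bullet> x) *\<^sub>R v i)" "\<And>i. norm (\<phi> i) \<le> D"
   using spread_basis[OF X(1) Dpos basis_strip] by metis
  \<comment> \<open>If all coordinates of \<open>y\<close> are in [0, \<eta>], the coefficients
    \<open>\<phi> i \<bullet> y\<close> are at most \<open>D * n * \<eta> = 1 / 2\<close>, the range
    allowed in \<open>stab_dense\<close>.\<close>
  define \<eta> where "\<eta> = 1 / (2 * real n * D)"
  have nD: "2 * real n * D \<ge> 1"
  proof -
   have "1 * 1 \<le> (2 * real n) * D" using n1 D1 by (intro mult_mono) auto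
   thus ?thesis by simp
  qed
  have eta: "0 < \<eta>" "\<eta> \<le> 1" unfolding \<eta>_def using nD n1 Dpos by auto
  have big: "real (card Z) ^ J > (2 * (real J * (4 * real CARD('n) + 4)) / \<sigma>\<^sup>2 + 1) ^ CARD('n)"
  proof -
   have s2: "\<sigma>\<^sup>2 > 0" "\<sigma>\<^sup>2 \<le> 1" using sg by (auto simp: power_le_one)
   have "(2 * (real J * (4 * real n + 4)) / \<sigma>\<^sup>2 + 1) ^ n \<le> (CJ / \<sigma>\<^sup>2) ^ n"
   proof (rule power_mono)
    have "1 \<le> 1 / \<sigma>\<^sup>2" using s2 by simp
    moreover have "CJ / \<sigma>\<^sup>2 = 2 * (real J * (4 * real n + 4)) / \<sigma>\<^sup>2 + 1 / \<sigma>\<^sup>2" unfolding CJ_def by (rule add_divide_distrib)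
    ultimately show "2 * (real J * (4 * real n + 4)) / \<sigma>\<^sup>2 + 1 \<le> CJ / \<sigma>\<^sup>2" by linarith
   qed (use s2 in simp)
   also have "\<dots> = CJ ^ n * R powr (2 * c * real n)"
   proof -
    have "\<sigma>\<^sup>2 = R powr (- (2 * c))" unfolding sigR power2_eq_square by (simp add: powr_add[symmetric])
    hence "1 / \<sigma>\<^sup>2 = R powr (2 * c)" by (simp add: powr_minus divide_inverse)
    hence "(1 / \<sigma>\<^sup>2) ^ n = (R powr (2 * c)) ^ n" by simp
    also have "\<dots> = R powr (2 * c * real n)" using Rp by (simp add: powr_realpow[symmetric] powr_powr)
    finally have "(1 / \<sigma>\<^sup>2) ^ n = R powr (2 * c * real n)" .
    moreover have "(CJ / \<sigma>\<^sup>2) ^ n = CJ ^ n * (1 / \<sigma>\<^sup>2) ^ n" by (simp add: power_divide)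
    ultimately show ?thesis by simp
   qed
   also have "\<dots> < R powr c * R powr (2 * c * real n)" using evR rpos by (intro mult_strict_right_mono) auto
   also have "\<dots> = R powr (c + 2 * c * real n)" by (simp add: powr_add)
   also have "\<dots> \<le> R powr (c * \<kappa> / 2 * real J)"
   proof (rule rle)
    have "real J \<ge> (4 * real n + 2) / \<kappa>" unfolding J_def by linarith
    hence "real J * \<kappa> \<ge> 4 * real n + 2" using kap by (simp add: pos_divide_le_eq)
    hence "c * (4 * real n + 2) \<le> c * (real J * \<kappa>)" using c0 by (intro mult_left_mono) auto
    thus "c + 2 * c * real n \<le> c * \<kappa> / 2 * real J" by (simp add: algebra_simps)
   qed
   also have "\<dots> = (R powr (c * \<kappa> / 2)) ^ J" using Rp by (simp add: powr_realpow[symmetric] powr_powr)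
   also have "\<dots> \<le> real (card Z) ^ J" using cZ Rp by (intro power_mono) auto
   finally show ?thesis unfolding n_def .
  qed
  have cZ2: "card Z \<ge> 2" using zz finZ by (metis card_2_iff card_mono empty_subsetI insert_subset)
  have T: "\<exists>t\<in>stab (l ^ e). t - y \<in> vbx (\<lambda>_. 6 * \<sigma>)" if y: "\<And>k. 0 \<le> y $ k \<and> y $ k \<le> \<eta>" for y
  proof -
   have cb: "\<bar>\<phi> i \<bullet> y\<bar> \<le> 1 / 2" for i
   proof -
    have "norm y \<le> (\<Sum>k\<in>UNIV. \<bar>y $ k\<bar>)" by (rule norm_le_l1_cart)
    also have "\<dots> \<le> (\<Sum>k\<in>(UNIV::'n set). \<eta>)" using y by (intro sum_mono) auto
    also have "\<dots> = real n * \<eta>" unfolding n_def by simp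
    finally have "norm (\<phi> i) * norm y \<le> D * (real n * \<eta>)" using v(3)[of i] Dpos by (intro mult_mono) auto
    also have "\<dots> = 1 / 2" unfolding \<eta>_def using n1 Dpos by simp
    finally show ?thesis using Cauchy_Schwarz_ineq2[of "\<phi> i" y] by linarith
   qed
   have "\<exists>t\<in>stab (l ^ (4 * gexp CARD('n) J + 15 + 4 * CARD('n))). t - (\<Sum>i\<in>UNIV. (\<phi> i \<bullet> y) *\<^sub>R v i) \<in> vbx (\<lambda>_. 6 * \<sigma>)"
   proof (rule stab_dense[OF Kl l3 \<sigma>_def _ finZ cZ2 _ _ _ _ big cb])
    show "Z \<subseteq> stab l" using Z(1) XK by blast
    show "Z \<subseteq> vbx (\<lambda>_. 2)" using Z(1) X(3) by blast
    show "\<bar>(z - z') $ i\<bar> \<ge> \<sigma>" if "z \<in> Z" "z' \<in> Z" "z \<noteq> z'" for z z' i using Z(3)[OF that, of i] by simp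
    show "v i \<in> stab l" for i using v(1) XK by blast
    show "v i \<in> vbx (\<lambda>_. 2)" for i using v(1) X(3) by blast
   qed
   thus ?thesis unfolding e_def n_def using v(2)[of y] by simp
  qed
  define \<theta> where "\<theta> = R powr (- g)"
  have th: "0 < \<theta>" "\<theta> \<le> 1" unfolding \<theta>_def using Rp rle[of "- g" 0] g0 by auto
  have thR: "1 / R \<le> \<theta>"
  proof -
   have "R powr (- 1) \<le> R powr (- g)" using g1 by (intro rle) simp
   thus ?thesis unfolding \<theta>_def using Rp by (simp add: powr_minus_divide)
  qed
  define MA where "MA = nat \<lceil>R powr (g * \<kappa> / 2)\<rceil>"
  have epg: "\<epsilon> \<le> g * \<kappa> / 8"
  proof -
   have "g * \<kappa> / (4 * (6 * real m + 2)) \<le> g * \<kappa> / 8" using g0 kap m1 by (intro divide_left_mono) auto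
   thus ?thesis using ep2 by linarith
  qed
  have strA: "(\<Sum>x\<in>{x \<in> A. \<bar>x $ k - a\<bar> \<le> \<theta> * R}. u x) \<le> K * (R powr (- g)) powr \<kappa>" for k a
   using As[rule_format, OF thR] unfolding \<theta>_def .
  have MAok: "real MA * (real CARD('n) * (K * (R powr (- g)) powr \<kappa>)) < (\<Sum>x\<in>A. u x)"
   using spread_ok[of g] g0 epg evR A(4) unfolding MA_def by linarith
  obtain ZA where ZA: "ZA \<subseteq> A" "card ZA = MA" "\<And>z z' k. z \<in> ZA \<Longrightarrow> z' \<in> ZA \<Longrightarrow> z \<noteq> z' \<Longrightarrow> \<bar>(z - z') $ k\<bar> > \<theta> * R"
   by (rule greedy_spread[OF A(1) A(3)[rule_format] _ _ strA MAok]) (use Kpos th Rp in auto)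
  have finZA: "finite ZA" using ZA(1) A(1) by (rule finite_subset)
  obtain y E' where E': "E' \<subseteq> ZA" "\<And>x. x \<in> E' \<Longrightarrow> x - y \<in> H" "real (card ZA) \<le> K * real (card E')"
   using covers_pigeonhole[OF A(2) finZA ZA(1)] by metis
  have MA1: "real MA \<ge> R powr (g * \<kappa> / 2)" unfolding MA_def by (rule real_nat_ceiling_ge)
  have MApos: "real MA > 0" using MA1 rpos[of "g * \<kappa> / 2"] by linarith
  have "E' \<noteq> {}" using E'(3) ZA(2) MApos by auto
  then obtain e0 where e0: "e0 \<in> E'" by blast
  \<comment> \<open>As in \<open>contracted_copies\<close>, the part of \<open>ZA\<close> in the
    fullest translate of \<open>H\<close> is moved into \<open>H + H\<close>.\<close>
  define Z0 where "Z0 = (\<lambda>x. x - e0) ` E'"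
  have finE: "finite E'" using E'(1) finZA by (rule finite_subset)
  have cZ0: "card Z0 = card E'" unfolding Z0_def by (intro card_image) (auto simp: inj_on_def)
  have Z0: "finite Z0" "Z0 \<subseteq> sumset H H" "Z0 \<noteq> {}" "\<And>z z' k. z \<in> Z0 \<Longrightarrow> z' \<in> Z0 \<Longrightarrow> z \<noteq> z' \<Longrightarrow> \<bar>(z - z') $ k\<bar> \<ge> \<theta> * R"
  proof -
   show "finite Z0" "Z0 \<noteq> {}" unfolding Z0_def using finE e0 by auto
   show "Z0 \<subseteq> sumset H H" unfolding Z0_def
   proof clarify
    fix x assume "x \<in> E'"
    from sumsetI[OF E'(2)[OF this] symm[OF E'(2)[OF e0]]] show "x - e0 \<in> sumset H H" by simp
   qed
   fix z z' k assume "z \<in> Z0" "z' \<in> Z0" "z \<noteq> z'"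
   then obtain x x' where x: "x \<in> E'" "x' \<in> E'" "z = x - e0" "z' = x' - e0" "x \<noteq> x'" unfolding Z0_def by auto
   have "\<bar>(x - x') $ k\<bar> > \<theta> * R" using x(1,2) E'(1) by (intro ZA(3) x(5)) auto
   thus "\<bar>(z - z') $ k\<bar> \<ge> \<theta> * R" unfolding x(3,4) by simp
  qed
  define C3 where "C3 = (real m + 1) * ((4 * C1 + 97) / \<eta>) ^ CARD('n)"
  obtain ne where first: "(real (card Z0) / ((K * K * K) ^ (2 * m) * K)) ^ ne \<le> C3 ^ m * (K ^ (3 * 2 ^ m) * l ^ e) * 5 ^ CARD('n)"
   and second: "R ^ CARD('n) * (\<theta> ^ CARD('n) / real (card Z0)) ^ m * \<sigma> ^ (CARD('n) * ne) \<le> (2 * C1 + 1) ^ (CARD('n) * m) * (K ^ (2 ^ m) * R powr (real CARD('n) - \<gamma>))"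
  proof (rule windows[OF R1 sg bst _ blo bhi rho(2,3) Z0 th eta T _ C1_def C3_def])
   have "1 * 1 * 1 \<le> K * K * K" using K_ge_1 by (intro mult_mono) auto
   thus "1 \<le> K * K * K" by simp
   show "real (card E) \<le> R powr (real CARD('n) - \<gamma>)" if "E \<subseteq> H" "finite E" "separated (\<lambda>_. 1) E" for E
    using PH that by blast
  qed
  have base: "R powr (g * \<kappa> / 4) \<le> real (card Z0) / ((K * K * K) ^ (2 * m) * K)"
  proof -
   have "(K * K * K) ^ (2 * m) * K * K = K ^ (6 * m + 2)"
   proof -
    have "K * K * K = K ^ 3" by (simp add: power3_eq_cube)
    hence "(K * K * K) ^ (2 * m) = K ^ (6 * m)" by (simp add: power_mult[symmetric])
    thus ?thesis by (simp add: power_add power2_eq_square)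
   qed
   also have "\<dots> \<le> R powr (\<epsilon> * real (6 * m + 2))" by (rule Kpow)
   also have "\<dots> \<le> R powr (g * \<kappa> / 4)"
   proof (rule rle)
    have "\<epsilon> * (6 * real m + 2) \<le> g * \<kappa> / (4 * (6 * real m + 2)) * (6 * real m + 2)" using ep2 by (intro mult_right_mono) auto
    also have "\<dots> = g * \<kappa> / 4"
    proof -
     have *: "a / (4 * b) * b = a / 4" if "b \<noteq> 0" for a b :: real using that by simp
     show ?thesis by (rule *) (use m1 in linarith)
    qed
    finally have "\<epsilon> * (6 * real m + 2) \<le> g * \<kappa> / 4" .
    moreover have "real (6 * m + 2) = 6 * real m + 2" by simp
    ultimately show "\<epsilon> * real (6 * m + 2) \<le> g * \<kappa> / 4" by (simp only:)
   qed
   finally have "R powr (g * \<kappa> / 4) * ((K * K * K) ^ (2 * m) * K * K) \<le> R powr (g * \<kappa> / 4) * R powr (g * \<kappa> / 4)"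
    by (intro mult_left_mono) auto
   also have "\<dots> = R powr (g * \<kappa> / 2)" by (simp only: powr_add[symmetric], rule arg_cong[where f = "\<lambda>x. R powr x"], simp)
   also have "\<dots> \<le> K * real (card Z0)" using MA1 E'(3) ZA(2) cZ0 by simp
   finally have "(R powr (g * \<kappa> / 4) * ((K * K * K) ^ (2 * m) * K)) * K \<le> real (card Z0) * K" by (simp add: mult_ac)
   hence "R powr (g * \<kappa> / 4) * ((K * K * K) ^ (2 * m) * K) \<le> real (card Z0)" using Kpos by (simp only: mult_le_cancel_right_pos)
   thus ?thesis using Kpos by (simp add: pos_le_divide_eq)
  qed
  have rhs: "C3 ^ m * (K ^ (3 * 2 ^ m) * l ^ e) * 5 ^ CARD('n) \<le> R powr (2 * c * real e)"
  proof -
   have C3e: "C3 ^ m = ((real m + 1) * ((4 * C1 + 97) * (2 * real n)) ^ n) ^ m * D ^ (n * m)"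
   proof -
    have "(4 * C1 + 97) / \<eta> = (4 * C1 + 97) * (2 * real n) * D" unfolding \<eta>_def by simp
    thus ?thesis unfolding C3_def n_def by (simp add: power_mult_distrib power_mult mult.assoc)
   qed
   have "D ^ (n * m) = 2 powr (real n * real m / \<kappa>) * (K\<^sup>2) powr (real n * real m / \<kappa>)"
   proof -
    have "D ^ (n * m) = D powr (real n * real m)" using Dpos by (simp add: powr_realpow[symmetric])
    also have "\<dots> = (2 * K\<^sup>2) powr (real n * real m / \<kappa>)" unfolding D_def by (simp add: powr_powr)
    also have "\<dots> = 2 powr (real n * real m / \<kappa>) * (K\<^sup>2) powr (real n * real m / \<kappa>)" by (simp add: powr_mult)
    finally show ?thesis .
   qed
   also have "\<dots> \<le> R powr (c * real e / 8) * R powr (c * real e / 8)"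
   proof (intro mult_mono)
    have "(K\<^sup>2) powr (real n * real m / \<kappa>) \<le> (R powr (\<epsilon> * real 2)) powr (real n * real m / \<kappa>)"
     using Kpow[of 2] kap by (intro powr_mono2) auto
    also have "\<dots> = R powr (\<epsilon> * real 2 * (real n * real m / \<kappa>))" by (simp add: powr_powr)
    also have "\<dots> \<le> R powr (c * real e / 8)"
    proof (rule rle)
     have "\<epsilon> * (real 2 * (real n * real m / \<kappa>)) \<le> c * real e * \<kappa> / (16 * real n * real m) * (real 2 * (real n * real m / \<kappa>))"
      using ep3 kap by (intro mult_right_mono) auto
     also have "\<dots> = c * real e / 8" using n1 m1 kap by simp
     finally show "\<epsilon> * real 2 * (real n * real m / \<kappa>) \<le> c * real e / 8" by (simp add: mult.assoc)
    qed
    finally show "(K\<^sup>2) powr (real n * real m / \<kappa>) \<le> R powr (c * real e / 8)" .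
   qed (use evR in auto)
   also have "\<dots> = R powr (c * real e / 4)" by (simp only: powr_add[symmetric], rule arg_cong[where f = "\<lambda>x. R powr x"], simp)
   finally have Dn: "D ^ (n * m) \<le> R powr (c * real e / 4)" .
   have "K ^ (3 * 2 ^ m) \<le> R powr (\<epsilon> * real (3 * 2 ^ m))" by (rule Kpow)
   also have "\<dots> \<le> R powr (c * real e / 4)"
   proof (rule rle)
    have "\<epsilon> * (3 * 2 ^ m) \<le> c * real e / (12 * 2 ^ m) * (3 * 2 ^ m)" using ep4 by (intro mult_right_mono) auto
    thus "\<epsilon> * real (3 * 2 ^ m) \<le> c * real e / 4" by simp
   qed
   finally have Kn: "K ^ (3 * 2 ^ m) \<le> R powr (c * real e / 4)" .
   have le: "l ^ e = R powr (c * real e)" unfolding l_def using Rp by (simp add: powr_realpow[symmetric] powr_powr)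
   have "C3 ^ m * (K ^ (3 * 2 ^ m) * l ^ e) * 5 ^ CARD('n)
    \<le> (R powr (c * real e / 4) * R powr (c * real e / 4)) * (R powr (c * real e / 4) * R powr (c * real e)) * R powr (c * real e / 4)"
    unfolding C3e le using evR Dn Kn Kpos Dpos unfolding n_def[symmetric]
    by (intro mult_mono mult_nonneg_nonneg) (auto simp: C1_def)
   also have "\<dots> = R powr (2 * c * real e)" by (simp only: powr_add[symmetric], rule arg_cong[where f = "\<lambda>x. R powr x"], simp)
   finally show ?thesis .
  qed
  \<comment> \<open>Comparing exponents in the first conclusion of \<open>windows\<close> bounds the
    number \<open>ne\<close> of exceptional scales.\<close>
  have "R powr (g * \<kappa> / 4 * real ne) = (R powr (g * \<kappa> / 4)) ^ ne" using Rp by (simp add: powr_realpow[symmetric] powr_powr)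
  also have "\<dots> \<le> (real (card Z0) / ((K * K * K) ^ (2 * m) * K)) ^ ne" using base by (intro power_mono) auto
  also have "\<dots> \<le> R powr (2 * c * real e)" using first rhs by linarith
  finally have exps: "R powr (g * \<kappa> / 4 * real ne) \<le> R powr (2 * c * real e)" .
  have Rgt: "R > 1"
  proof (rule ccontr)
   assume "\<not> R > 1" hence "R = 1" using R1 by simp
   thus False using evR by simp
  qed
  have nele: "g * \<kappa> / 4 * real ne \<le> 2 * c * real e" using exps Rgt by (simp add: powr_le_cancel_iff)
  have cZ0hi: "real (card Z0) \<le> R powr g"
  proof -
   have "card Z0 \<le> MA" unfolding cZ0 using card_mono[OF finZA E'(1)] ZA(2) by simp
   hence "real (card Z0) \<le> real MA" by simp
   also have "\<dots> \<le> 2 * R powr (g * \<kappa> / 2)" unfolding MA_def using r1[of "g * \<kappa> / 2"] g0 kap by (simp add: of_nat_nat) linarith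
   also have "\<dots> \<le> R powr (g / 2) * R powr (g / 2)"
   proof (intro mult_mono)
    have "g * \<kappa> \<le> g * 1" using g0 kap by (intro mult_left_mono) auto
    thus "R powr (g * \<kappa> / 2) \<le> R powr (g / 2)" by (intro rle) simp
   qed (use evR in auto)
   also have "\<dots> = R powr g" by (simp only: powr_add[symmetric], rule arg_cong[where f = "\<lambda>x. R powr x"], simp)
   finally show ?thesis .
  qed
  have cZ0pos: "real (card Z0) > 0" using Z0(1,3) by (simp add: card_gt_0_iff)
  \<comment> \<open>Exponents in the second conclusion: the left side loses
    \<open>\<gamma> / 8\<close> from the full scales and \<open>\<gamma> / 8\<close> from the
    exceptional ones, the right side is \<open>n - \<gamma>\<close> plus twice
    \<open>\<gamma> / 8\<close>, and \<open>n - \<gamma> / 4\<close> exceeds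
    \<open>n - 3 / 4 * \<gamma>\<close>.\<close>
  have "R powr (real n) * R powr (- (g * (real n + 1) * real m)) * R powr (- (c * (real n * real ne)))
    \<le> R ^ CARD('n) * (\<theta> ^ CARD('n) / real (card Z0)) ^ m * \<sigma> ^ (CARD('n) * ne)"
  proof (intro mult_mono)
   show "R powr (real n) \<le> R ^ CARD('n)" unfolding n_def using Rp by (simp add: powr_realpow)
   have "\<theta> ^ n = R powr (- (g * real n))" unfolding \<theta>_def using Rp by (simp add: powr_realpow[symmetric] powr_powr)
   moreover have "- (g * (real n + 1)) = - (g * real n) - g" by (simp add: distrib_left)
   ultimately have "R powr (- (g * (real n + 1))) = \<theta> ^ n / R powr g" by (simp only: powr_diff)
   also have "\<dots> \<le> \<theta> ^ n / real (card Z0)"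
    using cZ0hi cZ0pos th Rp by (intro divide_left_mono mult_pos_pos) auto
   finally have "(R powr (- (g * (real n + 1)))) ^ m \<le> (\<theta> ^ CARD('n) / real (card Z0)) ^ m"
    unfolding n_def[symmetric] by (intro power_mono) auto
   moreover have "(R powr (- (g * (real n + 1)))) ^ m = R powr (- (g * (real n + 1) * real m))"
    using Rp by (simp add: powr_realpow[symmetric] powr_powr)
   ultimately show "R powr (- (g * (real n + 1) * real m)) \<le> (\<theta> ^ CARD('n) / real (card Z0)) ^ m" by simp
   show "R powr (- (c * (real n * real ne))) \<le> \<sigma> ^ (CARD('n) * ne)"
    unfolding sigR n_def using Rp by (simp add: powr_realpow[symmetric] powr_powr)
  qed (use Rp th sg in auto)
  also have "\<dots> \<le> (2 * C1 + 1) ^ (CARD('n) * m) * (K ^ (2 ^ m) * R powr (real CARD('n) - \<gamma>))" by (rule second)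
  also have "\<dots> \<le> R powr (\<gamma> / 8) * (R powr (\<gamma> / 8) * R powr (real n - \<gamma>))"
  proof (intro mult_mono)
   have "K ^ (2 ^ m) \<le> R powr (\<epsilon> * real (2 ^ m))" by (rule Kpow)
   also have "\<dots> \<le> R powr (\<gamma> / 8)"
   proof (rule rle)
    have "\<epsilon> * 2 ^ m \<le> \<gamma> / (8 * 2 ^ m) * 2 ^ m" using ep5 by (intro mult_right_mono) auto
    thus "\<epsilon> * real (2 ^ m) \<le> \<gamma> / 8" by simp
   qed
   finally show "K ^ (2 ^ m) \<le> R powr (\<gamma> / 8)" .
  qed (use evR Kpos in \<open>auto simp: n_def C1_def\<close>)
  finally have "R powr (real n - g * (real n + 1) * real m - c * (real n * real ne)) \<le> R powr (real n - 3 / 4 * \<gamma>)"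
   by (simp add: powr_add[symmetric] algebra_simps)
  hence fin: "real n - g * (real n + 1) * real m - c * (real n * real ne) \<le> real n - 3 / 4 * \<gamma>"
   using Rgt by (simp only: powr_le_cancel_iff)
  have "g * (real n + 1) * real m = \<gamma> / 8"
  proof -
   have *: "\<gamma> / (8 * a * b) * a * b = \<gamma> / 8" if "a \<noteq> 0" "b \<noteq> 0" for a b :: real using that by simp
   show ?thesis unfolding g_def by (rule *) (use m1 in auto)
  qed
  moreover have "c * (real n * real ne) \<le> \<gamma> / 8"
  proof -
   have gk: "g * \<kappa> > 0" using g0 kap by simp
   have "real ne \<le> 8 * c * real e / (g * \<kappa>)" using nele gk by (simp add: pos_le_divide_eq algebra_simps)
   hence "c * (real n * real ne) \<le> c * (real n * (8 * c * real e / (g * \<kappa>)))" using c0 by (intro mult_left_mono) auto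
   also have "\<dots> = 64 * real n * (real n + 1) * real e / (\<beta>\<^sup>2 * \<gamma> * \<kappa>) / real m"
    unfolding c_def g_def using m1 bet gam kap by (simp add: field_simps power2_eq_square)
   also have "\<dots> \<le> \<gamma> / 8"
   proof -
    have "512 * real n * (real n + 1) * real e / (\<beta>\<^sup>2 * \<gamma>\<^sup>2 * \<kappa>) * \<gamma> \<le> real m * \<gamma>" using mbig gam by (intro mult_right_mono) auto
    moreover have "512 * real n * (real n + 1) * real e / (\<beta>\<^sup>2 * \<gamma>\<^sup>2 * \<kappa>) * \<gamma> = 8 * (64 * real n * (real n + 1) * real e / (\<beta>\<^sup>2 * \<gamma> * \<kappa>))"
     using gam by (simp add: power2_eq_square)
    moreover have "x \<le> \<gamma> / 8 * real m" if "y \<le> real m * \<gamma>" "y = 8 * x" for x y using that by (simp add: mult.commute)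
    ultimately have "64 * real n * (real n + 1) * real e / (\<beta>\<^sup>2 * \<gamma> * \<kappa>) \<le> \<gamma> / 8 * real m" by blast
    thus ?thesis using m1 by (subst pos_divide_le_eq) auto
   qed
   finally show ?thesis .
  qed
  ultimately show False using fin gam by linarith
 qed
qed

section \<open>Collision probabilities\<close>

definition mass :: "'i set \<Rightarrow> ('i \<Rightarrow> real) \<Rightarrow> ('i \<Rightarrow> 'b) \<Rightarrow> 'b \<Rightarrow> real" where
 "mass I w f c = (\<Sum>i\<in>{i \<in> I. f i = c}. w i)"

text \<open>Squared l^2 norm of the image law: for a probability weight, the probability that two
  independent samples have the same value of \<open>f\<close>. Keeping \<open>I\<close>,
  \<open>w\<close> and \<open>f\<close> apart makes it easy to change \<open>f\<close> or to
  restrict \<open>I\<close>.\<close>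

definition coll :: "'i set \<Rightarrow> ('i \<Rightarrow> real) \<Rightarrow> ('i \<Rightarrow> 'b) \<Rightarrow> real" where
 "coll I w f = (\<Sum>c\<in>f ` I. (mass I w f c)\<^sup>2)"

lemma mass_nonneg: "(\<And>i. i \<in> I \<Longrightarrow> w i \<ge> 0) \<Longrightarrow> mass I w f c \<ge> 0"
 unfolding mass_def by (intro sum_nonneg) auto

lemma mass_eq_0: "c \<notin> f ` I \<Longrightarrow> mass I w f c = 0"
proof -
 assume "c \<notin> f ` I"
 hence "{i \<in> I. f i = c} = {}" by blast
 thus ?thesis unfolding mass_def by (simp only: sum.empty)
qed

lemma mass_mono: "finite J \<Longrightarrow> I \<subseteq> J \<Longrightarrow> (\<And>i. i \<in> J \<Longrightarrow> w i \<ge> 0) \<Longrightarrow> mass I w f c \<le> mass J w f c"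
 unfolding mass_def by (intro sum_mono2) auto

lemma sum_mass_mult:
 assumes "finite I" "finite C" "f ` I \<subseteq> C"
 shows "(\<Sum>c\<in>C. mass I w f c * g c) = (\<Sum>i\<in>I. w i * g (f i))"
proof -
 have "(\<Sum>i\<in>I. w i * g (f i)) = (\<Sum>c\<in>C. \<Sum>i\<in>{i \<in> I. f i = c}. w i * g (f i))"
  by (rule sum.group[OF assms, symmetric])
 also have "\<dots> = (\<Sum>c\<in>C. mass I w f c * g c)"
  unfolding mass_def sum_distrib_right by (intro sum.cong refl) auto
 finally show ?thesis by simp
qed

lemma sum_mass:
 assumes "finite I" "finite C"
 shows "(\<Sum>c\<in>C. mass I w f c) = (\<Sum>i\<in>{i \<in> I. f i \<in> C}. w i)"
proof -
 have "(\<Sum>i\<in>{i \<in> I. f i \<in> C}. w i) = (\<Sum>c\<in>C. \<Sum>i\<in>{i \<in> {i \<in> I. f i \<in> C}. f i = c}. w i)"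
  using assms by (intro sum.group[symmetric]) auto
 also have "\<dots> = (\<Sum>c\<in>C. mass I w f c)"
  unfolding mass_def by (intro sum.cong refl) auto
 finally show ?thesis by simp
qed

lemma coll_superset: "finite C \<Longrightarrow> f ` I \<subseteq> C \<Longrightarrow> coll I w f = (\<Sum>c\<in>C. (mass I w f c)\<^sup>2)"
 unfolding coll_def by (intro sum.mono_neutral_left) (auto simp: mass_eq_0)

lemma coll_nonneg: "coll I w f \<ge> 0"
 unfolding coll_def by (intro sum_nonneg) auto

lemma coll_eq_sum: "finite I \<Longrightarrow> coll I w f = (\<Sum>i\<in>I. w i * mass I w f (f i))"
 unfolding coll_def power2_eq_square by (rule sum_mass_mult) auto

lemma coll_mono:
 assumes "finite J" "I \<subseteq> J" "\<And>i. i \<in> J \<Longrightarrow> w i \<ge> 0" shows "coll I w f \<le> coll J w f"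
proof -
 have fI: "finite I" using assms(1,2) finite_subset by blast
 have "coll I w f = (\<Sum>c\<in>f ` J. (mass I w f c)\<^sup>2)" using assms by (intro coll_superset) auto
 also have "\<dots> \<le> coll J w f" unfolding coll_def using assms
  by (intro sum_mono power_mono mass_mono mass_nonneg) auto
 finally show ?thesis .
qed

text \<open>Cauchy-Schwarz over the at most \<open>m\<close> values of \<open>g\<close> in a fibre
  of \<open>f\<close>; then one factor of each joint mass squared is bounded by the mass of the
  fibre of \<open>g\<close>. Roundings to unit cells are compared through this lemma.\<close>

lemma coll_fiber:
 assumes fin: "finite I" and w: "\<And>i. i \<in> I \<Longrightarrow> w i \<ge> 0"
  and fib: "\<And>c. real (card (g ` {i \<in> I. f i = c})) \<le> m"
 shows "coll I w f \<le> m * coll I w g"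
proof -
 define P where "P c d = mass I w (\<lambda>i. (f i, g i)) (c, d)" for c d
 have P0: "P c d \<ge> 0" for c d unfolding P_def using w by (rule mass_nonneg)
 have m0: "m \<ge> 0" using fib[of undefined] of_nat_0_le_iff[of "card (g ` {i \<in> I. f i = undefined})", where 'a = real] by linarith
 have Pg: "(\<Sum>c\<in>f ` I. P c d) = mass I w g d" for d
 proof -
  have "(\<Sum>c\<in>f ` I. \<Sum>i\<in>{i \<in> {i \<in> I. g i = d}. f i = c}. w i) = (\<Sum>i\<in>{i \<in> I. g i = d}. w i)"
   using fin by (intro sum.group) auto
  moreover have "{i \<in> {i \<in> I. g i = d}. f i = c} = {i \<in> I. (f i, g i) = (c, d)}" for c by auto
  ultimately show ?thesis unfolding P_def mass_def by simp
 qed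
 have Pf: "mass I w f c = (\<Sum>d\<in>g ` {i \<in> I. f i = c}. P c d)" for c
 proof -
  have "(\<Sum>d\<in>g ` {i \<in> I. f i = c}. \<Sum>i\<in>{i \<in> {i \<in> I. f i = c}. g i = d}. w i) = (\<Sum>i\<in>{i \<in> I. f i = c}. w i)"
   using fin by (intro sum.group) auto
  moreover have "{i \<in> {i \<in> I. f i = c}. g i = d} = {i \<in> I. (f i, g i) = (c, d)}" for d by auto
  ultimately show ?thesis unfolding P_def mass_def by simp
 qed
 have le: "(mass I w f c)\<^sup>2 \<le> m * (\<Sum>d\<in>g ` I. (P c d)\<^sup>2)" for c
 proof -
  have "(mass I w f c)\<^sup>2 \<le> (\<Sum>d\<in>g ` {i \<in> I. f i = c}. (P c d)\<^sup>2) * real (card (g ` {i \<in> I. f i = c}))"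
   unfolding Pf by (rule sum_squared_le_sum_of_squares)
  also have "\<dots> \<le> (\<Sum>d\<in>g ` I. (P c d)\<^sup>2) * m"
   using fin fib by (intro mult_mono sum_mono2 sum_nonneg) auto
  finally show ?thesis by (simp add: mult.commute)
 qed
 have "coll I w f \<le> (\<Sum>c\<in>f ` I. m * (\<Sum>d\<in>g ` I. (P c d)\<^sup>2))"
  unfolding coll_def by (intro sum_mono le)
 also have "\<dots> = m * (\<Sum>d\<in>g ` I. \<Sum>c\<in>f ` I. (P c d)\<^sup>2)"
  unfolding sum_distrib_left[symmetric] by (subst sum.swap) simp
 also have "\<dots> \<le> m * (\<Sum>d\<in>g ` I. \<Sum>c\<in>f ` I. P c d * mass I w g d)"
 proof (intro mult_left_mono m0 sum_mono)
  fix d c assume c: "c \<in> f ` I"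
  have "P c d \<le> (\<Sum>c\<in>f ` I. P c d)" using fin c by (intro member_le_sum P0) auto
  thus "(P c d)\<^sup>2 \<le> P c d * mass I w g d" unfolding Pg power2_eq_square using P0 by (intro mult_left_mono)
 qed
 also have "\<dots> = m * coll I w g"
  unfolding coll_def sum_distrib_right[symmetric] Pg power2_eq_square ..
 finally show ?thesis .
qed

lemma weighted_Cauchy_Schwarz:
 fixes v x :: "'a \<Rightarrow> real"
 assumes "\<And>a. a \<in> A \<Longrightarrow> v a \<ge> 0"
 shows "(\<Sum>a\<in>A. v a * x a)\<^sup>2 \<le> (\<Sum>a\<in>A. v a) * (\<Sum>a\<in>A. v a * (x a)\<^sup>2)"
proof -
 have "(\<Sum>a\<in>A. sqrt (v a) * (sqrt (v a) * x a))\<^sup>2 \<le> (\<Sum>a\<in>A. (sqrt (v a))\<^sup>2) * (\<Sum>a\<in>A. (sqrt (v a) * x a)\<^sup>2)"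
  by (rule Cauchy_Schwarz_ineq_sum)
 moreover have "(\<Sum>a\<in>A. sqrt (v a) * (sqrt (v a) * x a)) = (\<Sum>a\<in>A. v a * x a)"
  using assms by (intro sum.cong refl) (simp add: mult.assoc[symmetric])
 moreover have "(\<Sum>a\<in>A. (sqrt (v a))\<^sup>2) = (\<Sum>a\<in>A. v a)" using assms by (intro sum.cong refl) simp
 moreover have "(\<Sum>a\<in>A. (sqrt (v a) * x a)\<^sup>2) = (\<Sum>a\<in>A. v a * (x a)\<^sup>2)"
  using assms by (intro sum.cong refl) (simp add: power_mult_distrib)
 ultimately show ?thesis by simp
qed

lemma mass_prod:
 assumes "finite A" "finite B"
 shows "mass (A \<times> B) (\<lambda>(a, b). v a * w b) f c = (\<Sum>a\<in>A. v a * mass B w (\<lambda>b. f (a, b)) c)"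
proof -
 have "{i \<in> A \<times> B. f i = c} = Sigma A (\<lambda>a. {b \<in> B. f (a, b) = c})" by auto
 hence "mass (A \<times> B) (\<lambda>(a, b). v a * w b) f c = (\<Sum>(a, b)\<in>Sigma A (\<lambda>a. {b \<in> B. f (a, b) = c}). v a * w b)"
  unfolding mass_def by simp
 also have "\<dots> = (\<Sum>a\<in>A. \<Sum>b\<in>{b \<in> B. f (a, b) = c}. v a * w b)"
  using assms by (intro sum.Sigma[symmetric]) auto
 finally show ?thesis unfolding mass_def sum_distrib_left .
qed

text \<open>Convexity of the squared l^2 norm: the law on the product is a mixture, with weights
  \<open>v\<close>, of the laws on the slices.\<close>

lemma coll_prod_le:
 assumes fin: "finite A" "finite B" and v: "\<And>a. a \<in> A \<Longrightarrow> v a \<ge> 0"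
 shows "coll (A \<times> B) (\<lambda>(a, b). v a * w b) f \<le> (\<Sum>a\<in>A. v a) * (\<Sum>a\<in>A. v a * coll B w (\<lambda>b. f (a, b)))"
proof -
 define C where "C = f ` (A \<times> B)"
 have fC: "finite C" unfolding C_def using fin by simp
 have c: "coll B w (\<lambda>b. f (a, b)) = (\<Sum>c\<in>C. (mass B w (\<lambda>b. f (a, b)) c)\<^sup>2)" if "a \<in> A" for a
  using that fC by (intro coll_superset) (auto simp: C_def)
 have "coll (A \<times> B) (\<lambda>(a, b). v a * w b) f = (\<Sum>c\<in>C. (\<Sum>a\<in>A. v a * mass B w (\<lambda>b. f (a, b)) c)\<^sup>2)"
  unfolding coll_def C_def[symmetric] mass_prod[OF fin] ..
 also have "\<dots> \<le> (\<Sum>c\<in>C. (\<Sum>a\<in>A. v a) * (\<Sum>a\<in>A. v a * (mass B w (\<lambda>b. f (a, b)) c)\<^sup>2))"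
  using v by (intro sum_mono weighted_Cauchy_Schwarz)
 also have "\<dots> = (\<Sum>a\<in>A. v a) * (\<Sum>a\<in>A. v a * coll B w (\<lambda>b. f (a, b)))"
  unfolding sum_distrib_left[symmetric] by (subst sum.swap) (simp add: c sum_distrib_left)
 finally show ?thesis .
qed

lemma coll_reindex:
 assumes "bij_betw h I' I"
 shows "coll I w f = coll I' (\<lambda>i. w (h i)) (\<lambda>i. f (h i))"
proof -
 have "mass I w f c = mass I' (\<lambda>i. w (h i)) (\<lambda>i. f (h i)) c" for c
 proof -
  have "bij_betw h {i \<in> I'. f (h i) = c} {i \<in> I. f i = c}"
   using assms unfolding bij_betw_def inj_on_def by auto
  from sum.reindex_bij_betw[OF this, of w] show ?thesis unfolding mass_def by simp
 qed
 moreover have "f ` I = (\<lambda>i. f (h i)) ` I'" using assms unfolding bij_betw_def by auto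
 ultimately show ?thesis unfolding coll_def by simp
qed

lemma coll_prod_le_max:
 assumes fin: "finite A" "finite B" and v: "\<And>a. a \<in> A \<Longrightarrow> v a \<ge> 0"
  and le: "\<And>a. a \<in> A \<Longrightarrow> coll B w (\<lambda>b. f (a, b)) \<le> m"
 shows "coll (A \<times> B) (\<lambda>(a, b). v a * w b) f \<le> (\<Sum>a\<in>A. v a)\<^sup>2 * m"
proof -
 have "coll (A \<times> B) (\<lambda>(a, b). v a * w b) f \<le> (\<Sum>a\<in>A. v a) * (\<Sum>a\<in>A. v a * coll B w (\<lambda>b. f (a, b)))"
  using assms by (intro coll_prod_le)
 also have "\<dots> \<le> (\<Sum>a\<in>A. v a) * (\<Sum>a\<in>A. v a * m)"
  using v le by (intro mult_left_mono sum_mono sum_nonneg) auto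
 also have "\<dots> = (\<Sum>a\<in>A. v a)\<^sup>2 * m" by (simp add: sum_distrib_right[symmetric] power2_eq_square)
 finally show ?thesis .
qed

lemma coll_prod_le_max':
 assumes fin: "finite A" "finite B" and w: "\<And>b. b \<in> B \<Longrightarrow> w b \<ge> 0"
  and le: "\<And>b. b \<in> B \<Longrightarrow> coll A v (\<lambda>a. f (a, b)) \<le> m"
 shows "coll (A \<times> B) (\<lambda>(a, b). v a * w b) f \<le> (\<Sum>b\<in>B. w b)\<^sup>2 * m"
proof -
 have "bij_betw prod.swap (B \<times> A) (A \<times> B)" by (rule bij_betw_byWitness[where f' = prod.swap]) auto
 from coll_reindex[OF this, of "\<lambda>(a, b). v a * w b" f]
 have "coll (A \<times> B) (\<lambda>(a, b). v a * w b) f = coll (B \<times> A) (\<lambda>(b, a). w b * v a) (\<lambda>i. f (prod.swap i))"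
 proof -
  have "(\<lambda>i. (\<lambda>(a, b). v a * w b) (prod.swap i)) = (\<lambda>(b, a). w b * v a)" by (auto simp: fun_eq_iff)
  with \<open>coll (A \<times> B) (\<lambda>(a, b). v a * w b) f = _\<close> show ?thesis by (simp only:)
 qed
 also have "\<dots> \<le> (\<Sum>b\<in>B. w b)\<^sup>2 * m" using assms by (intro coll_prod_le_max) auto
 finally show ?thesis .
qed

lemma coll_Un_le:
 assumes "finite I" "finite J" "I \<inter> J = {}"
 shows "coll (I \<union> J) w f \<le> 2 * coll I w f + 2 * coll J w f"
proof -
 let ?C = "f ` (I \<union> J)"
 have mu: "mass (I \<union> J) w f c = mass I w f c + mass J w f c" for c
 proof -
  have "{i \<in> I \<union> J. f i = c} = {i \<in> I. f i = c} \<union> {i \<in> J. f i = c}" by blast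
  thus ?thesis unfolding mass_def using assms by (simp only:) (rule sum.union_disjoint, auto)
 qed
 have "coll (I \<union> J) w f \<le> (\<Sum>c\<in>?C. 2 * (mass I w f c)\<^sup>2 + 2 * (mass J w f c)\<^sup>2)"
  unfolding coll_def mu
 proof (intro sum_mono)
  fix c
  show "(mass I w f c + mass J w f c)\<^sup>2 \<le> 2 * (mass I w f c)\<^sup>2 + 2 * (mass J w f c)\<^sup>2"
   using sum_squares_bound[of "mass I w f c" "mass J w f c"] by (simp add: power2_sum)
 qed
 also have "\<dots> = 2 * coll I w f + 2 * coll J w f"
 proof -
  have "coll I w f = (\<Sum>c\<in>?C. (mass I w f c)\<^sup>2)" using assms by (intro coll_superset) auto
  moreover have "coll J w f = (\<Sum>c\<in>?C. (mass J w f c)\<^sup>2)" using assms by (intro coll_superset) auto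
  ultimately show ?thesis by (simp only: sum.distrib sum_distrib_left[symmetric])
 qed
 finally show ?thesis .
qed

lemma mass_add:
 fixes f :: "'i \<Rightarrow> 'a::ab_group_add"
 assumes "finite I" "finite J"
 shows "mass (I \<times> J) (\<lambda>(i, j). v i * w j) (\<lambda>(i, j). f i + g j) s = (\<Sum>a\<in>f ` I. mass I v f a * mass J w g (s - a))"
proof -
 have "mass (I \<times> J) (\<lambda>(i, j). v i * w j) (\<lambda>(i, j). f i + g j) s = (\<Sum>i\<in>I. v i * mass J w (\<lambda>j. f i + g j) s)"
  using mass_prod[OF assms, of v w "\<lambda>(i, j). f i + g j" s] by simp
 also have "\<dots> = (\<Sum>i\<in>I. v i * mass J w g (s - f i))"
 proof (intro sum.cong refl)
  fix i
  have "{j \<in> J. f i + g j = s} = {j \<in> J. g j = s - f i}" by (auto simp: algebra_simps)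
  thus "v i * mass J w (\<lambda>j. f i + g j) s = v i * mass J w g (s - f i)" unfolding mass_def by simp
 qed
 also have "\<dots> = (\<Sum>a\<in>f ` I. mass I v f a * mass J w g (s - a))"
  using sum_mass_mult[OF assms(1) _ order.refl, of f v "\<lambda>a. mass J w g (s - a)"] assms by simp
 finally show ?thesis .
qed

lemma ex_ge_weighted_average:
 fixes m e :: "'a \<Rightarrow> real"
 assumes "finite T" "\<And>t. t \<in> T \<Longrightarrow> m t \<ge> 0" "(\<Sum>t\<in>T. m t) > 0" "(\<Sum>t\<in>T. m t * e t) \<ge> x * (\<Sum>t\<in>T. m t)"
 obtains t where "t \<in> T" "e t \<ge> x"
proof -
 have "\<exists>t\<in>T. e t \<ge> x"
 proof (rule ccontr)
  assume n: "\<not> ?thesis"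
  have "(\<Sum>t\<in>T. m t * (x - e t)) \<le> 0" using assms(4)
   by (simp add: right_diff_distrib sum_subtractf sum_distrib_right[symmetric] mult.commute[of x])
  moreover have nn: "m t * (x - e t) \<ge> 0" if "t \<in> T" for t using n that assms(2)[OF that] by force
  ultimately have "(\<Sum>t\<in>T. m t * (x - e t)) = 0" using sum_nonneg[of T "\<lambda>t. m t * (x - e t)"] by force
  hence "\<forall>t\<in>T. m t * (x - e t) = 0" using sum_nonneg_eq_0_iff[OF assms(1), of "\<lambda>t. m t * (x - e t)"] nn by blast
  hence "\<forall>t\<in>T. m t = 0" using n by force
  thus False using assms(3) by simp
 qed
 thus thesis using that by blast
qed

text \<open>\<open>h z\<close> is the mass of those \<open>t\<close> whose set contains
  \<open>z\<close>. Its second moment is the sum of the weights of \<open>B t \<inter> B t0\<close>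
  over pairs, and Cauchy-Schwarz bounds it below by the square of the first. A good
  \<open>t0\<close> is fixed, and the \<open>t\<close> whose intersection with it is below
  \<open>\<beta>\<^sup>2 / 2\<close> are discarded.\<close>

lemma popular_intersections:
 fixes m :: "'t \<Rightarrow> real" and \<omega> :: "'z \<Rightarrow> real"
 assumes fin: "finite G" "finite Z" and m: "\<And>t. t \<in> G \<Longrightarrow> m t \<ge> 0" and mG: "(\<Sum>t\<in>G. m t) > 0"
  and om: "\<And>z. z \<in> Z \<Longrightarrow> \<omega> z \<ge> 0" "(\<Sum>z\<in>Z. \<omega> z) \<le> 1"
  and B: "\<And>t. t \<in> G \<Longrightarrow> B t \<subseteq> Z" "\<And>t. t \<in> G \<Longrightarrow> (\<Sum>z\<in>B t. \<omega> z) \<ge> \<beta>" and be: "\<beta> \<ge> 0"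
 obtains t0 X where "t0 \<in> G" "X \<subseteq> G" "(\<Sum>t\<in>X. m t) \<ge> (\<Sum>t\<in>G. m t) * (\<beta>\<^sup>2 / 2)"
  "\<And>t. t \<in> X \<Longrightarrow> (\<Sum>z\<in>B t \<inter> B t0. \<omega> z) \<ge> \<beta>\<^sup>2 / 2"
proof -
 let ?M = "\<Sum>t\<in>G. m t"
 define h where "h z = (\<Sum>t\<in>G. m t * (if z \<in> B t then 1 else 0))" for z
 define \<Phi> where "\<Phi> t0 = (\<Sum>t\<in>G. m t * (\<Sum>z\<in>B t \<inter> B t0. \<omega> z))" for t0
 have restr: "(\<Sum>z\<in>Z. \<omega> z * (if z \<in> Y then 1 else 0)) = (\<Sum>z\<in>Y. \<omega> z)" if "Y \<subseteq> Z" for Y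
 proof -
  have "(\<Sum>z\<in>Z. \<omega> z * (if z \<in> Y then 1 else 0)) = (\<Sum>z\<in>Z. if z \<in> Y then \<omega> z else 0)" by (intro sum.cong) auto
  also have "\<dots> = (\<Sum>z\<in>Z \<inter> Y. \<omega> z)" using fin(2) by (simp add: sum.inter_restrict)
  finally show ?thesis using that by (simp add: Int_absorb1)
 qed
 have "\<beta> * ?M \<le> (\<Sum>t\<in>G. m t * (\<Sum>z\<in>B t. \<omega> z))"
  unfolding sum_distrib_left[of \<beta>] using B(2) m by (intro sum_mono) (simp only: mult.commute[of \<beta>] mult_left_mono)
 also have "\<dots> = (\<Sum>t\<in>G. \<Sum>z\<in>Z. \<omega> z * (m t * (if z \<in> B t then 1 else 0)))"
 proof (intro sum.cong refl)
  fix t assume "t \<in> G"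
  have "m t * (\<Sum>z\<in>B t. \<omega> z) = m t * (\<Sum>z\<in>Z. \<omega> z * (if z \<in> B t then 1 else 0))" using restr[OF B(1)[OF \<open>t \<in> G\<close>]] by simp
  also have "\<dots> = (\<Sum>z\<in>Z. \<omega> z * (m t * (if z \<in> B t then 1 else 0)))" unfolding sum_distrib_left by (intro sum.cong refl) (simp add: ac_simps)
  finally show "m t * (\<Sum>z\<in>B t. \<omega> z) = (\<Sum>z\<in>Z. \<omega> z * (m t * (if z \<in> B t then 1 else 0)))" .
 qed
 also have "\<dots> = (\<Sum>z\<in>Z. \<omega> z * h z)" unfolding h_def sum_distrib_left by (rule sum.swap)
 finally have b: "\<beta> * ?M \<le> (\<Sum>z\<in>Z. \<omega> z * h z)" .
 have h2: "(\<Sum>z\<in>Z. \<omega> z * (h z)\<^sup>2) = (\<Sum>t0\<in>G. m t0 * \<Phi> t0)"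
 proof -
  have "(\<Sum>z\<in>Z. \<omega> z * (h z)\<^sup>2) = (\<Sum>z\<in>Z. \<Sum>t0\<in>G. \<Sum>t\<in>G. m t0 * (m t * (\<omega> z * (if z \<in> B t \<inter> B t0 then 1 else 0))))"
  proof (intro sum.cong refl)
   fix z
   have "\<omega> z * (h z)\<^sup>2 = (\<Sum>t0\<in>G. \<Sum>t\<in>G. \<omega> z * ((m t0 * (if z \<in> B t0 then 1 else 0)) * (m t * (if z \<in> B t then 1 else 0))))"
   proof -
    have "(h z)\<^sup>2 = (\<Sum>t0\<in>G. \<Sum>t\<in>G. (m t0 * (if z \<in> B t0 then 1 else 0)) * (m t * (if z \<in> B t then 1 else 0)))"
     unfolding h_def power2_eq_square by (rule sum_product)
    thus ?thesis by (simp only: sum_distrib_left)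
   qed
   also have "\<dots> = (\<Sum>t0\<in>G. \<Sum>t\<in>G. m t0 * (m t * (\<omega> z * (if z \<in> B t \<inter> B t0 then 1 else 0))))"
    by (intro sum.cong refl) auto
   finally show "\<omega> z * (h z)\<^sup>2 = (\<Sum>t0\<in>G. \<Sum>t\<in>G. m t0 * (m t * (\<omega> z * (if z \<in> B t \<inter> B t0 then 1 else 0))))" .
  qed
  also have "\<dots> = (\<Sum>t0\<in>G. \<Sum>z\<in>Z. \<Sum>t\<in>G. m t0 * (m t * (\<omega> z * (if z \<in> B t \<inter> B t0 then 1 else 0))))" by (rule sum.swap)
  also have "\<dots> = (\<Sum>t0\<in>G. \<Sum>t\<in>G. \<Sum>z\<in>Z. m t0 * (m t * (\<omega> z * (if z \<in> B t \<inter> B t0 then 1 else 0))))"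
   by (intro sum.cong refl sum.swap)
  also have "\<dots> = (\<Sum>t0\<in>G. m t0 * \<Phi> t0)"
  proof (intro sum.cong refl)
   fix t0 assume t0: "t0 \<in> G"
   have e: "(\<Sum>z\<in>Z. m t0 * (m t * (\<omega> z * (if z \<in> B t \<inter> B t0 then 1 else 0)))) = m t0 * (m t * (\<Sum>z\<in>B t \<inter> B t0. \<omega> z))" if "t \<in> G" for t
   proof -
    have "B t \<inter> B t0 \<subseteq> Z" using B(1)[OF that] by blast
    from restr[OF this] show ?thesis by (simp only: sum_distrib_left[symmetric])
   qed
   have "m t0 * \<Phi> t0 = (\<Sum>t\<in>G. m t0 * (m t * (\<Sum>z\<in>B t \<inter> B t0. \<omega> z)))" unfolding \<Phi>_def by (rule sum_distrib_left)
   thus "(\<Sum>t\<in>G. \<Sum>z\<in>Z. m t0 * (m t * (\<omega> z * (if z \<in> B t \<inter> B t0 then 1 else 0)))) = m t0 * \<Phi> t0"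
    by (simp only: e cong: sum.cong)
  qed
  finally show ?thesis .
 qed
 have "(\<beta> * ?M)\<^sup>2 \<le> (\<Sum>z\<in>Z. \<omega> z * h z)\<^sup>2" using b be mG by (intro power_mono) auto
 also have "\<dots> \<le> (\<Sum>z\<in>Z. \<omega> z) * (\<Sum>z\<in>Z. \<omega> z * (h z)\<^sup>2)" using om(1) by (rule weighted_Cauchy_Schwarz)
 also have "\<dots> \<le> 1 * (\<Sum>z\<in>Z. \<omega> z * (h z)\<^sup>2)" using om by (intro mult_right_mono sum_nonneg) auto
 finally have avg: "(\<Sum>t0\<in>G. m t0 * \<Phi> t0) \<ge> (\<beta>\<^sup>2 * ?M) * ?M" unfolding h2 by (simp add: power2_eq_square ac_simps)
 obtain t0 where t0: "t0 \<in> G" "\<Phi> t0 \<ge> \<beta>\<^sup>2 * ?M"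
  by (rule ex_ge_weighted_average[OF fin(1) m mG avg])
 define X where "X = {t \<in> G. (\<Sum>z\<in>B t \<inter> B t0. \<omega> z) \<ge> \<beta>\<^sup>2 / 2}"
 have le1: "(\<Sum>z\<in>B t \<inter> B t0. \<omega> z) \<le> 1" if "t \<in> G" for t
  by (rule order_trans[OF sum_mono2 om(2)]) (use fin om B(1)[OF that] in auto)
 have "\<Phi> t0 \<le> (\<Sum>t\<in>G. (if t \<in> X then m t else 0) + m t * (\<beta>\<^sup>2 / 2))"
  unfolding \<Phi>_def
 proof (intro sum_mono)
  fix t assume t: "t \<in> G"
  have "m t * (\<Sum>z\<in>B t \<inter> B t0. \<omega> z) \<le> m t * 1" using le1[OF t] m[OF t] by (intro mult_left_mono)
  moreover have "m t * (\<beta>\<^sup>2 / 2) \<ge> 0" using m[OF t] by simp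
  moreover have "m t * (\<Sum>z\<in>B t \<inter> B t0. \<omega> z) \<le> m t * (\<beta>\<^sup>2 / 2)" if "t \<notin> X"
   using that t m[OF t] unfolding X_def by (intro mult_left_mono) auto
  ultimately show "m t * (\<Sum>z\<in>B t \<inter> B t0. \<omega> z) \<le> (if t \<in> X then m t else 0) + m t * (\<beta>\<^sup>2 / 2)" by auto
 qed
 also have "\<dots> = (\<Sum>t\<in>X. m t) + ?M * (\<beta>\<^sup>2 / 2)"
 proof -
  have "G \<inter> X = X" unfolding X_def by blast
  thus ?thesis using fin(1) by (simp add: sum.distrib sum_distrib_right sum.inter_restrict[symmetric])
 qed
 finally have "(\<Sum>t\<in>X. m t) \<ge> ?M * (\<beta>\<^sup>2 / 2)" using t0(2) by (simp add: algebra_simps)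
 thus thesis using that[of t0 X] t0(1) unfolding X_def by blast
qed

section \<open>Unit cells under dilation and subtraction\<close>

definition flr :: "real^'n \<Rightarrow> real^'n" where
 "flr y = (\<chi> i. of_int \<lfloor>y $ i\<rfloor>)"

lemma flr_nth [simp]: "flr y $ i = of_int \<lfloor>y $ i\<rfloor>" unfolding flr_def by simp

lemma card_integral_box:
 fixes W :: "(real^'n) set"
 assumes "\<And>x i. x \<in> W \<Longrightarrow> x $ i \<in> of_int ` {a i..<a i + int m}"
 shows "finite W" "card W \<le> m ^ CARD('n)"
proof -
 let ?S = "{x :: int^'n. \<forall>i. x $ i \<in> {a i..<a i + int m}}"
 have sub: "W \<subseteq> (\<lambda>z. \<chi> i. of_int (z $ i)) ` ?S"
 proof
  fix x assume "x \<in> W"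
  hence "\<forall>i. \<exists>z. z \<in> {a i..<a i + int m} \<and> x $ i = of_int z" using assms by blast
  then obtain z where "\<forall>i. z i \<in> {a i..<a i + int m} \<and> x $ i = of_int (z i)" by (auto dest!: choice)
  thus "x \<in> (\<lambda>z. \<chi> i. of_int (z $ i)) ` ?S" by (intro image_eqI[of _ _ "\<chi> i. z i"]) (auto simp: vec_eq_iff)
 qed
 have fS: "finite ?S" by (rule card_vec_PiE) simp
 have "card ?S = (\<Prod>i\<in>UNIV. card {a i..<a i + int m})" by (rule card_vec_PiE) simp
 also have "\<dots> = m ^ CARD('n)" by simp
 finally have cS: "card ?S = m ^ CARD('n)" .
 show "finite W" using sub fS by (meson finite_imageI finite_subset)
 have "card W \<le> card ((\<lambda>z. \<chi> i. of_int (z $ i) :: real^'n) ` ?S)" using sub fS by (intro card_mono) auto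
 also have "\<dots> \<le> m ^ CARD('n)" unfolding cS[symmetric] by (rule card_image_le[OF fS])
 finally show "card W \<le> m ^ CARD('n)" .
qed

text \<open>As the coordinates of \<open>t\<close> are at least 1/2, the preimage of a unit cell has
  sides at most 2 and meets at most 3 cells in each coordinate.\<close>

lemma card_flr_le:
 fixes Y :: "(real^'n) set" and t b c :: "real^'n"
 assumes t: "\<And>i. t $ i \<ge> 1/2" and "\<And>y. y \<in> Y \<Longrightarrow> flr (t * y - b) = c"
 shows "real (card (flr ` Y)) \<le> 3 ^ CARD('n)"
proof -
 have "card (flr ` Y) \<le> 3 ^ CARD('n)"
 proof (rule card_integral_box(2)[where a = "\<lambda>i. \<lfloor>(b $ i + c $ i) / t $ i\<rfloor>"])
  fix x i assume "x \<in> flr ` Y"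
  then obtain y where y: "y \<in> Y" "x = flr y" by blast
  have ti: "t $ i > 0" using t[of i] by simp
  have "of_int \<lfloor>t $ i * y $ i - b $ i\<rfloor> = c $ i" using assms(2)[OF y(1)] by (metis flr_nth vector_minus_component vector_mult_component)
  hence c: "c $ i \<le> t $ i * y $ i - b $ i" "t $ i * y $ i - b $ i < c $ i + 1" by linarith+
  let ?l = "(b $ i + c $ i) / t $ i"
  have l: "?l \<le> y $ i" using c ti by (simp add: divide_le_eq mult.commute)
  have "y $ i < (b $ i + c $ i + 1) / t $ i" using c ti by (simp add: less_divide_eq mult.commute)
  also have "\<dots> = ?l + 1 / t $ i" by (simp add: add_divide_distrib)
  also have "\<dots> \<le> ?l + 2" using t[of i] ti by (simp add: divide_le_eq)
  finally have "\<lfloor>y $ i\<rfloor> \<in> {\<lfloor>?l\<rfloor>..<\<lfloor>?l\<rfloor> + int 3}" using l by simp linarith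
  thus "x $ i \<in> of_int ` {\<lfloor>?l\<rfloor>..<\<lfloor>?l\<rfloor> + int 3}" unfolding y by auto
 qed
 thus ?thesis by (simp only: of_nat_le_iff[symmetric, where 'a = real]) simp
qed

lemma coll_flr_dilate:
 fixes t :: "real^'n"
 assumes "finite S" "\<And>y. y \<in> S \<Longrightarrow> w y \<ge> 0" "\<And>i. t $ i \<ge> 1/2"
 shows "coll S w (\<lambda>y. flr (t * y - b)) \<le> 3 ^ CARD('n) * coll S w flr"
 using assms by (intro coll_fiber card_flr_le[of t _ b]) auto

text \<open>Once the floor of the difference is known, the difference of the floors has two possible
  values in each coordinate. Passing to the latter gives a difference of two independent lattice
  variables, to which additive combinatorics applies.\<close>

lemma coll_flr_diff:
 fixes f g :: "'i \<Rightarrow> real^'n"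
 assumes "finite I" "\<And>i. i \<in> I \<Longrightarrow> w i \<ge> 0"
 shows "coll I w (\<lambda>i. flr (f i - g i)) \<le> 2 ^ CARD('n) * coll I w (\<lambda>i. flr (f i) - flr (g i))"
proof (rule coll_fiber[OF assms])
 fix c :: "real^'n"
 have "card ((\<lambda>i. flr (f i) - flr (g i)) ` {i \<in> I. flr (f i - g i) = c}) \<le> 2 ^ CARD('n)"
 proof (rule card_integral_box(2)[where a = "\<lambda>i. \<lfloor>c $ i\<rfloor>"])
  fix x k assume "x \<in> (\<lambda>i. flr (f i) - flr (g i)) ` {i \<in> I. flr (f i - g i) = c}"
  then obtain i where i: "x = flr (f i) - flr (g i)" "flr (f i - g i) = c" by blast
  have "\<lfloor>c $ k\<rfloor> = \<lfloor>f i $ k - g i $ k\<rfloor>" unfolding i(2)[symmetric] by simp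
  hence "\<lfloor>f i $ k\<rfloor> - \<lfloor>g i $ k\<rfloor> \<in> {\<lfloor>c $ k\<rfloor>..<\<lfloor>c $ k\<rfloor> + int 2}" by simp linarith
  moreover have "x $ k = of_int (\<lfloor>f i $ k\<rfloor> - \<lfloor>g i $ k\<rfloor>)" unfolding i(1) by simp
  ultimately show "x $ k \<in> of_int ` {\<lfloor>c $ k\<rfloor>..<\<lfloor>c $ k\<rfloor> + int 2}" by blast
 qed
 thus "real (card ((\<lambda>i. flr (f i) - flr (g i)) ` {i \<in> I. flr (f i - g i) = c})) \<le> 2 ^ CARD('n)"
  by (simp only: of_nat_le_iff[symmetric, where 'a = real]) simp
qed

lemma sum_mass_image: "finite I \<Longrightarrow> (\<Sum>c\<in>f ` I. mass I w f c) = (\<Sum>i\<in>I. w i)"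
 using sum_mass_mult[of I "f ` I" f w "\<lambda>_. 1"] by simp

definition pw :: "('a \<Rightarrow> real) \<Rightarrow> ('b \<Rightarrow> real) \<Rightarrow> 'a \<times> 'b \<Rightarrow> real" where
 "pw v w = (\<lambda>(a, b). v a * w b)"

text \<open>The arguments are grouped as two multipliers and two points, so that the weight is the
  product of \<open>pw m m\<close> and \<open>pw w w\<close>.\<close>

definition dilate_diff :: "((real^'n) \<times> (real^'n)) \<times> ((real^'n) \<times> (real^'n)) \<Rightarrow> real^'n" where
 "dilate_diff = (\<lambda>((t1, t2), (y1, y2)). t1 * y1 - t2 * y2)"

lemma pw_nonneg: "(\<And>a. a \<in> A \<Longrightarrow> v a \<ge> 0) \<Longrightarrow> (\<And>b. b \<in> B \<Longrightarrow> w b \<ge> 0) \<Longrightarrow> x \<in> A \<times> B \<Longrightarrow> pw v w x \<ge> 0"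
 unfolding pw_def by auto

lemma sum_pw: "(\<Sum>x\<in>A \<times> B. pw v w x) = (\<Sum>a\<in>A. v a) * (\<Sum>b\<in>B. w b)"
 unfolding pw_def by (simp add: sum_product sum.cartesian_product)

text \<open>Given both multipliers and \<open>y2\<close>, what remains is a dilation by
  \<open>t1\<close> followed by a translation; convexity does the rest.\<close>

lemma coll_dilate_diff_le:
 fixes T S :: "(real^'n) set"
 assumes finT: "finite T" and T: "\<And>t i. t \<in> T \<Longrightarrow> 1/2 \<le> t $ i" and m: "\<And>t. t \<in> T \<Longrightarrow> m t \<ge> 0" "(\<Sum>t\<in>T. m t) = 1"
  and finS: "finite S" and w: "\<And>y. y \<in> S \<Longrightarrow> w y \<ge> 0" "(\<Sum>y\<in>S. w y) = 1"
 shows "coll ((T \<times> T) \<times> (S \<times> S)) (pw (pw m m) (pw w w)) (\<lambda>x. flr (dilate_diff x)) \<le> 3 ^ CARD('n) * coll S w flr"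
proof -
 have "coll ((T \<times> T) \<times> (S \<times> S)) (pw (pw m m) (pw w w)) (\<lambda>x. flr (dilate_diff x))
   \<le> (\<Sum>x\<in>T \<times> T. pw m m x)\<^sup>2 * (3 ^ CARD('n) * coll S w flr)"
  unfolding pw_def[of "pw m m"]
 proof (rule coll_prod_le_max)
  fix x assume x: "x \<in> T \<times> T"
  obtain t1 t2 where t: "x = (t1, t2)" "t1 \<in> T" "t2 \<in> T" using x by blast
  have "coll (S \<times> S) (pw w w) (\<lambda>b. flr (dilate_diff (x, b))) \<le> (\<Sum>y\<in>S. w y)\<^sup>2 * (3 ^ CARD('n) * coll S w flr)"
   unfolding pw_def
  proof (rule coll_prod_le_max')
   fix y2
   show "coll S w (\<lambda>a. flr (dilate_diff (x, a, y2))) \<le> 3 ^ CARD('n) * coll S w flr"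
    unfolding dilate_diff_def t using coll_flr_dilate[OF finS w(1) T[OF t(2)], where b = "t2 * y2"] by simp
  qed (use finS w in auto)
  thus "coll (S \<times> S) (pw w w) (\<lambda>b. flr (dilate_diff (x, b))) \<le> 3 ^ CARD('n) * coll S w flr" unfolding w(2) by simp
 qed (use finS finT m in \<open>auto simp: pw_def\<close>)
 thus ?thesis unfolding sum_pw m(2) by simp
qed

lemma coll_flr_translate:
 fixes t :: "real^'n"
 assumes finS: "finite S" and w: "\<And>y. y \<in> S \<Longrightarrow> w y \<ge> 0" and t: "\<And>i. 1/2 \<le> t $ i" and inj: "inj h"
 shows "coll S w (\<lambda>y. h (flr (t * y))) \<le> 3 ^ CARD('n) * coll S w flr"
proof (rule coll_fiber[OF finS w])
 fix c
 show "real (card (flr ` {i \<in> S. h (flr (t * i)) = c})) \<le> 3 ^ CARD('n)"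
  by (rule card_flr_le[OF t, of _ 0 "inv h c"]) (use inj in \<open>auto simp: inv_f_eq\<close>)
qed

section \<open>From stagnation to popular dilates\<close>

text \<open>Averaging over the first multiplier fixes \<open>\<tau>\<close>; the second is then
  restricted to those \<open>t\<close> with at least half of the guaranteed energy. They carry a
  large mass because no single energy exceeds \<open>3 ^ CARD('n) * Q\<close>.\<close>

lemma stagnation_popular_dilates:
 fixes T S :: "(real^'n) set"
 assumes finT: "finite T" and T: "\<And>t i. t \<in> T \<Longrightarrow> 1/2 \<le> t $ i" and m: "\<And>t. t \<in> T \<Longrightarrow> m t \<ge> 0" "(\<Sum>t\<in>T. m t) = 1"
  and finS: "finite S" and w: "\<And>y. y \<in> S \<Longrightarrow> w y \<ge> 0" "(\<Sum>y\<in>S. w y) = 1"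
  and K: "K > 0" and Q: "coll S w flr > 0"
  and stag: "coll ((T \<times> T) \<times> (S \<times> S)) (pw (pw m m) (pw w w)) (\<lambda>x. flr (dilate_diff x)) \<ge> coll S w flr / K"
 defines "K1 \<equiv> 2 * 6 ^ CARD('n) * K"
 obtains \<tau> G where "\<tau> \<in> T" "G \<subseteq> T" "(\<Sum>t\<in>G. m t) \<ge> 1 / K1"
  "\<And>t. t \<in> G \<Longrightarrow> coll (S \<times> S) (pw w w) (\<lambda>(y1, y2). flr (\<tau> * y1) - flr (t * y2)) \<ge> coll S w flr / K1"
proof -
 define Q where "Q = coll S w flr"
 define E where "E t1 t2 = coll (S \<times> S) (pw w w) (\<lambda>(y1, y2). flr (t1 * y1) - flr (t2 * y2))" for t1 t2
 define x where "x = Q / (2 ^ CARD('n) * K)"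
 have pww: "pw w w y \<ge> 0" if "y \<in> S \<times> S" for y using w(1) that by (intro pw_nonneg[of S w S]) auto
 have Ele: "E t1 t2 \<le> 3 ^ CARD('n) * Q" if "t1 \<in> T" for t1 t2
 proof -
  have "E t1 t2 \<le> (\<Sum>y\<in>S. w y)\<^sup>2 * (3 ^ CARD('n) * coll S w flr)"
   unfolding E_def pw_def
  proof (rule coll_prod_le_max')
   fix y2
   show "coll S w (\<lambda>a. case (a, y2) of (y1, y2) \<Rightarrow> flr (t1 * y1) - flr (t2 * y2)) \<le> 3 ^ CARD('n) * coll S w flr"
    using coll_flr_translate[OF finS w(1) T[OF that], where h = "\<lambda>z. z - flr (t2 * y2)"] by (simp add: inj_def)
  qed (use finS w in auto)
  thus ?thesis unfolding w(2) Q_def by simp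
 qed
 have "Q / K \<le> coll ((T \<times> T) \<times> (S \<times> S)) (pw (pw m m) (pw w w)) (\<lambda>x. flr (dilate_diff x))" using stag unfolding Q_def .
 also have "\<dots> \<le> (\<Sum>p\<in>T \<times> T. pw m m p) * (\<Sum>p\<in>T \<times> T. pw m m p * coll (S \<times> S) (pw w w) (\<lambda>b. flr (dilate_diff (p, b))))"
  unfolding pw_def[of "pw m m"] using finS finT m by (intro coll_prod_le pw_nonneg[of T m T]) auto
 also have "\<dots> = (\<Sum>p\<in>T \<times> T. pw m m p * coll (S \<times> S) (pw w w) (\<lambda>b. flr (dilate_diff (p, b))))"
  unfolding sum_pw m(2) by simp
 also have "\<dots> \<le> (\<Sum>p\<in>T \<times> T. pw m m p * (2 ^ CARD('n) * E (fst p) (snd p)))"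
 proof (intro sum_mono mult_left_mono)
  fix p assume p: "p \<in> T \<times> T"
  show "pw m m p \<ge> 0" using m(1) p by (intro pw_nonneg[of T m T]) auto
  have "coll (S \<times> S) (pw w w) (\<lambda>i. flr (fst p * fst i - snd p * snd i)) \<le> 2 ^ CARD('n) * coll (S \<times> S) (pw w w) (\<lambda>i. flr (fst p * fst i) - flr (snd p * snd i))"
   using finS pww by (intro coll_flr_diff) auto
  thus "coll (S \<times> S) (pw w w) (\<lambda>b. flr (dilate_diff (p, b))) \<le> 2 ^ CARD('n) * E (fst p) (snd p)"
   unfolding E_def dilate_diff_def case_prod_unfold by simp
 qed
 also have "\<dots> = 2 ^ CARD('n) * (\<Sum>\<tau>\<in>T. m \<tau> * (\<Sum>t\<in>T. m t * E \<tau> t))"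
  unfolding sum_distrib_left sum.cartesian_product pw_def by (intro sum.cong refl) (auto simp: ac_simps)
 finally have "x * (\<Sum>\<tau>\<in>T. m \<tau>) \<le> (\<Sum>\<tau>\<in>T. m \<tau> * (\<Sum>t\<in>T. m t * E \<tau> t))"
  unfolding m(2) x_def using K by (simp add: field_simps)
 from ex_ge_weighted_average[OF finT m(1) _ this]
 obtain \<tau> where tau: "\<tau> \<in> T" "(\<Sum>t\<in>T. m t * E \<tau> t) \<ge> x" using m(2) by auto
 define G where "G = {t \<in> T. E \<tau> t \<ge> x / 2}"
 have "x \<le> (\<Sum>t\<in>T. (if t \<in> G then m t else 0) * (3 ^ CARD('n) * Q) + m t * (x / 2))"
 proof (rule order_trans[OF tau(2)], rule sum_mono)
  fix t assume t: "t \<in> T"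
  have x0: "x \<ge> 0" unfolding x_def Q_def using K coll_nonneg[of S w flr] by simp
  have a: "m t * E \<tau> t \<le> m t * (3 ^ CARD('n) * Q)" using Ele[OF tau(1)] m(1)[OF t] by (intro mult_left_mono)
  have b: "m t * (x / 2) \<ge> 0" using x0 m(1)[OF t] by simp
  have c: "m t * E \<tau> t \<le> m t * (x / 2)" if "t \<notin> G" using that t m(1)[OF t] unfolding G_def by (intro mult_left_mono) auto
  show "m t * E \<tau> t \<le> (if t \<in> G then m t else 0) * (3 ^ CARD('n) * Q) + m t * (x / 2)" using a b c by auto
 qed
 also have "\<dots> = (\<Sum>t\<in>G. m t) * (3 ^ CARD('n) * Q) + x / 2"
 proof -
  have "G \<inter> T = G" "T \<inter> G = G" unfolding G_def by blast+
  thus ?thesis using finT m(2) by (simp add: sum.distrib sum_distrib_right[symmetric] sum_divide_distrib[symmetric] sum.inter_restrict[symmetric])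
 qed
 finally have s: "x / 2 \<le> (\<Sum>t\<in>G. m t) * (3 ^ CARD('n) * Q)" by simp
 have Qp: "Q > 0" using Q unfolding Q_def .
 have "6 ^ CARD('n) = (2::real) ^ CARD('n) * 3 ^ CARD('n)" by (simp add: power_mult_distrib[symmetric])
 hence "1 / K1 = (x / 2) / (3 ^ CARD('n) * Q)" unfolding K1_def x_def using K Qp by simp
 also have "\<dots> \<le> (\<Sum>t\<in>G. m t)" using s Qp by (simp add: pos_divide_le_eq)
 finally have mG: "(\<Sum>t\<in>G. m t) \<ge> 1 / K1" .
 have "Q / K1 \<le> x / 2"
 proof -
  have "(2::real) ^ CARD('n) \<le> 6 ^ CARD('n)" by (intro power_mono) auto
  thus ?thesis unfolding K1_def x_def using K Qp by (simp add: frac_le)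
 qed
 hence "E \<tau> t \<ge> Q / K1" if "t \<in> G" for t proof -
  have "E \<tau> t \<ge> x / 2" using that unfolding G_def by blast
  with \<open>Q / K1 \<le> x / 2\<close> show ?thesis by (rule order_trans)
 qed
 thus thesis using that[of \<tau> G] tau(1) mG unfolding E_def Q_def G_def by blast
qed

lemma heavy_sum_le:
 assumes "finite I" "\<And>i. i \<in> I \<Longrightarrow> w i \<ge> 0" "B > 0"
 shows "(\<Sum>i\<in>{i \<in> I. mass I w f (f i) > B}. w i) \<le> coll I w f / B"
proof -
 have "B * (\<Sum>i\<in>{i \<in> I. mass I w f (f i) > B}. w i) \<le> (\<Sum>i\<in>{i \<in> I. mass I w f (f i) > B}. w i * mass I w f (f i))"
  unfolding sum_distrib_left using assms by (intro sum_mono) (auto simp: mult.commute[of B] intro!: mult_left_mono)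
 also have "\<dots> \<le> (\<Sum>i\<in>I. w i * mass I w f (f i))"
  using assms by (intro sum_mono2 mult_nonneg_nonneg mass_nonneg) auto
 also have "\<dots> = coll I w f" using assms(1) by (rule coll_eq_sum[symmetric])
 finally show ?thesis using assms(3) by (simp add: le_divide_eq mult.commute)
qed

text \<open>A cell of \<open>t * y\<close> draws its mass from at most \<open>3 ^ CARD('n)\<close>
  cells of \<open>y\<close>, and each of these is light.\<close>

lemma mass_dilate_light:
 fixes S :: "(real^'n) set" and t :: "real^'n"
 assumes finS: "finite S" and w: "\<And>y. y \<in> S \<Longrightarrow> w y \<ge> 0" and t: "\<And>i. 1/2 \<le> t $ i" and B: "B \<ge> 0"
 shows "mass {y \<in> S. mass S w flr (flr y) \<le> B} w (\<lambda>y. flr (t * y)) c \<le> 3 ^ CARD('n) * B"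
proof -
 define Y where "Y = {y \<in> {y \<in> S. mass S w flr (flr y) \<le> B}. flr (t * y) = c}"
 have YS: "Y \<subseteq> S" unfolding Y_def by blast
 have fY: "finite Y" using finS unfolding Y_def by simp
 have "mass {y \<in> S. mass S w flr (flr y) \<le> B} w (\<lambda>y. flr (t * y)) c = (\<Sum>y\<in>Y. w y)" unfolding mass_def Y_def ..
 also have "\<dots> = (\<Sum>d\<in>flr ` Y. mass Y w flr d)" by (rule sum_mass_image[OF fY, symmetric])
 also have "\<dots> \<le> (\<Sum>d\<in>flr ` Y. B)"
 proof (rule sum_mono)
  fix d assume "d \<in> flr ` Y"
  then obtain y where y: "y \<in> Y" "d = flr y" by blast
  have "mass Y w flr d \<le> mass S w flr d" using finS YS w by (intro mass_mono)
  also have "\<dots> \<le> B" using y unfolding Y_def by blast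
  finally show "mass Y w flr d \<le> B" .
 qed
 also have "\<dots> = real (card (flr ` Y)) * B" by simp
 also have "\<dots> \<le> 3 ^ CARD('n) * B"
  using B by (intro mult_right_mono card_flr_le[OF t, of _ 0 c]) (auto simp: Y_def)
 finally show ?thesis .
qed

text \<open>Cells of mass above \<open>L * Q\<close> have total mass at most \<open>1 / L\<close> by
  Markov's inequality, so discarding them keeps a fixed fraction of the energy. The remaining masses
  are bounded by a multiple of \<open>Q\<close>, and \<open>weighted_BSG\<close> applies with
  \<open>N = 1 / Q\<close> to the cells of \<open>\<tau> * y\<close> and the negatives of the cells
  of \<open>t * y\<close>.\<close>

lemma dilate_BSG:
 fixes S :: "(real^'n) set" and \<tau> t :: "real^'n"
 assumes finS: "finite S" and w: "\<And>y. y \<in> S \<Longrightarrow> w y \<ge> 0" "(\<Sum>y\<in>S. w y) = 1"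
  and Q: "Q = coll S w flr" "Q > 0" and K1: "K1 \<ge> 1"
  and tau: "\<And>i. 1/2 \<le> \<tau> $ i" and t: "\<And>i. 1/2 \<le> t $ i"
  and E: "coll (S \<times> S) (pw w w) (\<lambda>(y1, y2). flr (\<tau> * y1) - flr (t * y2)) \<ge> Q / K1"
 defines "M \<equiv> 16 * 9 ^ CARD('n) * K1"
 defines "S0 \<equiv> {y \<in> S. mass S w flr (flr y) \<le> 16 * 3 ^ CARD('n) * K1 * Q}"
 obtains A s where "A \<subseteq> (\<lambda>y. flr (\<tau> * y)) ` S0" "(\<Sum>a\<in>A. mass S0 w (\<lambda>y. flr (\<tau> * y)) a) \<ge> 1 / (8 * M\<^sup>2)"
  "(\<Sum>y\<in>{y \<in> S0. s + flr (t * y) \<in> A}. w y) \<ge> 1 / (8 * M\<^sup>2)" "real (card (diffset A A)) \<le> 2048 * M ^ 5 / Q"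
proof -
 define L where "L = 16 * 3 ^ CARD('n) * K1"
 have L: "L \<ge> 1"
 proof -
  have "1 * 1 \<le> 16 * (3::real) ^ CARD('n)" by (intro mult_mono) auto
  hence "1 * 1 \<le> 16 * 3 ^ CARD('n) * K1" using K1 by (intro mult_mono) auto
  thus ?thesis unfolding L_def by simp
 qed
 have nine: "(9::real) ^ CARD('n) = 3 ^ CARD('n) * 3 ^ CARD('n)" by (simp add: power_mult_distrib[symmetric])
 have MeqL: "M = 3 ^ CARD('n) * L" unfolding M_def L_def nine by simp
 have three: "(3::real) ^ CARD('n) \<ge> 1" by simp
 have M1: "M \<ge> 1" unfolding MeqL using mult_mono[OF three L] by simp
 have finS0: "finite S0" unfolding S0_def using finS by simp
 have S0S: "S0 \<subseteq> S" unfolding S0_def by blast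
 define S1 where "S1 = S - S0"
 have S1: "S1 = {y \<in> S. mass S w flr (flr y) > L * Q}" unfolding S1_def S0_def L_def by auto
 have wS1: "(\<Sum>y\<in>S1. w y) \<le> 1 / L"
 proof -
  have "(\<Sum>y\<in>S1. w y) \<le> coll S w flr / (L * Q)" unfolding S1 using finS w L Q by (intro heavy_sum_le) auto
  thus ?thesis using Q L by simp
 qed
 have wS1': "(\<Sum>y\<in>S1. w y)\<^sup>2 \<le> (1 / L)\<^sup>2" using wS1 w S1 by (intro power_mono sum_nonneg) auto
 let ?f = "\<lambda>(y1, y2). flr (\<tau> * y1) - flr (t * y2)"
 have finS1: "finite S1" unfolding S1_def using finS by simp
 have c1: "coll (S1 \<times> S) (pw w w) ?f \<le> (1 / L)\<^sup>2 * (3 ^ CARD('n) * Q)"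
 proof -
  have "coll (S1 \<times> S) (pw w w) ?f \<le> (\<Sum>y\<in>S1. w y)\<^sup>2 * (3 ^ CARD('n) * Q)"
   unfolding pw_def
  proof (rule coll_prod_le_max)
   fix y1
   show "coll S w (\<lambda>b. ?f (y1, b)) \<le> 3 ^ CARD('n) * Q"
    using coll_flr_translate[OF finS w(1) t, where h = "\<lambda>z. flr (\<tau> * y1) - z"] Q by (simp add: inj_def)
  qed (use finS finS1 w S1 in auto)
  also have "\<dots> \<le> (1 / L)\<^sup>2 * (3 ^ CARD('n) * Q)" using wS1' Q by (intro mult_right_mono) auto
  finally show ?thesis .
 qed
 have c2: "coll (S0 \<times> S1) (pw w w) ?f \<le> (1 / L)\<^sup>2 * (3 ^ CARD('n) * Q)"
 proof -
  have "coll (S0 \<times> S1) (pw w w) ?f \<le> (\<Sum>y\<in>S1. w y)\<^sup>2 * (3 ^ CARD('n) * Q)"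
   unfolding pw_def
  proof (rule coll_prod_le_max')
   fix y2
   have "coll S0 w (\<lambda>a. ?f (a, y2)) \<le> coll S w (\<lambda>a. ?f (a, y2))" using finS S0S w by (intro coll_mono)
   also have "\<dots> \<le> 3 ^ CARD('n) * Q"
    using coll_flr_translate[OF finS w(1) tau, where h = "\<lambda>z. z - flr (t * y2)"] Q by (simp add: inj_def)
   finally show "coll S0 w (\<lambda>a. ?f (a, y2)) \<le> 3 ^ CARD('n) * Q" .
  qed (use finS0 finS1 w S1 in auto)
  also have "\<dots> \<le> (1 / L)\<^sup>2 * (3 ^ CARD('n) * Q)" using wS1' Q by (intro mult_right_mono) auto
  finally show ?thesis .
 qed
 \<comment> \<open>The pairs with a heavy component are split into two products, each bounded by
   convexity. The factor 8 below comes from applying \<open>coll_Un_le\<close> twice.\<close>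
 have e: "S \<times> S = (S0 \<times> S0) \<union> ((S1 \<times> S) \<union> (S0 \<times> S1))" using S0S unfolding S1_def by blast
 have "coll (S \<times> S) (pw w w) ?f \<le> 2 * coll (S0 \<times> S0) (pw w w) ?f + 2 * coll ((S1 \<times> S) \<union> (S0 \<times> S1)) (pw w w) ?f"
  unfolding e by (rule coll_Un_le) (use finS0 finS1 finS in \<open>auto simp: S1_def\<close>)
 moreover have "coll ((S1 \<times> S) \<union> (S0 \<times> S1)) (pw w w) ?f \<le> 2 * coll (S1 \<times> S) (pw w w) ?f + 2 * coll (S0 \<times> S1) (pw w w) ?f"
  by (rule coll_Un_le) (use finS0 finS1 finS in \<open>auto simp: S1_def\<close>)
 ultimately have E2: "Q / K1 \<le> 2 * coll (S0 \<times> S0) (pw w w) ?f + 8 * ((1 / L)\<^sup>2 * (3 ^ CARD('n) * Q))"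
  using c1 c2 E by linarith
 have sm: "8 * ((1 / L)\<^sup>2 * (3 ^ CARD('n) * Q)) \<le> Q / K1 / 2"
 proof -
  have "16 * 3 ^ CARD('n) * K1 \<le> L * L" unfolding L_def[symmetric] using L by (simp add: mult_le_cancel_left1)
  hence "Q * (16 * 3 ^ CARD('n) * K1) \<le> Q * (L * L)" using Q(2) by (intro mult_left_mono) auto
  thus ?thesis using L K1 by (simp add: field_simps power2_eq_square)
 qed
 have E3: "coll (S0 \<times> S0) (pw w w) ?f \<ge> Q / K1 / 4"
 proof -
  have "a / 4 \<le> z" if "a \<le> 2 * z + y" "y \<le> a / 2" for a y z :: real using that by linarith
  from this[OF E2 sm] show ?thesis .
 qed
 define p where "p = mass S0 w (\<lambda>y. flr (\<tau> * y))"
 define q where "q = mass S0 w (\<lambda>y. - flr (t * y))"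
 have w0: "\<And>y. y \<in> S0 \<Longrightarrow> w y \<ge> 0" using w(1) S0S by blast
 have sw: "(\<Sum>y\<in>S0. w y) \<le> 1" unfolding w(2)[symmetric] using finS S0S w(1) by (intro sum_mono2) auto
 have qm: "q b = mass S0 w (\<lambda>y. flr (t * y)) (- b)" for b
 proof -
  have "{y \<in> S0. - flr (t * y) = b} = {y \<in> S0. flr (t * y) = - b}" by (metis (no_types) minus_minus)
  thus ?thesis unfolding q_def mass_def by simp
 qed
 have plq: "mass S0 w (\<lambda>y. flr (t' * y)) c \<le> M / (1 / Q)" if "\<And>i. 1/2 \<le> t' $ i" for t' c
 proof -
  have "mass S0 w (\<lambda>y. flr (t' * y)) c \<le> 3 ^ CARD('n) * (L * Q)"
   unfolding S0_def L_def[symmetric] using finS w(1) that L Q(2) by (intro mass_dilate_light) auto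
  thus ?thesis unfolding MeqL by simp
 qed
 have en: "(\<Sum>s\<in>sumset ((\<lambda>y. flr (\<tau> * y)) ` S0) ((\<lambda>y. - flr (t * y)) ` S0). (\<Sum>a\<in>(\<lambda>y. flr (\<tau> * y)) ` S0. p a * q (s - a))\<^sup>2) \<ge> 1 / (M * (1 / Q))"
 proof -
  have M4: "4 * K1 \<le> M"
  proof -
   have "4 * 1 \<le> 16 * (9::real) ^ CARD('n)" by (intro mult_mono) auto
   from mult_right_mono[OF this, of K1] show ?thesis unfolding M_def using K1 by simp
  qed
  have "1 / (M * (1 / Q)) = Q / M" by simp
  also have "\<dots> \<le> Q / (4 * K1)" using M4 Q(2) K1 by (intro divide_left_mono) auto
  also have "\<dots> \<le> coll (S0 \<times> S0) (pw w w) ?f" using E3 by simp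
  also have "?f = (\<lambda>(i, j). flr (\<tau> * i) + - flr (t * j))" by auto
  also have "coll (S0 \<times> S0) (pw w w) (\<lambda>(i, j). flr (\<tau> * i) + - flr (t * j))
    = (\<Sum>s\<in>sumset ((\<lambda>y. flr (\<tau> * y)) ` S0) ((\<lambda>y. - flr (t * y)) ` S0). (mass (S0 \<times> S0) (pw w w) (\<lambda>(i, j). flr (\<tau> * i) + - flr (t * j)) s)\<^sup>2)"
  proof (rule coll_superset)
   show "(\<lambda>(i, j). flr (\<tau> * i) + - flr (t * j)) ` (S0 \<times> S0) \<subseteq> sumset ((\<lambda>y. flr (\<tau> * y)) ` S0) ((\<lambda>y. - flr (t * y)) ` S0)"
   proof
    fix x assume "x \<in> (\<lambda>(i, j). flr (\<tau> * i) + - flr (t * j)) ` (S0 \<times> S0)"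
    then obtain i j where ij: "i \<in> S0" "j \<in> S0" "x = flr (\<tau> * i) + - flr (t * j)" by auto
    show "x \<in> sumset ((\<lambda>y. flr (\<tau> * y)) ` S0) ((\<lambda>y. - flr (t * y)) ` S0)" unfolding ij(3) using ij(1,2) by (intro sumsetI imageI)
   qed
  qed (use finS0 in simp)
  finally show ?thesis unfolding pw_def mass_add[OF finS0 finS0] p_def q_def .
 qed
 obtain A s where A: "A \<subseteq> (\<lambda>y. flr (\<tau> * y)) ` S0" "(\<Sum>a\<in>A. p a) \<ge> 1 / (8 * M\<^sup>2)" "(\<Sum>a\<in>A. q (s - a)) \<ge> 1 / (8 * M\<^sup>2)"
  "real (card (diffset A A)) \<le> 2048 * M ^ 5 * (1 / Q)"
 proof (rule weighted_BSG[of "(\<lambda>y. flr (\<tau> * y)) ` S0" "(\<lambda>y. - flr (t * y)) ` S0" p q M "1 / Q"])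
  show "(\<Sum>x\<in>(\<lambda>y. flr (\<tau> * y)) ` S0. p x) \<le> 1" unfolding p_def sum_mass_image[OF finS0] by (rule sw)
  show "(\<Sum>x\<in>(\<lambda>y. - flr (t * y)) ` S0. q x) \<le> 1" unfolding q_def sum_mass_image[OF finS0] by (rule sw)
  show "p x \<le> M / (1 / Q)" for x unfolding p_def by (rule plq[OF tau])
  show "q x \<le> M / (1 / Q)" for x unfolding qm by (rule plq[OF t])
  show "1 / (M * (1 / Q)) \<le> (\<Sum>s\<in>sumset ((\<lambda>y. flr (\<tau> * y)) ` S0) ((\<lambda>y. - flr (t * y)) ` S0). (\<Sum>a\<in>(\<lambda>y. flr (\<tau> * y)) ` S0. p a * q (s - a))\<^sup>2)" by (rule en)
 qed (use finS0 M1 Q(2) w0 in \<open>auto simp: p_def q_def intro: mass_nonneg mass_eq_0\<close>)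
 have finA: "finite A" using A(1) finS0 by (meson finite_imageI finite_subset)
 have "(\<Sum>a\<in>A. q (s - a)) = (\<Sum>a\<in>A. mass S0 w (\<lambda>y. s + flr (t * y)) a)"
 proof (intro sum.cong refl)
  fix a
  have "{y \<in> S0. - flr (t * y) = s - a} = {y \<in> S0. s + flr (t * y) = a}" by (auto simp: algebra_simps)
  thus "q (s - a) = mass S0 w (\<lambda>y. s + flr (t * y)) a" unfolding q_def mass_def by simp
 qed
 also have "\<dots> = (\<Sum>y\<in>{y \<in> S0. s + flr (t * y) \<in> A}. w y)" using finS0 finA by (rule sum_mass)
 finally have "(\<Sum>y\<in>{y \<in> S0. s + flr (t * y) \<in> A}. w y) \<ge> 1 / (8 * M\<^sup>2)" using A(3) by simp
 thus thesis using that[of A s] A unfolding p_def by simp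
qed

section \<open>From small doubling to an approximate group\<close>

lemma covers_ruzsa:
 fixes B C :: "'a::ab_group_add set"
 assumes fin: "finite B" "finite C" and ne: "C \<noteq> {}" and c: "real (card (sumset B C)) \<le> k * real (card C)"
 shows "covers k B (diffset C C)"
proof -
 obtain Y where Y: "Y \<subseteq> B" "finite Y" "card Y * card C \<le> card (sumset B C)"
  "\<And>b. b \<in> B \<Longrightarrow> \<exists>y\<in>Y. \<exists>c\<in>C. \<exists>c'\<in>C. b = y + (c - c')" using ruzsa_covering[OF fin ne] by metis
 have C0: "real (card C) > 0" using fin ne by (simp add: card_gt_0_iff)
 have "real (card Y) * real (card C) \<le> k * real (card C)"
  using Y(3) c by (metis (mono_tags) of_nat_le_iff of_nat_mult order_trans)
 hence "real (card Y) \<le> k" using C0 by simp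
 thus ?thesis
 proof (rule coversI[OF Y(2)])
  fix x assume "x \<in> B"
  from Y(4)[OF this] obtain y c c' where y: "y \<in> Y" "c \<in> C" "c' \<in> C" "x = y + (c - c')" by blast
  hence "x - y \<in> diffset C C" by (auto intro: diffsetI)
  thus "\<exists>y\<in>Y. x - y \<in> diffset C C" using y(1) by blast
 qed
qed

lemma covers_uminus:
 fixes A :: "'a::ab_group_add set"
 assumes "covers m A H" "\<And>x. x \<in> H \<Longrightarrow> - x \<in> H" shows "covers m (uminus ` A) H"
proof -
 obtain Y where Y: "finite Y" "real (card Y) \<le> m" "\<And>x. x \<in> A \<Longrightarrow> \<exists>y\<in>Y. x - y \<in> H"
  using assms(1) by (rule coversE) blast
 show ?thesis
 proof (rule coversI[of "uminus ` Y"])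
  show "real (card (uminus ` Y)) \<le> m" using Y(2) card_image_le[OF Y(1), of uminus] by linarith
  fix x assume "x \<in> uminus ` A"
  then obtain a where a: "a \<in> A" "x = - a" by blast
  from Y(3)[OF a(1)] obtain y where y: "y \<in> Y" "a - y \<in> H" by blast
  have "x - (- y) \<in> H" using assms(2)[OF y(2)] a by simp
  thus "\<exists>y\<in>uminus ` Y. x - y \<in> H" using y(1) by blast
 qed (use Y in simp)
qed

lemma sumset_assoc: "sumset (sumset A B) C = sumset A (sumset B C)"
proof (intro equalityI subsetI)
 fix x assume "x \<in> sumset (sumset A B) C"
 then obtain a b c where "a \<in> A" "b \<in> B" "c \<in> C" "x = a + b + c" by (metis sumsetE)
 thus "x \<in> sumset A (sumset B C)" using sumsetI[of a A "b + c" "sumset B C"] by (simp add: sumsetI add.assoc)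
next
 fix x assume "x \<in> sumset A (sumset B C)"
 then obtain a b c where "a \<in> A" "b \<in> B" "c \<in> C" "x = a + (b + c)" by (metis sumsetE)
 thus "x \<in> sumset (sumset A B) C" using sumsetI[of "a + b" "sumset A B" c C] by (simp add: sumsetI add.assoc)
qed

fun nsum :: "'a::ab_group_add set \<Rightarrow> 'a set \<Rightarrow> nat \<Rightarrow> 'a set" where
 "nsum A P 0 = A"
| "nsum A P (Suc k) = sumset (nsum A P k) P"

lemma finite_nsum: "finite A \<Longrightarrow> finite P \<Longrightarrow> finite (nsum A P k)"
 by (induction k) auto

locale small_doubling =
 fixes A :: "'a::ab_group_add set" and KA :: real
 assumes finA: "finite A" and neA: "A \<noteq> {}" and KA1: "KA \<ge> 1"
  and dbl: "real (card (diffset A A)) \<le> KA * real (card A)"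
begin

text \<open>The core of the approximate group will be \<open>Q2\<close>. Popular differences being
  symmetric, it is also \<open>P - P\<close>, so Ruzsa covering by \<open>P\<close> produces
  translates of \<open>Q2\<close>.\<close>

definition "P = popular KA A"
definition "Q2 = sumset P P"

lemma finP: "finite P" unfolding P_def using finA by simp
lemma finQ2: "finite Q2" unfolding Q2_def using finP by simp
lemma P_minus: "x \<in> P \<Longrightarrow> - x \<in> P" unfolding P_def using finA by (rule popular_minus[rotated])
lemma zero_P: "0 \<in> P" unfolding P_def using neA KA1 by (rule zero_in_popular)
lemma zero_Q2: "0 \<in> Q2" unfolding Q2_def using sumsetI[OF zero_P zero_P] by simp

lemma Q2_minus: assumes "x \<in> Q2" shows "- x \<in> Q2"
proof -
 obtain p q where "p \<in> P" "q \<in> P" "x = p + q" using assms unfolding Q2_def by (rule sumsetE)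
 thus ?thesis unfolding Q2_def using sumsetI[OF P_minus P_minus, of p q] by simp
qed

lemma diffset_P: "diffset P P = Q2"
proof (intro equalityI subsetI)
 fix x assume "x \<in> diffset P P"
 then obtain p q where "p \<in> P" "q \<in> P" "x = p - q" by (rule diffsetE)
 thus "x \<in> Q2" unfolding Q2_def using sumsetI[of p P "- q" P] P_minus by simp
next
 fix x assume "x \<in> Q2"
 then obtain p q where "p \<in> P" "q \<in> P" "x = p + q" unfolding Q2_def by (rule sumsetE)
 thus "x \<in> diffset P P" using diffsetI[of p P "- q" P] P_minus by simp
qed

text \<open>Each summand \<open>P\<close> costs the factor \<open>2 * KA\<^sup>2\<close> of
  \<open>card_sumset_popular\<close>; the subtracted set \<open>A\<close> is the same
  throughout.\<close>

lemma growth: "real (card (diffset (nsum A P k) A)) \<le> (2 * KA\<^sup>2) ^ k * real (card (diffset A A))"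
proof (induction k)
 case (Suc k)
 have "real (card (diffset (sumset (nsum A P k) P) A)) \<le> 2 * KA\<^sup>2 * real (card (diffset (nsum A P k) A))"
  unfolding P_def using finA neA KA1 dbl by (intro card_sumset_popular finite_nsum) auto
 also have "\<dots> \<le> 2 * KA\<^sup>2 * ((2 * KA\<^sup>2) ^ k * real (card (diffset A A)))" using Suc by (intro mult_left_mono) auto
 finally show ?case by (simp add: ac_simps)
qed simp

lemma card_shift_le:
 assumes "\<And>x. x \<in> B \<Longrightarrow> x + z \<in> diffset (nsum A P k) A"
 shows "real (card B) \<le> (2 * KA\<^sup>2) ^ k * real (card (diffset A A))"
proof -
 have "card ((\<lambda>x. x + z) ` B) \<le> card (diffset (nsum A P k) A)"
  using assms finA finP by (intro card_mono finite_diffset finite_nsum) auto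
 moreover have "card ((\<lambda>x. x + z) ` B) = card B" by (intro card_image) (simp add: inj_on_def)
 ultimately show ?thesis using growth[of k] by (metis (mono_tags) of_nat_le_iff order_trans)
qed

lemma card_A_le_P: "real (card A) \<le> 2 * real (card P)"
 using card_popular_ge[OF finA neA _ dbl] KA1 unfolding P_def by simp

lemma P_ne: "P \<noteq> {}" using zero_P by blast

lemma covers_Q2:
 assumes "finite B" "\<And>x. x \<in> sumset B P \<Longrightarrow> x + z \<in> diffset (nsum A P k) A"
 shows "covers (2 * (2 * KA\<^sup>2) ^ k * KA) B Q2"
 unfolding diffset_P[symmetric]
proof (rule covers_ruzsa)
 have "real (card (sumset B P)) \<le> (2 * KA\<^sup>2) ^ k * real (card (diffset A A))" using assms(2) by (rule card_shift_le)
 also have "\<dots> \<le> (2 * KA\<^sup>2) ^ k * (KA * (2 * real (card P)))"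
  using order_trans[OF dbl mult_left_mono[OF card_A_le_P, of KA]] KA1 by (intro mult_left_mono) auto
 finally show "real (card (sumset B P)) \<le> 2 * (2 * KA\<^sup>2) ^ k * KA * real (card P)" by (simp add: ac_simps)
qed (use assms finP P_ne in auto)

lemma covers_A: "covers (2 * (2 * KA\<^sup>2) ^ 1 * KA) A Q2"
proof -
 obtain a where a: "a \<in> A" using neA by blast
 show ?thesis
 proof (rule covers_Q2[OF finA, of "- a"])
  fix x assume "x \<in> sumset A P"
  thus "x + - a \<in> diffset (nsum A P 1) A" using diffsetI[OF _ a, of x] by simp
 qed
qed

text \<open>\<open>Q2 + Q2 + P\<close> has five summands \<open>P\<close>, so a translate of any
  element of \<open>A\<close> by it lies in \<open>nsum A P 5\<close>.\<close>

lemma covers_4: "covers (2 * (2 * KA\<^sup>2) ^ 5 * KA) (sumset Q2 Q2) Q2"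
proof (rule covers_Q2[of _ 0])
 show "finite (sumset Q2 Q2)" using finQ2 by simp
 fix x assume "x \<in> sumset (sumset Q2 Q2) P"
 hence x: "x \<in> sumset P (sumset P (sumset P (sumset P P)))" unfolding Q2_def by (simp only: sumset_assoc)
 obtain a where a: "a \<in> A" using neA by blast
 have "a + x \<in> sumset A (sumset P (sumset P (sumset P (sumset P P))))" using a x by (rule sumsetI)
 also have "\<dots> = nsum A P 5" by (simp add: numeral_eq_Suc sumset_assoc)
 finally have "(a + x) - a \<in> diffset (nsum A P 5) A" using a by (rule diffsetI)
 thus "x + 0 \<in> diffset (nsum A P 5) A" by simp
qed

lemma card_Q2: "real (card Q2) \<le> (2 * KA\<^sup>2) ^ 2 * real (card (diffset A A))"
proof (rule card_shift_le[of _ 0])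
 fix x assume x: "x \<in> Q2"
 obtain a where a: "a \<in> A" using neA by blast
 have "a + x \<in> sumset A (sumset P P)" using a x unfolding Q2_def by (rule sumsetI)
 also have "\<dots> = nsum A P 2" by (simp add: numeral_eq_Suc sumset_assoc)
 finally have "(a + x) - a \<in> diffset (nsum A P 2) A" using a by (rule diffsetI)
 thus "x + 0 \<in> diffset (nsum A P 2) A" by simp
qed

text \<open>\<open>Q2 + D\<close> lies, up to translation, in \<open>A + P + P - A\<close>. This is
  the reverse comparison: \<open>Q2\<close> is covered by the differences of any large set that has
  a translate inside \<open>A\<close>.\<close>

lemma covers_translate:
 assumes D: "finite D" "D \<noteq> {}" "\<And>d. d \<in> D \<Longrightarrow> s + d \<in> A"
  and c: "(2 * KA\<^sup>2) ^ 2 * real (card (diffset A A)) \<le> b * real (card D)"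
 shows "covers b Q2 (diffset D D)"
proof (rule covers_ruzsa[OF finQ2 D(1,2)])
 obtain a where a: "a \<in> A" using neA by blast
 have "real (card (sumset Q2 D)) \<le> (2 * KA\<^sup>2) ^ 2 * real (card (diffset A A))"
 proof (rule card_shift_le[of _ "s - a"])
  fix x assume "x \<in> sumset Q2 D"
  then obtain q d where x: "q \<in> Q2" "d \<in> D" "x = q + d" by (rule sumsetE)
  have "(s + d) + q \<in> sumset A (sumset P P)" using D(3)[OF x(2)] x(1) unfolding Q2_def by (rule sumsetI)
  also have "\<dots> = nsum A P 2" by (simp add: numeral_eq_Suc sumset_assoc)
  finally have "((s + d) + q) - a \<in> diffset (nsum A P 2) A" using a by (rule diffsetI)
  thus "x + (s - a) \<in> diffset (nsum A P 2) A" unfolding x(3) by (simp add: algebra_simps)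
 qed
 thus "real (card (sumset Q2 D)) \<le> b * real (card D)" using c by linarith
qed

end

lemma covers_vbx:
 assumes "k \<ge> 0" shows "covers ((2 * k + 1) ^ CARD('n)) (vbx (\<lambda>_. k) :: (real^'n) set) (vbx (\<lambda>_. 1))"
proof -
 obtain Y :: "(real^'n) set" where Y: "Y \<subseteq> vbx (\<lambda>_. k)" "finite Y" "separated (\<lambda>_. 1) Y"
  "\<And>b. b \<in> vbx (\<lambda>_. k) \<Longrightarrow> \<exists>y\<in>Y. b - y \<in> vbx (\<lambda>_. 1)"
  using ex_maximal_separated[of "vbx (\<lambda>_. k)" "\<lambda>_. k" "\<lambda>_. 1"] by (metis order.refl zero_less_one)
 have "real (card Y) \<le> (\<Prod>i\<in>(UNIV :: 'n set). (2 * k / 1 + 1))"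
  by (rule card_separated_le(2)[of Y 0]) (use Y assms in auto)
 also have "\<dots> = (2 * k + 1) ^ CARD('n)" by simp
 finally show ?thesis using Y(2,4) by (intro coversI[of Y]) auto
qed

lemma sumset_vbx: "sumset (vbx (\<lambda>_. a)) (vbx (\<lambda>_. b)) \<subseteq> (vbx (\<lambda>_. a + b) :: (real^'n) set)"
 by (auto elim!: sumsetE intro: vbx_add)

lemma sumset_shuffle: "sumset (sumset A B) (sumset C D) \<subseteq> sumset (sumset A C) (sumset B D)"
proof
 fix x assume "x \<in> sumset (sumset A B) (sumset C D)"
 then obtain a b c d where x: "a \<in> A" "b \<in> B" "c \<in> C" "d \<in> D" "x = (a + b) + (c + d)" by (metis sumsetE)
 have "x = (a + c) + (b + d)" unfolding x by (simp add: algebra_simps)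
 thus "x \<in> sumset (sumset A C) (sumset B D)" using sumsetI[OF sumsetI[OF x(1,3)] sumsetI[OF x(2,4)]] by simp
qed

text \<open>Adding the unit box supplies the resolution 1; doubling the box costs
  \<open>5 ^ CARD('n)\<close>, a covering number of the box of radius 2.\<close>

lemma approx_group_thicken:
 fixes Q2 :: "(real^'n) set"
 assumes minus: "\<And>x. x \<in> Q2 \<Longrightarrow> - x \<in> Q2" and z: "0 \<in> Q2" and cov: "covers a (sumset Q2 Q2) Q2" and a: "a \<ge> 1"
  and r: "Q2 \<subseteq> vbx (\<lambda>_. r)"
 shows "approx_group (sumset Q2 (vbx (\<lambda>_. 1))) (a * 5 ^ CARD('n)) (r + 1)"
proof
 show "- x \<in> sumset Q2 (vbx (\<lambda>_. 1))" if mem: "x \<in> sumset Q2 (vbx (\<lambda>_. 1))" for x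
 proof -
  obtain q b where "q \<in> Q2" "b \<in> vbx (\<lambda>_. 1)" "x = q + b" using mem by (rule sumsetE)
  thus ?thesis using sumsetI[OF minus vbx_uminus, of q b "\<lambda>_. 1"] by simp
 qed
 show "vbx (\<lambda>_. 1) \<subseteq> sumset Q2 (vbx (\<lambda>_. 1))" using sumsetI[OF z] by force
 show "sumset Q2 (vbx (\<lambda>_. 1)) \<subseteq> vbx (\<lambda>_. r + 1)" using sumset_mono[OF r order.refl] sumset_vbx by blast
 have "1 * 1 \<le> a * 5 ^ CARD('n)" using a by (intro mult_mono) auto
 thus "1 \<le> a * 5 ^ CARD('n)" by simp
 have "covers ((2 * 2 + 1) ^ CARD('n)) (vbx (\<lambda>_. 2) :: (real^'n) set) (vbx (\<lambda>_. 1))" by (rule covers_vbx) simp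
 hence "covers (5 ^ CARD('n)) (sumset (vbx (\<lambda>_. 1)) (vbx (\<lambda>_. 1)) :: (real^'n) set) (vbx (\<lambda>_. 1))"
  by (rule covers_mono) (use sumset_vbx[of 1 1] in auto)
 from covers_sumset[OF cov this] sumset_shuffle
 show "covers (a * 5 ^ CARD('n)) (sumset (sumset Q2 (vbx (\<lambda>_. 1))) (sumset Q2 (vbx (\<lambda>_. 1)))) (sumset Q2 (vbx (\<lambda>_. 1)))"
  by (rule covers_mono) auto
qed

lemma diffset_eq_sumset: "diffset A B = sumset A (uminus ` B)"
proof (intro equalityI subsetI)
 fix x assume "x \<in> diffset A B"
 then obtain a b where "a \<in> A" "b \<in> B" "x = a - b" by (rule diffsetE)
 thus "x \<in> sumset A (uminus ` B)" using sumsetI[of a A "- b" "uminus ` B"] by simp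
next
 fix x assume "x \<in> sumset A (uminus ` B)"
 then obtain a b where "a \<in> A" "b \<in> B" "x = a + - b" by (auto elim!: sumsetE)
 thus "x \<in> diffset A B" using diffsetI[of a A b B] by simp
qed

lemma diffset_self_minus: "x \<in> diffset C C \<Longrightarrow> - x \<in> diffset C C"
 by (metis diffsetE diffsetI minus_diff_eq)

text \<open>The chain runs from \<open>x Q2\<close> through \<open>x (D - D)\<close>,
  \<open>At - At\<close>, two copies of \<open>C - C\<close> and two copies of \<open>A - A\<close>
  back to \<open>Q2\<close>. In the application \<open>D\<close> consists of cells of
  \<open>t0 * y\<close>; multiplied by the ratio of \<open>t\<close> and \<open>t0\<close> they are
  nearly cells of \<open>t * y\<close>, which a shift moves into \<open>At\<close>. The error 3,
  plus 2 from the thickening, gives the box of radius 5 and its covering number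
  \<open>11 ^ CARD('n)\<close>; the exponent 7 = 3 + 3 + 1 counts the uses of
  \<open>a\<close>.\<close>

lemma ratio_stabilizes:
 fixes Q2 :: "(real^'n) set"
 assumes minus: "\<And>x. x \<in> Q2 \<Longrightarrow> - x \<in> Q2" and cov4: "covers a (sumset Q2 Q2) Q2" and covA: "covers a A Q2"
  and covD: "covers b Q2 (diffset D D)" and covAt: "covers c At (diffset C C)" and CA: "C \<subseteq> A"
  and x: "x \<in> vbx (\<lambda>_. 2)" and D: "\<And>d d'. d \<in> D \<Longrightarrow> d' \<in> D \<Longrightarrow> \<exists>e\<in>diffset At At. x * (d - d') - e \<in> vbx (\<lambda>_. 3)"
 shows "covers (b * (c\<^sup>2 * a ^ 7 * 11 ^ CARD('n))) ((*) x ` sumset Q2 (vbx (\<lambda>_. 1))) (sumset Q2 (vbx (\<lambda>_. 1)))"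
proof -
 let ?V = "vbx (\<lambda>_. 1) :: (real^'n) set"
 have AA: "covers (a * a * a) (diffset A A) Q2"
  unfolding diffset_eq_sumset by (rule covers_trans[OF covers_sumset[OF covA covers_uminus[OF covA minus]] cov4])
 have AAAA: "covers (a ^ 7) (sumset (diffset A A) (diffset A A)) Q2"
  using covers_trans[OF covers_sumset[OF AA AA] cov4] by (simp add: numeral_eq_Suc ac_simps)
 have "covers (c * c * a ^ 7) (diffset At At) Q2"
 proof (rule covers_trans[OF _ AAAA])
  have "covers (c * c) (diffset At At) (sumset (diffset C C) (diffset C C))"
   unfolding diffset_eq_sumset[of At] by (rule covers_sumset[OF covAt covers_uminus[OF covAt diffset_self_minus]])
  thus "covers (c * c) (diffset At At) (sumset (diffset A A) (diffset A A))"
   by (rule covers_mono) (use sumset_mono[OF diffset_mono[OF CA CA] diffset_mono[OF CA CA]] in auto)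
 qed
 moreover have "covers (11 ^ CARD('n)) (vbx (\<lambda>_. 5) :: (real^'n) set) ?V" using covers_vbx[of 5, where 'n = 'n] by simp
 ultimately have fin: "covers (c * c * a ^ 7 * 11 ^ CARD('n)) (sumset (diffset At At) (vbx (\<lambda>_. 5))) (sumset Q2 ?V)"
  by (rule covers_sumset)
 have sub: "(*) x ` sumset (diffset D D) ?V \<subseteq> sumset (diffset At At) (vbx (\<lambda>_. 5))"
 proof
  fix z assume "z \<in> (*) x ` sumset (diffset D D) ?V"
  then obtain d d' v where z: "d \<in> D" "d' \<in> D" "v \<in> ?V" "z = x * (d - d' + v)" by (auto elim!: sumsetE diffsetE)
  obtain e where e: "e \<in> diffset At At" "x * (d - d') - e \<in> vbx (\<lambda>_. 3)" using D[OF z(1,2)] by blast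
  have "x * v \<in> vbx (\<lambda>_. 2)"
  proof -
   have "\<bar>x $ i * v $ i\<bar> \<le> 2 * 1" for i unfolding abs_mult using x z(3) unfolding vbx_def by (intro mult_mono) auto
   thus ?thesis unfolding vbx_def by simp
  qed
  from vbx_add[OF e(2) this] have "x * (d - d') - e + x * v \<in> vbx (\<lambda>_. 5)" by simp
  from sumsetI[OF e(1) this] show "z \<in> sumset (diffset At At) (vbx (\<lambda>_. 5))" unfolding z(4) by (simp add: algebra_simps)
 qed
 have "covers (b * 1) (sumset Q2 ?V) (sumset (diffset D D) ?V)" by (intro covers_sumset covD covers_refl) auto
 hence "covers b ((*) x ` sumset Q2 ?V) ((*) x ` sumset (diffset D D) ?V)" by (intro covers_dilate) simp
 hence "covers b ((*) x ` sumset Q2 ?V) (sumset (diffset At At) (vbx (\<lambda>_. 5)))"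
  by (rule covers_mono) (use sub in auto)
 from covers_trans[OF this fin] show ?thesis by (simp add: power2_eq_square)
qed

lemma card_separated_thicken:
 fixes Q2 :: "(real^'n) set"
 assumes "finite Q2" "E \<subseteq> sumset Q2 (vbx (\<lambda>_. 1))" "finite E" "separated (\<lambda>_. 1) E"
 shows "real (card E) \<le> real (card Q2) * 3 ^ CARD('n)"
proof -
 let ?F = "\<lambda>q. {x \<in> E. x - q \<in> vbx (\<lambda>_. 1)}"
 have "E \<subseteq> (\<Union>q\<in>Q2. ?F q)"
 proof
  fix x assume x: "x \<in> E"
  then obtain q v where "q \<in> Q2" "v \<in> vbx (\<lambda>_. 1)" "x = q + v" using assms(2) by (meson sumsetE subsetD)
  thus "x \<in> (\<Union>q\<in>Q2. ?F q)" using x by (intro UN_I[of q]) auto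
 qed
 hence "real (card E) \<le> (\<Sum>q\<in>Q2. real (card (?F q)))" using assms by (intro card_le_sum_card) auto
 also have "\<dots> \<le> (\<Sum>q\<in>Q2. 3 ^ CARD('n))"
 proof (rule sum_mono)
  fix q
  have "real (card (?F q)) \<le> (\<Prod>i\<in>(UNIV :: 'n set). (2 * 1 / 1 + 1))"
   by (rule card_separated_le(2)[of _ q]) (use separated_mono[OF assms(4), of "?F q" "\<lambda>_. 1"] in auto)
  thus "real (card (?F q)) \<le> 3 ^ CARD('n)" by simp
 qed
 finally show ?thesis by simp
qed

lemma approx_group_mono: "approx_group H K R \<Longrightarrow> K \<le> K' \<Longrightarrow> R \<le> R' \<Longrightarrow> approx_group H K' R'"
 unfolding approx_group_def
proof (intro conjI, goal_cases)
 case 3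
 have "vbx (\<lambda>_. R) \<subseteq> (vbx (\<lambda>_. R') :: (real^'a) set)" using \<open>R \<le> R'\<close> by (intro subsetI) (rule vbx_mono)
 thus ?case using 3 by (meson order_trans)
next
 case 5
 thus ?case using covers_mono[OF _ order.refl _ order.refl] by meson
qed auto

section \<open>Stagnation implies a small collision probability\<close>

text \<open>For each popular \<open>t\<close>, \<open>dilate_BSG\<close> gives a set
  \<open>AA t\<close> of cells and the set \<open>EE t\<close> of points whose dilates by
  \<open>t\<close> land in it after a shift. The \<open>AA t\<close> may be unrelated to each other.
  It is a \<open>t0\<close> for which both \<open>AA t \<inter> AA t0\<close> and
  \<open>EE t \<inter> EE t0\<close> are large, for many \<open>t\<close>, that produces one group
  \<open>H\<close> and many ratios almost stabilising it.\<close>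

theorem stagnation_bound:
 fixes \<kappa> \<gamma> :: real
 assumes kap: "0 < \<kappa>" "\<kappa> \<le> 1" and gam: "0 < \<gamma>" "\<gamma> \<le> 1"
 shows "\<exists>\<epsilon>>0. eventually (\<lambda>R. \<forall>(T :: (real^'n) set) m S w.
   finite T \<longrightarrow> (\<forall>t\<in>T. \<forall>i. 1/2 \<le> t $ i \<and> t $ i \<le> 1) \<longrightarrow> (\<forall>t\<in>T. m t \<ge> 0) \<longrightarrow> (\<Sum>t\<in>T. m t) = 1 \<longrightarrow>
   (\<forall>v a \<rho>. norm v = 1 \<longrightarrow> 1 / R \<le> \<rho> \<longrightarrow> (\<Sum>t\<in>{t \<in> T. \<bar>v \<bullet> t - a\<bar> \<le> \<rho>}. m t) \<le> R powr \<epsilon> * \<rho> powr \<kappa>) \<longrightarrow>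
   finite S \<longrightarrow> S \<subseteq> vbx (\<lambda>_. R / 8) \<longrightarrow> (\<forall>y\<in>S. w y \<ge> 0) \<longrightarrow> (\<Sum>y\<in>S. w y) = 1 \<longrightarrow>
   (\<forall>k a \<rho>. 1 / R \<le> \<rho> \<longrightarrow> (\<Sum>y\<in>{y \<in> S. \<bar>y $ k - a\<bar> \<le> \<rho> * R}. w y) \<le> R powr \<epsilon> * \<rho> powr \<kappa>) \<longrightarrow>
   coll S w flr / R powr \<epsilon> \<le> coll ((T \<times> T) \<times> (S \<times> S)) (pw (pw m m) (pw w w)) (\<lambda>x. flr (dilate_diff x)) \<longrightarrow>
   coll S w flr \<le> R powr (\<gamma> - real CARD('n))) at_top"
proof -
 have g2: "0 < \<gamma> / 2" "\<gamma> / 2 \<le> 1" using gam by auto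
 obtain e0 where e0: "e0 > 0" and core: "eventually (\<lambda>R. \<forall>(H :: (real^'n) set) K X w A u.
   approx_group H K R \<longrightarrow> K \<le> R powr e0 \<longrightarrow>
   finite X \<longrightarrow> X \<subseteq> approx_group.stab H K \<longrightarrow> X \<subseteq> vbx (\<lambda>_. 2) \<longrightarrow> (\<forall>x\<in>X. w x \<ge> 0) \<longrightarrow> (\<Sum>x\<in>X. w x) \<ge> 1 / K \<longrightarrow>
   (\<forall>v a \<rho>. norm v = 1 \<longrightarrow> 1 / R \<le> \<rho> \<longrightarrow> (\<Sum>x\<in>{x \<in> X. \<bar>v \<bullet> x - a\<bar> \<le> \<rho>}. w x) \<le> K * \<rho> powr \<kappa>) \<longrightarrow>
   finite A \<longrightarrow> covers K A H \<longrightarrow> (\<forall>x\<in>A. u x \<ge> 0) \<longrightarrow> (\<Sum>x\<in>A. u x) \<ge> 1 / K \<longrightarrow>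
   (\<forall>k a \<rho>. 1 / R \<le> \<rho> \<longrightarrow> (\<Sum>x\<in>{x \<in> A. \<bar>x $ k - a\<bar> \<le> \<rho> * R}. u x) \<le> K * \<rho> powr \<kappa>) \<longrightarrow>
   (\<forall>E\<subseteq>H. finite E \<longrightarrow> separated (\<lambda>_. 1) E \<longrightarrow> real (card E) \<le> R powr (real CARD('n) - \<gamma> / 2)) \<longrightarrow> False) at_top"
  using core_contradiction[OF kap g2] by blast
 \<comment> \<open>All constants are absorbed into powers of
   \<open>M \<le> R powr (\<epsilon> * 2)\<close>. The group constant is \<open>M ^ 1100\<close>,
   whence 2200; the packing bound needs \<open>M ^ 58 \<le> R powr (\<gamma> / 2)\<close>, for which
   240 suffices.\<close>
 define \<epsilon> where "\<epsilon> = min (e0 / 2200) (\<gamma> / 240)"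
 have ep: "\<epsilon> > 0" "\<epsilon> * 2200 \<le> e0" "\<epsilon> * 240 \<le> \<gamma>" unfolding \<epsilon>_def using e0 gam by auto
 have ev: "eventually (\<lambda>R. R \<ge> 10 \<and> 32 * 54 ^ CARD('n) < R powr \<epsilon>) at_top"
  using ep by (intro eventually_conj eventually_ge_at_top eventually_less_powr)
 show ?thesis
 proof (intro exI[of _ \<epsilon>] conjI ep(1), rule eventually_mono[OF eventually_conj[OF core ev]], intro allI impI, elim conjE)
  fix R :: real and T S :: "(real^'n) set" and m w :: "real^'n \<Rightarrow> real"
  assume core: "\<forall>(H :: (real^'n) set) K X w A u.
   approx_group H K R \<longrightarrow> K \<le> R powr e0 \<longrightarrow>
   finite X \<longrightarrow> X \<subseteq> approx_group.stab H K \<longrightarrow> X \<subseteq> vbx (\<lambda>_. 2) \<longrightarrow> (\<forall>x\<in>X. w x \<ge> 0) \<longrightarrow> (\<Sum>x\<in>X. w x) \<ge> 1 / K \<longrightarrow>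
   (\<forall>v a \<rho>. norm v = 1 \<longrightarrow> 1 / R \<le> \<rho> \<longrightarrow> (\<Sum>x\<in>{x \<in> X. \<bar>v \<bullet> x - a\<bar> \<le> \<rho>}. w x) \<le> K * \<rho> powr \<kappa>) \<longrightarrow>
   finite A \<longrightarrow> covers K A H \<longrightarrow> (\<forall>x\<in>A. u x \<ge> 0) \<longrightarrow> (\<Sum>x\<in>A. u x) \<ge> 1 / K \<longrightarrow>
   (\<forall>k a \<rho>. 1 / R \<le> \<rho> \<longrightarrow> (\<Sum>x\<in>{x \<in> A. \<bar>x $ k - a\<bar> \<le> \<rho> * R}. u x) \<le> K * \<rho> powr \<kappa>) \<longrightarrow>
   (\<forall>E\<subseteq>H. finite E \<longrightarrow> separated (\<lambda>_. 1) E \<longrightarrow> real (card E) \<le> R powr (real CARD('n) - \<gamma> / 2)) \<longrightarrow> False"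
  assume R10: "10 \<le> R" and Rbig: "32 * 54 ^ CARD('n) < R powr \<epsilon>"
  assume finT: "finite T" and T: "\<forall>t\<in>T. \<forall>i. 1/2 \<le> t $ i \<and> t $ i \<le> 1" and m0: "\<forall>t\<in>T. m t \<ge> 0" and m1: "(\<Sum>t\<in>T. m t) = 1"
  assume stripT: "\<forall>v a \<rho>. norm v = 1 \<longrightarrow> 1 / R \<le> \<rho> \<longrightarrow> (\<Sum>t\<in>{t \<in> T. \<bar>v \<bullet> t - a\<bar> \<le> \<rho>}. m t) \<le> R powr \<epsilon> * \<rho> powr \<kappa>"
  assume finS: "finite S" and SR: "S \<subseteq> vbx (\<lambda>_. R / 8)" and w0: "\<forall>y\<in>S. w y \<ge> 0" and w1: "(\<Sum>y\<in>S. w y) = 1"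
  assume stripS: "\<forall>k a \<rho>. 1 / R \<le> \<rho> \<longrightarrow> (\<Sum>y\<in>{y \<in> S. \<bar>y $ k - a\<bar> \<le> \<rho> * R}. w y) \<le> R powr \<epsilon> * \<rho> powr \<kappa>"
  assume stag: "coll S w flr / R powr \<epsilon> \<le> coll ((T \<times> T) \<times> (S \<times> S)) (pw (pw m m) (pw w w)) (\<lambda>x. flr (dilate_diff x))"
  define Q where "Q = coll S w flr"
  show "coll S w flr \<le> R powr (\<gamma> - real CARD('n))"
  proof (rule ccontr)
   assume "\<not> coll S w flr \<le> R powr (\<gamma> - real CARD('n))"
   hence Qbig: "Q > R powr (\<gamma> - real CARD('n))" unfolding Q_def by simp
   hence Q0: "Q > 0" using order.strict_trans1[OF powr_ge_zero] by blast
   define K where "K = R powr \<epsilon>"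
   have K1: "K \<ge> 1" unfolding K_def using R10 ep by (intro ge_one_powr_ge_zero) auto
   define KK where "KK = 2 * 6 ^ CARD('n) * K"
   define M where "M = 16 * 9 ^ CARD('n) * KK"
   define n where "n = CARD('n)"
   have six: "(6::real) ^ n \<ge> 1" "(9::real) ^ n \<ge> 1" "(54::real) ^ n = 9 ^ n * 6 ^ n" by (simp_all add: power_mult_distrib[symmetric])
   have KKK: "KK \<ge> K"

   proof -
    have "1 \<le> 2 * (6::real) ^ n" using six(1) by linarith
    from mult_right_mono[OF this, of K] show ?thesis unfolding KK_def n_def[symmetric] using K1 by simp
   qed
   have MKK: "M \<ge> 16 * 9 ^ n" "M \<ge> KK"
   proof -
    have "16 * 9 ^ n * 1 \<le> 16 * 9 ^ n * KK" using KKK K1 by (intro mult_left_mono) auto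
    thus "M \<ge> 16 * 9 ^ n" unfolding M_def n_def[symmetric] by simp
    have "1 \<le> 16 * (9::real) ^ n" using six(2) by linarith
    hence "1 * KK \<le> 16 * 9 ^ n * KK" using KKK K1 by (intro mult_right_mono) auto
    thus "M \<ge> KK" unfolding M_def n_def[symmetric] by simp
   qed
   have M16: "M \<ge> 16" using MKK(1) six(2) by linarith
   have M9: "9 ^ n \<le> M" using MKK(1) six(2) by linarith
   have MR: "M \<le> R powr (\<epsilon> * 2)"
   proof -
    have "M = (32 * 54 ^ n) * K" unfolding M_def KK_def n_def[symmetric] six(3) by simp
    also have "\<dots> \<le> R powr \<epsilon> * R powr \<epsilon>" unfolding K_def n_def using Rbig by (intro mult_right_mono) auto
    finally show ?thesis by (simp add: powr_add[symmetric] mult.commute)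
   qed
   \<comment> \<open>Numerical factors are traded for powers of \<open>M\<close>, which is at least
     16.\<close>
   have Mpow: "c * M ^ j \<le> M ^ k" if "c \<le> M ^ i" "i + j \<le> k" for c i j k
   proof -
    have "c * M ^ j \<le> M ^ i * M ^ j" using that(1) M16 by (intro mult_right_mono) auto
    also have "\<dots> = M ^ (i + j)" by (simp add: power_add)
    also have "\<dots> \<le> M ^ k" using that(2) M16 by (intro power_increasing) auto
    finally show ?thesis .
   qed
   have M2: "256 \<le> M ^ 2" using power_mono[OF M16, of 2] by simp
   have M3: "4096 \<le> M ^ 3" using power_mono[OF M16, of 3] by simp
   have M4: "65536 \<le> M ^ 4" using power_mono[OF M16, of 4] by simp
   have Mle: "M ^ i \<le> M ^ j" if "i \<le> j" for i j using that M16 by (intro power_increasing) auto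
   have T': "\<And>t i. t \<in> T \<Longrightarrow> 1/2 \<le> t $ i" "\<And>t i. t \<in> T \<Longrightarrow> t $ i \<le> 1" using T by auto
   have m0': "\<And>t. t \<in> T \<Longrightarrow> m t \<ge> 0" and w0': "\<And>y. y \<in> S \<Longrightarrow> w y \<ge> 0" using m0 w0 by auto
   obtain \<tau> G where G: "\<tau> \<in> T" "G \<subseteq> T" "(\<Sum>t\<in>G. m t) \<ge> 1 / KK"
    "\<And>t. t \<in> G \<Longrightarrow> coll (S \<times> S) (pw w w) (\<lambda>(y1, y2). flr (\<tau> * y1) - flr (t * y2)) \<ge> Q / KK"
    using stagnation_popular_dilates[OF finT T'(1) m0' m1 finS w0' w1 _ _ stag] K1 Q0
    unfolding KK_def[symmetric] K_def[symmetric] Q_def[symmetric] by auto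
   \<comment> \<open>The light points of \<open>dilate_BSG\<close>. The set depends on neither
     \<open>t\<close> nor \<open>\<tau>\<close>, so all \<open>EE t\<close> live in the same
     space.\<close>
   define S0 where "S0 = {y \<in> S. mass S w flr (flr y) \<le> 16 * 3 ^ CARD('n) * KK * Q}"
   have S0S: "S0 \<subseteq> S" unfolding S0_def by blast
   have finS0: "finite S0" unfolding S0_def using finS by simp
   have w0S: "\<And>y. y \<in> S0 \<Longrightarrow> w y \<ge> 0" using w0' S0S by blast
   have wS0: "(\<Sum>y\<in>S0. w y) \<le> 1" unfolding w1[symmetric] using finS S0S w0' by (intro sum_mono2) auto
   define p where "p = mass S0 w (\<lambda>y. flr (\<tau> * y))"
   define Z0 where "Z0 = (\<lambda>y. flr (\<tau> * y)) ` S0"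
   have finZ0: "finite Z0" unfolding Z0_def using finS0 by simp
   define good where "good t As \<longleftrightarrow> fst As \<subseteq> Z0 \<and> (\<Sum>a\<in>fst As. p a) \<ge> 1 / (8 * M\<^sup>2) \<and>
     (\<Sum>y\<in>{y \<in> S0. snd As + flr (t * y) \<in> fst As}. w y) \<ge> 1 / (8 * M\<^sup>2) \<and> real (card (diffset (fst As) (fst As))) \<le> 2048 * M ^ 5 / Q" for t and As :: "(real^'n) set \<times> (real^'n)"
   have "\<exists>As. good t As" if t: "t \<in> G" for t
   proof -
    have tT: "t \<in> T" using t G(2) by blast
    obtain A s where "A \<subseteq> Z0" "(\<Sum>a\<in>A. p a) \<ge> 1 / (8 * M\<^sup>2)"
     "(\<Sum>y\<in>{y \<in> S0. s + flr (t * y) \<in> A}. w y) \<ge> 1 / (8 * M\<^sup>2)" "real (card (diffset A A)) \<le> 2048 * M ^ 5 / Q"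
     using dilate_BSG[OF finS w0' w1 Q_def Q0 _ T'(1)[OF G(1)] T'(1)[OF tT] G(4)[OF t]] KKK K1
     unfolding M_def[symmetric] S0_def[symmetric] p_def[symmetric] Z0_def[symmetric] by auto
    thus ?thesis unfolding good_def by (intro exI[of _ "(A, s)"]) simp
   qed
   then obtain F where F: "\<forall>t\<in>G. good t (F t)" using bchoice[of G good] by blast
   define AA where "AA t = fst (F t)" for t
   define ss where "ss t = snd (F t)" for t
   define EE where "EE t = {y \<in> S0. ss t + flr (t * y) \<in> AA t}" for t
   have AA: "AA t \<subseteq> Z0" "(\<Sum>a\<in>AA t. p a) \<ge> 1 / (8 * M\<^sup>2)" "(\<Sum>y\<in>EE t. w y) \<ge> 1 / (8 * M\<^sup>2)"
    "real (card (diffset (AA t) (AA t))) \<le> 2048 * M ^ 5 / Q" if "t \<in> G" for t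
    using bspec[OF F that] unfolding good_def AA_def EE_def ss_def by auto
   have finAA: "finite (AA t)" if "t \<in> G" for t using AA(1)[OF that] finZ0 finite_subset by blast
   have EES: "EE t \<subseteq> S0" for t unfolding EE_def by blast
   have finEE: "finite (EE t)" for t using EES finS0 finite_subset by blast
   have p0: "p a \<ge> 0" for a unfolding p_def using w0S by (rule mass_nonneg)
   have pZ: "(\<Sum>a\<in>Z0. p a) \<le> 1" unfolding p_def Z0_def sum_mass_image[OF finS0] by (rule wS0)
   have light: "mass S0 w (\<lambda>y. flr (t * y)) c \<le> M * Q" if "t \<in> T" for t c
   proof -
    have "mass S0 w (\<lambda>y. flr (t * y)) c \<le> 3 ^ CARD('n) * (16 * 3 ^ CARD('n) * KK * Q)"
     unfolding S0_def using KKK K1 Q0 by (intro mass_dilate_light[OF finS w0' T'(1)[OF that]]) auto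
    also have "\<dots> = M * Q"
    proof -
     have "(9::real) ^ CARD('n) = 3 ^ CARD('n) * 3 ^ CARD('n)" by (simp add: power_mult_distrib[symmetric])
     thus ?thesis unfolding M_def by simp
    qed
    finally show ?thesis .
   qed
   define \<beta> where "\<beta> = 1 / (8 * M\<^sup>2) * (1 / (8 * M\<^sup>2))"
   have mG0: "(\<Sum>t\<in>G. m t) > 0"
   proof -
    have "1 / KK > 0" using KKK K1 by simp
    thus ?thesis using G(3) by (rule order.strict_trans2)
   qed
   have be0: "\<beta> \<ge> 0" unfolding \<beta>_def by simp
   have finG: "finite G" using G(2) finT finite_subset by blast
   \<comment> \<open>Applied to the products of \<open>AA t\<close> and \<open>EE t\<close>, so that
     one \<open>t0\<close> makes both intersections large at once.\<close>
   obtain t0 X where t0: "t0 \<in> G" "X \<subseteq> G" "(\<Sum>t\<in>X. m t) \<ge> (\<Sum>t\<in>G. m t) * (\<beta>\<^sup>2 / 2)"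
    "\<And>t. t \<in> X \<Longrightarrow> (\<Sum>z\<in>(AA t \<times> EE t) \<inter> (AA t0 \<times> EE t0). pw p w z) \<ge> \<beta>\<^sup>2 / 2"
   proof (rule popular_intersections[of G "Z0 \<times> S0" m "pw p w" "\<lambda>t. AA t \<times> EE t" \<beta>])
    show "m t \<ge> 0" if "t \<in> G" for t using that G(2) m0' by blast
    show "pw p w z \<ge> 0" if "z \<in> Z0 \<times> S0" for z using that p0 w0S by (intro pw_nonneg[of Z0 p S0]) auto
    show "(\<Sum>z\<in>Z0 \<times> S0. pw p w z) \<le> 1" unfolding sum_pw using pZ wS0 w0S by (intro mult_le_one sum_nonneg) auto
    show "AA t \<times> EE t \<subseteq> Z0 \<times> S0" if "t \<in> G" for t using AA(1)[OF that] EES by blast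
    show "\<beta> \<le> (\<Sum>z\<in>AA t \<times> EE t. pw p w z)" if "t \<in> G" for t
     unfolding sum_pw \<beta>_def using AA(2,3)[OF that] p0 by (intro mult_mono sum_nonneg) auto
   qed (use finG finZ0 finS0 mG0 be0 in auto)
   have b2: "\<beta>\<^sup>2 / 2 \<ge> 1 / M ^ 12"
   proof -
    have "\<beta>\<^sup>2 / 2 = 1 / (8192 * M ^ 8)" unfolding \<beta>_def by (simp add: power_divide power_mult_distrib power_mult[symmetric] field_simps)
    moreover have "8192 * M ^ 8 \<le> M ^ 12" by (rule Mpow[of _ 4]) (use M4 in auto)
    ultimately show ?thesis using M16 by (simp add: frac_le)
   qed
   have XG: "t \<in> G" if "t \<in> X" for t using that t0(2) by blast
   have XT: "t \<in> T" if "t \<in> X" for t using XG[OF that] G(2) by blast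
   have t0T: "t0 \<in> T" using t0(1) G(2) by blast
   define A where "A = AA t0"
   have inter: "(\<Sum>a\<in>AA t \<inter> A. p a) \<ge> 1 / M ^ 12" "(\<Sum>y\<in>EE t \<inter> EE t0. w y) \<ge> 1 / M ^ 12" if t: "t \<in> X" for t
   proof -
    have "1 / M ^ 12 \<le> (\<Sum>z\<in>(AA t \<inter> A) \<times> (EE t \<inter> EE t0). pw p w z)"
     using order_trans[OF b2 t0(4)[OF t]] unfolding A_def Times_Int_Times .
    hence pr: "1 / M ^ 12 \<le> (\<Sum>a\<in>AA t \<inter> A. p a) * (\<Sum>y\<in>EE t \<inter> EE t0. w y)" unfolding sum_pw .
    have a1: "(\<Sum>a\<in>AA t \<inter> A. p a) \<le> 1" by (rule order_trans[OF sum_mono2 pZ]) (use finZ0 p0 AA(1)[OF XG[OF t]] in auto)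
    have e1: "(\<Sum>y\<in>EE t \<inter> EE t0. w y) \<le> 1" by (rule order_trans[OF sum_mono2 wS0]) (use finS0 w0S EES in auto)
    have a0: "(\<Sum>a\<in>AA t \<inter> A. p a) \<ge> 0" using p0 by (intro sum_nonneg)
    have e0: "(\<Sum>y\<in>EE t \<inter> EE t0. w y) \<ge> 0" using EES w0S by (intro sum_nonneg) blast
    show "(\<Sum>a\<in>AA t \<inter> A. p a) \<ge> 1 / M ^ 12" using pr mult_left_mono[OF e1 a0] by simp
    show "(\<Sum>y\<in>EE t \<inter> EE t0. w y) \<ge> 1 / M ^ 12" using pr mult_right_mono[OF a1 e0] by simp
   qed
   have MQ: "M * Q > 0" using M16 Q0 by simp
   \<comment> \<open>No cell has mass above \<open>M * Q\<close>, so a lower bound on mass is a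
     lower bound on the number of cells.\<close>
   have cardge: "real (card C) \<ge> x / (M * Q)" if "(\<Sum>c\<in>C. f c) \<ge> x" "\<And>c. c \<in> C \<Longrightarrow> f c \<le> M * Q" for C :: "(real^'n) set" and f x
   proof -
    have "x \<le> (\<Sum>c\<in>C. M * Q)" using that(1) sum_mono[OF that(2)] by (rule order_trans)
    also have "\<dots> = real (card C) * (M * Q)" by simp
    finally show ?thesis using MQ by (simp add: pos_divide_le_eq)
   qed
   have finA: "finite A" unfolding A_def using finAA t0(1) .
   have pl: "p c \<le> M * Q" for c unfolding p_def using light[OF G(1)] .
   have cA: "real (card A) \<ge> 1 / (M ^ 4 * Q)"
   proof -
    have "real (card A) \<ge> 1 / (8 * M\<^sup>2) / (M * Q)" unfolding A_def using AA(2)[OF t0(1)] pl by (rule cardge)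
    moreover have "1 / (8 * M\<^sup>2) / (M * Q) = 1 / (8 * M ^ 3 * Q)" by (simp add: power2_eq_square power3_eq_cube)
    moreover have "8 * M ^ 3 * Q \<le> M ^ 4 * Q" using Q0 M16 by (intro mult_right_mono Mpow[of _ 1]) auto
    moreover have "1 / (M ^ 4 * Q) \<le> 1 / (8 * M ^ 3 * Q)" using Q0 M16 calculation(3) by (intro divide_left_mono) auto
    ultimately show ?thesis by linarith
   qed
   have K2: "real (card (diffset (AA t) (AA t))) \<le> M ^ 8 / Q" if "t \<in> G" for t
   proof -
    have "2048 * M ^ 5 \<le> M ^ 8" by (rule Mpow[of _ 3]) (use M3 in auto)
    hence "2048 * M ^ 5 / Q \<le> M ^ 8 / Q" using Q0 by (intro divide_right_mono) auto
    thus ?thesis using AA(4)[OF that] by linarith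
   qed
   have neA: "A \<noteq> {}"
   proof
    assume "A = {}"
    hence "1 / (M ^ 4 * Q) \<le> 0" using cA by simp
    thus False using Q0 M16 by (simp add: divide_le_0_iff mult_le_0_iff power_le_zero_eq)
   qed
   have dblA: "real (card (diffset A A)) \<le> M ^ 12 * real (card A)"
   proof -
    have "real (card (diffset A A)) \<le> M ^ 8 / Q" unfolding A_def by (rule K2[OF t0(1)])
    also have "\<dots> = M ^ 12 * (1 / (M ^ 4 * Q))" using M16 Q0 by (simp add: field_simps power_add[symmetric])
    also have "\<dots> \<le> M ^ 12 * real (card A)" using cA M16 by (intro mult_left_mono) auto
    finally show ?thesis .
   qed
   interpret sd: small_doubling A "M ^ 12"
    by unfold_locales (use finA neA dblA M16 in auto)
   define a where "a = M ^ 138"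
   have e24: "(M ^ 12)\<^sup>2 = M ^ 24" by (simp add: power_mult[symmetric])
   have a1: "a \<ge> 1" unfolding a_def using M16 by simp
   have covA: "covers a A sd.Q2"
   proof (rule covers_mono[OF sd.covers_A])
    have "2 * (2 * (M ^ 12)\<^sup>2) ^ 1 * M ^ 12 = 4 * M ^ 36" unfolding e24 by (simp add: power_add[symmetric])
    also have "\<dots> \<le> a" unfolding a_def by (rule Mpow[of _ 1]) (use M16 in auto)
    finally show "2 * (2 * (M ^ 12)\<^sup>2) ^ 1 * M ^ 12 \<le> a" .
   qed auto
   have cov4: "covers a (sumset sd.Q2 sd.Q2) sd.Q2"
   proof (rule covers_mono[OF sd.covers_4])
    have "2 * (2 * (M ^ 12)\<^sup>2) ^ 5 * M ^ 12 = 64 * M ^ 132" unfolding e24 by (simp add: power_mult_distrib power_mult[symmetric] power_add[symmetric])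
    also have "\<dots> \<le> a" unfolding a_def by (rule Mpow[of _ 2]) (use M2 in auto)
    finally show "2 * (2 * (M ^ 12)\<^sup>2) ^ 5 * M ^ 12 \<le> a" .
   qed auto
   have D2: "(2 * (M ^ 12)\<^sup>2) ^ 2 * real (card (diffset A A)) \<le> M ^ 57 / Q"
   proof -
    have "(2 * (M ^ 12)\<^sup>2) ^ 2 * real (card (diffset A A)) \<le> (2 * (M ^ 12)\<^sup>2) ^ 2 * (M ^ 8 / Q)"
     unfolding A_def using K2[OF t0(1)] by (intro mult_left_mono) auto
    also have "\<dots> = (4 * M ^ 56) / Q" unfolding e24 by (simp add: power_mult_distrib power_mult[symmetric] power_add[symmetric])
    also have "\<dots> \<le> M ^ 57 / Q" using Q0 M16 by (intro divide_right_mono Mpow[of _ 1]) auto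
    finally show ?thesis .
   qed
   define H where "H = sumset sd.Q2 (vbx (\<lambda>_. 1))"
   have Abox: "A \<subseteq> vbx (\<lambda>_. R / 8 + 1)"
   proof
    fix x assume "x \<in> A"
    then obtain y where y: "y \<in> S0" "x = flr (\<tau> * y)" using AA(1)[OF t0(1)] unfolding A_def Z0_def by blast
    have "\<bar>x $ i\<bar> \<le> R / 8 + 1" for i
    proof -
     have "\<bar>\<tau> $ i * y $ i\<bar> \<le> 1 * (R / 8)" unfolding abs_mult
      using T'[OF G(1), of i] y(1) S0S SR by (intro mult_mono) (auto simp: vbx_def)
     thus ?thesis unfolding y(2) by simp linarith
    qed
    thus "x \<in> vbx (\<lambda>_. R / 8 + 1)" unfolding vbx_def by simp
   qed
   have Pbox: "sd.P \<subseteq> vbx (\<lambda>_. R / 4 + 2)"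
   proof
    fix x assume "x \<in> sd.P"
    hence "x \<in> diffset A A" unfolding sd.P_def using popular_subset by blast
    then obtain b c where bc: "b \<in> A" "c \<in> A" "x = b + - c" by (auto elim: diffsetE)
    have "b + - c \<in> vbx (\<lambda>_. (R / 8 + 1) + (R / 8 + 1))" using bc Abox by (intro vbx_add vbx_uminus) auto
    thus "x \<in> vbx (\<lambda>_. R / 4 + 2)" unfolding bc(3) by (rule vbx_mono) simp
   qed
   have Q2box: "sd.Q2 \<subseteq> vbx (\<lambda>_. R / 2 + 4)"
   proof
    fix x assume "x \<in> sd.Q2"
    then obtain b c where bc: "b \<in> sd.P" "c \<in> sd.P" "x = b + c" unfolding sd.Q2_def by (rule sumsetE)
    have "b + c \<in> vbx (\<lambda>_. (R / 4 + 2) + (R / 4 + 2))" using bc Pbox by (intro vbx_add) auto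
    thus "x \<in> vbx (\<lambda>_. R / 2 + 4)" unfolding bc(3) by (rule vbx_mono) simp
   qed
   \<comment> \<open>The largest price that occurs is \<open>M ^ 1080\<close>, in the stability of
     the ratios.\<close>
   define Kc where "Kc = M ^ 1100"
   have Kc1: "Kc \<ge> M ^ j" if "j \<le> 1100" for j unfolding Kc_def by (rule Mle[OF that])
   have Kcpos: "Kc > 0" unfolding Kc_def using M16 by simp
   have n5: "5 ^ n \<le> M" by (rule order_trans[OF power_mono M9]) auto
   have n3: "3 ^ n \<le> M" by (rule order_trans[OF power_mono M9]) auto
   have n11: "11 ^ n \<le> M ^ 2"
   proof -
    have "(11::real) ^ n \<le> 81 ^ n" by (intro power_mono) auto
    also have "\<dots> = 9 ^ n * 9 ^ n" by (simp add: power_mult_distrib[symmetric])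
    also have "\<dots> \<le> M * M" using M9 M16 by (intro mult_mono) auto
    finally show ?thesis by (simp add: power2_eq_square)
   qed
   have grp: "approx_group H Kc R"
   proof (rule approx_group_mono)
    show "approx_group H (a * 5 ^ CARD('n)) (R / 2 + 4 + 1)"
     unfolding H_def using sd.Q2_minus sd.zero_Q2 cov4 a1 Q2box by (rule approx_group_thicken)
    have "a * 5 ^ n \<le> M ^ 138 * M" unfolding a_def using n5 M16 by (intro mult_left_mono) auto
    also have "\<dots> = M ^ 139" by (simp add: power_add[symmetric] flip: power_Suc2)
    also have "\<dots> \<le> Kc" by (rule Kc1) simp
    finally show "a * 5 ^ CARD('n) \<le> Kc" unfolding n_def .
    show "R / 2 + 4 + 1 \<le> R" using R10 by simp
   qed
   have KcR: "Kc \<le> R powr e0"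
   proof -
    have "Kc \<le> (R powr (\<epsilon> * 2)) ^ 1100" unfolding Kc_def using MR M16 by (intro power_mono) auto
    also have "\<dots> = R powr (\<epsilon> * 2200)" using R10 by (simp add: powr_realpow[symmetric] powr_powr mult.commute)
    also have "\<dots> \<le> R powr e0" using ep R10 by (intro powr_mono) auto
    finally show ?thesis .
   qed
   have stb: "t * vinv t0 \<in> approx_group.stab H Kc" "t * vinv t0 \<in> vbx (\<lambda>_. 2)" if t: "t \<in> X" for t
   proof -
    let ?x = "t * vinv t0"
    have t0p: "t0 $ i > 0" "1 / t0 $ i \<le> 2" for i using T'(1)[OF t0T, of i] by (auto simp: field_simps)
    have xn: "?x $ i = t $ i / t0 $ i" for i unfolding vinv_def by (simp add: divide_inverse)
    have xb: "\<bar>?x $ i\<bar> \<le> 2" for i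
    proof -
     have "\<bar>?x $ i\<bar> = t $ i * (1 / t0 $ i)" unfolding xn using T'(1)[OF XT[OF t], of i] t0p(1)[of i] by simp
     also have "\<dots> \<le> 1 * 2" using T'[OF XT[OF t], of i] t0p[of i] by (intro mult_mono) auto
     finally show ?thesis by simp
    qed
    show x2: "?x \<in> vbx (\<lambda>_. 2)" unfolding vbx_def using xb by simp
    define D where "D = (\<lambda>y. flr (t0 * y)) ` (EE t \<inter> EE t0)"
    define C where "C = AA t \<inter> A"
    have finD: "finite D" unfolding D_def using finEE by simp
    have finC: "finite C" unfolding C_def using finA by simp
    have i13: "1 / M ^ 12 / (M * Q) = 1 / (M ^ 13 * Q)" by (simp add: power_Suc2[symmetric] mult.assoc[symmetric] flip: power_Suc2)
    have cD: "real (card D) \<ge> 1 / (M ^ 13 * Q)"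
     unfolding i13[symmetric]
    proof (rule cardge)
     have "(\<Sum>y\<in>EE t \<inter> EE t0. w y) = (\<Sum>c\<in>D. mass (EE t \<inter> EE t0) w (\<lambda>y. flr (t0 * y)) c)"
      unfolding D_def by (rule sum_mass_image[symmetric]) (use finEE in simp)
     also have "\<dots> \<le> (\<Sum>c\<in>D. mass S0 w (\<lambda>y. flr (t0 * y)) c)"
      using finS0 EES w0S by (intro sum_mono mass_mono) auto
     finally show "1 / M ^ 12 \<le> (\<Sum>c\<in>D. mass S0 w (\<lambda>y. flr (t0 * y)) c)" using inter(2)[OF t] by linarith
    qed (rule light[OF t0T])
    have cC: "real (card C) \<ge> 1 / (M ^ 13 * Q)"
     unfolding i13[symmetric] C_def using inter(1)[OF t] pl by (rule cardge)
    have pos13: "1 / (M ^ 13 * Q) > 0" using M16 Q0 by simp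
    have "covers (M ^ 70 * ((M ^ 21)\<^sup>2 * a ^ 7 * 11 ^ CARD('n))) ((*) ?x ` H) H"
     unfolding H_def
    proof (rule ratio_stabilizes[where D = D and C = C and A = A and At = "AA t"])
     show "covers (M ^ 70) sd.Q2 (diffset D D)"
     proof (rule sd.covers_translate[of D "ss t0"])
      show "D \<noteq> {}" using cD pos13 by auto
      show "ss t0 + d \<in> A" if "d \<in> D" for d using that unfolding D_def EE_def A_def by blast
      have "(2 * (M ^ 12)\<^sup>2) ^ 2 * real (card (diffset A A)) \<le> M ^ 57 / Q" by (rule D2)
      also have "\<dots> = M ^ 70 * (1 / (M ^ 13 * Q))" using M16 Q0 by (simp add: field_simps power_add[symmetric])
      also have "\<dots> \<le> M ^ 70 * real (card D)" using cD M16 by (intro mult_left_mono) auto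
      finally show "(2 * (M ^ 12)\<^sup>2) ^ 2 * real (card (diffset A A)) \<le> M ^ 70 * real (card D)" .
     qed (use finD in auto)
     show "covers (M ^ 21) (AA t) (diffset C C)"
     proof -
      \<comment> \<open>Ruzsa covering concerns sums, so it is applied to the negatives of
        \<open>C\<close>, which have the same differences.\<close>
      have dC: "diffset (uminus ` C) (uminus ` C) = diffset C C"
      proof (intro equalityI subsetI)
       fix x assume "x \<in> diffset (uminus ` C) (uminus ` C)"
       then obtain c d where cd: "c \<in> C" "d \<in> C" "x = d - c" by (auto elim!: diffsetE)
       show "x \<in> diffset C C" unfolding cd(3) using cd by (intro diffsetI)
      next
       fix x assume "x \<in> diffset C C"
       then obtain c d where cd: "c \<in> C" "d \<in> C" "x = c - d" by (rule diffsetE)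
       have "x = - d - - c" unfolding cd(3) by simp
       thus "x \<in> diffset (uminus ` C) (uminus ` C)" using diffsetI[of "- d" "uminus ` C" "- c" "uminus ` C"] cd by simp
      qed
      have le: "real (card (sumset (AA t) (uminus ` C))) \<le> M ^ 21 * real (card (uminus ` C))"
      proof -
       have "card (diffset (AA t) C) \<le> card (diffset (AA t) (AA t))"
        unfolding C_def using finAA[OF XG[OF t]] by (intro card_mono finite_diffset diffset_mono) auto
       hence "real (card (diffset (AA t) C)) \<le> M ^ 8 / Q" using K2[OF XG[OF t]] by (meson of_nat_le_iff order_trans)
       also have "\<dots> = M ^ 21 * (1 / (M ^ 13 * Q))" using M16 Q0 by (simp add: field_simps power_add[symmetric])
       also have "\<dots> \<le> M ^ 21 * real (card C)" using cC M16 by (intro mult_left_mono) auto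
       finally show ?thesis unfolding diffset_eq_sumset by (simp add: card_image)
      qed
      have "C \<noteq> {}" using cC pos13 by (metis card.empty leD of_nat_0)
      hence ne: "uminus ` C \<noteq> {}" by simp
      from covers_ruzsa[OF finAA[OF XG[OF t]] _ ne le] show ?thesis unfolding dC using finC by simp
     qed
     fix d d' assume "d \<in> D" "d' \<in> D"
     then obtain y y' where y: "y \<in> EE t \<inter> EE t0" "d = flr (t0 * y)" "y' \<in> EE t \<inter> EE t0" "d' = flr (t0 * y')" unfolding D_def by blast
     \<comment> \<open>The shift \<open>ss t\<close> cancels in the difference. Rounding puts
       \<open>d - d'\<close> within 1 of \<open>t0 * (y - y')\<close>, which the ratio at most
       doubles, and rounding \<open>t * y\<close> and \<open>t * y'\<close> costs 1 more: hence the
       radius 3.\<close>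
     let ?e = "(ss t + flr (t * y)) - (ss t + flr (t * y'))"
     have "?e \<in> diffset (AA t) (AA t)" using y unfolding EE_def by (intro diffsetI) auto
     moreover have "?x * (d - d') - ?e \<in> vbx (\<lambda>_. 3)"
     proof -
      have "\<bar>(?x * (d - d') - ?e) $ i\<bar> \<le> 3" for i
      proof -
       have e: "(?x * (d - d') - ?e) $ i = ?x $ i * (d $ i - t0 $ i * y $ i - (d' $ i - t0 $ i * y' $ i)) + ((t $ i * y $ i - flr (t * y) $ i) - (t $ i * y' $ i - flr (t * y') $ i))"
       proof -
        have xt: "?x $ i * t0 $ i = t $ i" unfolding xn using t0p(1)[of i] by simp
        have gen: "X * (b - b') - ((s + g) - (s + g')) = X * (b - u * z - (b' - u * z')) + ((v * z - g) - (v * z' - g'))"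
         if "X * u = v" for X b b' s g g' u v z z' :: real unfolding that[symmetric] by (simp add: algebra_simps)
        have "(?x * (d - d') - ?e) $ i = ?x $ i * (d $ i - d' $ i) - ((ss t $ i + flr (t * y) $ i) - (ss t $ i + flr (t * y') $ i))"
         by (simp only: vector_minus_component vector_mult_component vector_add_component)
        thus ?thesis by (rule trans[OF _ gen[OF xt]])
       qed
       have f1: "\<bar>d $ i - t0 $ i * y $ i - (d' $ i - t0 $ i * y' $ i)\<bar> \<le> 1" unfolding y by simp linarith
       have f2: "\<bar>(t $ i * y $ i - flr (t * y) $ i) - (t $ i * y' $ i - flr (t * y') $ i)\<bar> \<le> 1" by simp linarith
       have "\<bar>?x $ i * (d $ i - t0 $ i * y $ i - (d' $ i - t0 $ i * y' $ i))\<bar> \<le> 2 * 1"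
        unfolding abs_mult using xb[of i] f1 by (intro mult_mono) auto
       thus ?thesis unfolding e using f2 by linarith
      qed
      thus ?thesis unfolding vbx_def by simp
     qed
     ultimately show "\<exists>e\<in>diffset (AA t) (AA t). ?x * (d - d') - e \<in> vbx (\<lambda>_. 3)" by blast
    qed (use sd.Q2_minus cov4 covA x2 in \<open>auto simp: C_def\<close>)
    moreover have "M ^ 70 * ((M ^ 21)\<^sup>2 * a ^ 7 * 11 ^ CARD('n)) \<le> Kc"
    proof -
     have "M ^ 70 * ((M ^ 21) ^ 2 * a ^ 7 * 11 ^ n) \<le> M ^ 70 * ((M ^ 21) ^ 2 * a ^ 7 * M ^ 2)"
      using n11 M16 a1 by (intro mult_left_mono) auto
     also have "\<dots> = M ^ 1080" unfolding a_def by (simp add: power_mult[symmetric] power_add[symmetric])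
     also have "\<dots> \<le> Kc" by (rule Kc1) simp
     finally show ?thesis unfolding n_def .
    qed
    ultimately show "?x \<in> approx_group.stab H Kc"
     unfolding approx_group.stab_def[OF grp] using covers_mono by blast
   qed
   define X' where "X' = (\<lambda>t. t * vinv t0) ` X"
   define w' where "w' x = m (x * t0)" for x
   have t0p: "t0 $ i > 0" for i using T'(1)[OF t0T, of i] by simp
   have undo: "t * vinv t0 * t0 = t" for t
   proof -
    have "t $ i * inverse (t0 $ i) * t0 $ i = t $ i" for i using t0p[of i] by simp
    thus ?thesis unfolding vinv_def by (simp add: vec_eq_iff)
   qed
   have injX: "inj_on (\<lambda>t. t * vinv t0) X" by (rule inj_on_inverseI[of _ "\<lambda>x. x * t0"]) (rule undo)
   have finX: "finite X" using t0(2) finG finite_subset by blast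
   have w'sum: "(\<Sum>x\<in>{x \<in> X'. P x}. w' x) = (\<Sum>t\<in>{t \<in> X. P (t * vinv t0)}. m t)" for P
   proof -
    have "{x \<in> X'. P x} = (\<lambda>t. t * vinv t0) ` {t \<in> X. P (t * vinv t0)}" unfolding X'_def by blast
    moreover have "inj_on (\<lambda>t. t * vinv t0) {t \<in> X. P (t * vinv t0)}" by (rule inj_on_subset[OF injX]) blast
    ultimately show ?thesis unfolding w'_def by (simp add: sum.reindex undo)
   qed
   have K_Kc: "K \<le> Kc" "4 * K \<le> Kc"
   proof -
    have "K \<le> M" using KKK MKK(2) by linarith
    moreover have "4 * M ^ 1 \<le> Kc" unfolding Kc_def by (rule Mpow[of _ 1]) (use M16 in auto)
    ultimately show "4 * K \<le> Kc" by simp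
    thus "K \<le> Kc" using K1 by linarith
   qed
   have sumX: "(\<Sum>x\<in>X'. w' x) \<ge> 1 / Kc"
   proof -
    have "1 / Kc \<le> 1 / (M * M ^ 12)"
     using Kc1[of 13] M16 by (intro divide_left_mono) (auto simp: Kc_def numeral_eq_Suc)
    also have "\<dots> = 1 / M * (1 / M ^ 12)" by simp
    also have "\<dots> \<le> 1 / KK * (\<beta>\<^sup>2 / 2)" using b2 MKK(2) KKK K1 M16 by (intro mult_mono divide_left_mono) auto
    also have "\<dots> \<le> (\<Sum>t\<in>G. m t) * (\<beta>\<^sup>2 / 2)" using G(3) by (intro mult_right_mono) auto
    also have "\<dots> \<le> (\<Sum>t\<in>X. m t)" by (rule t0(3))
    also have "\<dots> = (\<Sum>x\<in>X'. w' x)" using w'sum[of "\<lambda>_. True"] by simp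
    finally show ?thesis .
   qed
   have stripX: "(\<Sum>x\<in>{x \<in> X'. \<bar>v \<bullet> x - b\<bar> \<le> \<rho>}. w' x) \<le> Kc * \<rho> powr \<kappa>" if v: "norm v = 1" and rho: "1 / R \<le> \<rho>" for v b \<rho>
   proof -
    have rho0: "\<rho> \<ge> 0" using rho R10 order_trans[of 0 "1 / R" \<rho>] by simp
    \<comment> \<open>Dividing the normal by \<open>t0\<close> transfers the strip from the ratios
      to \<open>T\<close>. The coordinates of \<open>t0\<close> are at most 1, so \<open>u\<close>
      has norm at least 1 and normalising it only narrows the strip.\<close>
    define u where "u = v * vinv t0"
    have un: "u $ i = v $ i / t0 $ i" for i unfolding u_def vinv_def by (simp add: divide_inverse)
    have nu: "norm u \<ge> 1"
    proof -
     have "norm v \<le> norm u"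
     proof (rule norm_le_componentwise_cart)
      fix i
      have "\<bar>v $ i\<bar> * 1 \<le> \<bar>v $ i\<bar> * (1 / t0 $ i)" using T'(2)[OF t0T, of i] t0p[of i] by (intro mult_left_mono) auto
      thus "norm (v $ i) \<le> norm (u $ i)" unfolding un using t0p[of i] by (simp add: abs_divide)
     qed
     thus ?thesis using v by simp
    qed
    have dot: "v \<bullet> (t * vinv t0) = u \<bullet> t" for t
     unfolding u_def inner_vec_def by (intro sum.cong refl) (simp add: ac_simps)
    have "(\<Sum>x\<in>{x \<in> X'. \<bar>v \<bullet> x - b\<bar> \<le> \<rho>}. w' x) = (\<Sum>t\<in>{t \<in> X. \<bar>u \<bullet> t - b\<bar> \<le> \<rho>}. m t)"
     using w'sum[of "\<lambda>x. \<bar>v \<bullet> x - b\<bar> \<le> \<rho>"] by (simp add: dot)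
    also have "\<dots> \<le> (\<Sum>t\<in>{t \<in> T. \<bar>(u /\<^sub>R norm u) \<bullet> t - b / norm u\<bar> \<le> \<rho>}. m t)"
    proof (rule sum_mono2)
     show "{t \<in> X. \<bar>u \<bullet> t - b\<bar> \<le> \<rho>} \<subseteq> {t \<in> T. \<bar>(u /\<^sub>R norm u) \<bullet> t - b / norm u\<bar> \<le> \<rho>}"
     proof
      fix t assume t: "t \<in> {t \<in> X. \<bar>u \<bullet> t - b\<bar> \<le> \<rho>}"
      have "(u /\<^sub>R norm u) \<bullet> t - b / norm u = (u \<bullet> t - b) / norm u" by (simp add: divide_inverse algebra_simps)
      hence "\<bar>(u /\<^sub>R norm u) \<bullet> t - b / norm u\<bar> = \<bar>u \<bullet> t - b\<bar> / norm u" by (simp add: abs_divide)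
      also have "\<dots> \<le> \<rho> / 1" using t nu rho0 by (intro frac_le) auto
      finally show "t \<in> {t \<in> T. \<bar>(u /\<^sub>R norm u) \<bullet> t - b / norm u\<bar> \<le> \<rho>}" using t XT by simp
     qed
    qed (use finT m0' in auto)
    also have "\<dots> \<le> K * \<rho> powr \<kappa>"
    proof -
     have "norm u \<noteq> 0" using nu by linarith
     hence "norm (u /\<^sub>R norm u) = 1" by simp
     thus ?thesis using stripT rho unfolding K_def by blast
    qed
    also have "\<dots> \<le> Kc * \<rho> powr \<kappa>" using K_Kc by (intro mult_right_mono) auto
    finally show ?thesis .
   qed
   have stripA: "(\<Sum>x\<in>{x \<in> A. \<bar>x $ k - b\<bar> \<le> \<rho> * R}. p x) \<le> Kc * \<rho> powr \<kappa>" if rho: "1 / R \<le> \<rho>" for k b \<rho>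
   proof -
    have rho0: "\<rho> > 0" using rho R10 order.strict_trans2[of 0 "1 / R" \<rho>] by simp
    have rR: "\<rho> * R \<ge> 1" using rho R10 by (simp add: pos_divide_le_eq)
    define C where "C = {x \<in> A. \<bar>x $ k - b\<bar> \<le> \<rho> * R}"
    have fC: "finite C" unfolding C_def using finA by simp
    have "(\<Sum>x\<in>C. p x) = (\<Sum>y\<in>{y \<in> S0. flr (\<tau> * y) \<in> C}. w y)" unfolding p_def by (rule sum_mass[OF finS0 fC])
    \<comment> \<open>Undoing the rounding doubles the width, as \<open>\<rho> * R \<ge> 1\<close>,
      and dividing by a coordinate of \<open>\<tau>\<close> doubles it again.\<close>
    also have "\<dots> \<le> (\<Sum>y\<in>{y \<in> S. \<bar>y $ k - b / \<tau> $ k\<bar> \<le> (4 * \<rho>) * R}. w y)"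
    proof (rule sum_mono2)
     show "{y \<in> S0. flr (\<tau> * y) \<in> C} \<subseteq> {y \<in> S. \<bar>y $ k - b / \<tau> $ k\<bar> \<le> (4 * \<rho>) * R}"
     proof
      fix y assume y: "y \<in> {y \<in> S0. flr (\<tau> * y) \<in> C}"
      hence "\<bar>flr (\<tau> * y) $ k - b\<bar> \<le> \<rho> * R" unfolding C_def by blast
      hence c: "\<bar>\<tau> $ k * y $ k - b\<bar> \<le> 2 * (\<rho> * R)" using rR by simp linarith
      have tk: "\<tau> $ k \<ge> 1/2" by (rule T'(1)[OF G(1)])
      hence "y $ k - b / \<tau> $ k = (\<tau> $ k * y $ k - b) / \<tau> $ k" by (auto simp: diff_divide_distrib)
      hence "\<bar>y $ k - b / \<tau> $ k\<bar> = \<bar>\<tau> $ k * y $ k - b\<bar> / \<tau> $ k" using tk by (simp add: abs_divide)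
      also have "\<dots> \<le> (2 * (\<rho> * R)) / (1/2)" using c tk rR by (intro frac_le) auto
      finally show "y \<in> {y \<in> S. \<bar>y $ k - b / \<tau> $ k\<bar> \<le> (4 * \<rho>) * R}" using y S0S by auto
     qed
    qed (use finS w0' in auto)
    also have "\<dots> \<le> K * (4 * \<rho>) powr \<kappa>"
    proof -
     have "1 / R \<le> 4 * \<rho>" using rho rho0 by linarith
     thus ?thesis using stripS unfolding K_def by blast
    qed
    also have "\<dots> \<le> K * (4 * \<rho> powr \<kappa>)"
    proof -
     have "4 powr \<kappa> \<le> 4 powr 1" using kap by (intro powr_mono) auto
     thus ?thesis using K1 rho0 by (intro mult_left_mono) (auto simp: powr_mult intro: mult_right_mono)
    qed
    also have "\<dots> = 4 * K * \<rho> powr \<kappa>" by simp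
    also have "\<dots> \<le> Kc * \<rho> powr \<kappa>" using K_Kc by (intro mult_right_mono) auto
    finally show ?thesis unfolding C_def .
   qed
   have sumA: "(\<Sum>x\<in>A. p x) \<ge> 1 / Kc"
   proof -
    have "8 * M ^ 2 \<le> Kc" unfolding Kc_def by (rule Mpow[of _ 1]) (use M16 in auto)
    hence "1 / Kc \<le> 1 / (8 * M\<^sup>2)" using M16 Kcpos by (intro divide_left_mono) auto
    thus ?thesis using AA(2)[OF t0(1)] unfolding A_def by linarith
   qed
   have covAH: "covers Kc A H"
    by (rule covers_mono[OF covA]) (use Kc1[of 138] sumset_mono[of sd.Q2 sd.Q2 "{0}" "vbx (\<lambda>_. 1)"] in
     \<open>auto simp: a_def H_def vbx_def intro: sumsetI[of _ sd.Q2 0, simplified]\<close>)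
   \<comment> \<open>\<open>Q2\<close> has at most \<open>M ^ 57 / Q\<close> elements, so a
     collision probability above \<open>R powr (\<gamma> - n)\<close> leaves few unit cells in
     \<open>H\<close>.\<close>
   have sep: "real (card E) \<le> R powr (real CARD('n) - \<gamma> / 2)" if E: "E \<subseteq> H" "finite E" "separated (\<lambda>_. 1) E" for E
   proof -
    have "real (card E) \<le> real (card sd.Q2) * 3 ^ CARD('n)"
     using E unfolding H_def by (intro card_separated_thicken sd.finQ2)
    also have "\<dots> \<le> M ^ 57 / Q * M" using order_trans[OF sd.card_Q2 D2] n3 M16 Q0 unfolding n_def by (intro mult_mono) auto
    also have "\<dots> = M ^ 58 * (1 / Q)"
    proof -
     have "M ^ 57 * M = M ^ 58" by (simp add: numeral_eq_Suc)
     thus ?thesis by (metis mult.commute times_divide_eq_left times_divide_eq_right mult_1)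
    qed
    also have "\<dots> \<le> R powr (\<gamma> / 2) * (1 / R powr (\<gamma> - real CARD('n)))"
    proof (rule mult_mono)
     have "M ^ 58 \<le> (R powr (\<epsilon> * 2)) ^ 58" using MR M16 by (intro power_mono) auto
     also have "\<dots> = R powr (\<epsilon> * 116)" using R10 by (simp add: powr_realpow[symmetric] powr_powr mult.commute)
     also have "\<dots> \<le> R powr (\<gamma> / 2)" using ep R10 by (intro powr_mono) auto
     finally show "M ^ 58 \<le> R powr (\<gamma> / 2)" .
     show "1 / Q \<le> 1 / R powr (\<gamma> - real CARD('n))" using Qbig R10 Q0 by (intro divide_left_mono mult_pos_pos) auto
    qed (use Q0 in auto)
    also have "\<dots> = R powr (\<gamma> / 2 - (\<gamma> - real CARD('n)))" by (simp only: powr_diff) simp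
    also have "\<gamma> / 2 - (\<gamma> - real CARD('n)) = real CARD('n) - \<gamma> / 2" by simp
    finally show ?thesis .
   qed
   have "X' \<subseteq> approx_group.stab H Kc" "X' \<subseteq> vbx (\<lambda>_. 2)" unfolding X'_def using stb by auto
   moreover have "finite X'" unfolding X'_def using finX by simp
   moreover have "\<forall>x\<in>X'. w' x \<ge> 0" unfolding X'_def w'_def using m0' XT by (auto simp: undo)
   ultimately show False
    using core[rule_format, of H Kc X' w' A p] grp KcR sumX stripX finA covAH p0 sumA stripA sep by blast
  qed
 qed
qed

section \<open>Random polynomials and their characteristic functions\<close>

lemma cmod_iexp_diff_le: "cmod (iexp x - iexp y) \<le> \<bar>x - y\<bar>"
proof -
 have "iexp x - iexp y = iexp y * (iexp (x - y) - 1)" by (simp add: right_diff_distrib exp_add[symmetric] algebra_simps)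
 hence "cmod (iexp x - iexp y) = cmod (iexp (x - y) - 1)" by (simp add: norm_mult)
 also have "\<dots> \<le> \<bar>x - y\<bar>" using iexp_approx1[of "x - y" 0] by simp
 finally show ?thesis .
qed

lemma cmod_iexp_minus_1_ge:
 assumes "\<bar>x\<bar> \<le> 1" shows "cmod (iexp x - 1) \<ge> \<bar>x\<bar> / 2"
proof -
 have "cmod (iexp x - (1 + \<i> * of_real x)) \<le> \<bar>x\<bar>\<^sup>2 / 2" using iexp_approx1[of x 1] by (simp add: power2_eq_square)
 moreover have "\<bar>x\<bar>\<^sup>2 \<le> \<bar>x\<bar>" using mult_left_mono[OF assms, of "\<bar>x\<bar>"] by (simp only: power2_eq_square) simp
 moreover have "cmod (\<i> * of_real x) \<le> cmod (iexp x - 1) + cmod (iexp x - (1 + \<i> * of_real x))"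
 proof -
  have "\<i> * of_real x = (iexp x - 1) - (iexp x - (1 + \<i> * of_real x))" by simp
  thus ?thesis using norm_triangle_ineq4 by metis
 qed
 ultimately show ?thesis by (simp add: norm_mult)
qed

text \<open>Multiplication by \<open>iexp \<theta> - 1\<close>, of absolute value at least
  \<open>\<bar>\<theta>\<bar> / 2\<close>, makes the sum telescope.\<close>

lemma dirichlet_kernel_le:
 fixes N :: nat
 shows "cmod (\<Sum>z\<in>{-int N..int N}. iexp (\<theta> * of_int z)) \<le> 2 * real N + 1"
  and "\<theta> \<noteq> 0 \<Longrightarrow> \<bar>\<theta>\<bar> \<le> 1 \<Longrightarrow> cmod (\<Sum>z\<in>{-int N..int N}. iexp (\<theta> * of_int z)) \<le> 4 / \<bar>\<theta>\<bar>"
proof -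
 have "cmod (\<Sum>z\<in>{-int N..int N}. iexp (\<theta> * of_int z)) \<le> (\<Sum>z\<in>{-int N..int N}. 1)"
  by (rule sum_norm_le) simp
 thus "cmod (\<Sum>z\<in>{-int N..int N}. iexp (\<theta> * of_int z)) \<le> 2 * real N + 1" by simp
 assume th: "\<theta> \<noteq> 0" "\<bar>\<theta>\<bar> \<le> 1"
 have tele: "(iexp \<theta> - 1) * (\<Sum>z\<in>{-int N..int N}. iexp (\<theta> * of_int z)) = iexp (\<theta> * (real N + 1)) - iexp (\<theta> * - real N)"
 proof (induction N)
  case 0
  show ?case by simp
 next
  case (Suc N)
  have s: "{-int (Suc N)..int (Suc N)} = insert (- int (Suc N)) (insert (int (Suc N)) {-int N..int N})" by auto
  have "(\<Sum>z\<in>{-int (Suc N)..int (Suc N)}. iexp (\<theta> * of_int z)) = iexp (\<theta> * - (real N + 1)) + (iexp (\<theta> * (real N + 1)) + (\<Sum>z\<in>{-int N..int N}. iexp (\<theta> * of_int z)))"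
   unfolding s by (subst sum.insert, simp, simp, subst sum.insert) (simp_all add: algebra_simps)
  moreover have m: "(iexp \<theta> - 1) * iexp y = iexp (\<theta> + y) - iexp y" for y by (simp add: left_diff_distrib exp_add distrib_left)
  moreover have "\<theta> + \<theta> * - (real N + 1) = \<theta> * - real N" "\<theta> + \<theta> * (real N + 1) = \<theta> * (real (Suc N) + 1)" by (simp_all add: algebra_simps)
  ultimately have "(iexp \<theta> - 1) * (\<Sum>z\<in>{-int (Suc N)..int (Suc N)}. iexp (\<theta> * of_int z))
    = (iexp (\<theta> * - real N) - iexp (\<theta> * - (real N + 1))) + ((iexp (\<theta> * (real (Suc N) + 1)) - iexp (\<theta> * (real N + 1))) + (iexp (\<theta> * (real N + 1)) - iexp (\<theta> * - real N)))"
   using Suc by (simp only: distrib_left)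
  thus ?case by (simp add: algebra_simps)
 qed
 have "\<bar>\<theta>\<bar> / 2 * cmod (\<Sum>z\<in>{-int N..int N}. iexp (\<theta> * of_int z)) \<le> cmod (iexp \<theta> - 1) * cmod (\<Sum>z\<in>{-int N..int N}. iexp (\<theta> * of_int z))"
  using cmod_iexp_minus_1_ge[OF th(2)] by (intro mult_right_mono) auto
 also have "\<dots> \<le> 2" unfolding norm_mult[symmetric] tele
  using norm_triangle_ineq4[of "iexp (\<theta> * (real N + 1))" "iexp (\<theta> * - real N)"] by simp
 finally show "cmod (\<Sum>z\<in>{-int N..int N}. iexp (\<theta> * of_int z)) \<le> 4 / \<bar>\<theta>\<bar>" using th by (simp add: field_simps)
qed

lemma sum_mass_scaleR:
 fixes g :: "'b \<Rightarrow> 'v::real_vector"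
 assumes "finite I"
 shows "(\<Sum>c\<in>f ` I. mass I w f c *\<^sub>R g c) = (\<Sum>i\<in>I. w i *\<^sub>R g (f i))"
proof -
 have "(\<Sum>i\<in>I. w i *\<^sub>R g (f i)) = (\<Sum>c\<in>f ` I. \<Sum>i\<in>{i \<in> I. f i = c}. w i *\<^sub>R g (f i))"
  by (rule sum.group[symmetric]) (use assms in auto)
 also have "\<dots> = (\<Sum>c\<in>f ` I. mass I w f c *\<^sub>R g c)"
  unfolding mass_def scaleR_sum_left by (intro sum.cong refl) auto
 finally show ?thesis by simp
qed

lemma mass_push: "finite I \<Longrightarrow> mass (f ` I) (mass I w f) g c = mass I w (\<lambda>i. g (f i)) c"
proof -
 assume fin: "finite I"
 have "mass (f ` I) (mass I w f) g c = (\<Sum>i\<in>{i \<in> I. f i \<in> {y \<in> f ` I. g y = c}}. w i)"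
  unfolding mass_def[of "f ` I"] using fin by (intro sum_mass) auto
 also have "{i \<in> I. f i \<in> {y \<in> f ` I. g y = c}} = {i \<in> I. g (f i) = c}" by auto
 finally show ?thesis unfolding mass_def .
qed

lemma coll_push: "finite I \<Longrightarrow> coll (f ` I) (mass I w f) g = coll I w (\<lambda>i. g (f i))"
 unfolding coll_def by (simp add: mass_push image_image)

lemma mass_pw_le:
 assumes fin: "finite A" "finite B" and v: "\<And>a. a \<in> A \<Longrightarrow> v a \<ge> 0" "(\<Sum>a\<in>A. v a) = 1"
  and le: "\<And>a. a \<in> A \<Longrightarrow> mass B w (\<lambda>b. f (a, b)) c \<le> x"
 shows "mass (A \<times> B) (pw v w) f c \<le> x"
proof -
 have "mass (A \<times> B) (pw v w) f c = (\<Sum>a\<in>A. v a * mass B w (\<lambda>b. f (a, b)) c)" unfolding pw_def using fin by (rule mass_prod)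
 also have "\<dots> \<le> (\<Sum>a\<in>A. v a * x)" using v le by (intro sum_mono mult_left_mono) auto
 finally show ?thesis using v(2) by (simp add: sum_distrib_right[symmetric])
qed

section \<open>The laws of the random polynomials\<close>

locale finite_multiplier =
 fixes T :: "(real^'n) set" and m :: "real^'n \<Rightarrow> real"
 assumes finT: "finite T" and T_bounds: "\<And>t i. t \<in> T \<Longrightarrow> 1/2 \<le> t $ i" "\<And>t i. t \<in> T \<Longrightarrow> t $ i \<le> 1"
  and m0: "\<And>t. t \<in> T \<Longrightarrow> m t \<ge> 0" and m1: "(\<Sum>t\<in>T. m t) = 1"
begin

text \<open>The law of Y_j with initial scale \<open>c\<close>, as a finite support together with
  its weights; the recursion needs both parts at once.\<close>

primrec law :: "real \<Rightarrow> nat \<Rightarrow> (real^'n) set \<times> (real^'n \<Rightarrow> real)" where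
 "law c 0 = ((*\<^sub>R) c ` T, mass T m ((*\<^sub>R) c))"
| "law c (Suc j) = (dilate_diff ` ((T \<times> T) \<times> (fst (law c j) \<times> fst (law c j))),
   mass ((T \<times> T) \<times> (fst (law c j) \<times> fst (law c j))) (pw (pw m m) (pw (snd (law c j)) (snd (law c j)))) dilate_diff)"

definition "LS c j = fst (law c j)"
definition "LW c j = snd (law c j)"
definition "LI c j = (T \<times> T) \<times> (LS c j \<times> LS c j)"
definition "LV c j = pw (pw m m) (pw (LW c j) (LW c j))"

lemma LS_0: "LS c 0 = (*\<^sub>R) c ` T" and LW_0: "LW c 0 = mass T m ((*\<^sub>R) c)"
 unfolding LS_def LW_def by auto

lemma LS_Suc: "LS c (Suc j) = dilate_diff ` LI c j" and LW_Suc: "LW c (Suc j) = mass (LI c j) (LV c j) dilate_diff"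
 unfolding LS_def LW_def LI_def LV_def by auto

lemma law_prob: "finite (LS c j) \<and> (\<forall>y\<in>LS c j. LW c j y \<ge> 0) \<and> (\<Sum>y\<in>LS c j. LW c j y) = 1"
proof (induction j)
 case 0
 show ?case unfolding LS_0 LW_0 using finT m0 m1 by (auto simp: sum_mass_image intro: mass_nonneg)
next
 case (Suc j)
 have V0: "LV c j x \<ge> 0" if "x \<in> LI c j" for x
  using that Suc m0 unfolding LV_def LI_def by (intro pw_nonneg[of "T \<times> T" "pw m m" "LS c j \<times> LS c j"] pw_nonneg[of T m T] pw_nonneg[of "LS c j" "LW c j" "LS c j"]) auto
 have f: "finite (LI c j)" unfolding LI_def using finT Suc by simp
 have "(\<Sum>y\<in>LS c (Suc j). LW c (Suc j) y) = (\<Sum>x\<in>LI c j. LV c j x)" unfolding LS_Suc LW_Suc by (rule sum_mass_image[OF f])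
 also have "\<dots> = 1" unfolding LI_def LV_def sum_pw m1 using Suc by simp
 finally show ?case using f V0 unfolding LS_Suc LW_Suc by (auto intro: mass_nonneg)
qed

lemma finLS: "finite (LS c j)" and LW_nonneg: "y \<in> LS c j \<Longrightarrow> LW c j y \<ge> 0" and LW_sum: "(\<Sum>y\<in>LS c j. LW c j y) = 1"
 using law_prob by auto

lemma finLI: "finite (LI c j)" unfolding LI_def using finT finLS by simp

lemma coll_law_Suc: "coll (LS c (Suc j)) (LW c (Suc j)) flr = coll (LI c j) (LV c j) (\<lambda>x. flr (dilate_diff x))"
 unfolding LS_Suc LW_Suc by (rule coll_push[OF finLI])

lemma coll_law_le: "coll (LS c (Suc j)) (LW c (Suc j)) flr \<le> 3 ^ CARD('n) * coll (LS c j) (LW c j) flr"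
 unfolding coll_law_Suc LI_def LV_def using finT T_bounds(1) m0 m1 finLS LW_nonneg LW_sum by (rule coll_dilate_diff_le)

text \<open>The support at most doubles in size at each step, which dictates the initial scale R /
  (8 * 2^J) chosen later.\<close>

lemma LS_bound: "c \<ge> 0 \<Longrightarrow> LS c j \<subseteq> vbx (\<lambda>_. c * 2 ^ j)"
proof (induction j)
 case 0
 have "\<bar>c * t $ i\<bar> \<le> c * 1" if "t \<in> T" for t i
  unfolding abs_mult using T_bounds[OF that, of i] 0 by (intro mult_mono) auto
 thus ?case unfolding LS_0 vbx_def by auto
next
 case (Suc j)
 show ?case
 proof
  fix z assume "z \<in> LS c (Suc j)"
  then obtain t1 t2 y1 y2 where z: "t1 \<in> T" "t2 \<in> T" "y1 \<in> LS c j" "y2 \<in> LS c j" "z = t1 * y1 - t2 * y2"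
   unfolding LS_Suc LI_def dilate_diff_def by auto
  have b: "\<bar>t $ i * y $ i\<bar> \<le> 1 * (c * 2 ^ j)" if "t \<in> T" "y \<in> LS c j" for t y i
   unfolding abs_mult using T_bounds[OF that(1), of i] Suc that(2) unfolding vbx_def by (intro mult_mono) auto
  have "\<bar>z $ i\<bar> \<le> c * 2 ^ Suc j" for i using b[OF z(1,3), of i] b[OF z(2,4), of i] unfolding z(5) by simp
  thus "z \<in> vbx (\<lambda>_. c * 2 ^ Suc j)" unfolding vbx_def by simp
 qed
qed

text \<open>Conditioning on everything but the second point leaves a strip for
  \<open>t2 * y\<close>, hence a strip of at most twice the width for \<open>y\<close>; as
  \<open>\<kappa> \<le> 1\<close>, this costs a factor 2 per step.\<close>

lemma law_strips:
 assumes c: "0 < c0" "c0 \<le> 1" and R: "R > 0" and kap: "0 < \<kappa>" "\<kappa> \<le> 1" and K: "K \<ge> 0"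
  and strip: "\<And>k a \<rho>. \<rho> \<ge> 1 / R \<Longrightarrow> (\<Sum>t\<in>{t \<in> T. \<bar>t $ k - a\<bar> \<le> \<rho>}. m t) \<le> K * \<rho> powr \<kappa>"
 shows "\<rho> \<ge> 1 / R \<Longrightarrow> (\<Sum>y\<in>{y \<in> LS (c0 * R) j. \<bar>y $ k - a\<bar> \<le> \<rho> * R}. LW (c0 * R) j y) \<le> K / c0 * 2 ^ j * \<rho> powr \<kappa>"
proof (induction j arbitrary: a \<rho>)
 case 0
 have r0: "\<rho> > 0" using 0 R order.strict_trans2[of 0 "1 / R" \<rho>] by simp
 let ?c = "c0 * R"
 have "(\<Sum>y\<in>{y \<in> LS ?c 0. \<bar>y $ k - a\<bar> \<le> \<rho> * R}. LW ?c 0 y) = (\<Sum>t\<in>{t \<in> T. ?c *\<^sub>R t \<in> {y \<in> LS ?c 0. \<bar>y $ k - a\<bar> \<le> \<rho> * R}}. m t)"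
  unfolding LW_0 using finT finLS by (intro sum_mass) auto
 also have "{t \<in> T. ?c *\<^sub>R t \<in> {y \<in> LS ?c 0. \<bar>y $ k - a\<bar> \<le> \<rho> * R}} = {t \<in> T. \<bar>t $ k - a / ?c\<bar> \<le> \<rho> / c0}"
 proof -
  have "\<bar>?c * x - a\<bar> \<le> \<rho> * R \<longleftrightarrow> \<bar>x - a / ?c\<bar> \<le> \<rho> / c0" for x
  proof -
   have "?c * x - a = ?c * (x - a / ?c)" using c R by (simp add: right_diff_distrib)
   hence "\<bar>?c * x - a\<bar> = ?c * \<bar>x - a / ?c\<bar>" using c R by (simp add: abs_mult)
   thus ?thesis using c R by (simp add: pos_le_divide_eq ac_simps)
  qed
  thus ?thesis unfolding LS_0 by auto
 qed
 also have "(\<Sum>t\<in>\<dots>. m t) \<le> K * (\<rho> / c0) powr \<kappa>"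
 proof (rule strip)
  have "\<rho> * 1 \<le> \<rho> * (1 / c0)" using c r0 by (intro mult_left_mono) auto
  thus "1 / R \<le> \<rho> / c0" using 0 by simp
 qed
 also have "\<dots> = K * (\<rho> powr \<kappa> * (1 / c0) powr \<kappa>)" using powr_mult[of \<rho> "1 / c0" \<kappa>] by simp
 also have "\<dots> \<le> K * (\<rho> powr \<kappa> * (1 / c0) powr 1)"
  using c kap K by (intro mult_left_mono powr_mono) auto
 finally show ?case using c by (simp add: ac_simps)
next
 case (Suc j)
 have r0: "\<rho> > 0" using Suc.prems R order.strict_trans2[of 0 "1 / R" \<rho>] by simp
 let ?c = "c0 * R" let ?B = "K / c0 * 2 ^ Suc j * \<rho> powr \<kappa>"
 let ?P = "\<lambda>y :: real^'n. \<bar>y $ k - a\<bar> \<le> \<rho> * R"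
 \<comment> \<open>A strip is treated as the event that a predicate takes the value
   \<open>True\<close>, so that \<open>mass_push\<close> and \<open>mass_pw_le\<close> apply to
   it.\<close>
 have "(\<Sum>y\<in>{y \<in> LS ?c (Suc j). ?P y}. LW ?c (Suc j) y) = mass (LS ?c (Suc j)) (LW ?c (Suc j)) ?P True"
  unfolding mass_def by simp
 also have "\<dots> = mass (LI ?c j) (LV ?c j) (\<lambda>x. ?P (dilate_diff x)) True" unfolding LS_Suc LW_Suc by (rule mass_push[OF finLI])
 also have "\<dots> \<le> ?B"
  unfolding LI_def LV_def
 proof (rule mass_pw_le)
  fix x assume "x \<in> T \<times> T"
  then obtain t1 t2 where x: "x = (t1, t2)" "t1 \<in> T" "t2 \<in> T" by blast
  show "mass (LS ?c j \<times> LS ?c j) (pw (LW ?c j) (LW ?c j)) (\<lambda>b. ?P (dilate_diff (x, b))) True \<le> ?B"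
  proof (rule mass_pw_le)
   fix y1
   let ?b = "(t1 $ k * y1 $ k - a) / t2 $ k"
   have "mass (LS ?c j) (LW ?c j) (\<lambda>b. ?P (dilate_diff (x, y1, b))) True = (\<Sum>y\<in>{y \<in> LS ?c j. ?P (dilate_diff (x, y1, y))}. LW ?c j y)"
    unfolding mass_def by simp
   also have "\<dots> \<le> (\<Sum>y\<in>{y \<in> LS ?c j. \<bar>y $ k - ?b\<bar> \<le> (2 * \<rho>) * R}. LW ?c j y)"
   proof (rule sum_mono2)
    show "{y \<in> LS ?c j. ?P (dilate_diff (x, y1, y))} \<subseteq> {y \<in> LS ?c j. \<bar>y $ k - ?b\<bar> \<le> (2 * \<rho>) * R}"
    proof
     fix y assume y: "y \<in> {y \<in> LS ?c j. ?P (dilate_diff (x, y1, y))}"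
     have tk: "t2 $ k \<ge> 1/2" using T_bounds(1)[OF x(3)] .
     have "y $ k - ?b = - (t1 $ k * y1 $ k - t2 $ k * y $ k - a) / t2 $ k" using tk by (auto simp: diff_divide_distrib)
     hence "\<bar>y $ k - ?b\<bar> = \<bar>t1 $ k * y1 $ k - t2 $ k * y $ k - a\<bar> / t2 $ k" using tk by (simp add: abs_divide del: minus_diff_eq)
     also have "\<dots> \<le> (\<rho> * R) / (1/2)" using y tk r0 R unfolding dilate_diff_def x by (intro frac_le) auto
     finally show "y \<in> {y \<in> LS ?c j. \<bar>y $ k - ?b\<bar> \<le> (2 * \<rho>) * R}" using y by (simp add: ac_simps)
    qed
   qed (use finLS LW_nonneg in auto)
   also have "\<dots> \<le> K / c0 * 2 ^ j * (2 * \<rho>) powr \<kappa>" by (rule Suc.IH) (use Suc.prems r0 in linarith)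
   also have "\<dots> \<le> K / c0 * 2 ^ j * (2 * \<rho> powr \<kappa>)"
   proof -
    have "2 powr \<kappa> \<le> 2 powr 1" using kap by (intro powr_mono) auto
    hence "(2 * \<rho>) powr \<kappa> \<le> 2 * \<rho> powr \<kappa>" using r0 by (auto simp: powr_mult intro: mult_right_mono)
    thus ?thesis using K c by (intro mult_left_mono) auto
   qed
   also have "\<dots> = ?B" by simp
   finally show "mass (LS ?c j) (LW ?c j) (\<lambda>b. ?P (dilate_diff (x, y1, b))) True \<le> ?B" .
  qed (use finLS LW_nonneg LW_sum in auto)
 qed (use finT finLS m0 m1 in \<open>auto simp: sum_pw intro: pw_nonneg[of T m T]\<close>)
 finally show ?case .
qed

section \<open>Characteristic functions of products\<close>

text \<open>Characteristic function of the product of \<open>k\<close> independent multipliers: each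
  factor is moved onto the frequency, and the empty product is the vector 1.\<close>

fun phi :: "nat \<Rightarrow> real^'n \<Rightarrow> complex" where
 "phi 0 \<zeta> = iexp (2 * pi * (\<zeta> \<bullet> 1))"
| "phi (Suc k) \<zeta> = (\<Sum>t\<in>T. m t *\<^sub>R phi k (t * \<zeta>))"

definition "F k \<zeta> = (cmod (phi k \<zeta>))\<^sup>2"

lemma inner_times_commute: "(t * \<zeta>) \<bullet> x = \<zeta> \<bullet> (t * x)" for t \<zeta> x :: "real^'n"
 unfolding inner_vec_def by (intro sum.cong refl) (simp add: ac_simps)

lemma phi_1: "phi 1 \<zeta> = (\<Sum>t\<in>T. m t *\<^sub>R iexp (2 * pi * (\<zeta> \<bullet> t)))"
proof -
 have "(t * \<zeta>) \<bullet> 1 = \<zeta> \<bullet> t" for t using inner_times_commute[of t \<zeta> 1] by simp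
 thus ?thesis by simp
qed

text \<open>Exhibits \<open>phi k\<close> as the transform of a finitely supported probability law,
  on which positive definiteness rests.\<close>

lemma phi_rep:
 obtains X :: "(real^'n) set" and l where "finite X" "\<And>x. x \<in> X \<Longrightarrow> l x \<ge> 0" "(\<Sum>x\<in>X. l x) = 1"
  "\<And>\<zeta>. phi k \<zeta> = (\<Sum>x\<in>X. l x *\<^sub>R iexp (2 * pi * (\<zeta> \<bullet> x)))"
proof -
 have "\<exists>X l. finite X \<and> (\<forall>x\<in>X. l x \<ge> 0) \<and> (\<Sum>x\<in>X. l x) = 1 \<and> (\<forall>\<zeta>. phi k \<zeta> = (\<Sum>x\<in>X. l x *\<^sub>R iexp (2 * pi * (\<zeta> \<bullet> x))))"
 proof (induction k)
  case 0
  show ?case by (rule exI[of _ "{1}"], rule exI[of _ "\<lambda>_. 1"]) simp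
 next
  case (Suc k)
  then obtain X l where X: "finite X" "\<forall>x\<in>X. l x \<ge> 0" "(\<Sum>x\<in>X. l x) = 1" "\<forall>\<zeta>. phi k \<zeta> = (\<Sum>x\<in>X. l x *\<^sub>R iexp (2 * pi * (\<zeta> \<bullet> x)))" by blast
  define f where "f = (\<lambda>(t, x). t * x :: real^'n)"
  have fin: "finite (T \<times> X)" using finT X by simp
  have nn: "\<And>i. i \<in> T \<times> X \<Longrightarrow> pw m l i \<ge> 0" using m0 X by (intro pw_nonneg[of T m X]) auto
  show ?case
  proof (rule exI[of _ "f ` (T \<times> X)"], rule exI[of _ "mass (T \<times> X) (pw m l) f"], intro conjI ballI allI)
   show "(\<Sum>x\<in>f ` (T \<times> X). mass (T \<times> X) (pw m l) f x) = 1" unfolding sum_mass_image[OF fin] sum_pw using m1 X by simp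
   fix \<zeta>
   have "phi (Suc k) \<zeta> = (\<Sum>t\<in>T. \<Sum>x\<in>X. pw m l (t, x) *\<^sub>R iexp (2 * pi * (\<zeta> \<bullet> f (t, x))))"
    using X(4) by (simp add: scaleR_sum_right pw_def f_def inner_times_commute)
   also have "\<dots> = (\<Sum>i\<in>T \<times> X. pw m l i *\<^sub>R iexp (2 * pi * (\<zeta> \<bullet> f i)))" by (simp add: sum.cartesian_product case_prod_beta)
   also have "\<dots> = (\<Sum>x\<in>f ` (T \<times> X). mass (T \<times> X) (pw m l) f x *\<^sub>R iexp (2 * pi * (\<zeta> \<bullet> x)))"
    by (rule sum_mass_scaleR[OF fin, symmetric])
   finally show "phi (Suc k) \<zeta> = (\<Sum>x\<in>f ` (T \<times> X). mass (T \<times> X) (pw m l) f x *\<^sub>R iexp (2 * pi * (\<zeta> \<bullet> x)))" .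
  qed (use fin nn in \<open>auto intro: mass_nonneg\<close>)
 qed
 thus thesis using that by blast
qed

end

context finite_multiplier
begin

lemma cnj_iexp: "cnj (iexp x) = iexp (- x)"
 by (simp add: exp_cnj)

lemma norm_phi_le: "cmod (phi k \<zeta>) \<le> 1"
proof -
 obtain X :: "(real^'n) set" and l where X: "finite X" "\<And>x. x \<in> X \<Longrightarrow> l x \<ge> 0" "(\<Sum>x\<in>X. l x) = 1"
  "\<And>\<zeta>. phi k \<zeta> = (\<Sum>x\<in>X. l x *\<^sub>R iexp (2 * pi * (\<zeta> \<bullet> x)))" using phi_rep[of k] by blast
 have "cmod (phi k \<zeta>) \<le> (\<Sum>x\<in>X. l x)" unfolding X(4) by (rule sum_norm_le) (use X(2) in simp)
 thus ?thesis using X(3) by simp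
qed

lemma F_nonneg: "F k \<zeta> \<ge> 0" unfolding F_def by simp

lemma F_le_1: "F k \<zeta> \<le> 1" unfolding F_def using norm_phi_le by (simp add: power_le_one)

lemma F_Suc_le: "F (Suc k) \<zeta> \<le> (\<Sum>t\<in>T. m t * F k (t * \<zeta>))"
proof -
 have "cmod (phi (Suc k) \<zeta>) \<le> (\<Sum>t\<in>T. m t * cmod (phi k (t * \<zeta>)))"
  unfolding phi.simps by (rule sum_norm_le) (use m0 in simp)
 hence "F (Suc k) \<zeta> \<le> (\<Sum>t\<in>T. m t * cmod (phi k (t * \<zeta>)))\<^sup>2" unfolding F_def by (intro power_mono) auto
 also have "\<dots> \<le> (\<Sum>t\<in>T. m t) * (\<Sum>t\<in>T. m t * (cmod (phi k (t * \<zeta>)))\<^sup>2)" using m0 by (rule weighted_Cauchy_Schwarz)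
 finally show ?thesis unfolding m1 F_def by simp
qed

text \<open>\<open>F k\<close> is the characteristic function of the difference of two independent
  copies. Characters are indexed by pairs, so that equal differences need not be collected.\<close>

lemma F_spectral:
 obtains D :: "((real^'n) \<times> (real^'n)) set" and L and E :: "real^'n \<Rightarrow> (real^'n) \<times> (real^'n) \<Rightarrow> complex"
 where "finite D" "\<And>d. d \<in> D \<Longrightarrow> L d \<ge> 0" "(\<Sum>d\<in>D. L d) = 1"
  "\<And>\<zeta>. complex_of_real (F k \<zeta>) = (\<Sum>d\<in>D. of_real (L d) * E \<zeta> d)"
  "\<And>\<zeta> \<zeta>' d. E (\<zeta> - \<zeta>') d = E \<zeta> d * cnj (E \<zeta>' d)"
proof -
 obtain X :: "(real^'n) set" and l where X: "finite X" "\<And>x. x \<in> X \<Longrightarrow> l x \<ge> 0" "(\<Sum>x\<in>X. l x) = 1"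
  "\<And>\<zeta>. phi k \<zeta> = (\<Sum>x\<in>X. l x *\<^sub>R iexp (2 * pi * (\<zeta> \<bullet> x)))" using phi_rep[of k] by blast
 define e where "e \<zeta> x = iexp (2 * pi * (\<zeta> \<bullet> x))" for \<zeta> x :: "real^'n"
 define E where "E \<zeta> d = e \<zeta> (fst d) * cnj (e \<zeta> (snd d))" for \<zeta> and d :: "(real^'n) \<times> (real^'n)"
 have ed: "e (\<zeta> - \<zeta>') x = e \<zeta> x * cnj (e \<zeta>' x)" for \<zeta> \<zeta>' x
  unfolding e_def cnj_iexp by (simp add: inner_diff_left exp_add[symmetric] algebra_simps)
 show thesis
 proof (rule that[of "X \<times> X" "pw l l" E])
  show "finite (X \<times> X)" using X by simp
  show "pw l l d \<ge> 0" if "d \<in> X \<times> X" for d using that X(2) by (intro pw_nonneg[of X l X]) auto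
  show "(\<Sum>d\<in>X \<times> X. pw l l d) = 1" unfolding sum_pw using X(3) by simp
  show "E (\<zeta> - \<zeta>') d = E \<zeta> d * cnj (E \<zeta>' d)" for \<zeta> \<zeta>' d unfolding E_def ed by simp
  fix \<zeta>
  have p: "phi k \<zeta> = (\<Sum>x\<in>X. of_real (l x) * e \<zeta> x)" unfolding X(4) e_def by (simp add: scaleR_conv_of_real)
  have "complex_of_real (F k \<zeta>) = phi k \<zeta> * cnj (phi k \<zeta>)" unfolding F_def complex_norm_square ..
  also have "\<dots> = (\<Sum>x\<in>X. \<Sum>x'\<in>X. (of_real (l x) * e \<zeta> x) * (of_real (l x') * cnj (e \<zeta> x')))"
   unfolding p by (simp only: cnj_sum complex_cnj_mult complex_cnj_complex_of_real sum_product)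
  also have "\<dots> = (\<Sum>d\<in>X \<times> X. of_real (pw l l d) * E \<zeta> d)"
   unfolding sum.cartesian_product by (intro sum.cong refl) (auto simp: pw_def E_def)
  finally show "complex_of_real (F k \<zeta>) = (\<Sum>d\<in>X \<times> X. of_real (pw l l d) * E \<zeta> d)" .
 qed
qed

text \<open>In the spectral representation the left side is the square of the mean of
  \<open>S d\<close>, the right side the mean of the squared modulus of \<open>S d\<close>.\<close>

lemma F_positive_definite:
 fixes z :: "'i \<Rightarrow> real^'n"
 assumes c: "\<And>i. i \<in> I \<Longrightarrow> c i \<ge> 0"
 shows "(\<Sum>i\<in>I. c i * F k (z i))\<^sup>2 \<le> (\<Sum>i\<in>I. \<Sum>j\<in>I. c i * c j * F k (z i - z j))"
proof -
 obtain D :: "((real^'n) \<times> (real^'n)) set" and L and E :: "real^'n \<Rightarrow> (real^'n) \<times> (real^'n) \<Rightarrow> complex"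
  where D: "finite D" "\<And>d. d \<in> D \<Longrightarrow> L d \<ge> 0" "(\<Sum>d\<in>D. L d) = 1"
  and FE: "\<And>\<zeta>. complex_of_real (F k \<zeta>) = (\<Sum>d\<in>D. of_real (L d) * E \<zeta> d)"
  and Ed: "\<And>\<zeta> \<zeta>' d. E (\<zeta> - \<zeta>') d = E \<zeta> d * cnj (E \<zeta>' d)" using F_spectral[of k] by blast
 define S where "S d = (\<Sum>i\<in>I. of_real (c i) * E (z i) d)" for d
 have "complex_of_real (\<Sum>i\<in>I. \<Sum>j\<in>I. c i * c j * F k (z i - z j))
   = (\<Sum>i\<in>I. \<Sum>j\<in>I. \<Sum>d\<in>D. of_real (L d) * ((of_real (c i) * E (z i) d) * (of_real (c j) * cnj (E (z j) d))))"
  by (simp add: FE Ed sum_distrib_left ac_simps)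
 also have "\<dots> = (\<Sum>i\<in>I. \<Sum>d\<in>D. \<Sum>j\<in>I. of_real (L d) * ((of_real (c i) * E (z i) d) * (of_real (c j) * cnj (E (z j) d))))"
  by (intro sum.cong refl sum.swap)
 also have "\<dots> = (\<Sum>d\<in>D. \<Sum>i\<in>I. \<Sum>j\<in>I. of_real (L d) * ((of_real (c i) * E (z i) d) * (of_real (c j) * cnj (E (z j) d))))"
  by (rule sum.swap)
 also have "\<dots> = (\<Sum>d\<in>D. of_real (L d) * (S d * cnj (S d)))"
 proof -
  have "S d * cnj (S d) = (\<Sum>i\<in>I. \<Sum>j\<in>I. (of_real (c i) * E (z i) d) * (of_real (c j) * cnj (E (z j) d)))" for d
   unfolding S_def cnj_sum complex_cnj_mult complex_cnj_complex_of_real by (rule sum_product)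
  thus ?thesis by (simp only: sum_distrib_left)
 qed
 also have "\<dots> = complex_of_real (\<Sum>d\<in>D. L d * (cmod (S d))\<^sup>2)"
  by (simp only: complex_norm_square[symmetric] of_real_mult[symmetric] of_real_sum[symmetric])
 finally have B: "(\<Sum>i\<in>I. \<Sum>j\<in>I. c i * c j * F k (z i - z j)) = (\<Sum>d\<in>D. L d * (cmod (S d))\<^sup>2)" by (simp only: of_real_eq_iff)
 have "complex_of_real (\<Sum>i\<in>I. c i * F k (z i)) = (\<Sum>i\<in>I. \<Sum>d\<in>D. of_real (L d) * (of_real (c i) * E (z i) d))"
  by (simp add: FE sum_distrib_left ac_simps)
 also have "\<dots> = (\<Sum>d\<in>D. of_real (L d) * S d)" unfolding S_def sum_distrib_left by (rule sum.swap)
 finally have C: "complex_of_real (\<Sum>i\<in>I. c i * F k (z i)) = (\<Sum>d\<in>D. of_real (L d) * S d)" .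
 have "(\<Sum>i\<in>I. c i * F k (z i)) \<le> cmod (complex_of_real (\<Sum>i\<in>I. c i * F k (z i)))" unfolding norm_of_real by (rule abs_ge_self)
 also have "\<dots> \<le> (\<Sum>d\<in>D. L d * cmod (S d))" unfolding C by (rule sum_norm_le) (use D(2) in \<open>simp add: norm_mult\<close>)
 finally have "(\<Sum>i\<in>I. c i * F k (z i))\<^sup>2 \<le> (\<Sum>d\<in>D. L d * cmod (S d))\<^sup>2"
  using c F_nonneg by (intro power_mono sum_nonneg mult_nonneg_nonneg) auto
 also have "\<dots> \<le> (\<Sum>d\<in>D. L d) * (\<Sum>d\<in>D. L d * (cmod (S d))\<^sup>2)" using D(2) by (rule weighted_Cauchy_Schwarz)
 finally show ?thesis unfolding B D(3) by simp
qed

definition "avgF c j k \<eta> = (\<Sum>y\<in>LS c j. LW c j y * F k (y * \<eta>))"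

lemma avgF_nonneg: "avgF c j k \<eta> \<ge> 0"
 unfolding avgF_def using LW_nonneg F_nonneg by (intro sum_nonneg mult_nonneg_nonneg)

lemma avgF_0: "F (Suc k) (c *\<^sub>R \<eta>) \<le> avgF c 0 k \<eta>"
proof -
 have "avgF c 0 k \<eta> = (\<Sum>t\<in>T. m t * F k ((c *\<^sub>R t) * \<eta>))"
  unfolding avgF_def LS_0 LW_0 using finT by (intro sum_mass_mult) auto
 also have "\<dots> = (\<Sum>t\<in>T. m t * F k (t * (c *\<^sub>R \<eta>)))"
 proof -
  have "(c *\<^sub>R t) * \<eta> = t * (c *\<^sub>R \<eta>)" for t by (simp add: vec_eq_iff ac_simps)
  thus ?thesis by (simp only:)
 qed
 finally show ?thesis using F_Suc_le[of k "c *\<^sub>R \<eta>"] by simp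
qed

text \<open>Here the form of the recursion for Y_j pays off: squaring the average over
  \<open>t * y\<close> produces the differences \<open>t * y - t' * y'\<close> of independent
  copies, that is Y_{j+1}, at the cost of one factor of the product.\<close>

lemma avgF_Suc: "(avgF c j (Suc k) \<eta>)\<^sup>2 \<le> avgF c (Suc j) k \<eta>"
proof -
 let ?S = "LS c j" and ?w = "LW c j"
 define z where "z x = fst x * snd x * \<eta>" for x :: "(real^'n) \<times> (real^'n)"
 have "avgF c (Suc j) k \<eta> = (\<Sum>x\<in>LI c j. LV c j x * F k (dilate_diff x * \<eta>))"
  unfolding avgF_def LS_Suc LW_Suc using finLI by (intro sum_mass_mult) auto
 also have "\<dots> = (\<Sum>p\<in>(T \<times> ?S) \<times> (T \<times> ?S). pw m ?w (fst p) * pw m ?w (snd p) * F k (z (fst p) - z (snd p)))"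
  by (rule sum.reindex_bij_witness[where j = "\<lambda>((t1, t2), (y1, y2)). ((t1, y1), (t2, y2))" and i = "\<lambda>((t1, y1), (t2, y2)). ((t1, t2), (y1, y2))"])
   (auto simp: LI_def LV_def pw_def z_def dilate_diff_def algebra_simps)
 also have "\<dots> = (\<Sum>i\<in>T \<times> ?S. \<Sum>j\<in>T \<times> ?S. pw m ?w i * pw m ?w j * F k (z i - z j))"
  unfolding sum.cartesian_product by (intro sum.cong refl) auto
 finally have e: "avgF c (Suc j) k \<eta> = (\<Sum>i\<in>T \<times> ?S. \<Sum>j\<in>T \<times> ?S. pw m ?w i * pw m ?w j * F k (z i - z j))" .
 have "avgF c j (Suc k) \<eta> \<le> (\<Sum>y\<in>?S. ?w y * (\<Sum>t\<in>T. m t * F k (t * (y * \<eta>))))"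
  unfolding avgF_def using LW_nonneg F_Suc_le by (intro sum_mono mult_left_mono)
 also have "\<dots> = (\<Sum>y\<in>?S. \<Sum>t\<in>T. pw m ?w (t, y) * F k (z (t, y)))"
  by (simp add: sum_distrib_left pw_def z_def ac_simps)
 also have "\<dots> = (\<Sum>t\<in>T. \<Sum>y\<in>?S. pw m ?w (t, y) * F k (z (t, y)))" by (rule sum.swap)
 also have "\<dots> = (\<Sum>i\<in>T \<times> ?S. pw m ?w i * F k (z i))" unfolding sum.cartesian_product by (intro sum.cong refl) auto
 finally have "(avgF c j (Suc k) \<eta>)\<^sup>2 \<le> (\<Sum>i\<in>T \<times> ?S. pw m ?w i * F k (z i))\<^sup>2" using avgF_nonneg by (intro power_mono)
 also have "\<dots> \<le> avgF c (Suc j) k \<eta>" unfolding e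
  using m0 LW_nonneg by (intro F_positive_definite pw_nonneg[of T m ?S]) auto
 finally show ?thesis .
qed

text \<open>One factor of the product is spent on Y_0 and one on each of the \<open>j\<close>
  squarings; the other \<open>k\<close> remain in \<open>F k\<close>.\<close>

lemma F_descent: "F (Suc (j + k)) (c *\<^sub>R \<eta>) ^ (2 ^ j) \<le> avgF c j k \<eta>"
proof (induction j arbitrary: k)
 case 0
 show ?case using avgF_0 by simp
next
 case (Suc j)
 have "F (Suc (Suc j + k)) (c *\<^sub>R \<eta>) ^ (2 ^ Suc j) = (F (Suc (j + Suc k)) (c *\<^sub>R \<eta>) ^ (2 ^ j))\<^sup>2"
  by (simp add: power_mult[symmetric] mult.commute)
 also have "\<dots> \<le> (avgF c j (Suc k) \<eta>)\<^sup>2" using Suc.IH[of "Suc k"] F_nonneg by (intro power_mono) auto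
 also have "\<dots> \<le> avgF c (Suc j) k \<eta>" by (rule avgF_Suc)
 finally show ?case .
qed

lemma F_1_lipschitz:
 fixes y \<eta> :: "real^'n"
 shows "F 1 (y * \<eta>) \<le> F 1 (flr y * \<eta>) + 4 * pi * (real CARD('n) * norm \<eta>)"
proof -
 let ?a = "phi 1 (y * \<eta>)" and ?b = "phi 1 (flr y * \<eta>)"
 have d: "\<bar>(y * \<eta>) \<bullet> t - (flr y * \<eta>) \<bullet> t\<bar> \<le> real CARD('n) * norm \<eta>" if t: "t \<in> T" for t
 proof -
  have "(y * \<eta>) \<bullet> t - (flr y * \<eta>) \<bullet> t = (\<Sum>i\<in>UNIV. (y $ i - of_int \<lfloor>y $ i\<rfloor>) * \<eta> $ i * t $ i)"
   unfolding inner_vec_def by (simp add: sum_subtractf[symmetric] left_diff_distrib)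
  also have "\<bar>\<dots>\<bar> \<le> (\<Sum>i\<in>(UNIV::'n set). norm \<eta>)"
  proof (rule sum_norm_le[where 'a = real, simplified])
   fix i
   have "\<bar>y $ i - of_int \<lfloor>y $ i\<rfloor>\<bar> \<le> 1" by linarith
   moreover have "\<bar>\<eta> $ i\<bar> \<le> norm \<eta>" by (rule component_le_norm_cart)
   moreover have "\<bar>t $ i\<bar> \<le> 1" using T_bounds[OF t, of i] by simp
   ultimately have "\<bar>y $ i - of_int \<lfloor>y $ i\<rfloor>\<bar> * \<bar>\<eta> $ i\<bar> * \<bar>t $ i\<bar> \<le> 1 * norm \<eta> * 1" by (intro mult_mono) auto
   thus "\<bar>(y $ i - of_int \<lfloor>y $ i\<rfloor>) * \<eta> $ i * t $ i\<bar> \<le> norm \<eta>" by (simp add: abs_mult)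
  qed
  finally show ?thesis by simp
 qed
 have "?a - ?b = (\<Sum>t\<in>T. m t *\<^sub>R (iexp (2 * pi * ((y * \<eta>) \<bullet> t)) - iexp (2 * pi * ((flr y * \<eta>) \<bullet> t))))"
  unfolding phi_1 by (simp add: sum_subtractf[symmetric] scaleR_diff_right)
 also have "cmod \<dots> \<le> (\<Sum>t\<in>T. m t * (2 * pi * (real CARD('n) * norm \<eta>)))"
 proof (rule sum_norm_le)
  fix t assume t: "t \<in> T"
  have "cmod (iexp (2 * pi * ((y * \<eta>) \<bullet> t)) - iexp (2 * pi * ((flr y * \<eta>) \<bullet> t))) \<le> \<bar>2 * pi * ((y * \<eta>) \<bullet> t) - 2 * pi * ((flr y * \<eta>) \<bullet> t)\<bar>"
   by (rule cmod_iexp_diff_le)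
  also have "\<dots> = 2 * pi * \<bar>(y * \<eta>) \<bullet> t - (flr y * \<eta>) \<bullet> t\<bar>" by (simp add: right_diff_distrib[symmetric] abs_mult)
  also have "\<dots> \<le> 2 * pi * (real CARD('n) * norm \<eta>)" using d[OF t] by (intro mult_left_mono) auto
  finally show "cmod (m t *\<^sub>R (iexp (2 * pi * ((y * \<eta>) \<bullet> t)) - iexp (2 * pi * ((flr y * \<eta>) \<bullet> t)))) \<le> m t * (2 * pi * (real CARD('n) * norm \<eta>))"
   using m0[OF t] by (simp add: mult_left_mono)
 qed
 also have "\<dots> = 2 * pi * (real CARD('n) * norm \<eta>)" unfolding sum_distrib_right[symmetric] m1 by simp
 finally have ab: "cmod (?a - ?b) \<le> 2 * pi * (real CARD('n) * norm \<eta>)" .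
 have "(cmod ?a)\<^sup>2 - (cmod ?b)\<^sup>2 = (cmod ?a - cmod ?b) * (cmod ?a + cmod ?b)" by (simp add: power2_eq_square algebra_simps)
 also have "\<dots> \<le> cmod (?a - ?b) * 2"
  using norm_phi_le[of 1 "y * \<eta>"] norm_phi_le[of 1 "flr y * \<eta>"] norm_triangle_ineq2[of ?a ?b] by (intro mult_mono) auto
 finally show ?thesis unfolding F_def using ab by linarith
qed

lemma sum_F_grid_le:
 fixes \<eta> :: "real^'n" and N :: nat
 assumes strip: "\<And>a. (\<Sum>t\<in>{t \<in> T. \<bar>t $ k - a\<bar> \<le> \<rho>}. m t) \<le> B"
  and h: "0 < h" "h \<le> \<bar>\<eta> $ k\<bar>" and small: "2 * pi * \<bar>\<eta> $ k\<bar> \<le> 1" and rho: "\<rho> > 0"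
 shows "(\<Sum>g\<in>PiE UNIV (\<lambda>_. {-int N..int N}). F 1 ((\<chi> i. of_int (g i)) * \<eta>))
   \<le> (2 * real N + 1) ^ (CARD('n) - 1) * ((2 * real N + 1) * B + 1 / (h * \<rho>))"
proof -
 let ?G = "PiE (UNIV :: 'n set) (\<lambda>_. {-int N..int N})" and ?M = "2 * real N + 1"
 define \<theta> where "\<theta> t t' i = 2 * pi * (\<eta> $ i * (t $ i - t' $ i))" for t t' :: "real^'n" and i
 define D where "D t t' i = (\<Sum>z\<in>{-int N..int N}. iexp (\<theta> t t' i * of_int z))" for t t' i
 have FE: "complex_of_real (F 1 ((\<chi> i. of_int (g i)) * \<eta>)) = (\<Sum>t\<in>T. \<Sum>t'\<in>T. of_real (m t * m t') * (\<Prod>i\<in>UNIV. iexp (\<theta> t t' i * of_int (g i))))" for g :: "'n \<Rightarrow> int"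
 proof -
  let ?z = "(\<chi> i. of_int (g i)) * \<eta>"
  have "complex_of_real (F 1 ?z) = phi 1 ?z * cnj (phi 1 ?z)" unfolding F_def complex_norm_square ..
  also have "\<dots> = (\<Sum>t\<in>T. \<Sum>t'\<in>T. (of_real (m t) * iexp (2 * pi * (?z \<bullet> t))) * (of_real (m t') * iexp (- (2 * pi * (?z \<bullet> t')))))"
   unfolding phi_1 scaleR_conv_of_real by (simp only: cnj_sum complex_cnj_mult complex_cnj_complex_of_real cnj_iexp sum_product)
  also have "\<dots> = (\<Sum>t\<in>T. \<Sum>t'\<in>T. of_real (m t * m t') * (\<Prod>i\<in>UNIV. iexp (\<theta> t t' i * of_int (g i))))"
  proof (intro sum.cong refl)
   fix t t'
   have s: "2 * pi * (?z \<bullet> t) + - (2 * pi * (?z \<bullet> t')) = (\<Sum>i\<in>UNIV. \<theta> t t' i * of_int (g i))"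
    unfolding inner_vec_def \<theta>_def by (simp add: sum_distrib_left sum_subtractf[symmetric] algebra_simps)
   have "iexp (2 * pi * (?z \<bullet> t)) * iexp (- (2 * pi * (?z \<bullet> t'))) = iexp (2 * pi * (?z \<bullet> t) + - (2 * pi * (?z \<bullet> t')))"
    unfolding of_real_add distrib_left exp_add ..
   also have "\<dots> = (\<Prod>i\<in>UNIV. iexp (\<theta> t t' i * of_int (g i)))" unfolding s of_real_sum sum_distrib_left by (rule exp_sum) simp
   finally show "(of_real (m t) * iexp (2 * pi * (?z \<bullet> t))) * (of_real (m t') * iexp (- (2 * pi * (?z \<bullet> t')))) = of_real (m t * m t') * (\<Prod>i\<in>UNIV. iexp (\<theta> t t' i * of_int (g i)))"
    by (simp only: of_real_mult ac_simps)
  qed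
  finally show ?thesis .
 qed
 have "complex_of_real (\<Sum>g\<in>?G. F 1 ((\<chi> i. of_int (g i)) * \<eta>))
   = (\<Sum>g\<in>?G. \<Sum>t\<in>T. \<Sum>t'\<in>T. of_real (m t * m t') * (\<Prod>i\<in>UNIV. iexp (\<theta> t t' i * of_int (g i))))"
  unfolding of_real_sum FE ..
 also have "\<dots> = (\<Sum>t\<in>T. \<Sum>g\<in>?G. \<Sum>t'\<in>T. of_real (m t * m t') * (\<Prod>i\<in>UNIV. iexp (\<theta> t t' i * of_int (g i))))" by (rule sum.swap)
 also have "\<dots> = (\<Sum>t\<in>T. \<Sum>t'\<in>T. \<Sum>g\<in>?G. of_real (m t * m t') * (\<Prod>i\<in>UNIV. iexp (\<theta> t t' i * of_int (g i))))" by (intro sum.cong refl sum.swap)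
 also have "\<dots> = (\<Sum>t\<in>T. \<Sum>t'\<in>T. of_real (m t * m t') * (\<Prod>i\<in>UNIV. D t t' i))"
  unfolding sum_distrib_left[symmetric] D_def by (subst prod_sum_PiE) auto
 finally have eq: "complex_of_real (\<Sum>g\<in>?G. F 1 ((\<chi> i. of_int (g i)) * \<eta>)) = (\<Sum>t\<in>T. \<Sum>t'\<in>T. of_real (m t * m t') * (\<Prod>i\<in>UNIV. D t t' i))" .
 have Dprod: "cmod (\<Prod>i\<in>UNIV. D t t' i) \<le> ?M ^ (CARD('n) - 1) * cmod (D t t' k)" for t t'
 proof -
  have "cmod (\<Prod>i\<in>UNIV. D t t' i) = cmod (D t t' k) * (\<Prod>i\<in>UNIV - {k}. cmod (D t t' i))"
   unfolding prod_norm[symmetric] by (subst prod.remove[of _ k]) auto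
  also have "\<dots> \<le> cmod (D t t' k) * (\<Prod>i\<in>UNIV - {k}. ?M)"
   unfolding D_def by (intro mult_left_mono prod_mono conjI norm_ge_zero dirichlet_kernel_le(1))
  finally show ?thesis by (simp add: mult.commute card_Diff_singleton)
 qed
 have Dk: "cmod (D t t' k) \<le> (if \<bar>t $ k - t' $ k\<bar> \<le> \<rho> then 1 else 0) * ?M + 1 / (h * \<rho>)" if t: "t \<in> T" "t' \<in> T" for t t'
 proof (cases "\<bar>t $ k - t' $ k\<bar> \<le> \<rho>")
  case True
  have "1 / (h * \<rho>) \<ge> 0" using h rho by simp
  from add_mono[OF dirichlet_kernel_le(1)[of "\<theta> t t' k" N] this] show ?thesis using True unfolding D_def by simp
 next
  case False
  have a1: "\<bar>t $ k - t' $ k\<bar> \<le> 1" using T_bounds[OF t(1), of k] T_bounds[OF t(2), of k] by linarith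
  have th: "\<bar>\<theta> t t' k\<bar> = 2 * pi * \<bar>\<eta> $ k\<bar> * \<bar>t $ k - t' $ k\<bar>" unfolding \<theta>_def by (simp add: abs_mult)
  have le1: "\<bar>\<theta> t t' k\<bar> \<le> 1" unfolding th using mult_mono[OF small a1] by simp
  have "4 * (h * \<rho>) \<le> 2 * pi * (h * \<rho>)" using pi_ge_two h rho by (intro mult_right_mono) auto
  also have "\<dots> \<le> 2 * pi * (\<bar>\<eta> $ k\<bar> * \<bar>t $ k - t' $ k\<bar>)" using h rho False by (intro mult_left_mono mult_mono) auto
  finally have ge: "4 * (h * \<rho>) \<le> \<bar>\<theta> t t' k\<bar>" unfolding th by simp
  have p: "4 * (h * \<rho>) > 0" using h rho by simp
  have "\<bar>\<theta> t t' k\<bar> > 0" using ge p by linarith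
  hence "\<theta> t t' k \<noteq> 0" by simp
  hence "cmod (D t t' k) \<le> 4 / \<bar>\<theta> t t' k\<bar>" unfolding D_def using le1 by (rule dirichlet_kernel_le(2))
  also have "\<dots> \<le> 4 / (4 * (h * \<rho>))" using ge p \<open>\<bar>\<theta> t t' k\<bar> > 0\<close> by (intro divide_left_mono mult_pos_pos[of "\<bar>\<theta> t t' k\<bar>" "4 * (h * \<rho>)"]) auto
  finally show ?thesis using False by simp
 qed
 have inner: "(\<Sum>t\<in>T. m t * cmod (D t t' k)) \<le> ?M * B + 1 / (h * \<rho>)" if t': "t' \<in> T" for t'
 proof -
  have "(\<Sum>t\<in>T. m t * cmod (D t t' k)) \<le> (\<Sum>t\<in>T. m t * ((if \<bar>t $ k - t' $ k\<bar> \<le> \<rho> then 1 else 0) * ?M + 1 / (h * \<rho>)))"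
   using Dk[OF _ t'] m0 by (intro sum_mono mult_left_mono) auto
  also have "\<dots> = (\<Sum>t\<in>T. (if \<bar>t $ k - t' $ k\<bar> \<le> \<rho> then m t else 0)) * ?M + (\<Sum>t\<in>T. m t) * (1 / (h * \<rho>))"
   unfolding sum_distrib_right sum.distrib[symmetric] by (intro sum.cong refl) (auto simp: algebra_simps)
  also have "(\<Sum>t\<in>T. (if \<bar>t $ k - t' $ k\<bar> \<le> \<rho> then m t else 0)) = (\<Sum>t\<in>{t \<in> T. \<bar>t $ k - t' $ k\<bar> \<le> \<rho>}. m t)"
   using finT by (simp add: sum.inter_filter)
  also have "\<dots> * ?M \<le> B * ?M" using strip by (intro mult_right_mono) auto
  finally show ?thesis unfolding m1 by (simp add: mult.commute)
 qed
 have "(\<Sum>g\<in>?G. F 1 ((\<chi> i. of_int (g i)) * \<eta>)) \<le> cmod (complex_of_real (\<Sum>g\<in>?G. F 1 ((\<chi> i. of_int (g i)) * \<eta>)))"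
  unfolding norm_of_real by (rule abs_ge_self)
 also have "\<dots> \<le> (\<Sum>t\<in>T. \<Sum>t'\<in>T. m t * m t' * (?M ^ (CARD('n) - 1) * cmod (D t t' k)))"
  unfolding eq
 proof (intro sum_norm_le)
  fix t t' assume t: "t \<in> T" "t' \<in> T"
  have "cmod (of_real (m t * m t') * (\<Prod>i\<in>UNIV. D t t' i)) = (m t * m t') * cmod (\<Prod>i\<in>UNIV. D t t' i)"
   using m0[OF t(1)] m0[OF t(2)] by (simp only: norm_mult norm_of_real abs_mult abs_of_nonneg)
  also have "\<dots> \<le> m t * m t' * (?M ^ (CARD('n) - 1) * cmod (D t t' k))" using m0 t Dprod by (intro mult_left_mono) auto
  finally show "cmod (of_real (m t * m t') * (\<Prod>i\<in>UNIV. D t t' i)) \<le> m t * m t' * (?M ^ (CARD('n) - 1) * cmod (D t t' k))" .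
 qed
 also have "\<dots> = (\<Sum>t'\<in>T. \<Sum>t\<in>T. m t * m t' * (?M ^ (CARD('n) - 1) * cmod (D t t' k)))" by (rule sum.swap)
 also have "\<dots> = ?M ^ (CARD('n) - 1) * (\<Sum>t'\<in>T. m t' * (\<Sum>t\<in>T. m t * cmod (D t t' k)))"
  unfolding sum_distrib_left by (intro sum.cong refl) (simp add: ac_simps)
 also have "\<dots> \<le> ?M ^ (CARD('n) - 1) * (\<Sum>t'\<in>T. m t' * (?M * B + 1 / (h * \<rho>)))"
  using inner m0 by (intro mult_left_mono sum_mono) auto
 also have "\<dots> = ?M ^ (CARD('n) - 1) * (?M * B + 1 / (h * \<rho>))" unfolding sum_distrib_right[symmetric] m1 by simp
 finally show ?thesis .
qed

text \<open>After rounding to cells, Cauchy-Schwarz separates the masses of the cells from the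
  values of \<open>F 1\<close> on the lattice; the square of \<open>F 1\<close> is at most
  \<open>F 1\<close>.\<close>

lemma sum_F_le_coll:
 fixes \<eta> :: "real^'n" and N :: nat
 assumes finS: "finite S" and w: "\<And>y. y \<in> S \<Longrightarrow> w y \<ge> 0" "(\<Sum>y\<in>S. w y) = 1" and SN: "S \<subseteq> vbx (\<lambda>_. real N)"
 shows "(\<Sum>y\<in>S. w y * F 1 (y * \<eta>)) \<le> 4 * pi * (real CARD('n) * norm \<eta>)
   + sqrt (coll S w flr * (\<Sum>g\<in>PiE UNIV (\<lambda>_. {-int N..int N}). F 1 ((\<chi> i. of_int (g i)) * \<eta>)))"
proof -
 let ?G = "PiE (UNIV :: 'n set) (\<lambda>_. {-int N..int N})"
 let ?v = "\<lambda>g :: 'n \<Rightarrow> int. (\<chi> i. of_int (g i)) :: real^'n"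
 have "(\<Sum>y\<in>S. w y * F 1 (y * \<eta>)) \<le> (\<Sum>y\<in>S. w y * (F 1 (flr y * \<eta>) + 4 * pi * (real CARD('n) * norm \<eta>)))"
  using w F_1_lipschitz by (intro sum_mono mult_left_mono) auto
 also have "\<dots> = (\<Sum>y\<in>S. w y * F 1 (flr y * \<eta>)) + (\<Sum>y\<in>S. w y) * (4 * pi * (real CARD('n) * norm \<eta>))"
  by (simp only: distrib_left sum.distrib sum_distrib_right)
 also have "(\<Sum>y\<in>S. w y * F 1 (flr y * \<eta>)) = (\<Sum>c\<in>flr ` S. mass S w flr c * F 1 (c * \<eta>))"
  using finS by (intro sum_mass_mult[symmetric]) auto
 also have "\<dots> \<le> sqrt (coll S w flr * (\<Sum>g\<in>?G. F 1 (?v g * \<eta>)))"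
 proof (rule real_le_rsqrt)
  have "(\<Sum>c\<in>flr ` S. mass S w flr c * F 1 (c * \<eta>))\<^sup>2 \<le> (\<Sum>c\<in>flr ` S. (mass S w flr c)\<^sup>2) * (\<Sum>c\<in>flr ` S. (F 1 (c * \<eta>))\<^sup>2)"
   by (rule Cauchy_Schwarz_ineq_sum)
  also have "\<dots> \<le> coll S w flr * (\<Sum>g\<in>?G. F 1 (?v g * \<eta>))"
   unfolding coll_def[symmetric]
  proof (rule mult_left_mono[OF _ coll_nonneg])
   have "(\<Sum>c\<in>flr ` S. (F 1 (c * \<eta>))\<^sup>2) \<le> (\<Sum>c\<in>flr ` S. F 1 (c * \<eta>))"
    using F_nonneg F_le_1 by (intro sum_mono) (simp add: power2_eq_square mult_left_le)
   also have "\<dots> \<le> (\<Sum>c\<in>?v ` ?G. F 1 (c * \<eta>))"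
   proof (rule sum_mono2)
    show "flr ` S \<subseteq> ?v ` ?G"
    proof
     fix c assume "c \<in> flr ` S"
     then obtain y where y: "y \<in> S" "c = flr y" by blast
     have "\<lfloor>y $ i\<rfloor> \<in> {-int N..int N}" for i
     proof -
      have "\<bar>y $ i\<bar> \<le> real N" using SN y(1) unfolding vbx_def by auto
      thus ?thesis by simp linarith
     qed
     thus "c \<in> ?v ` ?G" unfolding y(2) by (intro image_eqI[of _ _ "\<lambda>i. \<lfloor>y $ i\<rfloor>"]) (auto simp: flr_def)
    qed
   qed (use F_nonneg in \<open>auto intro!: finite_imageI finite_PiE\<close>)
   also have "\<dots> = (\<Sum>g\<in>?G. F 1 (?v g * \<eta>))"
    by (rule sum.reindex_cong[where l = ?v]) (auto simp: inj_on_def vec_eq_iff)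
   finally show "(\<Sum>c\<in>flr ` S. (F 1 (c * \<eta>))\<^sup>2) \<le> (\<Sum>g\<in>?G. F 1 (?v g * \<eta>))" .
  qed
  finally show "(\<Sum>c\<in>flr ` S. mass S w flr c * F 1 (c * \<eta>))\<^sup>2 \<le> coll S w flr * (\<Sum>g\<in>?G. F 1 (?v g * \<eta>))" .
 qed
 finally show ?thesis unfolding w(2) by simp
qed

end

lemma coll_le_1:
 assumes "finite I" "\<And>i. i \<in> I \<Longrightarrow> w i \<ge> 0" "(\<Sum>i\<in>I. w i) = 1" shows "coll I w f \<le> 1"
proof -
 have "mass I w f c \<le> 1" for c unfolding mass_def assms(3)[symmetric] using assms by (intro sum_mono2) auto
 hence "(\<Sum>i\<in>I. w i * mass I w f (f i)) \<le> (\<Sum>i\<in>I. w i * 1)" using assms(2) by (intro sum_mono mult_left_mono)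
 thus ?thesis using coll_eq_sum[OF assms(1), of w f] assms(3) by simp
qed

section \<open>Decay for finitely supported laws\<close>

text \<open>The collision probability of Y_0 is at most 1. Either each of \<open>J\<close> steps
  gains the factor \<open>R powr (- es)\<close>, which leads below
  \<open>R powr (\<gamma> - n)\<close>, or some step stagnates and \<open>stagnation_bound\<close>
  gives that bound at once; later steps then lose only constants.\<close>

theorem finite_fourier_decay:
 fixes \<kappa> :: real
 assumes kap: "0 < \<kappa>" "\<kappa> \<le> 1/2"
 shows "\<exists>\<epsilon>>0. \<exists>e>0. \<exists>J::nat. eventually (\<lambda>R. \<forall>(T :: (real^'n) set) m \<xi>. finite_multiplier T m \<longrightarrow>
   (\<forall>v a \<rho>. norm v = 1 \<longrightarrow> 1 / R \<le> \<rho> \<longrightarrow> (\<Sum>t\<in>{t \<in> T. \<bar>v \<bullet> t - a\<bar> \<le> \<rho>}. m t) \<le> 2 * R powr \<epsilon> * \<rho> powr \<kappa>) \<longrightarrow>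
   R powr (1/2) / 2 \<le> norm \<xi> \<longrightarrow> norm \<xi> \<le> R powr (1/2) \<longrightarrow>
   cmod (finite_multiplier.phi T m J \<xi>) \<le> R powr (- e)) at_top"
proof -
 define n where "n = CARD('n)"
 have n1: "n \<ge> 1" unfolding n_def by (simp add: Suc_leI)
 define \<gamma> where "\<gamma> = \<kappa> / 16"
 have gam: "0 < \<gamma>" "\<gamma> \<le> 1" and kap1: "\<kappa> \<le> 1" unfolding \<gamma>_def using kap by auto
 obtain es where es: "es > 0" and stg: "eventually (\<lambda>R. \<forall>(T :: (real^'n) set) m S w.
   finite T \<longrightarrow> (\<forall>t\<in>T. \<forall>i. 1/2 \<le> t $ i \<and> t $ i \<le> 1) \<longrightarrow> (\<forall>t\<in>T. m t \<ge> 0) \<longrightarrow> (\<Sum>t\<in>T. m t) = 1 \<longrightarrow>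
   (\<forall>v a \<rho>. norm v = 1 \<longrightarrow> 1 / R \<le> \<rho> \<longrightarrow> (\<Sum>t\<in>{t \<in> T. \<bar>v \<bullet> t - a\<bar> \<le> \<rho>}. m t) \<le> R powr es * \<rho> powr \<kappa>) \<longrightarrow>
   finite S \<longrightarrow> S \<subseteq> vbx (\<lambda>_. R / 8) \<longrightarrow> (\<forall>y\<in>S. w y \<ge> 0) \<longrightarrow> (\<Sum>y\<in>S. w y) = 1 \<longrightarrow>
   (\<forall>k a \<rho>. 1 / R \<le> \<rho> \<longrightarrow> (\<Sum>y\<in>{y \<in> S. \<bar>y $ k - a\<bar> \<le> \<rho> * R}. w y) \<le> R powr es * \<rho> powr \<kappa>) \<longrightarrow>
   coll S w flr / R powr es \<le> coll ((T \<times> T) \<times> (S \<times> S)) (pw (pw m m) (pw w w)) (\<lambda>x. flr (dilate_diff x)) \<longrightarrow>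
   coll S w flr \<le> R powr (\<gamma> - real CARD('n))) at_top"
  using stagnation_bound[OF kap(1) kap1 gam, where 'n = 'n] by blast
 define J where "J = nat \<lceil>(real n + 1) / es\<rceil>"
 \<comment> \<open>Keeps the supports of all steps up to \<open>J\<close> in the box of radius
   \<open>R / 8\<close> that \<open>stagnation_bound\<close> asks for.\<close>
 define c0 where "c0 = 1 / (8 * 2 ^ J :: real)"
 define \<epsilon> where "\<epsilon> = min (es / 2) (\<kappa> / 64)"
 \<comment> \<open>The final bound \<open>R powr (- \<kappa> / 32)\<close> is for the power
   \<open>2 ^ J\<close> of the squared modulus.\<close>
 define e where "e = \<kappa> / (32 * 2 ^ Suc J)"
 define C where "C = 3 ^ (n * J) * (5 ^ n * (10 + 2 * real n))"
 have ep: "\<epsilon> > 0" "\<epsilon> \<le> es / 2" "\<epsilon> \<le> \<kappa> / 64" unfolding \<epsilon>_def using es kap by auto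
 have e0: "e > 0" unfolding e_def using kap by simp
 have c0: "0 < c0" "c0 \<le> 1"
 proof -
  have "1 \<le> 8 * (2::real) ^ J" using one_le_power[of "2::real" J] by linarith
  thus "0 < c0" "c0 \<le> 1" unfolding c0_def by (simp_all add: divide_le_eq)
 qed
 have C0: "C \<ge> 0" unfolding C_def by simp
 have ev: "eventually (\<lambda>R. R \<ge> 1 \<and> 2 / c0 * 2 ^ J < R powr (es / 2) \<and> 2 * pi / c0 < R powr (1/2) \<and>
   4 * pi * real n / c0 + sqrt C < R powr (\<kappa> / 32)) at_top"
  using es kap by (intro eventually_conj eventually_ge_at_top eventually_less_powr) auto
 show ?thesis
 \<comment> \<open>The number of factors \<open>Suc (J + 1)\<close> is one for Y_0, \<open>J\<close>
   for the squarings and one for the remaining \<open>F 1\<close>.\<close>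
 proof (rule exI[of _ \<epsilon>], rule conjI[OF ep(1)], rule exI[of _ e], rule conjI[OF e0], rule exI[of _ "Suc (J + 1)"], rule eventually_mono[OF eventually_conj[OF stg ev]], intro allI impI, elim conjE)
  fix R :: real and T :: "(real^'n) set" and m :: "real^'n \<Rightarrow> real" and \<xi> :: "real^'n"
  assume stg: "\<forall>(T :: (real^'n) set) m S w.
   finite T \<longrightarrow> (\<forall>t\<in>T. \<forall>i. 1/2 \<le> t $ i \<and> t $ i \<le> 1) \<longrightarrow> (\<forall>t\<in>T. m t \<ge> 0) \<longrightarrow> (\<Sum>t\<in>T. m t) = 1 \<longrightarrow>
   (\<forall>v a \<rho>. norm v = 1 \<longrightarrow> 1 / R \<le> \<rho> \<longrightarrow> (\<Sum>t\<in>{t \<in> T. \<bar>v \<bullet> t - a\<bar> \<le> \<rho>}. m t) \<le> R powr es * \<rho> powr \<kappa>) \<longrightarrow>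
   finite S \<longrightarrow> S \<subseteq> vbx (\<lambda>_. R / 8) \<longrightarrow> (\<forall>y\<in>S. w y \<ge> 0) \<longrightarrow> (\<Sum>y\<in>S. w y) = 1 \<longrightarrow>
   (\<forall>k a \<rho>. 1 / R \<le> \<rho> \<longrightarrow> (\<Sum>y\<in>{y \<in> S. \<bar>y $ k - a\<bar> \<le> \<rho> * R}. w y) \<le> R powr es * \<rho> powr \<kappa>) \<longrightarrow>
   coll S w flr / R powr es \<le> coll ((T \<times> T) \<times> (S \<times> S)) (pw (pw m m) (pw w w)) (\<lambda>x. flr (dilate_diff x)) \<longrightarrow>
   coll S w flr \<le> R powr (\<gamma> - real CARD('n))"
  assume R1: "1 \<le> R" and r1: "2 / c0 * 2 ^ J < R powr (es / 2)" and r2: "2 * pi / c0 < R powr (1/2)"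
   and r3: "4 * pi * real n / c0 + sqrt C < R powr (\<kappa> / 32)"
  assume fm: "finite_multiplier T m"
  assume strip: "\<forall>v a \<rho>. norm v = 1 \<longrightarrow> 1 / R \<le> \<rho> \<longrightarrow> (\<Sum>t\<in>{t \<in> T. \<bar>v \<bullet> t - a\<bar> \<le> \<rho>}. m t) \<le> 2 * R powr \<epsilon> * \<rho> powr \<kappa>"
  assume xi: "R powr (1/2) / 2 \<le> norm \<xi>" "norm \<xi> \<le> R powr (1/2)"
  interpret finite_multiplier T m by (rule fm)
  have R0: "R > 0" using R1 by simp
  define c where "c = c0 * R"
  have cpos: "c > 0" unfolding c_def using c0 R0 by simp
  have Rep: "2 / c0 * 2 ^ J * R powr \<epsilon> \<le> R powr es"
  proof -
   have "R powr \<epsilon> \<le> R powr (es / 2)" using ep R1 by (intro powr_mono) auto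
   hence "2 / c0 * 2 ^ J * R powr \<epsilon> \<le> R powr (es / 2) * R powr (es / 2)" using r1 by (intro mult_mono) auto
   thus ?thesis by (simp add: powr_add[symmetric])
  qed
  have cstrip: "(\<Sum>t\<in>{t \<in> T. \<bar>t $ k - a\<bar> \<le> \<rho>}. m t) \<le> (2 * R powr \<epsilon>) * \<rho> powr \<kappa>" if "1 / R \<le> \<rho>" for k a \<rho>
   using strip[rule_format, of "axis k 1" \<rho> a] that by (simp add: inner_axis inner_commute[of "axis k 1"])
  have twoc: "2 \<le> 2 / c0 * 2 ^ J"
  proof -
   have "1 * 1 \<le> 1 / c0 * 2 ^ J" using c0 by (intro mult_mono) auto
   thus ?thesis by simp
  qed
  define q where "q j = coll (LS c j) (LW c j) flr" for j
  have stepq: "q j \<le> R powr (\<gamma> - real n)" if j: "j < J" and st: "q j / R powr es \<le> q (Suc j)" for j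
   unfolding q_def n_def
  proof (rule stg[rule_format, of T m])
   show "(\<Sum>t\<in>{t \<in> T. \<bar>v \<bullet> t - a\<bar> \<le> \<rho>}. m t) \<le> R powr es * \<rho> powr \<kappa>" if "norm v = 1" "1 / R \<le> \<rho>" for v a \<rho>
   proof -
    have "2 * R powr \<epsilon> \<le> R powr es" using mult_right_mono[OF twoc, of "R powr \<epsilon>"] Rep by simp
    hence "2 * R powr \<epsilon> * \<rho> powr \<kappa> \<le> R powr es * \<rho> powr \<kappa>" by (intro mult_right_mono) auto
    thus ?thesis using strip that by (meson order_trans)
   qed
   show "(\<Sum>y\<in>{y \<in> LS c j. \<bar>y $ k - a\<bar> \<le> \<rho> * R}. LW c j y) \<le> R powr es * \<rho> powr \<kappa>" if "1 / R \<le> \<rho>" for k a \<rho>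
   proof -
    have "(\<Sum>y\<in>{y \<in> LS c j. \<bar>y $ k - a\<bar> \<le> \<rho> * R}. LW c j y) \<le> 2 * R powr \<epsilon> / c0 * 2 ^ j * \<rho> powr \<kappa>"
     unfolding c_def by (rule law_strips[OF c0 R0 kap(1) kap1 _ cstrip that]) auto
    also have "\<dots> \<le> R powr es * \<rho> powr \<kappa>"
    proof (rule mult_right_mono)
     have "(2::real) ^ j \<le> 2 ^ J" using j by (intro power_increasing) auto
     hence "2 * R powr \<epsilon> / c0 * 2 ^ j \<le> 2 * R powr \<epsilon> / c0 * 2 ^ J" using c0 by (intro mult_left_mono) auto
     thus "2 * R powr \<epsilon> / c0 * 2 ^ j \<le> R powr es" using Rep by (simp add: ac_simps)
    qed simp
    finally show ?thesis .
   qed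
   show "LS c j \<subseteq> vbx (\<lambda>_. R / 8)"
   proof
    fix y assume "y \<in> LS c j"
    hence "y \<in> vbx (\<lambda>_. c * 2 ^ j)" using LS_bound[of c j] cpos by auto
    moreover have "c * 2 ^ j \<le> R / 8"
    proof -
     have "(2::real) ^ j \<le> 2 ^ J" using j by (intro power_increasing) auto
     hence "c * 2 ^ j \<le> c * 2 ^ J" using cpos by (intro mult_left_mono) auto
     thus ?thesis unfolding c_def c0_def by simp
    qed
    ultimately show "y \<in> vbx (\<lambda>_. R / 8)" by (rule vbx_mono)
   qed
   show "coll (LS c j) (LW c j) flr / R powr es \<le> coll ((T \<times> T) \<times> LS c j \<times> LS c j) (pw (pw m m) (pw (LW c j) (LW c j))) (\<lambda>x. flr (dilate_diff x))"
    using st unfolding q_def coll_law_Suc LI_def LV_def .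
  qed (use finT T_bounds m0 m1 finLS LW_nonneg LW_sum in auto)
  have Rpos: "R powr x > 0" for x using R0 by simp
  have qJ: "q J \<le> 3 ^ (n * J) * R powr (\<gamma> - real n)"
  proof (cases "\<exists>j<J. q j / R powr es \<le> q (Suc j)")
   case True
   then obtain j where j: "j < J" "q j / R powr es \<le> q (Suc j)" by blast
   have "q (j + i) \<le> 3 ^ (n * i) * R powr (\<gamma> - real n)" for i
   proof (induction i)
    case 0
    show ?case using stepq[OF j] by simp
   next
    case (Suc i)
    have "q (j + Suc i) \<le> 3 ^ n * q (j + i)" unfolding q_def n_def using coll_law_le[of c "j + i"] by simp
    also have "\<dots> \<le> 3 ^ n * (3 ^ (n * i) * R powr (\<gamma> - real n))" using Suc by (intro mult_left_mono) auto
    finally show ?case by (simp add: power_add ac_simps)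
   qed
   from this[of "J - j"] have "q J \<le> 3 ^ (n * (J - j)) * R powr (\<gamma> - real n)" using j by simp
   also have "\<dots> \<le> 3 ^ (n * J) * R powr (\<gamma> - real n)" by (intro mult_right_mono power_increasing) auto
   finally show ?thesis .
  next
   case False
   have "j \<le> J \<Longrightarrow> q j \<le> R powr (- (es * real j))" for j
   proof (induction j)
    case 0
    have "q 0 \<le> 1" unfolding q_def by (intro coll_le_1 finLS LW_nonneg LW_sum)
    thus ?case using R0 by simp
   next
    case (Suc j)
    have "q (Suc j) \<le> q j / R powr es" using False Suc.prems by (metis Suc_le_lessD less_imp_le not_le)
    also have "\<dots> \<le> R powr (- (es * real j)) / R powr es" using Suc by (intro divide_right_mono) auto
    also have "\<dots> = R powr (- (es * real (Suc j)))" by (simp only: powr_diff[symmetric], rule arg_cong[where f = "\<lambda>x. R powr x"], simp add: algebra_simps)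
    finally show ?case .
   qed
   hence "q J \<le> R powr (- (es * real J))" by simp
   also have "\<dots> \<le> R powr (\<gamma> - real n)"
   proof (rule powr_mono[OF _ R1])
    have "(real n + 1) / es \<le> real J" unfolding J_def by (rule real_nat_ceiling_ge)
    hence "real n + 1 \<le> es * real J" using es by (simp add: divide_le_eq mult.commute)
    thus "- (es * real J) \<le> \<gamma> - real n" using gam by linarith
   qed
   also have "\<dots> \<le> 3 ^ (n * J) * R powr (\<gamma> - real n)" using mult_right_mono[of 1 "3 ^ (n * J)" "R powr (\<gamma> - real n)"] by simp
   finally show ?thesis .
  qed
  define \<eta> where "\<eta> = \<xi> /\<^sub>R c"
  have ceta: "c *\<^sub>R \<eta> = \<xi>" unfolding \<eta>_def using cpos by simp
  have half: "R powr (1/2) * R powr (1/2) = R" using R0 by (simp add: powr_add[symmetric])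
  have neta: "norm \<eta> \<le> R powr (- 1/2) / c0"
  proof -
   have "norm \<eta> = norm \<xi> / c" unfolding \<eta>_def using cpos by (simp add: divide_inverse mult.commute)
   also have "\<dots> \<le> R powr (1/2) / c" using xi cpos by (intro divide_right_mono) auto
   also have "\<dots> = R powr (1/2) / R powr 1 / c0" unfolding c_def using R0 by simp
   also have "R powr (1/2) / R powr 1 = R powr (- 1/2)" by (simp only: powr_diff[symmetric]) simp
   finally show ?thesis .
  qed
  \<comment> \<open>One coordinate carries at least the fraction \<open>1 / n\<close> of the
    frequency; the decay is taken from this coordinate alone.\<close>
  obtain k where k: "\<bar>\<xi> $ k\<bar> \<ge> norm \<xi> / real n"
  proof -
   have "\<exists>k. \<bar>\<xi> $ k\<bar> \<ge> norm \<xi> / real n"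
   proof (rule ccontr)
    assume "\<not> ?thesis"
    hence "(\<Sum>i\<in>UNIV. \<bar>\<xi> $ i\<bar>) < (\<Sum>i\<in>(UNIV::'n set). norm \<xi> / real n)" by (intro sum_strict_mono) (auto simp: not_le)
    also have "\<dots> = norm \<xi>" using n1 unfolding n_def by simp
    finally show False using norm_le_l1_cart[of \<xi>] by simp
   qed
   thus thesis using that by blast
  qed
  define h where "h = R powr (- 1/2) / (2 * real n * c0)"
  have h0: "0 < h" unfolding h_def using n1 c0 R0 by simp
  have hk: "h \<le> \<bar>\<eta> $ k\<bar>"
  proof -
   have "h = (R powr (1/2) / R powr 1) / (2 * real n * c0)" unfolding h_def by (simp only: powr_diff[symmetric]) simp
   also have "\<dots> = (R powr (1/2) / 2) / real n / c" unfolding c_def using R0 by simp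
   also have "\<dots> \<le> norm \<xi> / real n / c" using xi n1 cpos by (intro divide_right_mono) auto
   also have "\<dots> \<le> \<bar>\<xi> $ k\<bar> / c" using k cpos by (intro divide_right_mono) auto
   also have "\<dots> = \<bar>\<eta> $ k\<bar>" unfolding \<eta>_def using cpos by (simp add: divide_inverse abs_mult)
   finally show ?thesis .
  qed
  have small: "2 * pi * \<bar>\<eta> $ k\<bar> \<le> 1"
  proof -
   have "2 * pi * \<bar>\<eta> $ k\<bar> \<le> 2 * pi * (R powr (- 1/2) / c0)" using order_trans[OF component_le_norm_cart neta] by (intro mult_left_mono) auto
   also have "\<dots> = (2 * pi / c0) * R powr (- 1/2)" by simp
   also have "\<dots> \<le> R powr (1/2) * R powr (- 1/2)" using r2 by (intro mult_right_mono) auto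
   also have "\<dots> = 1" using R0 by (simp add: powr_add[symmetric])
   finally show ?thesis .
  qed
  define N where "N = nat \<lceil>R\<rceil>"
  have N: "R \<le> real N" "2 * real N + 1 \<le> 5 * R" unfolding N_def using R1 by linarith+
  \<comment> \<open>At this radius strips have mass about
    \<open>R powr (\<epsilon> - \<kappa> / 4)\<close>, while \<open>1 / (h * \<rho>)\<close> is of
    order \<open>R powr (3 / 4)\<close>, no more than \<open>R\<close> times that mass because
    \<open>\<kappa> \<le> 1/2\<close>.\<close>
  define \<rho> where "\<rho> = R powr (- 1/4)"
  have rho0: "\<rho> > 0" unfolding \<rho>_def using R0 by simp
  have rho1: "1 / R \<le> \<rho>"
  proof -
   have "1 / R = R powr (-1)" using R0 by (simp add: powr_minus divide_inverse)
   also have "\<dots> \<le> \<rho>" unfolding \<rho>_def using R1 by (intro powr_mono) auto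
   finally show ?thesis .
  qed
  define G where "G = (\<Sum>g\<in>PiE UNIV (\<lambda>_. {-int N..int N}). F 1 ((\<chi> i. of_int (g i)) * \<eta>))"
  have Gle: "G \<le> 5 ^ n * (10 + 2 * real n) * (R powr real n * R powr (\<epsilon> - \<kappa> / 4))"
  proof -
   have ka: "R powr (- 1/4) \<le> R powr (\<epsilon> - \<kappa> / 4)" using R1 ep kap by (intro powr_mono) auto
   have B: "2 * R powr \<epsilon> * \<rho> powr \<kappa> = 2 * R powr (\<epsilon> - \<kappa> / 4)"
    unfolding \<rho>_def powr_powr by (simp add: powr_add[symmetric])
   have hr: "1 / (h * \<rho>) \<le> 2 * real n * (R * R powr (- 1/4))"
   proof -
    have "1 / (h * \<rho>) = (2 * real n * c0) * (1 / (R powr (- 1/2) * R powr (- 1/4)))" unfolding h_def \<rho>_def by simp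
    also have "1 / (R powr (- 1/2) * R powr (- 1/4)) = R * R powr (- 1/4)"
    proof -
     have "R powr (- 1/2) * R powr (- 1/4) * (R powr 1 * R powr (- 1/4)) = R powr 0"
      by (simp only: powr_add[symmetric], rule arg_cong[where f = "\<lambda>x. R powr x"], simp)
     hence "R powr (- 1/2) * R powr (- 1/4) * (R * R powr (- 1/4)) = 1" using R0 by simp
     moreover have "1 / a = b" if "a * b = 1" for a b :: real using that by (auto simp: eq_divide_eq divide_eq_eq mult.commute)
     ultimately show ?thesis by blast
    qed
    also have "2 * real n * c0 * (R * R powr (- 1/4)) \<le> 2 * real n * 1 * (R * R powr (- 1/4))" using c0 R0 by (intro mult_right_mono mult_left_mono) auto
    finally show ?thesis by simp
   qed
   have "G \<le> (2 * real N + 1) ^ (n - 1) * ((2 * real N + 1) * (2 * R powr (\<epsilon> - \<kappa> / 4)) + 1 / (h * \<rho>))"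
    unfolding G_def n_def B[symmetric] by (rule sum_F_grid_le[OF cstrip[OF rho1] h0 hk small rho0])
   also have "\<dots> \<le> (5 * R) ^ (n - 1) * ((5 * R) * (2 * R powr (\<epsilon> - \<kappa> / 4)) + 2 * real n * (R * R powr (\<epsilon> - \<kappa> / 4)))"
   proof (intro mult_mono power_mono add_mono)
    have "2 * real n * (R * R powr (- 1/4)) \<le> 2 * real n * (R * R powr (\<epsilon> - \<kappa> / 4))" using ka R0 by (intro mult_left_mono) auto
    thus "1 / (h * \<rho>) \<le> 2 * real n * (R * R powr (\<epsilon> - \<kappa> / 4))" using hr by linarith
   qed (use N R0 h0 rho0 in auto)
   also have "\<dots> = 5 ^ (n - 1) * R ^ (n - 1) * R * ((10 + 2 * real n) * R powr (\<epsilon> - \<kappa> / 4))"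
    by (simp add: power_mult_distrib algebra_simps)
   also have "\<dots> = 5 ^ (n - 1) * R ^ n * ((10 + 2 * real n) * R powr (\<epsilon> - \<kappa> / 4))"
    using n1 by (simp add: power_eq_if mult.commute)
   also have "\<dots> \<le> 5 ^ n * R ^ n * ((10 + 2 * real n) * R powr (\<epsilon> - \<kappa> / 4))"
    using R0 by (intro mult_right_mono power_increasing) auto
   finally show ?thesis using R0 by (simp add: powr_realpow ac_simps)
  qed
  have G0: "G \<ge> 0" unfolding G_def by (intro sum_nonneg F_nonneg)
  \<comment> \<open>The volume \<open>R powr n\<close> cancels, and
    \<open>\<gamma> + \<epsilon>\<close>, at most \<open>\<kappa> / 16 + \<kappa> / 64\<close>, is
    below \<open>\<kappa> / 8\<close>.\<close>
  have qG: "q J * G \<le> C * R powr (- \<kappa> / 8)"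
  proof -
   have "q J * G \<le> (3 ^ (n * J) * R powr (\<gamma> - real n)) * (5 ^ n * (10 + 2 * real n) * (R powr real n * R powr (\<epsilon> - \<kappa> / 4)))"
    using qJ Gle G0 by (intro mult_mono) auto
   also have "\<dots> = C * (R powr (\<gamma> - real n) * R powr real n * R powr (\<epsilon> - \<kappa> / 4))" unfolding C_def by simp
   also have "R powr (\<gamma> - real n) * R powr real n * R powr (\<epsilon> - \<kappa> / 4) = R powr (\<gamma> + \<epsilon> - \<kappa> / 4)"
    by (simp only: powr_add[symmetric], rule arg_cong[where f = "\<lambda>x. R powr x"], simp)
   also have "C * R powr (\<gamma> + \<epsilon> - \<kappa> / 4) \<le> C * R powr (- \<kappa> / 8)"
    using C0 R1 ep kap unfolding \<gamma>_def by (intro mult_left_mono powr_mono) auto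
   finally show ?thesis .
  qed
  have "F (Suc (J + 1)) \<xi> ^ (2 ^ J) \<le> avgF c J 1 \<eta>" using F_descent[of J 1 c \<eta>] unfolding ceta .
  also have "\<dots> \<le> 4 * pi * (real n * norm \<eta>) + sqrt (q J * G)"
   unfolding avgF_def n_def q_def G_def
  proof (rule sum_F_le_coll[OF finLS LW_nonneg LW_sum])
   show "LS c J \<subseteq> vbx (\<lambda>_. real N)"
   proof
    fix y assume "y \<in> LS c J"
    hence "y \<in> vbx (\<lambda>_. c * 2 ^ J)" using LS_bound[of c J] cpos by auto
    moreover have "c * 2 ^ J \<le> real N" unfolding c_def c0_def using N R0 by simp
    ultimately show "y \<in> vbx (\<lambda>_. real N)" by (rule vbx_mono)
   qed
  qed
  also have "\<dots> \<le> 4 * pi * real n / c0 * R powr (- \<kappa> / 16) + sqrt C * R powr (- \<kappa> / 16)"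
  proof (rule add_mono)
   have "4 * pi * (real n * norm \<eta>) \<le> 4 * pi * (real n * (R powr (- 1/2) / c0))" using neta by (intro mult_left_mono) auto
   also have "\<dots> = 4 * pi * real n / c0 * R powr (- 1/2)" by simp
   also have "\<dots> \<le> 4 * pi * real n / c0 * R powr (- \<kappa> / 16)" using R1 kap c0 by (intro mult_left_mono powr_mono) auto
   finally show "4 * pi * (real n * norm \<eta>) \<le> 4 * pi * real n / c0 * R powr (- \<kappa> / 16)" .
   have "sqrt (q J * G) \<le> sqrt (C * R powr (- \<kappa> / 8))" using qG by (rule real_sqrt_le_mono)
   also have "\<dots> = sqrt C * sqrt (R powr (- \<kappa> / 16) * R powr (- \<kappa> / 16))" by (simp add: real_sqrt_mult powr_add[symmetric])
   also have "\<dots> = sqrt C * R powr (- \<kappa> / 16)" by simp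
   finally show "sqrt (q J * G) \<le> sqrt C * R powr (- \<kappa> / 16)" .
  qed
  also have "\<dots> = (4 * pi * real n / c0 + sqrt C) * R powr (- \<kappa> / 16)" by (simp add: distrib_right)
  also have "\<dots> \<le> R powr (\<kappa> / 32) * R powr (- \<kappa> / 16)" using r3 by (intro mult_right_mono) auto
  also have "\<dots> = R powr (- \<kappa> / 32)" by (simp add: powr_add[symmetric])
  finally have "F (Suc (J + 1)) \<xi> ^ (2 ^ J) \<le> R powr (- \<kappa> / 32)" .
  hence "cmod (phi (Suc (J + 1)) \<xi>) ^ (2 ^ Suc J) \<le> R powr (- \<kappa> / 32)" unfolding F_def by (simp add: power_mult)
  also have "R powr (- \<kappa> / 32) = (R powr (- e)) ^ (2 ^ Suc J)"
   using R0 unfolding e_def by (simp add: powr_realpow[symmetric] powr_powr)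
  finally have "cmod (phi (Suc (J + 1)) \<xi>) ^ (2 ^ Suc J) \<le> (R powr (- e)) ^ (2 ^ Suc J)" .
  thus "cmod (phi (Suc (J + 1)) \<xi>) \<le> R powr (- e)" by (subst (asm) power_mono_iff) auto
 qed
qed

section \<open>Reduction to finitely supported laws\<close>

context finite_multiplier
begin

text \<open>Dilation by a multiplier does not increase the l^1 distance, its coordinates being at
  most 1; hence the constant is independent of \<open>k\<close>.\<close>

lemma phi_lipschitz: "cmod (phi k \<zeta> - phi k \<zeta>') \<le> 2 * pi * (\<Sum>i\<in>UNIV. \<bar>\<zeta> $ i - \<zeta>' $ i\<bar>)"
proof (induction k arbitrary: \<zeta> \<zeta>')
 case 0
 have "cmod (phi 0 \<zeta> - phi 0 \<zeta>') \<le> \<bar>2 * pi * (\<zeta> \<bullet> 1) - 2 * pi * (\<zeta>' \<bullet> 1)\<bar>"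
  unfolding phi.simps by (rule cmod_iexp_diff_le)
 also have "\<dots> = 2 * pi * \<bar>\<Sum>i\<in>UNIV. \<zeta> $ i - \<zeta>' $ i\<bar>"
  by (simp add: right_diff_distrib[symmetric] abs_mult inner_vec_def sum_subtractf)
 also have "\<dots> \<le> 2 * pi * (\<Sum>i\<in>UNIV. \<bar>\<zeta> $ i - \<zeta>' $ i\<bar>)" by (intro mult_left_mono sum_abs) auto
 finally show ?case .
next
 case (Suc k)
 have "cmod (phi (Suc k) \<zeta> - phi (Suc k) \<zeta>') = cmod (\<Sum>t\<in>T. m t *\<^sub>R (phi k (t * \<zeta>) - phi k (t * \<zeta>')))"
  by (simp add: sum_subtractf scaleR_diff_right)
 also have "\<dots> \<le> (\<Sum>t\<in>T. m t * (2 * pi * (\<Sum>i\<in>UNIV. \<bar>\<zeta> $ i - \<zeta>' $ i\<bar>)))"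
 proof (rule sum_norm_le)
  fix t assume t: "t \<in> T"
  have "\<bar>(t * \<zeta>) $ i - (t * \<zeta>') $ i\<bar> \<le> 1 * \<bar>\<zeta> $ i - \<zeta>' $ i\<bar>" for i
  proof -
   have "\<bar>(t * \<zeta>) $ i - (t * \<zeta>') $ i\<bar> = \<bar>t $ i\<bar> * \<bar>\<zeta> $ i - \<zeta>' $ i\<bar>" by (simp add: right_diff_distrib[symmetric] abs_mult)
   also have "\<dots> \<le> 1 * \<bar>\<zeta> $ i - \<zeta>' $ i\<bar>" using T_bounds[OF t, of i] by (intro mult_right_mono) auto
   finally show ?thesis .
  qed
  hence "(\<Sum>i\<in>UNIV. \<bar>(t * \<zeta>) $ i - (t * \<zeta>') $ i\<bar>) \<le> (\<Sum>i\<in>UNIV. \<bar>\<zeta> $ i - \<zeta>' $ i\<bar>)" by (intro sum_mono) simp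
  hence "2 * pi * (\<Sum>i\<in>UNIV. \<bar>(t * \<zeta>) $ i - (t * \<zeta>') $ i\<bar>) \<le> 2 * pi * (\<Sum>i\<in>UNIV. \<bar>\<zeta> $ i - \<zeta>' $ i\<bar>)" by (intro mult_left_mono) auto
  with Suc.IH[of "t * \<zeta>" "t * \<zeta>'"] have le: "cmod (phi k (t * \<zeta>) - phi k (t * \<zeta>')) \<le> 2 * pi * (\<Sum>i\<in>UNIV. \<bar>\<zeta> $ i - \<zeta>' $ i\<bar>)"
   by (rule order_trans)
  have "cmod (m t *\<^sub>R (phi k (t * \<zeta>) - phi k (t * \<zeta>'))) = m t * cmod (phi k (t * \<zeta>) - phi k (t * \<zeta>'))"
   using m0[OF t] unfolding norm_scaleR by simp
  also have "\<dots> \<le> m t * (2 * pi * (\<Sum>i\<in>UNIV. \<bar>\<zeta> $ i - \<zeta>' $ i\<bar>))" using le m0[OF t] by (rule mult_left_mono)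
  finally show "cmod (m t *\<^sub>R (phi k (t * \<zeta>) - phi k (t * \<zeta>'))) \<le> m t * (2 * pi * (\<Sum>i\<in>UNIV. \<bar>\<zeta> $ i - \<zeta>' $ i\<bar>))" .
 qed
 also have "\<dots> = 2 * pi * (\<Sum>i\<in>UNIV. \<bar>\<zeta> $ i - \<zeta>' $ i\<bar>)" unfolding sum_distrib_right[symmetric] m1 by simp
 finally show ?case .
qed

end

lemma vec_prod_nth: "(\<Prod>j\<in>A. x j) $ i = (\<Prod>j\<in>A. x j $ i)" for x :: "'b \<Rightarrow> real^'n"
 by (induction A rule: infinite_finite_induct) auto

lemma borel_measurable_vec_nth: "(\<lambda>x::real^'n. x $ i) \<in> borel_measurable borel"
 by (intro borel_measurable_continuous_onI continuous_intros)

lemma borel_measurable_iexp: "iexp \<in> borel_measurable borel"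
 by (intro borel_measurable_continuous_onI continuous_intros)

section \<open>Fourier coefficients as iterated integrals\<close>

locale box_measure =
 fixes \<mu> :: "(real^'n) measure"
 assumes prob: "prob_space \<mu>" and sets_mu: "sets \<mu> = sets borel"
  and box: "emeasure \<mu> {x. \<forall>i. x $ i \<in> {1/2..1}} = 1"
begin

sublocale M: prob_space \<mu> by (rule prob)

lemma nth_measurable: "(\<lambda>x. x $ i) \<in> borel_measurable \<mu>"
 unfolding measurable_cong_sets[OF sets_mu refl] by (rule borel_measurable_vec_nth)

lemma AE_box: "AE x in \<mu>. \<forall>i. x $ i \<in> {1/2..1}"
proof -
 have "measure \<mu> {x. \<forall>i. x $ i \<in> {1/2..1}} = 1" unfolding measure_def box by simp
 from M.AE_prob_1[OF this] show ?thesis by (simp only: mem_Collect_eq)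
qed

lemma component_measurable: assumes "j \<in> I" shows "(\<lambda>x. x j $ i) \<in> borel_measurable (PiM I (\<lambda>_. \<mu>))"
proof -
 have "(\<lambda>x. x j) \<in> measurable (PiM I (\<lambda>_. \<mu>)) \<mu>" using measurable_component_singleton[OF assms, of "\<lambda>_. \<mu>"] .
 from measurable_compose[OF this nth_measurable[of i]] show ?thesis .
qed

text \<open>\<open>G_0\<close> and \<open>G_Suc\<close> mirror the two equations of
  \<open>phi\<close>, so that the two functions can be compared by induction.\<close>

definition G :: "nat \<Rightarrow> real^'n \<Rightarrow> complex" where
 "G k \<zeta> = (\<integral>x. iexp (2 * pi * (\<zeta> \<bullet> (\<Prod>i<k. x i))) \<partial>PiM {..<k} (\<lambda>_. \<mu>))"

lemma fourier_eq_G: "fourier_tr (mult_conv \<mu> k) \<zeta> = G k \<zeta>"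
proof -
 have g: "(\<lambda>x. \<Prod>i<k. x i) \<in> borel_measurable (PiM {..<k} (\<lambda>_. \<mu>))"
 proof (subst borel_measurable_euclidean_space, rule ballI)
  fix b :: "real^'n" assume "b \<in> Basis"
  then obtain i where b: "b = axis i 1" unfolding Basis_vec_def by auto
  have "(\<lambda>x. \<Prod>j<k. x j $ i) \<in> borel_measurable (PiM {..<k} (\<lambda>_. \<mu>))"
   by (intro borel_measurable_prod component_measurable)
  thus "(\<lambda>x. (\<Prod>j<k. x j) \<bullet> b) \<in> borel_measurable (PiM {..<k} (\<lambda>_. \<mu>))" unfolding b by (simp add: inner_axis vec_prod_nth)
 qed
 have f: "(\<lambda>x. iexp (2 * pi * (\<zeta> \<bullet> x))) \<in> borel_measurable borel"
  by (intro borel_measurable_continuous_onI continuous_intros)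
 have e: "exp (2 * pi * \<i> * complex_of_real y) = iexp (2 * pi * y)" for y
  by (rule arg_cong[where f = exp]) simp
 show ?thesis unfolding fourier_tr_def mult_conv_def G_def e by (rule integral_distr[OF g f])
qed

text \<open>Fubini for the last factor, which is then moved onto the frequency.\<close>

lemma G_Suc: "integrable \<mu> (\<lambda>t. G k (t * \<zeta>))" "G (Suc k) \<zeta> = (\<integral>t. G k (t * \<zeta>) \<partial>\<mu>)"
proof -
 let ?P = "PiM {..<k} (\<lambda>_. \<mu>)"
 have pP: "prob_space (PiM I (\<lambda>_. \<mu>))" for I :: "nat set" by (rule prob_space_PiM) (rule prob)
 interpret P: prob_space ?P by (rule pP)
 interpret product_sigma_finite "\<lambda>_ :: nat. \<mu>" by unfold_locales
 interpret pr: pair_prob_space \<mu> ?P by unfold_locales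
 define f where "f = (\<lambda>y x. iexp (2 * pi * ((y * \<zeta>) \<bullet> (\<Prod>i<k. x i))))"
 define h where "h = (\<lambda>x :: nat \<Rightarrow> real^'n. iexp (2 * pi * (\<zeta> \<bullet> (\<Prod>i<Suc k. x i))))"
 have m1: "(\<lambda>p. fst p $ j) \<in> borel_measurable (\<mu> \<Otimes>\<^sub>M ?P)" for j
  using measurable_compose[OF measurable_fst[of \<mu> ?P] nth_measurable[of j]] .
 have m2: "(\<lambda>p. snd p i $ j) \<in> borel_measurable (\<mu> \<Otimes>\<^sub>M ?P)" if "i \<in> {..<k}" for i j
  using measurable_compose[OF measurable_snd[of \<mu> ?P] component_measurable[OF that, of j]] .
 have "(\<lambda>p. 2 * pi * (\<Sum>j\<in>UNIV. (fst p $ j * \<zeta> $ j) * (\<Prod>i<k. snd p i $ j))) \<in> borel_measurable (\<mu> \<Otimes>\<^sub>M ?P)"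
  by (intro borel_measurable_times borel_measurable_sum borel_measurable_prod borel_measurable_const m1 m2)
 from measurable_compose[OF this borel_measurable_iexp]
 have fm: "case_prod f \<in> borel_measurable (\<mu> \<Otimes>\<^sub>M ?P)"
  unfolding f_def case_prod_unfold inner_vec_def vec_prod_nth vector_mult_component inner_real_def .
 have fi: "integrable (\<mu> \<Otimes>\<^sub>M ?P) (case_prod f)"
  by (rule pr.integrable_const_bound[of _ 1]) (use fm in \<open>simp_all add: f_def case_prod_unfold\<close>)
 have Gf: "G k (y * \<zeta>) = (\<integral>x. f y x \<partial>?P)" for y unfolding G_def f_def ..
 show "integrable \<mu> (\<lambda>t. G k (t * \<zeta>))" unfolding Gf by (rule pr.integrable_fst[OF fi])
 have ins: "{..<Suc k} = insert k {..<k}" by auto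
 have "(\<lambda>x. 2 * pi * (\<Sum>j\<in>UNIV. \<zeta> $ j * (\<Prod>i<Suc k. x i $ j))) \<in> borel_measurable (PiM {..<Suc k} (\<lambda>_. \<mu>))"
  by (intro borel_measurable_times borel_measurable_sum borel_measurable_prod borel_measurable_const component_measurable)
 from measurable_compose[OF this borel_measurable_iexp]
 have hm: "h \<in> borel_measurable (PiM {..<Suc k} (\<lambda>_. \<mu>))"
  unfolding h_def inner_vec_def vec_prod_nth inner_real_def .
 have hi: "integrable (PiM (insert k {..<k}) (\<lambda>_. \<mu>)) h" unfolding ins[symmetric]
  by (rule finite_measure.integrable_const_bound[OF prob_space.axioms(1)[OF pP], of _ 1]) (use hm in \<open>simp_all add: h_def ins[symmetric]\<close>)
 have "G (Suc k) \<zeta> = (\<integral>x. h x \<partial>PiM (insert k {..<k}) (\<lambda>_. \<mu>))" unfolding G_def h_def ins[symmetric] ..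
 also have "\<dots> = (\<integral>x. (\<integral>y. h (x(k := y)) \<partial>\<mu>) \<partial>?P)" by (rule product_integral_insert[OF _ _ hi]) auto
 also have "\<dots> = (\<integral>x. (\<integral>y. f y x \<partial>\<mu>) \<partial>?P)"
 proof -
  have "h (x(k := y)) = f y x" for x y
  proof -
   have "(\<Prod>i<Suc k. (x(k := y)) i) = y * (\<Prod>i<k. x i)"
   proof -
    have "(\<Prod>i\<in>insert k {..<k}. (x(k := y)) i) = (x(k := y)) k * (\<Prod>i<k. (x(k := y)) i)" by (rule prod.insert) simp_all
    moreover have "(\<Prod>i<k. (x(k := y)) i) = (\<Prod>i<k. x i)" by (rule prod.cong) simp_all
    ultimately show ?thesis unfolding ins by (simp only: fun_upd_same)
   qed
   moreover have "\<zeta> \<bullet> (y * z) = (y * \<zeta>) \<bullet> z" for z :: "real^'n"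
    unfolding inner_vec_def by (intro sum.cong refl) (simp add: ac_simps)
   ultimately show ?thesis unfolding h_def f_def by (simp only:)
  qed
  thus ?thesis by simp
 qed
 also have "\<dots> = (\<integral>y. (\<integral>x. f y x \<partial>?P) \<partial>\<mu>)" by (rule pr.Fubini_integral[OF fi])
 finally show "G (Suc k) \<zeta> = (\<integral>t. G k (t * \<zeta>) \<partial>\<mu>)" unfolding Gf .
qed

lemma G_0: "G 0 \<zeta> = iexp (2 * pi * (\<zeta> \<bullet> 1))"
proof -
 interpret P: prob_space "PiM {} (\<lambda>_ :: nat. \<mu>)" by (rule prob_space_PiM) (rule prob)
 have "{..<0::nat} = {}" by auto
 thus ?thesis unfolding G_def by (simp only: prod.empty lebesgue_integral_const P.prob_space scaleR_one)
qed

section \<open>Rounding the measure to a finite grid\<close>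

context
 fixes q :: nat
 assumes q: "q > 0"
begin

text \<open>Rounding down to multiples of \<open>1 / (2 * q)\<close>: both 1/2 and 1 are such
  multiples, so the values stay in the box. Off the box, on a null set, the default 1 keeps the
  range of \<open>r\<close> in the box.\<close>

definition r :: "real^'n \<Rightarrow> real^'n" where
 "r x = (if \<forall>i. x $ i \<in> {1/2..1} then (\<chi> i. of_int \<lfloor>2 * real q * x $ i\<rfloor> / (2 * real q)) else 1)"

definition "rT = range r"
definition "rm c = measure \<mu> {x. r x = c}"

lemma r_close: assumes "\<forall>i. x $ i \<in> {1/2..1}" shows "\<bar>x $ i - r x $ i\<bar> \<le> 1 / (2 * real q)"
proof -
 have r: "r x $ i = of_int \<lfloor>2 * real q * x $ i\<rfloor> / (2 * real q)" unfolding r_def using assms by simp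
 have "x $ i - r x $ i = (2 * real q * x $ i - of_int \<lfloor>2 * real q * x $ i\<rfloor>) / (2 * real q)"
  unfolding r using q by (simp add: diff_divide_distrib)
 moreover have "\<bar>2 * real q * x $ i - of_int \<lfloor>2 * real q * x $ i\<rfloor>\<bar> \<le> 1" by linarith
 ultimately show ?thesis using q by (simp add: abs_divide divide_right_mono)
qed

lemma r_floor_range: assumes "\<forall>i. x $ i \<in> {1/2..1}" shows "\<lfloor>2 * real q * x $ i\<rfloor> \<in> {int q..int (2 * q)}"
proof -
 have "1/2 \<le> x $ i" "x $ i \<le> 1" using assms by auto
 hence "2 * real q * (1/2) \<le> 2 * real q * x $ i" "2 * real q * x $ i \<le> 2 * real q * 1" using q by (intro mult_left_mono; simp)+
 hence "real_of_int (int q) \<le> 2 * real q * x $ i" "2 * real q * x $ i \<le> real_of_int (int (2 * q))" by simp_all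
 thus ?thesis by (simp only: atLeastAtMost_iff le_floor_iff) (metis floor_mono floor_of_int)
qed

lemma r_bounds: "1/2 \<le> r x $ i" "r x $ i \<le> 1"
proof -
 show "1/2 \<le> r x $ i"
 proof (cases "\<forall>i. x $ i \<in> {1/2..1}")
  case True
  have "real q \<le> of_int \<lfloor>2 * real q * x $ i\<rfloor>" using r_floor_range[OF True, of i] by (simp, linarith?)
  thus ?thesis using True q unfolding r_def by (simp add: pos_le_divide_eq)
 qed (auto simp: r_def)
 show "r x $ i \<le> 1"
 proof (cases "\<forall>i. x $ i \<in> {1/2..1}")
  case True
  have "of_int \<lfloor>2 * real q * x $ i\<rfloor> \<le> 2 * real q" using r_floor_range[OF True, of i] by (simp, linarith?)
  thus ?thesis using True q unfolding r_def by (simp add: pos_divide_le_eq)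
 qed (auto simp: r_def)
qed

lemma finite_rT: "finite rT"
proof -
 have "rT \<subseteq> insert 1 ((\<lambda>g. \<chi> i. of_int (g i) / (2 * real q)) ` (PiE UNIV (\<lambda>_. {int q..int (2 * q)})))"
 proof
  fix c assume "c \<in> rT"
  then obtain x where x: "c = r x" unfolding rT_def by blast
  show "c \<in> insert 1 ((\<lambda>g. \<chi> i. of_int (g i) / (2 * real q)) ` (PiE UNIV (\<lambda>_. {int q..int (2 * q)})))"
  proof (cases "\<forall>i. x $ i \<in> {1/2..1}")
   case True
   show ?thesis
   proof (intro insertI2 image_eqI[of _ _ "\<lambda>i. \<lfloor>2 * real q * x $ i\<rfloor>"])
    show "c = (\<chi> i. of_int \<lfloor>2 * real q * x $ i\<rfloor> / (2 * real q))" unfolding x r_def using True by simp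
    show "(\<lambda>i. \<lfloor>2 * real q * x $ i\<rfloor>) \<in> PiE UNIV (\<lambda>_. {int q..int (2 * q)})"
     unfolding PiE_UNIV_domain using r_floor_range[OF True] by (intro Pi_I)
   qed
  qed (auto simp: x r_def)
 qed
 thus ?thesis by (rule finite_subset) (intro finite.insertI finite_imageI finite_PiE, auto)
qed

lemma r_sets: "{x. r x = c} \<in> sets \<mu>"
proof -
 have b: "{x :: real^'n. x $ i \<in> {1/2..1}} \<in> sets borel" for i
  using measurable_sets[OF borel_measurable_vec_nth[of i], of "{1/2..1}"] by (simp add: vimage_def)
 have fl: "{x :: real^'n. of_int \<lfloor>2 * real q * x $ i\<rfloor> / (2 * real q) = c $ i} \<in> sets borel" for i
 proof -
  have "(\<lambda>y. of_int \<lfloor>2 * real q * y\<rfloor> / (2 * real q)) \<in> borel_measurable (borel :: real measure)" by measurable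
  from measurable_sets[OF measurable_compose[OF borel_measurable_vec_nth this], of "{c $ i}"] show ?thesis by (simp add: vimage_def)
 qed
 let ?B = "\<Inter>i\<in>UNIV. {x :: real^'n. x $ i \<in> {1/2..1}}" and ?F = "\<Inter>i\<in>UNIV. {x :: real^'n. of_int \<lfloor>2 * real q * x $ i\<rfloor> / (2 * real q) = c $ i}"
 have B: "?B \<in> sets borel" using b by (intro sets.finite_INT) auto
 have F: "?F \<in> sets borel" using fl by (intro sets.finite_INT) auto
 have "{x. r x = c} = (?B \<inter> ?F) \<union> (if c = 1 then - ?B else {})"
  unfolding r_def by (auto simp: vec_eq_iff)
 also have "\<dots> \<in> sets borel"
 proof (intro sets.Un sets.Int B F)
  have "- ?B \<in> sets borel" using sets.compl_sets[OF B] by (simp only: Compl_eq_Diff_UNIV space_borel)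
  thus "(if c = 1 then - ?B else {}) \<in> sets borel" by (cases "c = 1") (simp_all only: if_True if_False sets.empty_sets refl)
 qed
 finally show ?thesis unfolding sets_mu .
qed

lemma integral_r:
 fixes g :: "real^'n \<Rightarrow> 'b :: {banach, second_countable_topology}"
 shows "integrable \<mu> (\<lambda>x. g (r x))" "(\<integral>x. g (r x) \<partial>\<mu>) = (\<Sum>c\<in>rT. rm c *\<^sub>R g c)"
proof -
 have e: "g (r x) = (\<Sum>c\<in>rT. indicator {x. r x = c} x *\<^sub>R g c)" for x
 proof -
  have "(\<Sum>c\<in>rT. indicator {x. r x = c} x *\<^sub>R g c) = (\<Sum>c\<in>rT. if r x = c then g c else 0)" by (intro sum.cong refl) (simp add: indicator_def)
  also have "\<dots> = g (r x)" using finite_rT by (simp add: rT_def)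
  finally show ?thesis by simp
 qed
 have i: "integrable \<mu> (\<lambda>x. indicator {x. r x = c} x *\<^sub>R g c)" for c
  by (intro integrable_scaleR_left integrable_real_indicator r_sets) (simp add: M.emeasure_finite less_top[symmetric])
 show "integrable \<mu> (\<lambda>x. g (r x))" unfolding e by (intro Bochner_Integration.integrable_sum i)
 have "(\<integral>x. g (r x) \<partial>\<mu>) = (\<Sum>c\<in>rT. \<integral>x. indicator {x. r x = c} x *\<^sub>R g c \<partial>\<mu>)" unfolding e by (rule Bochner_Integration.integral_sum) (rule i)
 also have "\<dots> = (\<Sum>c\<in>rT. rm c *\<^sub>R g c)"
 proof (intro sum.cong refl)
  fix c
  have "(\<integral>x. indicator {x. r x = c} x *\<^sub>R g c \<partial>\<mu>) = (\<integral>x. indicator {x. r x = c} x \<partial>\<mu>) *\<^sub>R g c"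
   by (intro Bochner_Integration.integral_scaleR_left integrable_real_indicator r_sets) (simp add: M.emeasure_finite less_top[symmetric])
  also have "(\<integral>x. indicator {x. r x = c} x \<partial>\<mu>) = rm c"
   unfolding rm_def using sets.sets_into_space[OF r_sets[of c]] by (simp add: Int_absorb2)
  finally show "(\<integral>x. indicator {x. r x = c} x *\<^sub>R g c \<partial>\<mu>) = rm c *\<^sub>R g c" .
 qed
 finally show "(\<integral>x. g (r x) \<partial>\<mu>) = (\<Sum>c\<in>rT. rm c *\<^sub>R g c)" .
qed

lemma finite_multiplier_r: "finite_multiplier rT rm"
proof
 show "(\<Sum>t\<in>rT. rm t) = 1" using integral_r(2)[of "\<lambda>_. 1 :: real"] M.prob_space by simp
qed (use r_bounds finite_rT in \<open>auto simp: rT_def rm_def\<close>)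

interpretation fm: finite_multiplier rT rm by (rule finite_multiplier_r)

text \<open>One factor is replaced at a time. Each replacement moves a coordinate of the frequency
  by at most the fraction \<open>1 / (2 * q)\<close> of its size and pays the Lipschitz constant
  \<open>2 * pi\<close>.\<close>

lemma G_phi: "cmod (G k \<zeta> - fm.phi k \<zeta>) \<le> real k * (2 * pi * (1 / (2 * real q)) * (\<Sum>i\<in>UNIV. \<bar>\<zeta> $ i\<bar>))"
proof (induction k arbitrary: \<zeta>)
 case 0
 show ?case by (simp add: G_0)
next
 case (Suc k)
 let ?s = "\<Sum>i\<in>UNIV. \<bar>\<zeta> $ i\<bar>" and ?d = "1 / (2 * real q)"
 have p: "fm.phi (Suc k) \<zeta> = (\<integral>x. fm.phi k (r x * \<zeta>) \<partial>\<mu>)" using integral_r(2)[of "\<lambda>c. fm.phi k (c * \<zeta>)"] by simp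
 have int: "integrable \<mu> (\<lambda>x. G k (x * \<zeta>) - fm.phi k (r x * \<zeta>))"
  by (intro Bochner_Integration.integrable_diff G_Suc(1) integral_r(1)[of "\<lambda>c. fm.phi k (c * \<zeta>)"])
 have ptw: "cmod (G k (x * \<zeta>) - fm.phi k (r x * \<zeta>)) \<le> real (Suc k) * (2 * pi * ?d * ?s)" if x: "\<forall>i. x $ i \<in> {1/2..1}" for x
 proof -
  have "(\<Sum>i\<in>UNIV. \<bar>(x * \<zeta>) $ i\<bar>) \<le> ?s"
  proof (rule sum_mono)
   fix i
   have "1/2 \<le> x $ i" "x $ i \<le> 1" using x by auto
   hence "\<bar>x $ i\<bar> * \<bar>\<zeta> $ i\<bar> \<le> 1 * \<bar>\<zeta> $ i\<bar>" by (intro mult_right_mono) auto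
   thus "\<bar>(x * \<zeta>) $ i\<bar> \<le> \<bar>\<zeta> $ i\<bar>" by (simp add: abs_mult)
  qed
  hence "real k * (2 * pi * ?d * (\<Sum>i\<in>UNIV. \<bar>(x * \<zeta>) $ i\<bar>)) \<le> real k * (2 * pi * ?d * ?s)" by (intro mult_left_mono) auto
  hence a: "cmod (G k (x * \<zeta>) - fm.phi k (x * \<zeta>)) \<le> real k * (2 * pi * ?d * ?s)" using Suc.IH[of "x * \<zeta>"] by linarith
  have "(\<Sum>i\<in>UNIV. \<bar>(x * \<zeta>) $ i - (r x * \<zeta>) $ i\<bar>) \<le> (\<Sum>i\<in>UNIV. ?d * \<bar>\<zeta> $ i\<bar>)"
  proof (rule sum_mono)
   fix i
   have "\<bar>(x * \<zeta>) $ i - (r x * \<zeta>) $ i\<bar> = \<bar>x $ i - r x $ i\<bar> * \<bar>\<zeta> $ i\<bar>" by (simp add: left_diff_distrib[symmetric] abs_mult)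
   also have "\<dots> \<le> ?d * \<bar>\<zeta> $ i\<bar>" using r_close[OF x] by (intro mult_right_mono) auto
   finally show "\<bar>(x * \<zeta>) $ i - (r x * \<zeta>) $ i\<bar> \<le> ?d * \<bar>\<zeta> $ i\<bar>" .
  qed
  hence "2 * pi * (\<Sum>i\<in>UNIV. \<bar>(x * \<zeta>) $ i - (r x * \<zeta>) $ i\<bar>) \<le> 2 * pi * (?d * ?s)" unfolding sum_distrib_left[symmetric] by (intro mult_left_mono) auto
  hence b: "cmod (fm.phi k (x * \<zeta>) - fm.phi k (r x * \<zeta>)) \<le> 2 * pi * ?d * ?s" using fm.phi_lipschitz[of k "x * \<zeta>" "r x * \<zeta>"] by simp
  have tri: "cmod (G k (x * \<zeta>) - fm.phi k (r x * \<zeta>)) \<le> cmod (G k (x * \<zeta>) - fm.phi k (x * \<zeta>)) + cmod (fm.phi k (x * \<zeta>) - fm.phi k (r x * \<zeta>))"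
   using norm_triangle_ineq[of "G k (x * \<zeta>) - fm.phi k (x * \<zeta>)" "fm.phi k (x * \<zeta>) - fm.phi k (r x * \<zeta>)"] by simp
  have gen: "z \<le> real (Suc k) * y" if "z \<le> a1 + b1" "a1 \<le> real k * y" "b1 \<le> y" for z a1 b1 y :: real
   using that by (simp add: distrib_right)
  show ?thesis by (rule gen[OF tri a b])
 qed
 have "G (Suc k) \<zeta> - fm.phi (Suc k) \<zeta> = (\<integral>x. G k (x * \<zeta>) - fm.phi k (r x * \<zeta>) \<partial>\<mu>)"
  unfolding p G_Suc(2) by (rule Bochner_Integration.integral_diff[OF G_Suc(1) integral_r(1)[of "\<lambda>c. fm.phi k (c * \<zeta>)"], symmetric])
 hence "cmod (G (Suc k) \<zeta> - fm.phi (Suc k) \<zeta>) = cmod (\<integral>x. G k (x * \<zeta>) - fm.phi k (r x * \<zeta>) \<partial>\<mu>)" by (simp only:)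
 also have "\<dots> \<le> (\<integral>x. cmod (G k (x * \<zeta>) - fm.phi k (r x * \<zeta>)) \<partial>\<mu>)" by (rule Bochner_Integration.integral_norm_bound)
 also have "\<dots> \<le> real (Suc k) * (2 * pi * ?d * ?s)"
 proof (rule M.integral_le_const)
  show "integrable \<mu> (\<lambda>x. cmod (G k (x * \<zeta>) - fm.phi k (r x * \<zeta>)))" using int by (rule Bochner_Integration.integrable_norm)
  show "AE x in \<mu>. cmod (G k (x * \<zeta>) - fm.phi k (r x * \<zeta>)) \<le> real (Suc k) * (2 * pi * ?d * ?s)"
   using AE_box by (rule eventually_mono) (rule ptw)
 qed
 finally show ?case .
qed

text \<open>Rounding moves \<open>v \<bullet> x\<close> by at most
  \<open>CARD('n) / (2 * q)\<close>, hence by at most \<open>\<rho>\<close>.\<close>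

lemma strip_le:
 assumes v: "norm v = 1" and rho: "real CARD('n) / (2 * real q) \<le> \<rho>"
 shows "(\<Sum>t\<in>{t \<in> rT. \<bar>v \<bullet> t - a\<bar> \<le> \<rho>}. rm t) \<le> measure \<mu> {x. v \<bullet> x \<in> {a - 2 * \<rho>..a + 2 * \<rho>}}"
proof -
 let ?g = "\<lambda>c. if \<bar>v \<bullet> c - a\<bar> \<le> \<rho> then 1 else 0 :: real"
 define S where "S = {x. v \<bullet> x \<in> {a - 2 * \<rho>..a + 2 * \<rho>}}"
 have "(\<lambda>x. v \<bullet> x) \<in> borel_measurable borel" by (intro borel_measurable_continuous_onI continuous_intros)
 from measurable_sets[OF this, of "{a - 2 * \<rho>..a + 2 * \<rho>}"] have S: "S \<in> sets \<mu>" unfolding sets_mu S_def by (simp add: vimage_def)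
 have "(\<Sum>t\<in>{t \<in> rT. \<bar>v \<bullet> t - a\<bar> \<le> \<rho>}. rm t) = (\<Sum>t\<in>rT. if \<bar>v \<bullet> t - a\<bar> \<le> \<rho> then rm t else 0)"
  by (rule sum.inter_filter[OF finite_rT])
 also have "\<dots> = (\<Sum>c\<in>rT. rm c *\<^sub>R ?g c)" by (intro sum.cong refl) auto
 also have "\<dots> = (\<integral>x. ?g (r x) \<partial>\<mu>)" using integral_r(2)[of ?g] by simp
 also have "\<dots> \<le> (\<integral>x. indicator S x \<partial>\<mu>)"
 proof (rule integral_mono_AE)
  show "integrable \<mu> (\<lambda>x. ?g (r x))" by (rule integral_r(1))
  show "integrable \<mu> (indicator S :: _ \<Rightarrow> real)" using S by (intro integrable_real_indicator) (simp_all add: M.emeasure_finite less_top[symmetric])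
  show "AE x in \<mu>. ?g (r x) \<le> indicator S x" using AE_box
  proof (rule eventually_mono)
   fix x :: "real^'n" assume x: "\<forall>i. x $ i \<in> {1/2..1}"
   have "\<bar>v \<bullet> x - v \<bullet> r x\<bar> \<le> (\<Sum>i\<in>(UNIV :: 'n set). 1 * (1 / (2 * real q)))"
   proof -
    have "\<bar>v \<bullet> x - v \<bullet> r x\<bar> = \<bar>\<Sum>i\<in>UNIV. v $ i * (x $ i - r x $ i)\<bar>" by (simp add: inner_vec_def sum_subtractf right_diff_distrib)
    also have "\<dots> \<le> (\<Sum>i\<in>UNIV. \<bar>v $ i * (x $ i - r x $ i)\<bar>)" by (rule sum_abs)
    also have "\<dots> \<le> (\<Sum>i\<in>(UNIV :: 'n set). 1 * (1 / (2 * real q)))"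
     unfolding abs_mult using component_le_norm_cart[of v] v r_close[OF x] by (intro sum_mono mult_mono) auto
    finally show ?thesis .
   qed
   hence "\<bar>v \<bullet> x - v \<bullet> r x\<bar> \<le> \<rho>" using rho by simp
   have xS: "x \<in> S" if "\<bar>v \<bullet> r x - a\<bar> \<le> \<rho>"
   proof -
    have "a - 2 * \<rho> \<le> v \<bullet> x" "v \<bullet> x \<le> a + 2 * \<rho>" using that \<open>\<bar>v \<bullet> x - v \<bullet> r x\<bar> \<le> \<rho>\<close> by linarith+
    thus ?thesis unfolding S_def by simp
   qed
   show "?g (r x) \<le> indicator S x"
   proof (cases "\<bar>v \<bullet> r x - a\<bar> \<le> \<rho>")
    case True
    thus ?thesis using xS by simp
   qed simp
  qed
 qed
 also have "\<dots> = measure \<mu> S" using sets_eq_imp_space_eq[OF sets_mu] by simp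
 finally show ?thesis unfolding S_def .
qed

end

end

section \<open>Passage to general measures\<close>

theorem theorem1p1:
 fixes \<kappa>\<^sub>0 :: real
 assumes "\<kappa>\<^sub>0 > 0"
 shows "\<exists>\<epsilon>>0. \<exists>\<epsilon>\<^sub>1>0. \<exists>k::nat. \<exists>\<delta>\<^sub>0>0. \<forall>\<delta>. 0 < \<delta> \<and> \<delta> < \<delta>\<^sub>0 \<longrightarrow>
   (\<forall>\<mu> :: (real ^ 'n) measure.
    prob_space \<mu> \<and> sets \<mu> = sets borel \<and>
    emeasure \<mu> {x. \<forall>i. x $ i \<in> {1/2..1}} = 1 \<and>
    (\<forall>\<rho>\<ge>\<delta>. \<forall>a::real. \<forall>v::real^'n. norm v = 1 \<longrightarrow>
      measure \<mu> {x. v \<bullet> x \<in> {a - \<rho>..a + \<rho>}} \<le> \<delta> powr (-\<epsilon>) * \<rho> powr \<kappa>\<^sub>0)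
    \<longrightarrow> (\<forall>\<xi>::real^'n. inverse \<delta> / 2 \<le> norm \<xi> \<and> norm \<xi> \<le> inverse \<delta> \<longrightarrow>
        cmod (fourier_tr (mult_conv \<mu> k) \<xi>) \<le> \<delta> powr \<epsilon>\<^sub>1))"
proof -
 \<comment> \<open>Halved because the hypothesis at scale \<open>\<delta> = R powr (- 1/2)\<close>
   has to serve all scales down to \<open>1 / R\<close>, where
   \<open>\<delta> powr \<kappa>\<^sub>0 \<le> (1 / R) powr \<kappa>\<close>. The minimum with 1
   gives \<open>\<kappa> \<le> 1/2\<close>.\<close>
 define \<kappa> where "\<kappa> = min \<kappa>\<^sub>0 1 / 2"
 have kap: "0 < \<kappa>" "\<kappa> \<le> 1/2" "2 * \<kappa> \<le> \<kappa>\<^sub>0" "\<kappa> \<le> \<kappa>\<^sub>0" unfolding \<kappa>_def using assms by auto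
 obtain \<epsilon> e J where ee: "\<epsilon> > 0" "e > 0" and dec: "eventually (\<lambda>R. \<forall>(T :: (real^'n) set) m \<xi>. finite_multiplier T m \<longrightarrow>
   (\<forall>v a \<rho>. norm v = 1 \<longrightarrow> 1 / R \<le> \<rho> \<longrightarrow> (\<Sum>t\<in>{t \<in> T. \<bar>v \<bullet> t - a\<bar> \<le> \<rho>}. m t) \<le> 2 * R powr \<epsilon> * \<rho> powr \<kappa>) \<longrightarrow>
   R powr (1/2) / 2 \<le> norm \<xi> \<longrightarrow> norm \<xi> \<le> R powr (1/2) \<longrightarrow>
   cmod (finite_multiplier.phi T m J \<xi>) \<le> R powr (- e)) at_top"
  using finite_fourier_decay[OF kap(1,2), where 'n = 'n] by blast
 have "eventually (\<lambda>R. 2 < R powr (e / 2)) at_top" using ee by (intro eventually_less_powr) simp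
 from eventually_conj[OF dec this] obtain R0 where R0: "\<And>R. R \<ge> R0 \<Longrightarrow> (\<forall>(T :: (real^'n) set) m \<xi>. finite_multiplier T m \<longrightarrow>
   (\<forall>v a \<rho>. norm v = 1 \<longrightarrow> 1 / R \<le> \<rho> \<longrightarrow> (\<Sum>t\<in>{t \<in> T. \<bar>v \<bullet> t - a\<bar> \<le> \<rho>}. m t) \<le> 2 * R powr \<epsilon> * \<rho> powr \<kappa>) \<longrightarrow>
   R powr (1/2) / 2 \<le> norm \<xi> \<longrightarrow> norm \<xi> \<le> R powr (1/2) \<longrightarrow>
   cmod (finite_multiplier.phi T m J \<xi>) \<le> R powr (- e)) \<and> 2 < R powr (e / 2)"
  unfolding eventually_at_top_linorder by blast
 define R1 where "R1 = max R0 1"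
 have R1: "R1 \<ge> 1" "R1 \<ge> R0" unfolding R1_def by auto
 \<comment> \<open>The exponent \<open>2 * \<epsilon>\<close> appears because
   \<open>\<delta> powr (- (2 * \<epsilon>)) = R powr \<epsilon>\<close>, and the threshold on
   \<open>\<delta>\<close> is the one that makes \<open>R \<ge> R1\<close>.\<close>
 show ?thesis
 proof (rule exI[of _ "2 * \<epsilon>"], rule conjI, use ee in simp, rule exI[of _ e], rule conjI[OF ee(2)], rule exI[of _ J],
   rule exI[of _ "R1 powr (- 1/2)"], rule conjI, use R1 in simp, intro allI impI, elim conjE)
  fix \<delta> :: real and \<mu> :: "(real^'n) measure" and \<xi> :: "real^'n"
  assume d: "0 < \<delta>" "\<delta> < R1 powr (- 1/2)"
  assume mu: "prob_space \<mu>" "sets \<mu> = sets borel" "emeasure \<mu> {x. \<forall>i. x $ i \<in> {1/2..1}} = 1"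
  assume strip: "\<forall>\<rho>\<ge>\<delta>. \<forall>a::real. \<forall>v::real^'n. norm v = 1 \<longrightarrow>
      measure \<mu> {x. v \<bullet> x \<in> {a - \<rho>..a + \<rho>}} \<le> \<delta> powr (- (2 * \<epsilon>)) * \<rho> powr \<kappa>\<^sub>0"
  assume xi: "inverse \<delta> / 2 \<le> norm \<xi>" "norm \<xi> \<le> inverse \<delta>"
  interpret box_measure \<mu> by (rule box_measure.intro[OF mu])
  have d1: "\<delta> \<le> 1"
  proof -
   have "R1 powr (- 1/2) \<le> R1 powr 0" using R1 by (intro powr_mono) auto
   thus ?thesis using d R1 by simp
  qed
  define R where "R = \<delta> powr (- 2)"
  have Rpos: "R > 0" unfolding R_def using d by simp
  have RR1: "R \<ge> R1"
  proof -
   have "(R1 powr (- 1/2)) powr (- 2) \<le> R" unfolding R_def using d by (intro powr_mono2') auto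
   thus ?thesis using R1 by (simp add: powr_powr)
  qed
  have Rge1: "R \<ge> 1" using RR1 R1 by linarith
  have Rp: "R powr x = \<delta> powr (- (2 * x))" for x unfolding R_def powr_powr by simp
  have Rinv: "1 / R = \<delta> powr 2" unfolding R_def using d by (simp add: powr_minus_divide)
  have Rhalf: "R powr (1/2) = inverse \<delta>" unfolding Rp using d by (simp add: powr_minus)
  have decR: "\<forall>(T :: (real^'n) set) m \<xi>. finite_multiplier T m \<longrightarrow>
   (\<forall>v a \<rho>. norm v = 1 \<longrightarrow> 1 / R \<le> \<rho> \<longrightarrow> (\<Sum>t\<in>{t \<in> T. \<bar>v \<bullet> t - a\<bar> \<le> \<rho>}. m t) \<le> 2 * R powr \<epsilon> * \<rho> powr \<kappa>) \<longrightarrow>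
   R powr (1/2) / 2 \<le> norm \<xi> \<longrightarrow> norm \<xi> \<le> R powr (1/2) \<longrightarrow>
   cmod (finite_multiplier.phi T m J \<xi>) \<le> R powr (- e)" and two: "2 < R powr (e / 2)"
   using R0[of R] RR1 R1(2) by auto
  have Reps: "R powr \<epsilon> \<ge> 1" using Rge1 ee by (intro ge_one_powr_ge_zero) auto
  have stripR: "measure \<mu> {x. v \<bullet> x \<in> {a - \<sigma>..a + \<sigma>}} \<le> R powr \<epsilon> * \<sigma> powr \<kappa>" if v: "norm v = 1" and s: "1 / R \<le> \<sigma>" for v a \<sigma>
  proof -
   have s0: "\<sigma> > 0" using s Rpos order.strict_trans2[of 0 "1 / R" \<sigma>] by simp
   consider "\<sigma> \<ge> 1" | "\<delta> \<le> \<sigma>" "\<sigma> \<le> 1" | "\<sigma> \<le> \<delta>" by linarith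
   thus ?thesis
   proof cases
    case 1
    have "1 \<le> \<sigma> powr \<kappa>" using 1 kap by (intro ge_one_powr_ge_zero) auto
    hence "1 * 1 \<le> R powr \<epsilon> * \<sigma> powr \<kappa>" using Reps by (intro mult_mono) auto
    thus ?thesis using M.prob_le_1[of "{x. v \<bullet> x \<in> {a - \<sigma>..a + \<sigma>}}"] by linarith
   next
    case 2
    have "measure \<mu> {x. v \<bullet> x \<in> {a - \<sigma>..a + \<sigma>}} \<le> R powr \<epsilon> * \<sigma> powr \<kappa>\<^sub>0" unfolding Rp using strip 2 v by blast
    also have "\<dots> \<le> R powr \<epsilon> * \<sigma> powr \<kappa>" using 2 s0 kap by (intro mult_left_mono powr_mono') auto
    finally show ?thesis .
   next
    \<comment> \<open>Below scale \<open>\<delta>\<close> the strip is enlarged to half-width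
      \<open>\<delta>\<close>.\<close>
    case 3
    have "(\<lambda>x. v \<bullet> x) \<in> borel_measurable borel" by (intro borel_measurable_continuous_onI continuous_intros)
    from measurable_sets[OF this, of "{a - \<delta>..a + \<delta>}"] have "{x. v \<bullet> x \<in> {a - \<delta>..a + \<delta>}} \<in> sets \<mu>" unfolding mu(2) by (simp add: vimage_def)
    hence "measure \<mu> {x. v \<bullet> x \<in> {a - \<sigma>..a + \<sigma>}} \<le> measure \<mu> {x. v \<bullet> x \<in> {a - \<delta>..a + \<delta>}}"
     using 3 by (intro M.finite_measure_mono) auto
    also have "\<dots> \<le> R powr \<epsilon> * \<delta> powr \<kappa>\<^sub>0" unfolding Rp using strip v by blast
    also have "\<dots> \<le> R powr \<epsilon> * \<sigma> powr \<kappa>"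
    proof (rule mult_left_mono)
     have "\<delta> powr \<kappa>\<^sub>0 \<le> \<delta> powr (2 * \<kappa>)" using d d1 kap by (intro powr_mono') auto
     also have "\<dots> = (1 / R) powr \<kappa>" unfolding Rinv powr_powr ..
     also have "\<dots> \<le> \<sigma> powr \<kappa>" using s kap Rpos by (intro powr_mono2) auto
     finally show "\<delta> powr \<kappa>\<^sub>0 \<le> \<sigma> powr \<kappa>" .
    qed simp
    finally show ?thesis .
   qed
  qed
  define s where "s = (\<Sum>i\<in>UNIV. \<bar>\<xi> $ i\<bar>)"
  have s0: "s \<ge> 0" unfolding s_def by (intro sum_nonneg) auto
  \<comment> \<open>The first entry makes the rounding finer than \<open>1 / R\<close>, the smallest
    strip radius in use; the second makes the error in \<open>G_phi\<close> at most
    \<open>R powr (- e)\<close>.\<close>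
  define q where "q = nat \<lceil>max (real CARD('n) * R) (real J * (2 * pi) * s * R powr e)\<rceil> + 1"
  have q0: "q > 0" unfolding q_def by simp
  have qq: "max (real CARD('n) * R) (real J * (2 * pi) * s * R powr e) \<le> 2 * real q"
  proof -
   have "x \<le> 2 * real (nat \<lceil>x\<rceil> + 1)" for x :: real using real_nat_ceiling_ge[of x] by simp
   thus ?thesis unfolding q_def .
  qed
  have q1: "real CARD('n) / (2 * real q) \<le> 1 / R"
  proof -
   have "real CARD('n) * R \<le> 2 * real q" using qq by simp
   thus ?thesis using q0 Rpos by (simp add: divide_le_eq le_divide_eq mult.commute)
  qed
  have q2: "real J * (2 * pi * (1 / (2 * real q)) * s) \<le> R powr (- e)"
  proof -
   have "real J * (2 * pi) * s * R powr e \<le> 2 * real q" using qq by simp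
   hence "real J * (2 * pi) * s * R powr e / (2 * real q) \<le> 1" using q0 by (simp add: pos_divide_le_eq)
   hence "real J * (2 * pi) * s * R powr e / (2 * real q) * R powr (- e) \<le> 1 * R powr (- e)" by (intro mult_right_mono) auto
   moreover have "R powr e * R powr (- e) = 1" using Rpos by (simp add: powr_add[symmetric])
   ultimately show ?thesis by (simp add: mult.assoc)
  qed
  have "cmod (finite_multiplier.phi (rT q) (rm q) J \<xi>) \<le> R powr (- e)"
  proof (rule decR[rule_format, OF finite_multiplier_r[OF q0]])
   fix v :: "real^'n" and a \<rho> :: real
   assume v: "norm v = 1" and rho: "1 / R \<le> \<rho>"
   have rho0: "\<rho> > 0" using rho Rpos order.strict_trans2[of 0 "1 / R" \<rho>] by simp
   have "(\<Sum>t\<in>{t \<in> rT q. \<bar>v \<bullet> t - a\<bar> \<le> \<rho>}. rm q t) \<le> measure \<mu> {x. v \<bullet> x \<in> {a - 2 * \<rho>..a + 2 * \<rho>}}"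
    using q1 rho by (intro strip_le[OF q0 v]) linarith
   also have "\<dots> \<le> R powr \<epsilon> * (2 * \<rho>) powr \<kappa>" using rho rho0 by (intro stripR[OF v]) linarith
   also have "\<dots> \<le> R powr \<epsilon> * (2 * \<rho> powr \<kappa>)"
   proof -
    have "2 powr \<kappa> \<le> 2 powr 1" using kap by (intro powr_mono) auto
    thus ?thesis using rho0 by (intro mult_left_mono) (auto simp: powr_mult intro: mult_right_mono)
   qed
   finally show "(\<Sum>t\<in>{t \<in> rT q. \<bar>v \<bullet> t - a\<bar> \<le> \<rho>}. rm q t) \<le> 2 * R powr \<epsilon> * \<rho> powr \<kappa>" by simp
  qed (use xi in \<open>simp_all add: Rhalf\<close>)
  moreover have "cmod (G J \<xi> - finite_multiplier.phi (rT q) (rm q) J \<xi>) \<le> R powr (- e)"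
   using G_phi[OF q0, of J \<xi>] q2 unfolding s_def by linarith
  ultimately have "cmod (G J \<xi>) \<le> 2 * R powr (- e)"
   using norm_triangle_ineq[of "G J \<xi> - finite_multiplier.phi (rT q) (rm q) J \<xi>" "finite_multiplier.phi (rT q) (rm q) J \<xi>"] by simp
  also have "\<dots> \<le> R powr (e / 2) * R powr (- e)" using two by (intro mult_right_mono) auto
  also have "\<dots> = R powr (- e / 2)" by (simp add: powr_add[symmetric])
  also have "\<dots> = \<delta> powr e" unfolding Rp by simp
  finally show "cmod (fourier_tr (mult_conv \<mu> J) \<xi>) \<le> \<delta> powr e" unfolding fourier_eq_G .
 qed
qed

end
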